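(* Let $\widetilde{\mathbf g}\in L^2(0,T;\mathbb H^{-1}(\Omega))$ and $(\widehat{\mathbf u}_0,\widehat\xi_0)\in\mathbb L^2(\Omega)\times L^2(\Omega)$, and let $(\widehat{\mathbf u},\widehat\xi)$ be the unique weak solution of the uncontrolled tidal dynamics system (control $\mathrm U=\mathbf 0$) with external forcing $\widetilde{\mathbf g}$ and initial data $(\widehat{\mathbf u}_0,\widehat\xi_0)$. Let $(\mathfrak w_0,\eta_0)\in\mathbb L^2(\Omega)\times L^2(\Omega)$, $\widehat{\mathbf g}\in L^2(0,T;\mathbb H^{-1}(\Omega))$ and $\mathrm U\in L^2(0,T;\mathbb H^{-1}(\Omega))$. Then there exists a unique weak solution $(\mathfrak w,\eta)$ of the linearized system $$\begin{cases}\partial_t\mathfrak w(t)+\mathrm A\mathfrak w(t)+\mathrm B'(\widehat{\mathbf u}(t))\mathfrak w(t)+\nabla\eta(t)=\widehat{\mathbf g}(t)+\mathrm U(t)&\text{in }\mathbb H^{-1}(\Omega),\\ \partial_t\eta(t)+\mathrm{div}(h\,\mathfrak w(t))=0&\text{in }L^2(\Omega),\\ (\mathfrak w(0),\eta(0))=(\mathfrak w_0,\eta_0),\end{cases}\qquad\text{for a.e. }t\in[0,T],$$ (with $\mathfrak w=\mathbf 0$ on $\partial\Omega\times[0,T]$) satisfying $$(\mathfrak w,\eta)\in\big(C([0,T];\mathbb L^2(\Omega))\cap L^2(0,T;\mathbb H^1_0(\Omega))\big)\times C([0,T];L^2(\Omega)),$$ $$(\partial_t\mathfrak w,\partial_t\eta)\in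 L^2(0,T;\mathbb H^{-1}(\Omega))\times L^2(0,T;L^2(\Omega)).$$
   Context: Setting. $\Omega\subset\mathbb R^2$ is a bounded domain with smooth boundary and $T>0$. $\alpha,\beta,r>0$ are constants. $h$ is a continuously differentiable function on $\overline\Omega$ with $0<\lambda=\min h$, $\mu=\max h$, $\max|\nabla h|\le M$ for a constant $M\ge 0$; $\gamma(x)=r/h(x)$ is a strictly positive smooth function. $\mathbf w^0:\Omega\times[0,T]\to\mathbb R^2$ is a given smooth function with $\mathbf w^0\in L^\infty(0,T;\mathbb L^2(\Omega))\cap L^2(0,T;\mathbb H^1(\Omega))$ and $\partial_t\mathbf w^0\in L^2(0,T;\mathbb H^{-1}(\Omega))$. Spaces. $\mathbb L^p(\Omega)=L^p(\Omega;\mathbb R^2)$, $\mathbb H^1(\Omega)=H^1(\Omega;\mathbb R^2)$, $\mathbb H_0^1(\Omega)=H_0^1(\Omega;\mathbb R^2)$ with norm $\|\mathbf u\|_{\mathbb H^1_0}=\|\nabla\mathbf u\|_{\mathbb L^2}$, $\mathbb H^{-1}(\Omega)$ its dual with the dual norm, $\langle\cdot,\cdot\rangle$ the duality pairing. Operators. $\mathrm A\mathbf u=-\alpha\Delta\mathbf u+\beta\,\mathbf k\times\mathbf u$ with $\mathbf k\times\mathbf u=(-u_2,u_1)$, viewed as a map $\mathbb H_0^1(\Omega)\to\mathbb H^{-1}(\Omega)$. $\mathrm B(\mathbf u)=\gamma\,|\mathbf u+\mathbf w^0|(\mathbf u+\mathbf w^0)$. $\mathrm B'(\mathbf u)\mathbf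 v:=2\gamma\,|\mathbf u+\mathbf w^0|\,\mathbf v$. Tidal dynamics system. For a forcing $\mathbf f$, control $\mathrm U$ (both in $L^2(0,T;\mathbb H^{-1}(\Omega))$) and initial data $(\mathbf u_0,\xi_0)\in\mathbb L^2(\Omega)\times L^2(\Omega)$: $$\partial_t\mathbf u+\mathrm A\mathbf u+\mathrm B(\mathbf u)+\nabla\xi=\mathbf f+\mathrm U,\quad \partial_t\xi+\mathrm{div}(h\mathbf u)=0,\quad \mathbf u|_{\partial\Omega}=\mathbf 0,\quad \mathbf u(0)=\mathbf u_0,\ \xi(0)=\xi_0 .$$ A weak solution is a pair $(\mathbf u,\xi)\in(C([0,T];\mathbb L^2(\Omega))\cap L^2(0,T;\mathbb H_0^1(\Omega)))\times C([0,T];L^2(\Omega))$ with $(\partial_t\mathbf u,\partial_t\xi)\in L^2(0,T;\mathbb H^{-1}(\Omega))\times L^2(0,T;L^2(\Omega))$ satisfying the first equation in $\mathbb H^{-1}(\Omega)$ (tested against every $\mathbf v\in\mathbb H_0^1(\Omega)$) and the second in $L^2(\Omega)$ (tested against every $\eta\in L^2(\Omega)$) for a.e. $t\in[0,T]$, attaining the initial data, and satisfying the energy equality $\frac{d}{dt}(\|\sqrt h\,\mathbf u\|_{\mathbb L^2}^2+\|\xi\|_{L^2}^2)+2\langle \mathrm A\mathbf u+\mathrm B(\mathbf u)-\mathbf f-\mathrm U,h\mathbf u\rangle=0$ for a.e. $t$. It is known that a unique weak solution exists for all such data. A weak solution of the linearized system is understood in the same sense: the equations hold in $\mathbb H^{-1}(\Omega)$,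 respectively $L^2(\Omega)$, for a.e. $t$, and the initial data are attained. *)

theory Defs
  imports "HOL-Analysis.Analysis"
begin

section \<open>Smooth functions and smooth domains\<close>

text \<open>Meant for open \<open>S\<close>; \<open>frechet_derivative f (at x) v\<close> is the directional derivative of \<open>f\<close>
  along \<open>v\<close>.\<close>

primrec Ck_on :: "nat \<Rightarrow> 'a::real_normed_vector set \<Rightarrow> ('a \<Rightarrow> 'b::real_normed_vector) \<Rightarrow> bool" where
  "Ck_on 0 S f \<longleftrightarrow> continuous_on S f"
| "Ck_on (Suc k) S f \<longleftrightarrow>
     (\<forall>x\<in>S. f differentiable (at x)) \<and> (\<forall>v. Ck_on k S (\<lambda>x. frechet_derivative f (at x) v))"

definition smooth_on :: "'a::real_normed_vector set \<Rightarrow> ('a \<Rightarrow> 'b::real_normed_vector) \<Rightarrow> bool" where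
  "smooth_on S f \<longleftrightarrow> (\<forall>k. Ck_on k S f)"

text \<open>Smoothness on a set that need not be open, such as \<open>\<Omega> \<times> [0,T]\<close>.\<close>

definition smooth_ext_on :: "'a::real_normed_vector set \<Rightarrow> ('a \<Rightarrow> 'b::real_normed_vector) \<Rightarrow> bool" where
  "smooth_ext_on S f \<longleftrightarrow>
     (\<exists>W g. open W \<and> S \<subseteq> W \<and> smooth_on W g \<and> (\<forall>x\<in>S. g x = f x))"

definition test_functions :: "'a::euclidean_space set \<Rightarrow> ('a \<Rightarrow> 'b::real_normed_vector) set" where
  "test_functions S =
     {\<phi>. smooth_on UNIV \<phi> \<and> compact (closure {x. \<phi> x \<noteq> 0}) \<and> closure {x. \<phi> x \<noteq> 0} \<subseteq> S}"

text \<open>Near each boundary point the domain is, in suitable orthonormal coordinates along \<open>e\<close> and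
  \<open>e'\<close>, the strict supergraph of a smooth function.\<close>

definition smooth_bounded_domain :: "(real^2) set \<Rightarrow> bool" where
  "smooth_bounded_domain \<Omega> \<longleftrightarrow>
     open \<Omega> \<and> connected \<Omega> \<and> \<Omega> \<noteq> {} \<and> bounded \<Omega> \<and>
     (\<forall>p \<in> frontier \<Omega>. \<exists>\<rho>>0. \<exists>e e' (g :: real \<Rightarrow> real).
        norm e = 1 \<and> norm e' = 1 \<and> e \<bullet> e' = 0 \<and> smooth_on UNIV g \<and>
        \<Omega> \<inter> ball p \<rho> = {x \<in> ball p \<rho>. g (x \<bullet> e') < x \<bullet> e})"


section \<open>Function spaces on the domain\<close>

text \<open>Elements of Lebesgue and Sobolev spaces are represented by functions, and equality in these
  spaces is equality almost everywhere in \<open>\<Omega>\<close>; values outside \<open>\<Omega>\<close> are irrelevant.\<close>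

definition L2 :: "(real^2) set \<Rightarrow> (real^2 \<Rightarrow> 'b::euclidean_space) set" where
  "L2 \<Omega> = {f. f \<in> borel_measurable (lebesgue_on \<Omega>) \<and>
              integrable (lebesgue_on \<Omega>) (\<lambda>x. (norm (f x))\<^sup>2)}"

definition L2_inner :: "(real^2) set \<Rightarrow> (real^2 \<Rightarrow> 'b::euclidean_space) \<Rightarrow> (real^2 \<Rightarrow> 'b) \<Rightarrow> real" where
  "L2_inner \<Omega> f g = (LINT x|lebesgue_on \<Omega>. f x \<bullet> g x)"

definition L2_norm :: "(real^2) set \<Rightarrow> (real^2 \<Rightarrow> 'b::euclidean_space) \<Rightarrow> real" where
  "L2_norm \<Omega> f = sqrt (LINT x|lebesgue_on \<Omega>. (norm (f x))\<^sup>2)"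

definition has_weak_jacobian ::
  "(real^2) set \<Rightarrow> (real^2 \<Rightarrow> real^2) \<Rightarrow> (real^2 \<Rightarrow> real^2^2) \<Rightarrow> bool" where
  "has_weak_jacobian \<Omega> u G \<longleftrightarrow>
     (\<forall>\<phi> \<in> test_functions \<Omega>. \<forall>i j.
        (LINT x|lebesgue_on \<Omega>. u x $ i * frechet_derivative \<phi> (at x) (axis j 1))
          = - (LINT x|lebesgue_on \<Omega>. G x $ i $ j * \<phi> x))"

definition H1 :: "(real^2) set \<Rightarrow> (real^2 \<Rightarrow> real^2) set" where
  "H1 \<Omega> = {u \<in> L2 \<Omega>. \<exists>G \<in> L2 \<Omega>. has_weak_jacobian \<Omega> u G}"

text \<open>Meaningful for \<open>u \<in> H1 \<Omega>\<close>, where it is determined almost everywhere in \<open>\<Omega>\<close>. The norm and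
  inner product of \<open>real^2^2\<close> are those of Frobenius.\<close>

definition weak_jacobian :: "(real^2) set \<Rightarrow> (real^2 \<Rightarrow> real^2) \<Rightarrow> (real^2 \<Rightarrow> real^2^2)" where
  "weak_jacobian \<Omega> u = (SOME G. G \<in> L2 \<Omega> \<and> has_weak_jacobian \<Omega> u G)"

definition weak_div :: "(real^2) set \<Rightarrow> (real^2 \<Rightarrow> real^2) \<Rightarrow> (real^2 \<Rightarrow> real)" where
  "weak_div \<Omega> u = (\<lambda>x. trace (weak_jacobian \<Omega> u x))"

definition H1_norm :: "(real^2) set \<Rightarrow> (real^2 \<Rightarrow> real^2) \<Rightarrow> real" where
  "H1_norm \<Omega> u = sqrt ((L2_norm \<Omega> u)\<^sup>2 + (L2_norm \<Omega> (weak_jacobian \<Omega> u))\<^sup>2)"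

definition H10 :: "(real^2) set \<Rightarrow> (real^2 \<Rightarrow> real^2) set" where
  "H10 \<Omega> = {u \<in> H1 \<Omega>. \<exists>\<phi> :: nat \<Rightarrow> real^2 \<Rightarrow> real^2.
      (\<forall>n. \<phi> n \<in> test_functions \<Omega>) \<and> (\<lambda>n. H1_norm \<Omega> (\<lambda>x. u x - \<phi> n x)) \<longlonglongrightarrow> 0}"

definition H10_norm :: "(real^2) set \<Rightarrow> (real^2 \<Rightarrow> real^2) \<Rightarrow> real" where
  "H10_norm \<Omega> u = L2_norm \<Omega> (weak_jacobian \<Omega> u)"

text \<open>An element of the dual of \<open>H10 \<Omega>\<close> is a functional \<open>F\<close>, and the duality pairing with \<open>v\<close>
  is \<open>F v\<close>; only the values on \<open>H10 \<Omega>\<close> matter. Boundedness makes \<open>F\<close> respect equality almost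
  everywhere.\<close>

definition Hminus1 :: "(real^2) set \<Rightarrow> ((real^2 \<Rightarrow> real^2) \<Rightarrow> real) set" where
  "Hminus1 \<Omega> = {F.
     (\<forall>u \<in> H10 \<Omega>. \<forall>v \<in> H10 \<Omega>. F (\<lambda>x. u x + v x) = F u + F v) \<and>
     (\<forall>u \<in> H10 \<Omega>. \<forall>c. F (\<lambda>x. c *\<^sub>R u x) = c * F u) \<and>
     (\<exists>C. \<forall>u \<in> H10 \<Omega>. \<bar>F u\<bar> \<le> C * H10_norm \<Omega> u)}"

definition Hminus1_norm :: "(real^2) set \<Rightarrow> ((real^2 \<Rightarrow> real^2) \<Rightarrow> real) \<Rightarrow> real" where
  "Hminus1_norm \<Omega> F = (SUP v \<in> {v \<in> H10 \<Omega>. H10_norm \<Omega> v \<le> 1}. \<bar>F v\<bar>)"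


section \<open>Spaces of functions of time\<close>

text \<open>Below \<open>V\<close> is the carrier and \<open>N\<close> the norm of a space whose elements are represented by
  functions. Measurability is Bochner's: an almost everywhere limit, in \<open>N\<close>, of simple functions.\<close>

definition strongly_measurable ::
  "real \<Rightarrow> ('a \<Rightarrow> 'b::real_normed_vector) set \<Rightarrow> (('a \<Rightarrow> 'b) \<Rightarrow> real) \<Rightarrow> (real \<Rightarrow> 'a \<Rightarrow> 'b) \<Rightarrow> bool" where
  "strongly_measurable T V N f \<longleftrightarrow>
     (\<exists>s :: nat \<Rightarrow> real \<Rightarrow> 'a \<Rightarrow> 'b.
        (\<forall>n. finite (s n ` {0..T}) \<and> s n ` {0..T} \<subseteq> V \<and>
             (\<forall>c. {t \<in> {0..T}. s n t = c} \<in> sets lebesgue)) \<and>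
        (AE t in lebesgue_on {0..T}. (\<lambda>n. N (\<lambda>x. f t x - s n t x)) \<longlonglongrightarrow> 0))"

definition L2_time ::
  "real \<Rightarrow> ('a \<Rightarrow> 'b::real_normed_vector) set \<Rightarrow> (('a \<Rightarrow> 'b) \<Rightarrow> real) \<Rightarrow> (real \<Rightarrow> 'a \<Rightarrow> 'b) set" where
  "L2_time T V N = {f. strongly_measurable T V N f \<and> (AE t in lebesgue_on {0..T}. f t \<in> V) \<and>
                       integrable (lebesgue_on {0..T}) (\<lambda>t. (N (f t))\<^sup>2)}"

definition Linf_time ::
  "real \<Rightarrow> ('a \<Rightarrow> 'b::real_normed_vector) set \<Rightarrow> (('a \<Rightarrow> 'b) \<Rightarrow> real) \<Rightarrow> (real \<Rightarrow> 'a \<Rightarrow> 'b) set" where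
  "Linf_time T V N = {f. strongly_measurable T V N f \<and> (AE t in lebesgue_on {0..T}. f t \<in> V) \<and>
                         (\<exists>C. AE t in lebesgue_on {0..T}. N (f t) \<le> C)}"

definition C_time ::
  "real \<Rightarrow> ('a \<Rightarrow> 'b::real_normed_vector) set \<Rightarrow> (('a \<Rightarrow> 'b) \<Rightarrow> real) \<Rightarrow> (real \<Rightarrow> 'a \<Rightarrow> 'b) set" where
  "C_time T V N = {f. \<forall>t \<in> {0..T}. f t \<in> V \<and>
                      ((\<lambda>s. N (\<lambda>x. f s x - f t x)) \<longlongrightarrow> 0) (at t within {0..T})}"

text \<open>\<open>F\<close> and \<open>D\<close> are families of functionals on \<open>V\<close>. The identity
  \<open>\<integral> \<phi>' F dt = - \<integral> \<phi> D dt\<close> defining the weak derivative \<open>D\<close> of \<open>F\<close> is an identity between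
  functionals on \<open>V\<close>, and is therefore stated by its value at every \<open>v \<in> V\<close>.\<close>

definition has_weak_time_deriv ::
  "real \<Rightarrow> 'v set \<Rightarrow> (real \<Rightarrow> 'v \<Rightarrow> real) \<Rightarrow> (real \<Rightarrow> 'v \<Rightarrow> real) \<Rightarrow> bool" where
  "has_weak_time_deriv T V F D \<longleftrightarrow>
     (\<forall>v \<in> V. \<forall>\<phi> \<in> test_functions {0<..<T}.
        (LINT t|lebesgue_on {0..T}. deriv \<phi> t * F t v)
          = - (LINT t|lebesgue_on {0..T}. \<phi> t * D t v))"


section \<open>The operators\<close>

text \<open>Functions \<open>f\<close> on \<open>\<Omega>\<close> act as functionals on \<open>H10 \<Omega>\<close> through \<open>L2_inner \<Omega> f\<close>.\<close>

definition k_cross :: "real^2 \<Rightarrow> real^2" where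
  "k_cross u = vector [- (u $ 2), u $ 1]"

definition A_op ::
  "(real^2) set \<Rightarrow> real \<Rightarrow> real \<Rightarrow> (real^2 \<Rightarrow> real^2) \<Rightarrow> (real^2 \<Rightarrow> real^2) \<Rightarrow> real" where
  "A_op \<Omega> \<alpha> \<beta> u = (\<lambda>v. \<alpha> * L2_inner \<Omega> (weak_jacobian \<Omega> u) (weak_jacobian \<Omega> v)
                        + \<beta> * L2_inner \<Omega> (\<lambda>x. k_cross (u x)) v)"

definition B_op ::
  "(real^2 \<Rightarrow> real) \<Rightarrow> (real^2 \<Rightarrow> real^2) \<Rightarrow> (real^2 \<Rightarrow> real^2) \<Rightarrow> (real^2 \<Rightarrow> real^2)" where
  "B_op \<gamma> w u = (\<lambda>x. (\<gamma> x * norm (u x + w x)) *\<^sub>R (u x + w x))"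

definition B'_op ::
  "(real^2 \<Rightarrow> real) \<Rightarrow> (real^2 \<Rightarrow> real^2) \<Rightarrow> (real^2 \<Rightarrow> real^2) \<Rightarrow> (real^2 \<Rightarrow> real^2) \<Rightarrow> (real^2 \<Rightarrow> real^2)" where
  "B'_op \<gamma> w u v = (\<lambda>x. (2 * \<gamma> x * norm (u x + w x)) *\<^sub>R v x)"

text \<open>The gradient of \<open>\<xi> \<in> L2 \<Omega>\<close> as a functional on \<open>H10 \<Omega>\<close>.\<close>

definition grad_op :: "(real^2) set \<Rightarrow> (real^2 \<Rightarrow> real) \<Rightarrow> (real^2 \<Rightarrow> real^2) \<Rightarrow> real" where
  "grad_op \<Omega> \<xi> = (\<lambda>v. - L2_inner \<Omega> \<xi> (weak_div \<Omega> v))"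


section \<open>Weak solutions\<close>

abbreviation L2_Hminus1 :: "(real^2) set \<Rightarrow> real \<Rightarrow> (real \<Rightarrow> (real^2 \<Rightarrow> real^2) \<Rightarrow> real) set" where
  "L2_Hminus1 \<Omega> T \<equiv> L2_time T (Hminus1 \<Omega>) (Hminus1_norm \<Omega>)"

text \<open>Here \<open>du\<close> and \<open>d\<xi>\<close> are the time derivatives of \<open>u\<close> and \<open>\<xi>\<close>. The boundary condition is
  membership in \<open>H10 \<Omega>\<close>.\<close>

definition solution_class ::
  "(real^2) set \<Rightarrow> real \<Rightarrow> (real \<Rightarrow> real^2 \<Rightarrow> real^2) \<Rightarrow> (real \<Rightarrow> real^2 \<Rightarrow> real) \<Rightarrow>
   (real \<Rightarrow> (real^2 \<Rightarrow> real^2) \<Rightarrow> real) \<Rightarrow> (real \<Rightarrow> real^2 \<Rightarrow> real) \<Rightarrow> bool" where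
  "solution_class \<Omega> T u \<xi> du d\<xi> \<longleftrightarrow>
     u \<in> C_time T (L2 \<Omega>) (L2_norm \<Omega>) \<inter> L2_time T (H10 \<Omega>) (H10_norm \<Omega>) \<and>
     \<xi> \<in> C_time T (L2 \<Omega>) (L2_norm \<Omega>) \<and>
     du \<in> L2_Hminus1 \<Omega> T \<and>
     d\<xi> \<in> L2_time T (L2 \<Omega>) (L2_norm \<Omega>) \<and>
     has_weak_time_deriv T (H10 \<Omega>) (\<lambda>t. L2_inner \<Omega> (u t)) du \<and>
     has_weak_time_deriv T (L2 \<Omega>) (\<lambda>t. L2_inner \<Omega> (\<xi> t)) (\<lambda>t. L2_inner \<Omega> (d\<xi> t))"

definition tidal_weak_solution ::
  "(real^2) set \<Rightarrow> real \<Rightarrow> real \<Rightarrow> real \<Rightarrow> (real^2 \<Rightarrow> real) \<Rightarrow> (real^2 \<Rightarrow> real) \<Rightarrow>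
   (real \<Rightarrow> real^2 \<Rightarrow> real^2) \<Rightarrow>
   (real \<Rightarrow> (real^2 \<Rightarrow> real^2) \<Rightarrow> real) \<Rightarrow> (real \<Rightarrow> (real^2 \<Rightarrow> real^2) \<Rightarrow> real) \<Rightarrow>
   (real^2 \<Rightarrow> real^2) \<Rightarrow> (real^2 \<Rightarrow> real) \<Rightarrow>
   (real \<Rightarrow> real^2 \<Rightarrow> real^2) \<Rightarrow> (real \<Rightarrow> real^2 \<Rightarrow> real) \<Rightarrow> bool" where
  "tidal_weak_solution \<Omega> T \<alpha> \<beta> h \<gamma> w0 f U u0 \<xi>0 u \<xi> \<longleftrightarrow>
     (\<exists>du d\<xi>. solution_class \<Omega> T u \<xi> du d\<xi> \<and>
       (AE t in lebesgue_on {0..T}. \<forall>v \<in> H10 \<Omega>.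
          du t v + A_op \<Omega> \<alpha> \<beta> (u t) v + L2_inner \<Omega> (B_op \<gamma> (w0 t) (u t)) v + grad_op \<Omega> (\<xi> t) v
            = f t v + U t v) \<and>
       (AE t in lebesgue_on {0..T}. \<forall>\<zeta> \<in> L2 \<Omega>.
          L2_inner \<Omega> (d\<xi> t) \<zeta> + L2_inner \<Omega> (weak_div \<Omega> (\<lambda>x. h x *\<^sub>R u t x)) \<zeta> = 0)) \<and>
     (AE x in lebesgue_on \<Omega>. u 0 x = u0 x) \<and>
     (AE x in lebesgue_on \<Omega>. \<xi> 0 x = \<xi>0 x) \<and>
     (AE t in lebesgue_on {0..T}.
        ((\<lambda>s. (L2_norm \<Omega> (\<lambda>x. sqrt (h x) *\<^sub>R u s x))\<^sup>2 + (L2_norm \<Omega> (\<xi> s))\<^sup>2)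
          has_real_derivative
            - 2 * (let v = (\<lambda>x. h x *\<^sub>R u t x) in
                   A_op \<Omega> \<alpha> \<beta> (u t) v + L2_inner \<Omega> (B_op \<gamma> (w0 t) (u t)) v - f t v - U t v))
        (at t within {0..T}))"

definition linearized_weak_solution ::
  "(real^2) set \<Rightarrow> real \<Rightarrow> real \<Rightarrow> real \<Rightarrow> (real^2 \<Rightarrow> real) \<Rightarrow> (real^2 \<Rightarrow> real) \<Rightarrow>
   (real \<Rightarrow> real^2 \<Rightarrow> real^2) \<Rightarrow> (real \<Rightarrow> real^2 \<Rightarrow> real^2) \<Rightarrow>
   (real \<Rightarrow> (real^2 \<Rightarrow> real^2) \<Rightarrow> real) \<Rightarrow> (real \<Rightarrow> (real^2 \<Rightarrow> real^2) \<Rightarrow> real) \<Rightarrow>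
   (real^2 \<Rightarrow> real^2) \<Rightarrow> (real^2 \<Rightarrow> real) \<Rightarrow>
   (real \<Rightarrow> real^2 \<Rightarrow> real^2) \<Rightarrow> (real \<Rightarrow> real^2 \<Rightarrow> real) \<Rightarrow> bool" where
  "linearized_weak_solution \<Omega> T \<alpha> \<beta> h \<gamma> w0 uh g U v0 \<eta>0 w \<eta> \<longleftrightarrow>
     (\<exists>dw d\<eta>. solution_class \<Omega> T w \<eta> dw d\<eta> \<and>
       (AE t in lebesgue_on {0..T}. \<forall>v \<in> H10 \<Omega>.
          dw t v + A_op \<Omega> \<alpha> \<beta> (w t) v + L2_inner \<Omega> (B'_op \<gamma> (w0 t) (uh t) (w t)) v
            + grad_op \<Omega> (\<eta> t) v
            = g t v + U t v) \<and>
       (AE t in lebesgue_on {0..T}. \<forall>\<zeta> \<in> L2 \<Omega>.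
          L2_inner \<Omega> (d\<eta> t) \<zeta> + L2_inner \<Omega> (weak_div \<Omega> (\<lambda>x. h x *\<^sub>R w t x)) \<zeta> = 0)) \<and>
     (AE x in lebesgue_on \<Omega>. w 0 x = v0 x) \<and>
     (AE x in lebesgue_on \<Omega>. \<eta> 0 x = \<eta>0 x)"

end

theory Submission imports Defs "HOL-Analysis.Analysis"
begin

text \<open>
  The pair (velocity, elevation) solves a linear evolution equation \<open>z' + A(t) z = g\<close> whose operator is
  coercive up to a lower order term. Testing with \<open>(w, \<eta>)\<close>, the viscous term gives
  \<open>\<alpha> |\<nabla>w|^2\<close>; the rotation drops out because \<open>k \<times> w\<close> is orthogonal to \<open>w\<close>; the friction term
  \<open>2 \<gamma> |u + w0| |w|^2\<close> is nonnegative; and the two coupling terms, the integrals of \<open>- \<eta> div w\<close> and of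
  \<open>\<eta> div (h w)\<close>, are bounded by \<open>K |\<nabla>w| |\<eta>|\<close>, which Young's inequality absorbs into the viscous term
  and a multiple of \<open>|\<eta>|^2\<close>. This is a Garding inequality (\<open>Aop_garding\<close>). The only delicate point is
  that friction is a bounded operator: the coefficient is merely square integrable in space, but the
  product of two fields in \<open>H10\<close> is again square integrable because of Ladyzhenskaya's inequality in the
  plane (\<open>ladyzhenskaya_test\<close>, \<open>bounded_bilinear_dotx\<close>). Since \<open>u\<close> is continuous and \<open>w0\<close> essentially
  bounded in time with values in \<open>L2\<close>, the bound is uniform in time.

  For such equations existence and uniqueness are due to J.-L. Lions. The system being linear,
  existence follows from a projection argument (\<open>lions_projection\<close>, \<open>evolution_exists\<close>): the
  equation is tested with time antiderivatives that vanish at the final time, so that the unknown need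
  not be differentiated. That a solution of the integrated
  equation is continuous with values in the pivot space and satisfies the energy identity is the theorem
  of Lions and Magenes (\<open>energy_identity\<close>), obtained here by regularising with the resolvents of
  \<open>\<iota>* \<iota>\<close>. Uniqueness follows from the energy identity, the Garding inequality and Gronwall's lemma
  (\<open>evolution_unique\<close>).

  All spaces are realised inside the Hilbert space type \<open>('a, 'b) l2\<close> of classes of square integrable
  functions. A function on the domain is extended by zero (\<open>cls\<close>), and a velocity in \<open>H10\<close> is represented
  by its weak gradient, which ranges over a closed subspace \<open>V0\<close> by Poincare's inequality; \<open>PV\<close> projects
  onto \<open>V0\<close>, and \<open>iota\<close> sends a gradient to the field itself. By Riesz' theorem \<open>V0\<close> also represents
  the dual space \<open>Hminus1\<close> (\<open>rho\<close>). Bochner measurability then becomes Borel measurability into a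
  separable Hilbert space, and a weak time derivative, which is tested with one fixed field at a time,
  becomes an integral identity by the lemma of du Bois-Reymond (\<open>linearized_integrated\<close>).
\<close>

section \<open>Hilbert spaces\<close>

text \<open>The representing vector is the limit of a minimising sequence of \<open>|s|^2 - 2 f s\<close> over \<open>S\<close>, which
 is Cauchy by the parallelogram identity. As \<open>S\<close> need not be closed, the limit is found in its
 closure.\<close>

lemma riesz_subspace:
 fixes S :: "'a::{real_inner,complete_space} set" and f :: "'a => real"
 assumes S: "subspace S"
  and add: "\<And>x y. x \<in> S ==> y \<in> S ==> f (x + y) = f x + f y"
  and scale: "\<And>c x. x \<in> S ==> f (c *\<^sub>R x) = c * f x"
  and bound: "\<And>x. x \<in> S ==> \<bar>f x\<bar> \<le> C * norm x"
 shows "\<exists>y\<in>closure S. \<forall>s\<in>S. f s = y \<bullet> s"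
proof -
 define J where "J s = (norm s)\<^sup>2 - 2 * f s" for s
 have J_lower: "J s \<ge> - C\<^sup>2" if "s \<in> S" for s proof -
  have "0 \<le> (norm s - C)\<^sup>2" by simp
  moreover have "f s \<le> C * norm s" using bound[OF that] by linarith
  ultimately show ?thesis by (simp add: J_def power2_eq_square algebra_simps)
 qed
 define m where "m = Inf (J ` S)"
 have S0: "0 \<in> S" using S by (rule subspace_0)
 have bdd: "bdd_below (J ` S)" using J_lower by (auto intro!: bdd_belowI2)
 have m_le: "m \<le> J s" if "s \<in> S" for s unfolding m_def using bdd that by (auto intro: cInf_lower)
 have "\<exists>s\<in>S. J s < m + 1 / real (Suc n)" for n proof -
  have "Inf (J ` S) < m + 1 / real (Suc n)" by (simp add: m_def)
  then show ?thesis using cInf_lessD[of "J ` S"] S0 by fastforce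
 qed
 then obtain s where sS: "\<And>n. s n \<in> S" and s: "\<And>n. J (s n) < m + 1 / real (Suc n)" by metis
 have par: "(norm (a - b))\<^sup>2 \<le> 2 * (J a - m) + 2 * (J b - m)" if "a \<in> S" "b \<in> S" for a b proof -
  define c where "c = (1/2) *\<^sub>R (a + b)"
  have cS: "c \<in> S" unfolding c_def using S that by (simp add: subspace_add subspace_scale)
  have fc: "f c = (f a + f b) / 2" unfolding c_def using scale[of "a + b" "1/2"] add[OF that] S that
   by (simp add: subspace_add)
  have "(norm (a - b))\<^sup>2 = 2 * (norm a)\<^sup>2 + 2 * (norm b)\<^sup>2 - 4 * (norm c)\<^sup>2"
   unfolding c_def power2_norm_eq_inner by (simp add: inner_simps inner_commute field_simps)
  also have "\<dots> = 2 * J a + 2 * J b - 4 * J c" unfolding J_def fc by (simp add: field_simps)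
  finally show ?thesis using m_le[OF cS] by simp
 qed
 have "Cauchy s" proof (rule metric_CauchyI)
  fix e :: real assume e: "e > 0"
  obtain N where N: "1 / real (Suc N) < e\<^sup>2 / 4"
   using nat_approx_posE[of "e\<^sup>2/4"] e by (metis divide_pos_pos zero_less_numeral zero_less_power)
  have "dist (s i) (s j) < e" if "i \<ge> N" "j \<ge> N" for i j proof -
   have "1 / real (Suc i) \<le> 1 / real (Suc N)" "1 / real (Suc j) \<le> 1 / real (Suc N)"
    using that by (auto simp: frac_le)
   then have "J (s i) - m < e\<^sup>2 / 4" "J (s j) - m < e\<^sup>2 / 4"
    using order.strict_trans2[OF s[of i], of "m + 1 / real (Suc N)"]
     order.strict_trans2[OF s[of j], of "m + 1 / real (Suc N)"] N by simp_all
   then have "(norm (s i - s j))\<^sup>2 < e\<^sup>2" using par[OF sS[of i] sS[of j]] by argo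
   then show ?thesis using e by (simp add: dist_norm power_less_imp_less_base)
  qed
  then show "\<exists>N. \<forall>i\<ge>N. \<forall>j\<ge>N. dist (s i) (s j) < e" by blast
 qed
 then obtain y where y: "s \<longlonglongrightarrow> y" using Cauchy_convergent convergent_def by blast
 have ycl: "y \<in> closure S" using y sS by (meson closure_sequential)
 have "f v = y \<bullet> v" if v: "v \<in> S" for v proof -
  have nn: "0 \<le> 2 * t * (y \<bullet> v - f v) + t\<^sup>2 * (norm v)\<^sup>2" for t proof (rule LIMSEQ_le[of "\<lambda>n. - 1 / real (Suc n)"])
   show "(\<lambda>n. - 1 / real (Suc n)) \<longlonglongrightarrow> 0" using LIMSEQ_Suc[OF lim_const_over_n[of "-1::real"]] by simp
   show "(\<lambda>n. 2 * t * (s n \<bullet> v - f v) + t\<^sup>2 * (norm v)\<^sup>2) \<longlonglongrightarrow>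
     2 * t * (y \<bullet> v - f v) + t\<^sup>2 * (norm v)\<^sup>2"
    by (intro tendsto_intros y)
   have "- 1 / real (Suc n) \<le> 2 * t * (s n \<bullet> v - f v) + t\<^sup>2 * (norm v)\<^sup>2" for n proof -
    have tv: "t *\<^sub>R v \<in> S" using S v by (simp add: subspace_scale)
    have "J (s n + t *\<^sub>R v) = J (s n) + 2 * t * (s n \<bullet> v - f v) + t\<^sup>2 * (norm v)\<^sup>2"
     unfolding J_def power2_norm_eq_inner add[OF sS tv] scale[OF v]
     by (simp add: inner_simps inner_commute power2_eq_square algebra_simps)
    moreover have "m \<le> J (s n + t *\<^sub>R v)" using sS tv S by (intro m_le subspace_add)
    ultimately show ?thesis using s[of n] by linarith
   qed
   then show "\<exists>N. \<forall>n\<ge>N. - 1 / real (Suc n) \<le> 2 * t * (s n \<bullet> v - f v) + t\<^sup>2 * (norm v)\<^sup>2" by blast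
  qed
  show ?thesis proof (cases "v = 0")
   case True then show ?thesis using scale[of 0 0] S0 by simp
  next
   case False
   then have pos: "(norm v)\<^sup>2 > 0" by simp
   define d where "d = y \<bullet> v - f v"
   have "0 \<le> 2 * (- d / (norm v)\<^sup>2) * d + (- d / (norm v)\<^sup>2)\<^sup>2 * (norm v)\<^sup>2"
    using nn[of "- d / (norm v)\<^sup>2"] by (simp add: d_def)
   also have "\<dots> = - (d\<^sup>2 / (norm v)\<^sup>2)" using pos by (simp add: field_simps power2_eq_square)
   finally have "d\<^sup>2 / (norm v)\<^sup>2 \<le> 0" by simp
   then have "d = 0" using pos by (simp add: divide_le_0_iff)
   then show ?thesis by (simp add: d_def)
  qed
 qed
 with ycl show ?thesis by blast
qed

lemma riesz:
 fixes f :: "'a::{real_inner,complete_space} => real"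
 assumes "bounded_linear f"
 shows "\<exists>y. \<forall>x. f x = y \<bullet> x"
proof -
 interpret bounded_linear f by fact
 obtain K where "\<And>x. norm (f x) \<le> norm x * K" using bounded by blast
 then show ?thesis using riesz_subspace[of UNIV f K] by (auto simp: add scaleR mult.commute)
qed

lemma adjoint_exists:
 fixes f :: "'a::{real_inner,complete_space} => 'b::real_inner"
 assumes "bounded_linear f"
 shows "\<exists>g. \<forall>x y. f x \<bullet> y = x \<bullet> g y"
proof -
 have "\<exists>z. \<forall>x. f x \<bullet> y = z \<bullet> x" for y by (rule riesz) (intro bounded_linear_inner_left_comp assms)
 then obtain g where "\<And>x y. f x \<bullet> y = g y \<bullet> x" by metis
 then show ?thesis by (metis inner_commute)
qed

text \<open>The library chooses the adjoint among all maps with the defining property; in infinite dimension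
 that choice is meaningful for bounded operators, by Riesz.\<close>

lemma adjoint_inner:
 fixes f :: "'a::{real_inner,complete_space} => 'b::real_inner"
 assumes "bounded_linear f"
 shows "f x \<bullet> y = x \<bullet> adjoint f y"
 using someI_ex[OF adjoint_exists[OF assms]] unfolding adjoint_def by blast

lemma bounded_linear_adjoint:
 fixes f :: "'a::{real_inner,complete_space} => 'b::real_inner"
 assumes f: "bounded_linear f"
 shows "bounded_linear (adjoint f)"
proof -
 obtain K where K: "\<And>x. norm (f x) \<le> norm x * K" "K \<ge> 0" using bounded_linear.nonneg_bounded[OF f] by blast
 note ad = adjoint_inner[OF f, symmetric]
 show ?thesis proof (rule bounded_linear_intro[where K = K])
  show "adjoint f (x + y) = adjoint f x + adjoint f y" for x y
   by (rule vector_eq_ldot[THEN iffD1]) (simp add: ad inner_add_right)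
  show "adjoint f (r *\<^sub>R x) = r *\<^sub>R adjoint f x" for r x by (rule vector_eq_ldot[THEN iffD1]) (simp add: ad)
  show "norm (adjoint f x) \<le> norm x * K" for x proof -
   have "norm (adjoint f x) * norm (adjoint f x) = f (adjoint f x) \<bullet> x"
    by (simp add: adjoint_inner[OF f] power2_norm_eq_inner[symmetric] power2_eq_square)
   also have "\<dots> \<le> norm (f (adjoint f x)) * norm x" by (rule norm_cauchy_schwarz)
   also have "\<dots> \<le> norm (adjoint f x) * K * norm x" by (intro mult_right_mono K) auto
   finally have "norm (adjoint f x) * norm (adjoint f x) \<le> norm (adjoint f x) * (K * norm x)" by simp
   then show ?thesis using K(2) by (cases "adjoint f x = 0") (auto simp: mult.commute)
  qed
 qed
qed

text \<open>The orthogonal projection onto the closure of \<open>S\<close>; testing with \<open>S\<close> alone determines it.\<close>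

definition proj :: "'a::{real_inner,complete_space} set => 'a => 'a" where
 "proj S x = (SOME y. y \<in> closure S \<and> (\<forall>s\<in>S. x \<bullet> s = y \<bullet> s))"

lemma orthogonal_closure:
 fixes x :: "'a::real_inner"
 assumes "\<forall>s\<in>S. x \<bullet> s = 0" "y \<in> closure S"
 shows "x \<bullet> y = 0"
proof -
 obtain s where s: "\<And>n. s n \<in> S" "s \<longlonglongrightarrow> y" using assms(2) by (auto simp: closure_sequential)
 have "(\<lambda>n. x \<bullet> s n) \<longlonglongrightarrow> x \<bullet> y" by (intro tendsto_intros s)
 moreover have "(\<lambda>n. x \<bullet> s n) = (\<lambda>n. 0)" using s assms by auto
 ultimately show ?thesis by (metis LIMSEQ_unique tendsto_const)
qed

lemma
 fixes S :: "'a::{real_inner,complete_space} set"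
 assumes S: "subspace S"
 shows proj_in_closure: "proj S x \<in> closure S"
  and proj_inner: "y \<in> closure S ==> proj S x \<bullet> y = x \<bullet> y"
proof -
 have "\<exists>y\<in>closure S. \<forall>s\<in>S. x \<bullet> s = y \<bullet> s" by (rule riesz_subspace[OF S, of _ "norm x"])
    (auto simp: inner_add_right intro: Cauchy_Schwarz_ineq2)
 then have *: "proj S x \<in> closure S \<and> (\<forall>s\<in>S. x \<bullet> s = proj S x \<bullet> s)" unfolding proj_def Bex_def by (rule someI_ex)
 then show "proj S x \<in> closure S" by blast
 show "proj S x \<bullet> y = x \<bullet> y" if "y \<in> closure S"
  using orthogonal_closure[of S "proj S x - x" y] * that by (auto simp: inner_diff_left)
qed

lemma subspace_inner_eqI:
 fixes x y :: "'a::real_inner"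
 assumes "subspace S" "x \<in> S" "y \<in> S" "\<And>s. s \<in> S ==> x \<bullet> s = y \<bullet> s"
 shows "x = y"
proof -
 have "(x - y) \<bullet> (x - y) = 0" using assms(4)[of "x - y"] assms(1-3) by (simp add: subspace_diff inner_diff_left)
 then show ?thesis by simp
qed

lemma closure_subspace:
 fixes S :: "'a::real_normed_vector set"
 assumes S: "subspace S"
 shows "subspace (closure S)"
proof (rule subspaceI)
 show "0 \<in> closure S" using subspace_0[OF S] closure_subset by blast
 show "x + y \<in> closure S" if "x \<in> closure S" "y \<in> closure S" for x y proof -
  obtain a b where "\<And>n. a n \<in> S" "a \<longlonglongrightarrow> x" "\<And>n. b n \<in> S" "b \<longlonglongrightarrow> y"
   using \<open>x \<in> closure S\<close> \<open>y \<in> closure S\<close> by (auto simp: closure_sequential)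
  then have "(\<forall>n. a n + b n \<in> S) \<and> (\<lambda>n. a n + b n) \<longlonglongrightarrow> x + y" using S by (auto intro: tendsto_add subspace_add)
  then show ?thesis unfolding closure_sequential by (rule exI[where x = "\<lambda>n. a n + b n"])
 qed
 show "c *\<^sub>R x \<in> closure S" if "x \<in> closure S" for c x proof -
  obtain a where "\<forall>n. a n \<in> S" "a \<longlonglongrightarrow> x" using \<open>x \<in> closure S\<close> unfolding closure_sequential by blast
  then have "(\<forall>n. c *\<^sub>R a n \<in> S) \<and> (\<lambda>n. c *\<^sub>R a n) \<longlonglongrightarrow> c *\<^sub>R x"
   using S by (auto intro!: tendsto_intros subspace_scale)
  then show ?thesis unfolding closure_sequential by (rule exI[where x = "\<lambda>n. c *\<^sub>R a n"])
 qed
qed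

lemma proj_eqI:
 fixes S :: "'a::{real_inner,complete_space} set"
 assumes "subspace S" "y \<in> closure S" "\<And>s. s \<in> S ==> x \<bullet> s = y \<bullet> s"
 shows "proj S x = y"
proof (rule subspace_inner_eqI[of "closure S"])
 show "proj S x \<bullet> s = y \<bullet> s" if "s \<in> closure S" for s
  using orthogonal_closure[of S "x - y" s] assms(3) that proj_inner[OF assms(1) that]
  by (auto simp: inner_diff_left)
qed (use assms proj_in_closure closure_subspace in auto)

lemma proj_id:
 fixes S :: "'a::{real_inner,complete_space} set"
 assumes "subspace S" "x \<in> closure S"
 shows "proj S x = x"
 by (rule proj_eqI) (use assms in auto)

lemma bounded_linear_proj:
 fixes S :: "'a::{real_inner,complete_space} set"
 assumes S: "subspace S"
 shows "bounded_linear (proj S)"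
proof (rule bounded_linear_intro[where K = 1])
 have cl: "subspace (closure S)" by (simp add: S closure_subspace)
 have *: "proj S x \<bullet> s = x \<bullet> s" if "s \<in> S" for x s using proj_inner[OF S, of s x] that closure_subset by blast
 show "proj S (x + y) = proj S x + proj S y" for x y
  by (rule proj_eqI) (use S cl * in \<open>auto simp: subspace_add proj_in_closure inner_add_left\<close>)
 show "proj S (r *\<^sub>R x) = r *\<^sub>R proj S x" for r x
  by (rule proj_eqI) (use S cl * in \<open>auto simp: subspace_scale proj_in_closure\<close>)
 show "norm (proj S x) \<le> norm x * 1" for x proof -
  have "norm (proj S x) * norm (proj S x) = x \<bullet> proj S x" using proj_inner[OF S proj_in_closure[OF S], of x x]
   by (metis inner_commute power2_norm_eq_inner power2_eq_square)
  also have "\<dots> \<le> norm x * norm (proj S x)" by (rule norm_cauchy_schwarz)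
  finally show ?thesis by (cases "proj S x = 0") auto
 qed
qed

lemma proj_symmetric:
 fixes S :: "'a::{real_inner,complete_space} set"
 assumes "subspace S"
 shows "proj S x \<bullet> y = x \<bullet> proj S y"
 using proj_inner[OF assms proj_in_closure[OF assms, of y], of x]
  proj_inner[OF assms proj_in_closure[OF assms, of x], of y] by (simp add: inner_commute)

lemma norm_projection_le:
 fixes P :: "'a::real_inner => 'a"
 assumes sym: "\<And>x y. P x \<bullet> y = x \<bullet> P y" and idem: "\<And>x. P (P x) = P x"
 shows "norm (P x) \<le> norm x"
proof -
 have "norm (P x) * norm (P x) = x \<bullet> P x"
  using sym[of x "P x"] by (simp add: idem flip: power2_norm_eq_inner power2_eq_square)
 also have "\<dots> \<le> norm x * norm (P x)" by (rule norm_cauchy_schwarz)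
 finally show ?thesis by (cases "P x = 0") auto
qed

lemma dense_if_orthogonal_trivial:
 fixes S :: "'a::{real_inner,complete_space} set"
 assumes S: "subspace S" and "\<And>x. (\<forall>s\<in>S. x \<bullet> s = 0) ==> x = 0"
 shows "closure S = UNIV"
proof -
 have "x - proj S x = 0" for x proof (rule assms(2), rule ballI)
  fix s assume "s \<in> S"
  then show "(x - proj S x) \<bullet> s = 0"
   using proj_inner[OF S, of s x] closure_subset[of S] by (auto simp: inner_diff_left)
 qed
 then have "x = proj S x" for x by simp
 then show ?thesis using proj_in_closure[OF S] by (metis UNIV_eq_I)
qed

text \<open>A form of the Lax-Milgram theorem whose test space carries no complete norm. Coercivity along \<open>\<Phi>\<close>
 bounds \<open>q \<psi>\<close>, and hence \<open>L \<psi>\<close>, by the norm of the vector that represents \<open>E _ \<psi>\<close>. So \<open>L\<close> factors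
 through these vectors as a bounded functional, and its Riesz representative is the solution.\<close>

lemma lions_projection:
 fixes E :: "'h::{real_inner,complete_space} => 'a::real_vector => real"
 assumes El: "\<And>\<psi>. bounded_linear (\<lambda>w. E w \<psi>)"
  and Er: "\<And>w. linear (E w)" and L: "linear L"
  and c: "c > 0" and coer: "\<And>\<psi>. E (\<Phi> \<psi>) \<psi> \<ge> c * (q \<psi>)\<^sup>2"
  and \<Phi>: "\<And>\<psi>. norm (\<Phi> \<psi>) \<le> C * q \<psi>" and Lb: "\<And>\<psi>. \<bar>L \<psi>\<bar> \<le> C * q \<psi>" and C: "C \<ge> 0"
  and q: "\<And>\<psi>. q \<psi> \<ge> 0"
 shows "\<exists>w. \<forall>\<psi>. E w \<psi> = L \<psi>"
proof -
 have "\<exists>n. \<forall>w. E w \<psi> = n \<bullet> w" for \<psi> by (rule riesz[OF El])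
 then obtain N where N: "\<And>\<psi> w. E w \<psi> = N \<psi> \<bullet> w" by metis
 have linN: "linear N" proof (rule linearI)
  show "N (a + b) = N a + N b" for a b
   by (rule vector_eq_rdot[THEN iffD1]) (auto simp: inner_add_left linear_add[OF Er] simp flip: N)
  show "N (r *\<^sub>R a) = r *\<^sub>R N a" for r a
   by (rule vector_eq_rdot[THEN iffD1]) (auto simp: linear_scale[OF Er] simp flip: N)
 qed
 have qN: "c * q \<psi> \<le> C * norm (N \<psi>)" for \<psi> proof (cases "q \<psi> = 0")
  case False
  then have qp: "q \<psi> > 0" using q[of \<psi>] by simp
  have "c * (q \<psi>)\<^sup>2 \<le> N \<psi> \<bullet> \<Phi> \<psi>" using coer[of \<psi>] by (simp add: N)
  also have "\<dots> \<le> norm (N \<psi>) * norm (\<Phi> \<psi>)" by (rule norm_cauchy_schwarz)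
  also have "\<dots> \<le> norm (N \<psi>) * (C * q \<psi>)" by (intro mult_left_mono \<Phi>) auto
  finally have "q \<psi> * (c * q \<psi>) \<le> q \<psi> * (C * norm (N \<psi>))" by (simp add: power2_eq_square algebra_simps)
  then show ?thesis using qp by simp
 qed (use C in auto)
 have LN: "\<bar>L \<psi>\<bar> \<le> C * (C / c) * norm (N \<psi>)" for \<psi> proof -
  have "\<bar>L \<psi>\<bar> \<le> C * q \<psi>" by (rule Lb)
  also have "\<dots> \<le> C * (C * norm (N \<psi>) / c)" using qN[of \<psi>] c C by (intro mult_left_mono) (auto simp: field_simps)
  finally show ?thesis by simp
 qed
 have wd: "L \<psi> = L \<psi>'" if "N \<psi> = N \<psi>'" for \<psi> \<psi>' proof -
  have "N (\<psi> - \<psi>') = 0" using that by (simp add: linear_diff[OF linN])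
  then have "L (\<psi> - \<psi>') = 0" using LN[of "\<psi> - \<psi>'"] by simp
  then show ?thesis by (simp add: linear_diff[OF L])
 qed
 define f where "f n = L (SOME \<psi>. N \<psi> = n)" for n
 have f: "f (N \<psi>) = L \<psi>" for \<psi> unfolding f_def by (rule wd) (rule someI, rule refl)
 have "\<exists>y\<in>closure (range N). \<forall>s\<in>range N. f s = y \<bullet> s" proof (rule riesz_subspace[where C = "C * (C / c)"])
  show "subspace (range N)" by (rule linear_subspace_image[OF linN subspace_UNIV])
  show "f (x + y) = f x + f y" if "x \<in> range N" "y \<in> range N" for x y
   using that by (auto simp: f linear_add[OF L] simp flip: linear_add[OF linN])
  show "f (r *\<^sub>R x) = r * f x" if "x \<in> range N" for x r
   using that by (auto simp: f linear_scale[OF L] simp flip: linear_scale[OF linN])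
  show "\<bar>f x\<bar> \<le> C * (C / c) * norm x" if "x \<in> range N" for x using that LN by (auto simp: f)
 qed
 then obtain y where "\<And>\<psi>. f (N \<psi>) = y \<bullet> N \<psi>" by blast
 then have "\<forall>\<psi>. E y \<psi> = L \<psi>" by (simp add: f N inner_commute)
 then show ?thesis by blast
qed

section \<open>The Hilbert space of square integrable functions\<close>

definition sqint :: "('a::euclidean_space => 'b::{real_inner,banach,second_countable_topology}) => bool" where
 "sqint f \<longleftrightarrow> f \<in> borel_measurable lebesgue \<and> integrable lebesgue (\<lambda>x. (norm (f x))\<^sup>2)"

lemma sqintD [measurable_dest]: "sqint f ==> f \<in> borel_measurable lebesgue"
 by (simp add: sqint_def)

lemma sqint_integrable: "sqint f ==> integrable lebesgue (\<lambda>x. (norm (f x))\<^sup>2)"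
 by (simp add: sqint_def)

lemma sqint_bound:
 assumes "sqint g" and [measurable]: "f \<in> borel_measurable lebesgue"
  and "AE x in lebesgue. norm (f x) \<le> C * norm (g x)"
 shows "sqint f"
 unfolding sqint_def
proof (intro conjI)
 show "integrable lebesgue (\<lambda>x. (norm (f x))\<^sup>2)" proof (rule Bochner_Integration.integrable_bound)
  show "integrable lebesgue (\<lambda>x. C\<^sup>2 * (norm (g x))\<^sup>2)" using sqint_integrable[OF assms(1)] by simp
  show "AE x in lebesgue. norm ((norm (f x))\<^sup>2) \<le> norm (C\<^sup>2 * (norm (g x))\<^sup>2)" using assms(3) proof eventually_elim
   case (elim x)
   then have "(norm (f x))\<^sup>2 \<le> (C * norm (g x))\<^sup>2" by (intro power_mono) auto
   then show ?case by (simp add: power_mult_distrib)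
  qed
 qed simp
qed simp

lemma sqint_cong_AE:
 assumes "sqint f" "g \<in> borel_measurable lebesgue" "AE x in lebesgue. f x = g x"
 shows "sqint g"
 by (rule sqint_bound[OF assms(1,2), of 1]) (use assms(3) in auto)

lemma sqint_add:
 assumes f: "sqint f" and g: "sqint g"
 shows "sqint (\<lambda>x. f x + g x)"
 unfolding sqint_def
proof (intro conjI)
 have [measurable]: "f \<in> borel_measurable lebesgue" "g \<in> borel_measurable lebesgue"
  using assms by (auto simp: sqint_def)
 show "(\<lambda>x. f x + g x) \<in> borel_measurable lebesgue" by simp
 show "integrable lebesgue (\<lambda>x. (norm (f x + g x))\<^sup>2)" proof (rule Bochner_Integration.integrable_bound)
  show "integrable lebesgue (\<lambda>x. 2 * (norm (f x))\<^sup>2 + 2 * (norm (g x))\<^sup>2)"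
   using sqint_integrable[OF f] sqint_integrable[OF g] by simp
  show "AE x in lebesgue. norm ((norm (f x + g x))\<^sup>2) \<le> norm (2 * (norm (f x))\<^sup>2 + 2 * (norm (g x))\<^sup>2)"
  proof (rule AE_I2)
   fix x
   have "(norm (f x + g x))\<^sup>2 \<le> (norm (f x) + norm (g x))\<^sup>2" by (intro power_mono norm_triangle_ineq) auto
   also have "\<dots> \<le> 2 * (norm (f x))\<^sup>2 + 2 * (norm (g x))\<^sup>2"
    using sum_squares_bound[of "norm (f x)" "norm (g x)"] by (simp add: power2_sum)
   finally show "norm ((norm (f x + g x))\<^sup>2) \<le> norm (2 * (norm (f x))\<^sup>2 + 2 * (norm (g x))\<^sup>2)" by simp
  qed
 qed simp
qed

lemma sqint_zero [simp]: "sqint (\<lambda>x. 0)"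
 by (simp add: sqint_def)

lemma sqint_scaleR: "sqint f ==> sqint (\<lambda>x. c *\<^sub>R f x)"
 by (rule sqint_bound[of f _ "\<bar>c\<bar>"]) (auto simp: sqintD)

lemma sqint_minus: "sqint f ==> sqint (\<lambda>x. - f x)"
 by (rule sqint_bound[of f _ 1]) (auto simp: sqintD)

lemma sqint_diff: "sqint f ==> sqint g ==> sqint (\<lambda>x. f x - g x)"
 using sqint_add[of f "\<lambda>x. - g x"] sqint_minus[of g] by simp

lemma sqint_norm: "sqint f ==> sqint (\<lambda>x. norm (f x))"
 by (rule sqint_bound[of f _ 1]) (auto simp: sqintD)

lemma sqint_mult_norm_integrable:
 assumes f: "sqint f" and g: "sqint g"
 shows "integrable lebesgue (\<lambda>x. norm (f x) * norm (g x))"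
proof (rule Bochner_Integration.integrable_bound)
 have [measurable]: "f \<in> borel_measurable lebesgue" "g \<in> borel_measurable lebesgue"
  using assms by (auto simp: sqint_def)
 show "(\<lambda>x. norm (f x) * norm (g x)) \<in> borel_measurable lebesgue" by simp
 show "integrable lebesgue (\<lambda>x. (norm (f x))\<^sup>2 + (norm (g x))\<^sup>2)"
  using sqint_integrable[OF f] sqint_integrable[OF g] by simp
 show "AE x in lebesgue. norm (norm (f x) * norm (g x)) \<le> norm ((norm (f x))\<^sup>2 + (norm (g x))\<^sup>2)" proof (rule AE_I2)
  fix x
  show "norm (norm (f x) * norm (g x)) \<le> norm ((norm (f x))\<^sup>2 + (norm (g x))\<^sup>2)" proof -
   have "2 * (norm (f x) * norm (g x)) \<le> (norm (f x))\<^sup>2 + (norm (g x))\<^sup>2"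
    using sum_squares_bound[of "norm (f x)" "norm (g x)"] by (simp add: mult.assoc)
   moreover have "0 \<le> norm (f x) * norm (g x)" by simp
   moreover have "norm (norm (f x) * norm (g x)) = norm (f x) * norm (g x)" by simp
   moreover have "norm ((norm (f x))\<^sup>2 + (norm (g x))\<^sup>2) = (norm (f x))\<^sup>2 + (norm (g x))\<^sup>2" by simp
   ultimately show ?thesis by linarith
  qed
 qed
qed

lemma sqint_inner_integrable:
 assumes f: "sqint f" and g: "sqint g"
 shows "integrable lebesgue (\<lambda>x. f x \<bullet> g x)"
 by (rule Bochner_Integration.integrable_bound[OF sqint_mult_norm_integrable[OF f g]])
   (use f g in \<open>auto simp: sqint_def Cauchy_Schwarz_ineq2\<close>)

lemma sqint_indicator_integrable:
 fixes f :: "'a::euclidean_space => 'b::{real_inner,banach,second_countable_topology}"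
 assumes f: "sqint f" and A: "A \<in> sets lebesgue" "emeasure lebesgue A < \<infinity>"
 shows "integrable lebesgue (\<lambda>x. indicator A x *\<^sub>R f x)"
proof (rule Bochner_Integration.integrable_bound)
 have "sqint (indicator A :: 'a => real)" unfolding sqint_def proof
  have "(\<lambda>x. (norm (indicator A x :: real))\<^sup>2) = indicator A" by (auto simp: indicator_def fun_eq_iff)
  then show "integrable lebesgue (\<lambda>x. (norm (indicator A x :: real))\<^sup>2)" using A by simp
 qed (use A in auto)
 from sqint_mult_norm_integrable[OF this f]
 show "integrable lebesgue (\<lambda>x. norm (indicator A x :: real) * norm (f x))" .
 show "(\<lambda>x. indicator A x *\<^sub>R f x) \<in> borel_measurable lebesgue" using A sqintD[OF f] by measurable
qed auto

quotient_type (overloaded) ('a, 'b) l2 =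
 "'a::euclidean_space => 'b::{real_inner,banach,second_countable_topology}" /
 partial: "\<lambda>f g. sqint f \<and> sqint g \<and> (AE x in lebesgue. f x = g x)"
proof (rule part_equivpI)
 show "\<exists>f::'a => 'b. sqint f \<and> sqint f \<and> (AE x in lebesgue. f x = f x)" by (rule exI[of _ "\<lambda>x. 0"]) simp
 show "symp (\<lambda>f g::'a => 'b. sqint f \<and> sqint g \<and> (AE x in lebesgue. f x = g x))" by (rule sympI) auto
 show "transp (\<lambda>f g::'a => 'b. sqint f \<and> sqint g \<and> (AE x in lebesgue. f x = g x))"
  by (rule transpI) (auto elim: AE_mp)
qed

lemma sqint_rep [simp]: "sqint (rep_l2 x)"
 using Quotient3_rep_reflp[OF Quotient3_l2, of x] by simp

lemma abs_rep_l2 [simp]: "abs_l2 (rep_l2 x) = x"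
 using Quotient3_abs_rep[OF Quotient3_l2] .

lemma abs_l2_eq_iff: "sqint f ==> sqint g ==> abs_l2 f = abs_l2 g \<longleftrightarrow> (AE x in lebesgue. f x = g x)"
 using Quotient3_rel[OF Quotient3_l2, of f g] by auto

lemma rep_abs_l2: "sqint f ==> AE x in lebesgue. rep_l2 (abs_l2 f) x = f x"
 by (metis abs_l2_eq_iff abs_rep_l2 sqint_rep)

lemma rep_l2_measurable [measurable]: "rep_l2 x \<in> borel_measurable lebesgue"
 by (rule sqintD) simp

instantiation l2 :: (euclidean_space, "{real_inner,banach,second_countable_topology}") real_inner
begin

lift_definition zero_l2 :: "('a,'b) l2" is "\<lambda>x. 0" by simp
lift_definition plus_l2 :: "('a,'b) l2 => ('a,'b) l2 => ('a,'b) l2" is "\<lambda>f g x. f x + g x" by (auto intro: sqint_add)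
lift_definition minus_l2 :: "('a,'b) l2 => ('a,'b) l2 => ('a,'b) l2" is "\<lambda>f g x. f x - g x"
 by (auto intro: sqint_diff)
lift_definition uminus_l2 :: "('a,'b) l2 => ('a,'b) l2" is "\<lambda>f x. - f x" by (auto intro: sqint_minus)
lift_definition scaleR_l2 :: "real => ('a,'b) l2 => ('a,'b) l2" is "\<lambda>c f x. c *\<^sub>R f x" by (auto intro: sqint_scaleR)
lift_definition inner_l2 :: "('a,'b) l2 => ('a,'b) l2 => real" is "\<lambda>f g. \<integral>x. f x \<bullet> g x \<partial>lebesgue"
proof -
 fix f f' g g' :: "'a => 'b"
 assume f: "sqint f \<and> sqint f' \<and> (AE x in lebesgue. f x = f' x)"
  and g: "sqint g \<and> sqint g' \<and> (AE x in lebesgue. g x = g' x)"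
 show "(\<integral>x. f x \<bullet> g x \<partial>lebesgue) = (\<integral>x. f' x \<bullet> g' x \<partial>lebesgue)"
  by (rule integral_cong_AE) (use f g in \<open>auto simp: sqint_def\<close>)
qed

definition norm_l2 :: "('a,'b) l2 => real" where "norm_l2 x = sqrt (x \<bullet> x)"
definition dist_l2 :: "('a,'b) l2 => ('a,'b) l2 => real" where "dist_l2 x y = norm (x - y)"
definition sgn_l2 :: "('a,'b) l2 => ('a,'b) l2" where "sgn_l2 x = inverse (norm x) *\<^sub>R x"
definition uniformity_l2 :: "(('a,'b) l2 \<times> ('a,'b) l2) filter" where
 "uniformity_l2 = (INF e\<in>{0 <..}. principal {(x, y). dist x y < e})"
definition open_l2 :: "('a,'b) l2 set => bool" where
 "open_l2 U = (\<forall>x\<in>U. eventually (\<lambda>(x', y). x' = x \<longrightarrow> y \<in> U) uniformity)"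

instance
proof
 fix x y z :: "('a,'b) l2" and a b :: real and U :: "('a,'b) l2 set"
 show "x + y + z = x + (y + z)" by transfer (auto intro!: sqint_add simp: add.assoc)
 show "x + y = y + x" by transfer (auto intro!: sqint_add simp: add.commute)
 show "0 + x = x" by transfer auto
 show "- x + x = 0" by transfer auto
 show "x - y = x + - y" by transfer (auto intro!: sqint_add sqint_diff sqint_minus)
 show "a *\<^sub>R (x + y) = a *\<^sub>R x + a *\<^sub>R y" by transfer (auto intro!: sqint_add sqint_scaleR simp: scaleR_add_right)
 show "(a + b) *\<^sub>R x = a *\<^sub>R x + b *\<^sub>R x" by transfer (auto intro!: sqint_add sqint_scaleR simp: scaleR_add_left)
 show "a *\<^sub>R b *\<^sub>R x = (a * b) *\<^sub>R x" by transfer (auto intro!: sqint_scaleR)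
 show "1 *\<^sub>R x = x" by transfer auto
 show "dist x y = norm (x - y)" by (simp add: dist_l2_def)
 show "sgn x = inverse (norm x) *\<^sub>R x" by (simp add: sgn_l2_def)
 show "uniformity = (INF e\<in>{0 <..}. principal {(x, y). dist (x::('a,'b) l2) y < e})" by (simp add: uniformity_l2_def)
 show "open U = (\<forall>x\<in>U. eventually (\<lambda>(x', y). x' = x \<longrightarrow> y \<in> U) uniformity)" by (simp add: open_l2_def)
 show "x \<bullet> y = y \<bullet> x" by transfer (simp add: inner_commute)
 show "(x + y) \<bullet> z = x \<bullet> z + y \<bullet> z" by transfer (auto simp: inner_add_left sqint_inner_integrable)
 show "a *\<^sub>R x \<bullet> y = a * (x \<bullet> y)" by transfer simp
 show "0 \<le> x \<bullet> x" by transfer simp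
 show "x \<bullet> x = 0 \<longleftrightarrow> x = 0" proof transfer
  fix f :: "'a => 'b" assume "sqint f \<and> sqint f \<and> (AE x in lebesgue. f x = f x)"
  then have f: "sqint f" by blast
  have "(\<integral>x. f x \<bullet> f x \<partial>lebesgue) = 0 \<longleftrightarrow> (AE x in lebesgue. f x \<bullet> f x = 0)"
   by (rule integral_nonneg_eq_0_iff_AE) (auto simp: sqint_inner_integrable f)
  then show "((\<integral>x. f x \<bullet> f x \<partial>lebesgue) = 0) = (sqint f \<and> sqint (\<lambda>x. 0::'b) \<and> (AE x in lebesgue. f x = 0))"
   using f by simp
 qed
 show "norm x = sqrt (x \<bullet> x)" by (simp add: norm_l2_def)
qed

end

lemma inner_abs_l2: "sqint f ==> sqint g ==> abs_l2 f \<bullet> abs_l2 g = (\<integral>t. f t \<bullet> g t \<partial>lebesgue)"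
 by (simp add: inner_l2.abs_eq)

lemma inner_l2: "x \<bullet> y = (\<integral>t. rep_l2 x t \<bullet> rep_l2 y t \<partial>lebesgue)"
 using inner_abs_l2[OF sqint_rep sqint_rep, of x y] by simp

lemma add_abs_l2: "sqint f ==> sqint g ==> abs_l2 f + abs_l2 g = abs_l2 (\<lambda>x. f x + g x)"
 by (simp add: plus_l2.abs_eq)

lemma diff_abs_l2: "sqint f ==> sqint g ==> abs_l2 f - abs_l2 g = abs_l2 (\<lambda>x. f x - g x)"
 by (simp add: minus_l2.abs_eq)

lemma scaleR_abs_l2: "sqint f ==> c *\<^sub>R abs_l2 f = abs_l2 (\<lambda>x. c *\<^sub>R f x)"
 by (simp add: scaleR_l2.abs_eq)

lemma zero_abs_l2: "0 = abs_l2 (\<lambda>x. 0)"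
 by (simp add: zero_l2_def)

lemma norm_abs_l2: "sqint f ==> (norm (abs_l2 f))\<^sup>2 = (\<integral>t. (norm (f t))\<^sup>2 \<partial>lebesgue)"
 by (simp add: power2_norm_eq_inner inner_abs_l2)

lemma norm_l2: "(norm x)\<^sup>2 = (\<integral>t. (norm (rep_l2 x t))\<^sup>2 \<partial>lebesgue)"
 using norm_abs_l2[OF sqint_rep, of x] by simp

lemma
 shows rep_add_l2: "AE t in lebesgue. rep_l2 (x + y) t = rep_l2 x t + rep_l2 y t"
  and rep_diff_l2: "AE t in lebesgue. rep_l2 (x - y) t = rep_l2 x t - rep_l2 y t"
  and rep_scaleR_l2: "AE t in lebesgue. rep_l2 (c *\<^sub>R x) t = c *\<^sub>R rep_l2 x t"
proof -
 show "AE t in lebesgue. rep_l2 (x + y) t = rep_l2 x t + rep_l2 y t"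
  using rep_abs_l2[OF sqint_add[OF sqint_rep sqint_rep], of x y] by (simp add: add_abs_l2[symmetric])
 show "AE t in lebesgue. rep_l2 (x - y) t = rep_l2 x t - rep_l2 y t"
  using rep_abs_l2[OF sqint_diff[OF sqint_rep sqint_rep], of x y] by (simp add: diff_abs_l2[symmetric])
 show "AE t in lebesgue. rep_l2 (c *\<^sub>R x) t = c *\<^sub>R rep_l2 x t"
  using rep_abs_l2[OF sqint_scaleR[OF sqint_rep], of c x] by (simp add: scaleR_abs_l2[symmetric])
qed

lemma norm_l2_mono:
 assumes "sqint f" "sqint g" "AE x in lebesgue. norm (f x) \<le> C * norm (g x)" "C \<ge> 0"
 shows "norm (abs_l2 f) \<le> C * norm (abs_l2 g)"
proof (rule power2_le_imp_le)
 have "(norm (abs_l2 f))\<^sup>2 = (\<integral>t. (norm (f t))\<^sup>2 \<partial>lebesgue)" by (rule norm_abs_l2) fact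
 also have "\<dots> \<le> (\<integral>t. C\<^sup>2 * (norm (g t))\<^sup>2 \<partial>lebesgue)" proof (rule integral_mono_AE)
  show "AE t in lebesgue. (norm (f t))\<^sup>2 \<le> C\<^sup>2 * (norm (g t))\<^sup>2" using assms(3) proof eventually_elim
   case (elim t)
   then have "(norm (f t))\<^sup>2 \<le> (C * norm (g t))\<^sup>2" by (intro power_mono) auto
   then show ?case by (simp add: power_mult_distrib)
  qed
 qed (use assms in \<open>auto simp: sqint_integrable\<close>)
 also have "\<dots> = (C * norm (abs_l2 g))\<^sup>2" by (simp add: norm_abs_l2 assms power_mult_distrib)
 finally show "(norm (abs_l2 f))\<^sup>2 \<le> (C * norm (abs_l2 g))\<^sup>2" .
qed (use assms in auto)

lemma sqint_sum: "(\<And>i. i \<in> I ==> sqint (f i)) ==> sqint (\<lambda>x. \<Sum>i\<in>I. f i x)"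
 by (induction I rule: infinite_finite_induct) (auto intro: sqint_add)

lemma norm_abs_l2_sum:
 assumes "\<And>i. i \<in> I ==> sqint (f i)"
 shows "norm (abs_l2 (\<lambda>x. \<Sum>i\<in>I. f i x)) \<le> (\<Sum>i\<in>I. norm (abs_l2 (f i)))"
 using assms
proof (induction I rule: infinite_finite_induct)
 case (insert i I)
 have "abs_l2 (\<lambda>x. \<Sum>j\<in>insert i I. f j x) = abs_l2 (f i) + abs_l2 (\<lambda>x. \<Sum>j\<in>I. f j x)"
  using insert by (simp add: add_abs_l2 sqint_sum)
 then have "norm (abs_l2 (\<lambda>x. \<Sum>j\<in>insert i I. f j x)) \<le> norm (abs_l2 (f i)) + norm (abs_l2 (\<lambda>x. \<Sum>j\<in>I. f j x))"
  by (simp add: norm_triangle_ineq)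
 then show ?case using insert by simp
qed (auto simp flip: zero_abs_l2)

text \<open>Riesz-Fischer: along a subsequence whose increments are summable in norm, the increments are
 absolutely summable almost everywhere, with a square integrable sum that dominates everything.\<close>

lemma riesz_fischer:
 fixes g :: "nat => 'a::euclidean_space => 'b::{real_inner,banach,second_countable_topology}"
 assumes g: "\<And>n. sqint (g n)"
  and b: "\<And>n. norm (abs_l2 (\<lambda>x. g (Suc n) x - g n x)) \<le> (1/2) ^ n"
 shows "\<exists>h k. sqint h \<and> sqint k \<and> (AE x in lebesgue. (\<lambda>n. g n x) \<longlonglongrightarrow> h x) \<and>
  (AE x in lebesgue. \<forall>n. norm (g n x) \<le> k x) \<and> (\<lambda>n. abs_l2 (g n)) \<longlonglongrightarrow> abs_l2 h"
proof -
 have [measurable]: "g n \<in> borel_measurable lebesgue" for n using g by (auto simp: sqint_def)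
 define d where "d n x = norm (g (Suc n) x - g n x)" for n x
 have d: "sqint (d n)" for n unfolding d_def by (intro sqint_norm sqint_diff g)
 have [measurable]: "d n \<in> borel_measurable lebesgue" for n using d by (auto simp: sqint_def)
 have d0: "d n x \<ge> 0" for n x by (simp add: d_def)
 have nd: "norm (abs_l2 (d n)) \<le> (1/2) ^ n" for n proof -
  have "norm (abs_l2 (d n)) \<le> 1 * norm (abs_l2 (\<lambda>x. g (Suc n) x - g n x))"
   by (rule norm_l2_mono) (auto simp: d sqint_diff g d_def)
  then show ?thesis using b[of n] by simp
 qed
 define S where "S N x = (\<Sum>n<N. d n x)" for N x
 have S: "sqint (S N)" for N unfolding S_def by (intro sqint_sum d)
 have [measurable]: "S n \<in> borel_measurable lebesgue" for n using S by (auto simp: sqint_def)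
 have S0: "S N x \<ge> 0" for N x by (auto simp: S_def d0 sum_nonneg)
 have "norm (abs_l2 (S N)) \<le> 2" for N proof -
  have "norm (abs_l2 (S N)) \<le> (\<Sum>n<N. norm (abs_l2 (d n)))" unfolding S_def by (rule norm_abs_l2_sum) (rule d)
  also have "\<dots> \<le> (\<Sum>n<N. (1/2) ^ n)" by (intro sum_mono nd)
  also have "\<dots> \<le> (\<Sum>n. (1/2::real) ^ n)" by (rule sum_le_suminf) auto
  also have "\<dots> = 2" by (simp add: suminf_geometric)
  finally show ?thesis .
 qed
 then have "(norm (abs_l2 (S N)))\<^sup>2 \<le> 2\<^sup>2" for N by (intro power_mono) auto
 then have S4: "(\<integral>x. (S N x)\<^sup>2 \<partial>lebesgue) \<le> 4" for N using S S0 by (simp add: norm_abs_l2)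
 have nnS: "(\<integral>\<^sup>+x. ennreal ((S N x)\<^sup>2) \<partial>lebesgue) \<le> 4" for N proof -
  have "(\<integral>\<^sup>+x. ennreal ((S N x)\<^sup>2) \<partial>lebesgue) = ennreal (\<integral>x. (S N x)\<^sup>2 \<partial>lebesgue)"
   using sqint_integrable[OF S[of N]] by (intro nn_integral_eq_integral) auto
  also have "\<dots> \<le> ennreal 4" using S4 by (rule ennreal_leI)
  finally show ?thesis by simp
 qed
 define F where "F x = (SUP N. ennreal ((S N x)\<^sup>2))" for x
 have [measurable]: "F \<in> borel_measurable lebesgue" unfolding F_def by measurable
 have Smono: "S N x \<le> S M x" if "N \<le> M" for N M x unfolding S_def by (rule sum_mono2) (use that d0 in auto)
 have "(\<integral>\<^sup>+x. F x \<partial>lebesgue) = (SUP N. \<integral>\<^sup>+x. ennreal ((S N x)\<^sup>2) \<partial>lebesgue)" unfolding F_def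
  by (rule nn_integral_monotone_convergence_SUP)
    (auto simp: incseq_def le_fun_def intro!: ennreal_leI power_mono Smono S0)
 also have "\<dots> \<le> 4" using nnS by (intro SUP_least) auto
 finally have F4: "(\<integral>\<^sup>+x. F x \<partial>lebesgue) \<le> 4" .
 then have Ffin: "(\<integral>\<^sup>+x. F x \<partial>lebesgue) \<noteq> \<infinity>" by (auto simp: top_unique)
 then have AEF: "AE x in lebesgue. F x \<noteq> \<infinity>" by (intro nn_integral_PInf_AE) auto
 define R where "R x = sqrt (enn2real (F x))" for x
 have [measurable]: "R \<in> borel_measurable lebesgue" unfolding R_def by measurable
 have SR: "AE x in lebesgue. \<forall>N. S N x \<le> R x" using AEF proof eventually_elim
  case (elim x)
  show ?case proof
   fix N
   have "ennreal ((S N x)\<^sup>2) \<le> F x" unfolding F_def by (rule SUP_upper) simp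
   then have "enn2real (ennreal ((S N x)\<^sup>2)) \<le> enn2real (F x)"
    using elim by (intro enn2real_mono) (auto simp: less_top)
   then have "(S N x)\<^sup>2 \<le> enn2real (F x)" by simp
   then show "S N x \<le> R x" unfolding R_def by (rule real_le_rsqrt)
  qed
 qed
 have Rint: "sqint R" unfolding sqint_def proof
  have "AE x in lebesgue. ennreal ((R x)\<^sup>2) = F x" using AEF by eventually_elim (auto simp: R_def less_top)
  then have "(\<integral>\<^sup>+x. ennreal ((R x)\<^sup>2) \<partial>lebesgue) = (\<integral>\<^sup>+x. F x \<partial>lebesgue)" by (rule nn_integral_cong_AE)
  then show "integrable lebesgue (\<lambda>x. (norm (R x))\<^sup>2)"
   using Ffin by (intro integrableI_nonneg) (auto simp: less_top)
 qed simp
 define h where "h x = lim (\<lambda>n. g n x)" for x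
 have [measurable]: "h \<in> borel_measurable lebesgue" unfolding h_def by (rule borel_measurable_lim_metric) simp
 define k where "k x = norm (g 0 x) + R x" for x
 have k: "sqint k" unfolding k_def by (intro sqint_add sqint_norm g Rint)
 have tel: "g N x = g 0 x + (\<Sum>n<N. g (Suc n) x - g n x)" for N x
  using sum_lessThan_telescope[of "\<lambda>n. g n x" N] by simp
 have gk: "AE x in lebesgue. \<forall>n. norm (g n x) \<le> k x" using SR proof eventually_elim
  case (elim x)
  show ?case proof
   fix n
   have "norm (g n x) \<le> norm (g 0 x) + norm (\<Sum>i<n. g (Suc i) x - g i x)" by (subst tel) (rule norm_triangle_ineq)
   also have "norm (\<Sum>i<n. g (Suc i) x - g i x) \<le> S n x" unfolding S_def d_def by (rule norm_sum)
   finally show "norm (g n x) \<le> k x" using elim[rule_format, of n] by (simp add: k_def)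
  qed
 qed
 have gh: "AE x in lebesgue. (\<lambda>n. g n x) \<longlonglongrightarrow> h x" using SR proof eventually_elim
  case (elim x)
  have "summable (\<lambda>n. d n x)"
   by (rule summableI_nonneg_bounded[where x = "R x"]) (use elim d0 in \<open>auto simp: S_def\<close>)
  then have "summable (\<lambda>n. g (Suc n) x - g n x)" unfolding d_def by (rule summable_norm_cancel)
  then have "(\<lambda>N. g 0 x + (\<Sum>n<N. g (Suc n) x - g n x)) \<longlonglongrightarrow> g 0 x + (\<Sum>n. g (Suc n) x - g n x)"
   by (intro tendsto_intros summable_LIMSEQ)
  then have "convergent (\<lambda>N. g N x)" unfolding tel[symmetric] by (auto simp: convergent_def)
  then show ?case unfolding h_def by (simp add: convergent_LIMSEQ_iff)
 qed
 have hk: "AE x in lebesgue. norm (h x) \<le> k x" using gk gh proof eventually_elim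
  case (elim x)
  show ?case by (rule LIMSEQ_le_const2[OF tendsto_norm[OF elim(2)]]) (use elim(1) in auto)
 qed
 have h: "sqint h" by (rule sqint_bound[OF k, of _ 1]) (use hk in \<open>auto elim: eventually_mono\<close>)
 have "(\<lambda>n. \<integral>x. (norm (g n x - h x))\<^sup>2 \<partial>lebesgue) \<longlonglongrightarrow> integral\<^sup>L (lebesgue :: 'a measure) (\<lambda>x. 0)"
 proof (rule integral_dominated_convergence[where w = "\<lambda>x. 4 * (k x)\<^sup>2"])
  show "integrable lebesgue (\<lambda>x. 4 * (k x)\<^sup>2)" using sqint_integrable[OF k] by simp
  show "AE x in lebesgue. (\<lambda>n. (norm (g n x - h x))\<^sup>2) \<longlonglongrightarrow> 0"
   using gh by eventually_elim (auto intro!: tendsto_eq_intros)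
  show "AE x in lebesgue. norm ((norm (g n x - h x))\<^sup>2) \<le> 4 * (k x)\<^sup>2" for n using gk hk proof eventually_elim
   case (elim x)
   have "norm (g n x - h x) \<le> 2 * k x"
    using norm_triangle_ineq4[of "g n x" "h x"] elim(1)[rule_format, of n] elim(2) by linarith
   then have "(norm (g n x - h x))\<^sup>2 \<le> (2 * k x)\<^sup>2" by (intro power_mono) auto
   then show ?case by simp
  qed
 qed simp_all
 then have "(\<lambda>n. (norm (abs_l2 (g n) - abs_l2 h))\<^sup>2) \<longlonglongrightarrow> 0" by (simp add: norm_abs_l2 diff_abs_l2 g h sqint_diff)
 then have "(\<lambda>n. sqrt ((norm (abs_l2 (g n) - abs_l2 h))\<^sup>2)) \<longlonglongrightarrow> sqrt 0" by (rule tendsto_real_sqrt)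
 then have "(\<lambda>n. abs_l2 (g n)) \<longlonglongrightarrow> abs_l2 h" by (simp add: tendsto_norm_zero_iff LIM_zero_iff)
 with h k gh gk show ?thesis by blast
qed

lemma fast_subsequence:
 fixes X :: "nat => 'a::real_normed_vector"
 assumes "Cauchy X"
 shows "\<exists>r::nat => nat. strict_mono r \<and> (\<forall>n. norm (X (r (Suc n)) - X (r n)) \<le> (1/2) ^ n)"
proof -
 have "\<exists>M. \<forall>m\<ge>M. \<forall>n\<ge>M. norm (X m - X n) < (1/2) ^ k" for k using CauchyD[OF assms, of "(1/2)^k"] by simp
 then obtain M where M: "\<And>k m n. m \<ge> M k ==> n \<ge> M k ==> norm (X m - X n) < (1/2) ^ k" by metis
 have "\<exists>r. \<forall>n. r n \<ge> M n \<and> r (Suc n) > r n" proof (rule dependent_nat_choice)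
  show "\<exists>x. x \<ge> M 0" by blast
  show "\<exists>y. y \<ge> M (Suc n) \<and> y > x" for x n by (rule exI[of _ "max (M (Suc n)) (Suc x)"]) auto
 qed
 then obtain r where r: "\<And>n. r n \<ge> M n" "\<And>n. r (Suc n) > r n" by metis
 have "norm (X (r (Suc n)) - X (r n)) \<le> (1/2) ^ n" for n
  using M[of n "r (Suc n)" "r n"] r(1)[of n] r(2)[of n] by simp
 then show ?thesis using r(2) by (intro exI[of _ r]) (auto simp: strict_mono_Suc_iff)
qed

instance l2 :: (euclidean_space, "{real_inner,banach,second_countable_topology}") banach
proof
 fix X :: "nat => ('a,'b) l2" assume X: "Cauchy X"
 obtain r where r: "strict_mono r" "\<And>n. norm (X (r (Suc n)) - X (r n)) \<le> (1/2) ^ n"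
  using fast_subsequence[OF X] by blast
 define g where "g n = rep_l2 (X (r n))" for n
 have ag: "abs_l2 (g n) = X (r n)" for n by (simp add: g_def)
 have g: "sqint (g n)" for n by (simp add: g_def)
 obtain h where "(\<lambda>n. abs_l2 (g n)) \<longlonglongrightarrow> abs_l2 h"
  using riesz_fischer[of g, OF g] r(2) by (auto simp: g ag simp flip: diff_abs_l2)
 then have "(X \<circ> r) \<longlonglongrightarrow> abs_l2 h" by (simp add: ag o_def)
 then show "convergent X" using Cauchy_converges_subseq[OF X r(1)] by (auto simp: convergent_def)
qed

lemma l2_tendsto_AE_subseq:
 fixes X :: "nat => ('a::euclidean_space,'b::{real_inner,banach,second_countable_topology}) l2"
 assumes X: "X \<longlonglongrightarrow> x"
 shows "\<exists>r::nat => nat. strict_mono r \<and> (AE t in lebesgue. (\<lambda>n. rep_l2 (X (r n)) t) \<longlonglongrightarrow> rep_l2 x t)"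
proof -
 obtain r where r: "strict_mono r" "\<And>n. norm (X (r (Suc n)) - X (r n)) \<le> (1/2) ^ n"
  using fast_subsequence[OF LIMSEQ_imp_Cauchy[OF X]] by blast
 define g where "g n = rep_l2 (X (r n))" for n
 have ag: "abs_l2 (g n) = X (r n)" for n by (simp add: g_def)
 have g: "sqint (g n)" for n by (simp add: g_def)
 obtain h where h: "sqint h" "AE t in lebesgue. (\<lambda>n. g n t) \<longlonglongrightarrow> h t" "(\<lambda>n. abs_l2 (g n)) \<longlonglongrightarrow> abs_l2 h"
  using riesz_fischer[of g, OF g] r(2) by (auto simp: g ag simp flip: diff_abs_l2)
 have "abs_l2 h = x" using LIMSEQ_unique[OF h(3)] LIMSEQ_subseq_LIMSEQ[OF X r(1)] by (auto simp: ag o_def)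
 then have "AE t in lebesgue. rep_l2 x t = h t" using rep_abs_l2[OF h(1)] by simp
 with h(2) have "AE t in lebesgue. (\<lambda>n. g n t) \<longlonglongrightarrow> rep_l2 x t" by eventually_elim simp
 then show ?thesis using r(1) by (auto simp: g_def)
qed

text \<open>The positive and negative parts are densities of measures that agree on boxes, and boxes generate
 the Borel sets and are closed under intersection.\<close>

lemma AE_zero_if_box_integrals_zero:
 fixes f :: "'a::euclidean_space => real"
 assumes f: "integrable lebesgue f"
  and z: "\<And>a b. (\<integral>x. indicator (box a b) x * f x \<partial>lebesgue) = 0"
 shows "AE x in lebesgue. f x = 0"
proof -
 obtain g where g[measurable]: "g \<in> borel_measurable borel" and fg: "AE x in lborel. f x = g x"
  using completion_ex_borel_measurable_real[OF borel_measurable_integrable[OF f]] by auto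
 have fg': "AE x in lebesgue. f x = g x" using fg by (rule AE_completion)
 have gl: "integrable lebesgue g" by (rule integrable_cong_AE_imp[OF f _ fg']) (simp add: measurable_completion)
 then have gi: "integrable lborel g" by (simp add: integrable_completion)
 have zg: "(\<integral>x. indicator (box a b) x * g x \<partial>lborel) = 0" for a b proof -
  have "(\<integral>x. indicator (box a b) x * g x \<partial>lborel) = (\<integral>x. indicator (box a b) x * g x \<partial>lebesgue)"
   by (rule integral_completion[symmetric]) simp
  also have "\<dots> = (\<integral>x. indicator (box a b) x * f x \<partial>lebesgue)" proof (rule integral_cong_AE)
   note [measurable] = borel_measurable_integrable[OF f] borel_measurable_integrable[OF gl]
   show "(\<lambda>x. indicator (box a b) x * f x) \<in> borel_measurable lebesgue"
    "(\<lambda>x. indicator (box a b) x * g x) \<in> borel_measurable lebesgue"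
    by (auto intro!: borel_measurable_times borel_measurable_indicator
       borel_measurable_integrable[OF f] borel_measurable_integrable[OF gl])
   show "AE x in lebesgue. indicator (box a b) x * g x = indicator (box a b) x * f x"
    using fg' by eventually_elim simp
  qed
  finally show ?thesis using z by simp
 qed
 define p where "p x = max 0 (g x)" for x
 define n where "n x = max 0 (- g x)" for x
 have [measurable]: "p \<in> borel_measurable borel" "n \<in> borel_measurable borel" unfolding p_def n_def by measurable
 have pi: "integrable lborel p" "integrable lborel n" unfolding p_def n_def using gi by auto
 have em: "emeasure (density lborel (\<lambda>x. ennreal (q x))) (box a b) = ennreal (\<integral>x. indicator (box a b) x * q x \<partial>lborel)"
  if [measurable]: "q \<in> borel_measurable borel" and "integrable lborel q" "\<And>x. q x \<ge> 0" for q and a b :: 'a proof -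
  have "emeasure (density lborel (\<lambda>x. ennreal (q x))) (box a b) = (\<integral>\<^sup>+x. ennreal (q x) * indicator (box a b) x \<partial>lborel)"
   by (rule emeasure_density) auto
  also have "\<dots> = (\<integral>\<^sup>+x. ennreal (indicator (box a b) x * q x) \<partial>lborel)"
   by (intro nn_integral_cong) (auto simp: indicator_def)
  also have "\<dots> = ennreal (\<integral>x. indicator (box a b) x * q x \<partial>lborel)"
   using integrable_mult_indicator[OF _ that(2), of "box a b"] that(3) by (intro nn_integral_eq_integral) auto
  finally show ?thesis .
 qed
 have eq: "(\<integral>x. indicator (box a b) x * p x \<partial>lborel) = (\<integral>x. indicator (box a b) x * n x \<partial>lborel)" for a b proof -
  have i: "integrable lborel (\<lambda>x. indicator (box a b) x * p x)" "integrable lborel (\<lambda>x. indicator (box a b) x * n x)"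
   using integrable_mult_indicator[OF _ pi(1), of "box a b"] integrable_mult_indicator[OF _ pi(2), of "box a b"] by auto
  have "(\<integral>x. indicator (box a b) x * p x \<partial>lborel) - (\<integral>x. indicator (box a b) x * n x \<partial>lborel)
    = (\<integral>x. indicator (box a b) x * p x - indicator (box a b) x * n x \<partial>lborel)"
   using i by simp
  also have "(\<lambda>x. indicator (box a b) x * p x - indicator (box a b) x * n x) = (\<lambda>x. indicator (box a b) x * g x)"
   by (auto simp: p_def n_def fun_eq_iff max_def indicator_def)
  finally show ?thesis using zg by simp
 qed
 have "density lborel (\<lambda>x. ennreal (p x)) = density lborel (\<lambda>x. ennreal (n x))"
 proof (rule measure_eqI_generator_eq[where E = "range (\<lambda>(a, b). box a b)" and A = "\<lambda>i. box (- (real i *\<^sub>R One)) (real i *\<^sub>R One)"])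
  show "Int_stable (range (\<lambda>(a, b). box a b :: 'a set))" by (auto simp: Int_stable_def box_Int_box)
  show "sets (density lborel (\<lambda>x. ennreal (p x))) = sigma_sets UNIV (range (\<lambda>(a, b). box a b))"
   "sets (density lborel (\<lambda>x. ennreal (n x))) = sigma_sets UNIV (range (\<lambda>(a, b). box a b))"
   by (simp_all add: borel_eq_box)
  show "range (\<lambda>i. box (- (real i *\<^sub>R One)) (real i *\<^sub>R One)) \<subseteq> range (\<lambda>(a, b). box a b :: 'a set)" by auto
  show "(\<Union>i. box (- (real i *\<^sub>R One)) (real i *\<^sub>R One)) = (UNIV :: 'a set)" by (rule UN_box_eq_UNIV)
  show "emeasure (density lborel (\<lambda>x. ennreal (p x))) (box (- (real i *\<^sub>R One)) (real i *\<^sub>R One)) \<noteq> \<infinity>" for i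
   using pi by (subst em) (auto simp: p_def)
  show "emeasure (density lborel (\<lambda>x. ennreal (p x))) X = emeasure (density lborel (\<lambda>x. ennreal (n x))) X"
   if Xr: "X \<in> range (\<lambda>(a, b). box a b)" for X proof -
   obtain a b where X: "X = box a b" using Xr by auto
   show ?thesis unfolding X using pi by (subst (1 2) em) (auto simp: p_def n_def eq[unfolded p_def n_def])
  qed
 qed auto
 then have "AE x in lborel. ennreal (p x) = ennreal (n x)"
  by (intro sigma_finite_measure.density_unique[OF sigma_finite_lborel]) auto
 then have "AE x in lborel. g x = 0" by eventually_elim (auto simp: p_def n_def max_def split: if_splits)
 then have "AE x in lebesgue. g x = 0" by (rule AE_completion)
 with fg' show ?thesis by eventually_elim simp
qed

lemma indicator_box_tendsto:
 fixes a b t :: "'a::euclidean_space"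
 assumes "an \<longlonglongrightarrow> a" "bn \<longlonglongrightarrow> b" "t \<notin> cbox a b - box a b"
 shows "(\<lambda>n. indicator (box (an n) (bn n)) t :: real) \<longlonglongrightarrow> indicator (box a b) t"
proof -
 have lim: "(\<lambda>n. an n \<bullet> i) \<longlonglongrightarrow> a \<bullet> i" "(\<lambda>n. bn n \<bullet> i) \<longlonglongrightarrow> b \<bullet> i" for i using assms by (auto intro: tendsto_intros)
 have "eventually (\<lambda>n. t \<in> box (an n) (bn n) \<longleftrightarrow> t \<in> box a b) sequentially" proof (cases "t \<in> box a b")
  case True
  have "eventually (\<lambda>n. \<forall>i\<in>Basis. an n \<bullet> i < t \<bullet> i \<and> t \<bullet> i < bn n \<bullet> i) sequentially"
  proof (rule eventually_ball_finite, simp, rule ballI)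
   fix i :: 'a assume "i \<in> Basis"
   with True have "a \<bullet> i < t \<bullet> i" "t \<bullet> i < b \<bullet> i" by (auto simp: mem_box)
   then show "eventually (\<lambda>n. an n \<bullet> i < t \<bullet> i \<and> t \<bullet> i < bn n \<bullet> i) sequentially"
    using order_tendstoD(2)[OF lim(1)] order_tendstoD(1)[OF lim(2)] by (intro eventually_conj) auto
  qed
  then show ?thesis by eventually_elim (use True in \<open>auto simp: mem_box\<close>)
 next
  case False
  then have "t \<notin> cbox a b" using assms(3) by auto
  then obtain i where i: "i \<in> Basis" "t \<bullet> i < a \<bullet> i \<or> b \<bullet> i < t \<bullet> i" by (auto simp: mem_box not_le)
  from i(2) have "eventually (\<lambda>n. t \<bullet> i < an n \<bullet> i \<or> bn n \<bullet> i < t \<bullet> i) sequentially" proof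
   assume "t \<bullet> i < a \<bullet> i"
   from order_tendstoD(1)[OF lim(1) this] show ?thesis by eventually_elim simp
  next
   assume "b \<bullet> i < t \<bullet> i"
   from order_tendstoD(2)[OF lim(2) this] show ?thesis by eventually_elim simp
  qed
  then show ?thesis proof eventually_elim
   case (elim n)
   then have "t \<notin> box (an n) (bn n)" using i(1) by (force simp: mem_box)
   then show ?case using False by simp
  qed
 qed
 then have "eventually (\<lambda>n. indicator (box (an n) (bn n)) t = (indicator (box a b) t :: real)) sequentially"
  by eventually_elim (auto simp: indicator_def)
 then show ?thesis by (rule tendsto_eventually)
qed

text \<open>Every box is a limit of boxes with corners in \<open>D\<close>, up to its boundary, which is a null set.\<close>

lemma sqint_AE_zero_if_dense_box_integrals_zero:
 fixes f :: "'a::euclidean_space => real"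
 assumes f: "sqint f" and D: "closure D = UNIV"
  and z: "\<And>a b. a \<in> D ==> b \<in> D ==> (\<integral>x. indicator (box a b) x * f x \<partial>lebesgue) = 0"
 shows "AE x in lebesgue. f x = 0"
proof -
 have [measurable]: "f \<in> borel_measurable lebesgue" using f by (simp add: sqint_def)
 have fi: "integrable lebesgue (\<lambda>x. indicator (cbox a b) x * f x)" for a b
  using sqint_indicator_integrable[OF f, of "cbox a b"] emeasure_lborel_cbox_finite[of a b] by simp
 have fi': "integrable lebesgue (\<lambda>x. indicator (box a b) x * f x)" for a b
  using sqint_indicator_integrable[OF f, of "box a b"] emeasure_lborel_box_finite[of a b] by simp
 have zall: "(\<integral>x. indicator (box a b) x * f x \<partial>lebesgue) = 0" for a b proof -
  have "a \<in> closure D" "b \<in> closure D" using D by auto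
  then obtain an bn where D': "\<And>n. an n \<in> D" "\<And>n. bn n \<in> D" and lim: "an \<longlonglongrightarrow> a" "bn \<longlonglongrightarrow> b"
   unfolding closure_sequential by blast
  obtain R1 where R1: "\<And>n. norm (an n) \<le> R1" using convergent_imp_Bseq[of an] lim by (auto simp: convergent_def Bseq_def)
  obtain R2 where R2: "\<And>n. norm (bn n) \<le> R2" using convergent_imp_Bseq[of bn] lim by (auto simp: convergent_def Bseq_def)
  define R where "R = max R1 R2"
  have sub: "box (an n) (bn n) \<subseteq> cbox (- (R *\<^sub>R One)) (R *\<^sub>R One)" for n proof
   fix t assume t: "t \<in> box (an n) (bn n)"
   have "- R \<le> t \<bullet> i \<and> t \<bullet> i \<le> R" if "i \<in> Basis" for i proof -
    have "an n \<bullet> i < t \<bullet> i" "t \<bullet> i < bn n \<bullet> i" using t that by (auto simp: mem_box)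
    moreover have "\<bar>an n \<bullet> i\<bar> \<le> R1" "\<bar>bn n \<bullet> i\<bar> \<le> R2"
     using Basis_le_norm[OF that, of "an n"] Basis_le_norm[OF that, of "bn n"] R1[of n] R2[of n] by auto
    ultimately show ?thesis unfolding R_def by linarith
   qed
   then show "t \<in> cbox (- (R *\<^sub>R One)) (R *\<^sub>R One)" by (auto simp: mem_box)
  qed
  have "(\<lambda>n. \<integral>x. indicator (box (an n) (bn n)) x * f x \<partial>lebesgue) \<longlonglongrightarrow> (\<integral>x. indicator (box a b) x * f x \<partial>lebesgue)"
  proof (rule integral_dominated_convergence[where w = "\<lambda>x. norm (indicator (cbox (- (R *\<^sub>R One)) (R *\<^sub>R One)) x * f x)"])
   show "integrable lebesgue (\<lambda>x. norm (indicator (cbox (- (R *\<^sub>R One)) (R *\<^sub>R One)) x * f x))"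
    by (intro integrable_norm fi)
   show "AE x in lebesgue. (\<lambda>n. indicator (box (an n) (bn n)) x * f x) \<longlonglongrightarrow> indicator (box a b) x * f x"
   proof (rule AE_mp)
    have "cbox a b - box a b \<in> null_sets lebesgue"
     using negligible_frontier_interval[of a b] by (simp add: negligible_iff_null_sets)
    then show "AE x in lebesgue. x \<notin> cbox a b - box a b" by (rule AE_not_in)
    show "AE x in lebesgue. x \<notin> cbox a b - box a b \<longrightarrow>
      (\<lambda>n. indicator (box (an n) (bn n)) x * f x) \<longlonglongrightarrow> indicator (box a b) x * f x"
     by (intro AE_I2 impI tendsto_intros indicator_box_tendsto lim)
   qed
   show "AE x in lebesgue. norm (indicator (box (an n) (bn n)) x * f x)
     \<le> norm (indicator (cbox (- (R *\<^sub>R One)) (R *\<^sub>R One)) x * f x)" for n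
    using sub[of n] by (intro AE_I2) (auto simp: indicator_def)
  qed (auto intro!: borel_measurable_times borel_measurable_indicator)
  then show ?thesis using z[OF D'] by (simp add: LIMSEQ_const_iff)
 qed
 have "AE x in lebesgue. \<forall>k::nat. indicator (box (- (real k *\<^sub>R One)) (real k *\<^sub>R One)) x * f x = 0"
 proof (subst AE_all_countable, rule allI, rule AE_zero_if_box_integrals_zero[OF fi'])
  fix k :: nat and a b :: 'a
  have "(\<lambda>x. indicator (box a b) x * (indicator (box (- (real k *\<^sub>R One)) (real k *\<^sub>R One)) x * f x))
   = (\<lambda>x. indicator (box a b \<inter> box (- (real k *\<^sub>R One)) (real k *\<^sub>R One)) x * f x)"
   by (auto simp: indicator_def fun_eq_iff)
  then show "(\<integral>x. indicator (box a b) x * (indicator (box (- (real k *\<^sub>R One)) (real k *\<^sub>R One)) x * f x) \<partial>lebesgue) = 0"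
   using zall by (simp add: box_Int_box)
 qed
 then show ?thesis proof eventually_elim
  case (elim x)
  have "x \<in> (\<Union>i::nat. box (- (real i *\<^sub>R One)) (real i *\<^sub>R One))" using UN_box_eq_UNIV by blast
  then obtain k :: nat where "x \<in> box (- (real k *\<^sub>R One)) (real k *\<^sub>R One)" by blast
  then show ?case using elim[rule_format, of k] by (simp add: indicator_def)
 qed
qed

lemma countable_basis_if_countable_dense:
 fixes D :: "'a::metric_space set"
 assumes "countable D" "closure D = UNIV"
 shows "\<exists>B::'a set set. countable B \<and> open = generate_topology B"
proof -
 define B where "B = (\<lambda>(d, n). ball d (1 / real (Suc n))) ` (D \<times> (UNIV :: nat set))"
 have "topological_basis B" proof (rule topological_basisI)
  show "open B'" if "B' \<in> B" for B' using that by (auto simp: B_def)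
  show "\<exists>B'\<in>B. x \<in> B' \<and> B' \<subseteq> U" if Ux: "open U" "x \<in> U" for U x proof -
   obtain e where e: "e > 0" "ball x e \<subseteq> U" using Ux unfolding open_contains_ball by auto
   obtain n where n: "1 / real (Suc n) < e / 2" using nat_approx_posE[of "e/2"] e by auto
   have "x \<in> closure D" using assms by simp
   then obtain d where d: "d \<in> D" "dist d x < 1 / real (Suc n)"
    unfolding closure_approachable by (metis of_nat_0_less_iff zero_less_Suc zero_less_divide_1_iff)
   have "ball d (1 / real (Suc n)) \<subseteq> ball x e" proof
    fix y assume "y \<in> ball d (1 / real (Suc n))"
    then have "dist d y < 1 / real (Suc n)" by simp
    then have "dist x y < e" using dist_triangle[of x y d] d(2) n by (simp add: dist_commute)
    then show "y \<in> ball x e" by simp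
   qed
   then show ?thesis using d e by (intro bexI[of _ "ball d (1 / real (Suc n))"]) (auto simp: B_def)
  qed
 qed
 moreover have "countable B" unfolding B_def using assms by auto
 ultimately show ?thesis using topological_basis_imp_subbasis by blast
qed

text \<open>Rational combinations of the elements of \<open>C\<close> are dense in the span, and the span is dense.\<close>

lemma countable_dense_if_countable_total:
 fixes C :: "'a::{real_inner,complete_space} set"
 assumes "countable C" and "\<And>x. (\<forall>c\<in>C. x \<bullet> c = 0) ==> x = 0"
 shows "\<exists>D::'a set. countable D \<and> closure D = UNIV"
proof -
 define D where "D = (\<lambda>l. \<Sum>(q, c)\<leftarrow>l. q *\<^sub>R c) ` lists (\<rat> \<times> C)"
 have "countable D" unfolding D_def using assms(1) by (auto intro: countable_rat)
 have Dadd: "x + y \<in> D" if xy: "x \<in> D" "y \<in> D" for x y proof -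
  obtain l k where "l \<in> lists (\<rat> \<times> C)" "k \<in> lists (\<rat> \<times> C)"
   and "x = (\<Sum>(q, c)\<leftarrow>l. q *\<^sub>R c)" "y = (\<Sum>(q, c)\<leftarrow>k. q *\<^sub>R c)"
   using xy unfolding D_def by blast
  then show ?thesis unfolding D_def by (intro image_eqI[of _ _ "l @ k"]) auto
 qed
 have Dscale: "r *\<^sub>R x \<in> D" if rx: "r \<in> \<rat>" "x \<in> D" for r x proof -
  obtain l where l: "l \<in> lists (\<rat> \<times> C)" and x: "x = (\<Sum>(q, c)\<leftarrow>l. q *\<^sub>R c)" using rx unfolding D_def by blast
  have "r *\<^sub>R (\<Sum>(q, c)\<leftarrow>l. q *\<^sub>R c) = (\<Sum>(q, c)\<leftarrow>map (\<lambda>(q, c). (r * q, c)) l. q *\<^sub>R c)"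
   by (induction l) (auto simp: scaleR_add_right)
  moreover have "map (\<lambda>(q, c). (r * q, c)) l \<in> lists (\<rat> \<times> C)" using l rx(1) by (induction l) auto
  ultimately show ?thesis unfolding D_def x by blast
 qed
 have "subspace (closure D)" proof (rule subspaceI)
  have "(\<Sum>(q, c)\<leftarrow>[]. q *\<^sub>R c) \<in> D" unfolding D_def by (rule imageI) simp
  then show "0 \<in> closure D" using closure_subset by auto
  show "x + y \<in> closure D" if xy: "x \<in> closure D" "y \<in> closure D" for x y proof -
   obtain a b where "\<forall>n. a n \<in> D" "a \<longlonglongrightarrow> x" "\<forall>n. b n \<in> D" "b \<longlonglongrightarrow> y" using xy unfolding closure_sequential by blast
   then have "(\<forall>n. a n + b n \<in> D) \<and> (\<lambda>n. a n + b n) \<longlonglongrightarrow> x + y" using Dadd by (auto intro: tendsto_add)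
   then show ?thesis unfolding closure_sequential by (rule exI[where x = "\<lambda>n. a n + b n"])
  qed
  show "r *\<^sub>R x \<in> closure D" if x: "x \<in> closure D" for r x proof -
   obtain a where a: "\<forall>n. a n \<in> D" "a \<longlonglongrightarrow> x" using x unfolding closure_sequential by blast
   have "\<exists>q\<in>\<rat>. r < q \<and> q < r + 1 / real (Suc n)" for n
    using Rats_dense_in_real[of r "r + 1 / real (Suc n)"] by auto
   then obtain q where q: "\<And>n. q n \<in> \<rat>" "\<And>n. r < q n" "\<And>n. q n < r + 1 / real (Suc n)" by metis
   have "q \<longlonglongrightarrow> r" proof (rule tendsto_sandwich[of "\<lambda>n. r" q _ "\<lambda>n. r + 1 / real (Suc n)"])
    show "(\<lambda>n. r + 1 / real (Suc n)) \<longlonglongrightarrow> r"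
     using tendsto_add[OF tendsto_const LIMSEQ_Suc[OF lim_const_over_n[of "1::real"]], of r] by simp
   qed (use q in \<open>auto intro!: always_eventually less_imp_le\<close>)
   then have "(\<forall>n. q n *\<^sub>R a n \<in> D) \<and> (\<lambda>n. q n *\<^sub>R a n) \<longlonglongrightarrow> r *\<^sub>R x"
    using Dscale q(1) a by (auto intro: tendsto_scaleR)
   then show ?thesis unfolding closure_sequential by (rule exI[where x = "\<lambda>n. q n *\<^sub>R a n"])
  qed
 qed
 moreover have "C \<subseteq> D" proof
  fix c assume c: "c \<in> C"
  then have "(\<Sum>(q, c)\<leftarrow>[(1::real, c)]. q *\<^sub>R c) \<in> D" unfolding D_def by (intro imageI) auto
  then show "c \<in> D" by simp
 qed
 then have "C \<subseteq> closure D" using closure_subset by blast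
 ultimately have "span C \<subseteq> closure D" by (intro span_minimal)
 moreover have "closure (span C) = UNIV"
  by (rule dense_if_orthogonal_trivial[OF subspace_span]) (use assms(2) span_base in blast)
 ultimately have "closure D = UNIV" by (metis closure_closure closure_mono top.extremum_unique)
 with \<open>countable D\<close> show ?thesis by blast
qed

text \<open>Bochner integrals with values in this space require separability. A countable total set is given
 by the indicators of boxes with corners in a countable dense set, times basis vectors.\<close>

instance l2 :: (euclidean_space, euclidean_space) second_countable_topology
proof
 obtain D :: "'a set" where D: "countable D" "closure D = UNIV" proof -
  obtain D :: "'a set" where "countable D" "\<And>X. open X ==> X \<noteq> {} ==> \<exists>d\<in>D. d \<in> X"
   using countable_dense_setE by blast
  moreover have "x \<in> closure D" for x unfolding closure_approachable proof (intro allI impI)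
   fix e :: real assume "e > 0"
   then have "\<exists>d\<in>D. d \<in> ball x e" by (intro calculation(2)) auto
   then show "\<exists>y\<in>D. dist y x < e" by (auto simp: dist_commute)
  qed
  ultimately show ?thesis using that[of D] by blast
 qed
 define e :: "'a => 'a => 'b => 'a => 'b" where "e a b i = (\<lambda>x. indicator (box a b) x *\<^sub>R i)" for a b i
 have e: "sqint (e a b i)" for a b i proof -
  have "sqint (indicator (box a b) :: 'a => real)" unfolding sqint_def proof
   have "(\<lambda>x. (norm (indicator (box a b) x :: real))\<^sup>2) = indicator (box a b)"
    by (auto simp: indicator_def fun_eq_iff)
   then show "integrable lebesgue (\<lambda>x. (norm (indicator (box a b) x :: real))\<^sup>2)"
    using emeasure_lborel_box_finite[of a b] by (simp add: integrable_indicator_iff)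
  qed (auto intro!: borel_measurable_indicator)
  then show ?thesis by (rule sqint_bound[of _ _ "norm i"])
     (auto simp: e_def intro!: borel_measurable_scaleR borel_measurable_indicator)
 qed
 define C where "C = (\<lambda>(a, b, i). abs_l2 (e a b i)) ` (D \<times> D \<times> Basis)"
 have "countable C" unfolding C_def using D(1)
  by (intro countable_image countable_SIGMA) (auto simp: countable_finite)
 have tot: "x = 0" if x: "\<forall>c\<in>C. x \<bullet> c = 0" for x proof -
  have "AE t in lebesgue. rep_l2 x t \<bullet> i = 0" if i: "i \<in> Basis" for i
  proof (rule sqint_AE_zero_if_dense_box_integrals_zero[OF _ D(2)])
   show "sqint (\<lambda>t. rep_l2 x t \<bullet> i)" by (rule sqint_bound[OF sqint_rep[of x], of _ 1]) (auto simp: Basis_le_norm i)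
   show "(\<integral>t. indicator (box a b) t * (rep_l2 x t \<bullet> i) \<partial>lebesgue) = 0" if "a \<in> D" "b \<in> D" for a b proof -
    have "0 = abs_l2 (rep_l2 x) \<bullet> abs_l2 (e a b i)" using x that i by (auto simp: C_def)
    also have "\<dots> = (\<integral>t. rep_l2 x t \<bullet> e a b i t \<partial>lebesgue)" by (rule inner_abs_l2) (simp_all add: e)
    finally show ?thesis by (simp add: e_def)
   qed
  qed
  then have "AE t in lebesgue. \<forall>i\<in>Basis. rep_l2 x t \<bullet> i = 0" by (intro AE_finite_allI) auto
  then have "AE t in lebesgue. rep_l2 x t = 0" by eventually_elim (rule euclidean_eqI, simp)
  then have "abs_l2 (rep_l2 x) = abs_l2 (\<lambda>x. 0)" by (subst abs_l2_eq_iff) auto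
  then show ?thesis by (simp add: zero_abs_l2)
 qed
 obtain E :: "('a,'b) l2 set" where "countable E" "closure E = UNIV"
  using countable_dense_if_countable_total[OF \<open>countable C\<close> tot] by blast
 then show "\<exists>B::('a,'b) l2 set set. countable B \<and> open = generate_topology B"
  by (rule countable_basis_if_countable_dense)
qed

text \<open>The operator that acts pointwise through a measurable field \<open>F\<close> of linear maps.\<close>

definition l2_map :: "('a => 'b => 'c) =>
  ('a::euclidean_space, 'b::{real_inner,banach,second_countable_topology}) l2 =>
  ('a, 'c::{real_inner,banach,second_countable_topology}) l2" where
 "l2_map F x = abs_l2 (\<lambda>t. F t (rep_l2 x t))"

lemma
 fixes F :: "'a::euclidean_space => 'b::{real_inner,banach,second_countable_topology} =>
  'c::{real_inner,banach,second_countable_topology}"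
 assumes meas: "\<And>f. f \<in> borel_measurable lebesgue ==> (\<lambda>t. F t (f t)) \<in> borel_measurable lebesgue"
  and lin: "\<And>t. linear (F t)" and bd: "\<And>t y. norm (F t y) \<le> C * norm y" and C: "C \<ge> 0"
 shows sqint_map: "sqint f ==> sqint (\<lambda>t. F t (f t))"
  and l2_map_abs: "sqint f ==> l2_map F (abs_l2 f) = abs_l2 (\<lambda>t. F t (f t))"
  and bounded_linear_l2_map: "bounded_linear (l2_map F)"
proof -
 show sq: "sqint (\<lambda>t. F t (f t))" if "sqint f" for f
  by (rule sqint_bound[OF that meas, where C = C]) (use that bd in \<open>auto simp: sqint_def\<close>)
 show *: "l2_map F (abs_l2 f) = abs_l2 (\<lambda>t. F t (f t))" if "sqint f" for f
  unfolding l2_map_def using rep_abs_l2[OF that] by (subst abs_l2_eq_iff) (auto simp: sq that elim: eventually_mono)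
 have nb: "norm (l2_map F x) \<le> C * norm x" for x
  using norm_l2_mono[OF sq[OF sqint_rep[of x]] sqint_rep[of x], of C] bd C by (simp add: l2_map_def)
 show "bounded_linear (l2_map F)" proof (rule bounded_linear_intro[where K = C])
  fix x y r
  have "l2_map F (abs_l2 (rep_l2 x) + abs_l2 (rep_l2 y)) = l2_map F (abs_l2 (rep_l2 x)) + l2_map F (abs_l2 (rep_l2 y))"
   by (simp only: add_abs_l2 * sqint_rep sqint_add sq linear_add[OF lin])
  then show "l2_map F (x + y) = l2_map F x + l2_map F y" by simp
  have "l2_map F (r *\<^sub>R abs_l2 (rep_l2 x)) = r *\<^sub>R l2_map F (abs_l2 (rep_l2 x))"
   by (simp only: scaleR_abs_l2 * sqint_rep sqint_scaleR sq linear_scale[OF lin])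
  then show "l2_map F (r *\<^sub>R x) = r *\<^sub>R l2_map F x" by simp
  show "norm (l2_map F x) \<le> norm x * C" using nb[of x] by (simp add: mult.commute)
 qed
qed

section \<open>Integrals over time intervals\<close>

text \<open>Half-open intervals make the integral additive under concatenation.\<close>

definition tint :: "(real => 'b::{banach,second_countable_topology}) => real => real => 'b" where
 "tint f a b = (\<integral>r. indicator {a<..b} r *\<^sub>R f r \<partial>lebesgue)"

definition tintegrable :: "(real => 'b::{banach,second_countable_topology}) => real => real => bool" where
 "tintegrable f a b \<longleftrightarrow> integrable lebesgue (\<lambda>r. indicator {a<..b} r *\<^sub>R f r)"

lemma emeasure_Ioc_finite: "emeasure lebesgue {a<..b::real} < \<infinity>"
 by (cases "a \<le> b") auto

lemma tintegrable_subset: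
 assumes f: "tintegrable f a b" and "a \<le> s" "t \<le> b"
 shows "tintegrable f s t"
proof -
 have "integrable lebesgue (\<lambda>r. indicator {s<..t} r *\<^sub>R (indicator {a<..b} r *\<^sub>R f r))"
  by (rule integrable_mult_indicator) (use f in \<open>auto simp: tintegrable_def\<close>)
 also have "(\<lambda>r. indicator {s<..t} r *\<^sub>R (indicator {a<..b} r *\<^sub>R f r)) = (\<lambda>r. indicator {s<..t} r *\<^sub>R f r)"
  using assms by (auto simp: indicator_def fun_eq_iff)
 finally show ?thesis by (simp add: tintegrable_def)
qed

lemma sqint_tintegrable: "sqint f ==> tintegrable f a b"
 unfolding tintegrable_def by (rule sqint_indicator_integrable[OF _ _ emeasure_Ioc_finite]) auto

lemma tint_empty: "b \<le> a ==> tint f a b = 0"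
 by (simp add: tint_def)

lemma tint_combine:
 assumes "tintegrable f a c" "a \<le> b" "b \<le> c"
 shows "tint f a c = tint f a b + tint f b c"
proof -
 have "tintegrable f a b" "tintegrable f b c" using assms by (auto intro: tintegrable_subset)
 then have "tint f a b + tint f b c = (\<integral>r. indicator {a<..b} r *\<^sub>R f r + indicator {b<..c} r *\<^sub>R f r \<partial>lebesgue)"
  by (simp add: tint_def tintegrable_def)
 also have "(\<lambda>r. indicator {a<..b} r *\<^sub>R f r + indicator {b<..c} r *\<^sub>R f r) = (\<lambda>r. indicator {a<..c} r *\<^sub>R f r)"
  using assms by (auto simp: indicator_def fun_eq_iff)
 finally show ?thesis by (simp add: tint_def)
qed

lemma tint_add: "tintegrable f a b ==> tintegrable g a b ==> tint (\<lambda>r. f r + g r) a b = tint f a b + tint g a b"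
 by (simp add: tint_def tintegrable_def scaleR_add_right)

lemma tint_diff: "tintegrable f a b ==> tintegrable g a b ==> tint (\<lambda>r. f r - g r) a b = tint f a b - tint g a b"
 by (simp add: tint_def tintegrable_def scaleR_diff_right)

lemma tint_bounded_linear:
 assumes "bounded_linear B" "tintegrable f a b"
 shows "tint (\<lambda>r. B (f r)) a b = B (tint f a b)" "tintegrable (\<lambda>r. B (f r)) a b"
 using integral_bounded_linear[OF assms(1), of lebesgue "\<lambda>r. indicator {a<..b} r *\<^sub>R f r"]
  integrable_bounded_linear[OF assms(1), of lebesgue "\<lambda>r. indicator {a<..b} r *\<^sub>R f r"] assms(2)
 by (simp_all add: tint_def tintegrable_def linear_scale[OF bounded_linear.linear[OF assms(1)]])

lemma tint_scaleR: "tint (\<lambda>r. c *\<^sub>R f r) a b = c *\<^sub>R tint f a b"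
proof -
 have "(\<lambda>r. indicator {a<..b} r *\<^sub>R c *\<^sub>R f r) = (\<lambda>r. c *\<^sub>R (indicator {a<..b} r *\<^sub>R f r))" by (simp add: fun_eq_iff)
 then show ?thesis by (simp only: tint_def integral_scaleR_right)
qed

lemma tint_cmult: "tint (\<lambda>r. c * f r) a b = c * tint f a (b::real)" for f :: "real => real"
 using tint_scaleR[of c f a b] by simp

lemma tintegrable_cmult: "tintegrable f a b ==> tintegrable (\<lambda>r. c * f r) a (b::real)" for f :: "real => real"
 using tint_bounded_linear(2)[OF bounded_linear_mult_right] .

lemma norm_tint_le: "norm (tint f a b) \<le> tint (\<lambda>r. norm (f r)) a b"
 using integral_norm_bound[of lebesgue "\<lambda>r. indicator {a<..b} r *\<^sub>R f r"] by (simp add: tint_def)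

lemma tintegrable_norm: "tintegrable f a b ==> tintegrable (\<lambda>r. norm (f r)) a b"
 using integrable_norm[of lebesgue "\<lambda>r. indicator {a<..b} r *\<^sub>R f r"] by (simp add: tintegrable_def)

lemma tint_mono:
 fixes f g :: "real => real"
 assumes "tintegrable f a b" "tintegrable g a b" "AE r in lebesgue. r \<in> {a<..b} \<longrightarrow> f r \<le> g r"
 shows "tint f a b \<le> tint g a b"
 unfolding tint_def
 by (rule integral_mono_AE) (use assms in \<open>auto simp: tintegrable_def indicator_def elim!: eventually_mono\<close>)

lemma tint_cong_AE:
 assumes "AE r in lebesgue. r \<in> {a<..b} \<longrightarrow> f r = g r" "tintegrable f a b" "tintegrable g a b"
 shows "tint f a b = tint g a b"
 unfolding tint_def
 by (rule integral_cong_AE) (use assms in \<open>auto simp: tintegrable_def indicator_def elim!: eventually_mono\<close>)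

lemma tint_cong: "(\<And>r. r \<in> {a<..b} ==> f r = g r) ==> tint f a b = tint g a b"
 unfolding tint_def by (rule Bochner_Integration.integral_cong) (auto simp: indicator_def)

lemma tint_nonneg: "(\<And>r. r \<in> {a<..b} ==> (f r :: real) \<ge> 0) ==> tint f a b \<ge> 0"
 unfolding tint_def by (rule integral_nonneg_AE) (auto simp: indicator_def)

lemma tint_const: "a \<le> b ==> tint (\<lambda>r. c) a b = (b - a) *\<^sub>R c"
 by (simp add: tint_def)

lemma sqint_indicator_const: "sqint (\<lambda>r. indicator {a<..b} r *\<^sub>R (c::'b::{real_inner,banach,second_countable_topology}))"
 for a b :: real
proof -
 have "sqint (indicator {a<..b} :: real => real)" unfolding sqint_def proof
  have "(\<lambda>x. (norm (indicator {a<..b} x :: real))\<^sup>2) = indicator {a<..b}" by (auto simp: indicator_def fun_eq_iff)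
  then show "integrable lebesgue (\<lambda>x. (norm (indicator {a<..b} x :: real))\<^sup>2)"
   using emeasure_Ioc_finite[of a b] by (simp add: integrable_indicator_iff)
 qed (auto intro!: borel_measurable_indicator)
 then show ?thesis by (rule sqint_bound[of _ _ "norm c"])
    (auto intro!: borel_measurable_scaleR borel_measurable_indicator)
qed

lemma sqint_indicator: "sqint f ==> sqint (\<lambda>r. indicator {a<..b} r *\<^sub>R f r)" for a b :: real
 by (rule sqint_bound[of f _ 1])
   (auto simp: sqint_def intro!: borel_measurable_scaleR borel_measurable_indicator split: split_indicator)

lemma sqint_bounded_indicator:
 fixes f :: "real => 'b::{real_inner,banach,second_countable_topology}"
 assumes "f \<in> borel_measurable lebesgue" "\<And>r. r \<in> {a<..b} ==> norm (f r) \<le> B"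
 shows "sqint (\<lambda>r. indicator {a<..b} r *\<^sub>R f r)"
 by (rule sqint_bound[OF sqint_indicator_const[of a b "1::real"], of _ B])
   (use assms in \<open>auto intro!: borel_measurable_scaleR borel_measurable_indicator split: split_indicator\<close>)

lemma sqint_continuous_indicator:
 fixes f :: "real => 'b::{real_inner,banach,second_countable_topology}"
 assumes "continuous_on UNIV f"
 shows "sqint (\<lambda>r. indicator {a<..b} r *\<^sub>R f r)"
proof -
 have "compact (f ` {a..b})" by (rule compact_continuous_image) (use assms continuous_on_subset in auto)
 from compact_imp_bounded[OF this] obtain B where "\<forall>y\<in>f ` {a..b}. norm y \<le> B" unfolding bounded_iff by blast
 then show ?thesis using assms by (intro sqint_bounded_indicator[of _ _ _ B])
   (auto intro!: measurable_completion borel_measurable_continuous_onI)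
qed

lemma tint_inner_eq:
 assumes "sqint f" "sqint g"
 shows "tint (\<lambda>r. f r \<bullet> g r) a b
   = abs_l2 (\<lambda>r. indicator {a<..b} r *\<^sub>R f r) \<bullet> abs_l2 (\<lambda>r. indicator {a<..b} r *\<^sub>R g r)"
 unfolding inner_abs_l2[OF sqint_indicator[OF assms(1)] sqint_indicator[OF assms(2)]] tint_def
 by (rule Bochner_Integration.integral_cong) (auto simp: indicator_def)

lemma tintegrable_inner: "sqint f ==> sqint g ==> tintegrable (\<lambda>r. f r \<bullet> g r) a b"
 unfolding tintegrable_def by (rule integrable_mult_indicator) (auto simp: sqint_inner_integrable)

lemma tintegrable_norm2: "sqint f ==> tintegrable (\<lambda>r. (norm (f r))\<^sup>2) a b"
 using tintegrable_inner[of f f] by (simp add: power2_norm_eq_inner)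

lemma tint_norm_square_le:
 assumes f: "sqint f" and "a \<le> b"
 shows "(tint (\<lambda>r. norm (f r)) a b)\<^sup>2 \<le> (b - a) * tint (\<lambda>r. (norm (f r))\<^sup>2) a b"
proof -
 let ?f = "abs_l2 (\<lambda>r. indicator {a<..b} r *\<^sub>R norm (f r))"
 let ?g = "abs_l2 (\<lambda>r. indicator {a<..b} r *\<^sub>R (1::real))"
 have s: "sqint (\<lambda>r. indicator {a<..b} r *\<^sub>R norm (f r))" "sqint (\<lambda>r. indicator {a<..b} r *\<^sub>R (1::real))"
  by (intro sqint_indicator sqint_norm f) (rule sqint_indicator_const)
 have "tint (\<lambda>r. norm (f r)) a b = ?f \<bullet> ?g" unfolding inner_abs_l2[OF s] tint_def
  by (rule Bochner_Integration.integral_cong) (auto simp: indicator_def)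
 moreover have "(?f \<bullet> ?g)\<^sup>2 \<le> (?f \<bullet> ?f) * (?g \<bullet> ?g)" by (rule Cauchy_Schwarz_ineq)
 moreover have "?f \<bullet> ?f = tint (\<lambda>r. (norm (f r))\<^sup>2) a b" unfolding inner_abs_l2[OF s(1) s(1)] tint_def
  by (rule Bochner_Integration.integral_cong) (auto simp: indicator_def power2_eq_square)
 moreover have "?g \<bullet> ?g = tint (\<lambda>r. 1) a b" unfolding inner_abs_l2[OF s(2) s(2)] tint_def
  by (rule Bochner_Integration.integral_cong) (auto simp: indicator_def)
 ultimately show ?thesis using assms(2) by (simp add: tint_const mult.commute)
qed

lemma tint_norm2_le:
 assumes "sqint f"
 shows "tint (\<lambda>r. (norm (f r))\<^sup>2) a b \<le> (norm (abs_l2 f))\<^sup>2"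
 unfolding norm_abs_l2[OF assms] tint_def by (rule integral_mono_AE)
   (use tintegrable_norm2[OF assms, of a b] sqint_integrable[OF assms] in
   \<open>auto simp: tintegrable_def indicator_def\<close>)

lemma continuous_on_tint:
 fixes f :: "real => 'b::{real_inner,banach,second_countable_topology}"
 assumes f: "sqint f"
 shows "continuous_on UNIV (\<lambda>t. tint f a t)"
proof -
 define N where "N = norm (abs_l2 f)"
 have le: "norm (tint f a t - tint f a s) \<le> sqrt (t - s) * N" if st: "s \<le> t" for s t proof (cases "t \<le> a")
  case True
  then show ?thesis using st by (simp add: tint_empty N_def)
 next
  case False
  define s' where "s' = max a s"
  have eq: "tint f a s = tint f a s'" unfolding s'_def by (cases "s \<le> a") (auto simp: tint_empty max_def)
  have "tint f a t = tint f a s' + tint f s' t"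
   using st False by (intro tint_combine sqint_tintegrable f) (auto simp: s'_def)
  then have "norm (tint f a t - tint f a s) \<le> tint (\<lambda>r. norm (f r)) s' t" using norm_tint_le[of f s' t] eq by simp
  also have "\<dots> \<le> sqrt (t - s) * N" proof (rule power2_le_imp_le)
   have "(tint (\<lambda>r. norm (f r)) s' t)\<^sup>2 \<le> (t - s') * tint (\<lambda>r. (norm (f r))\<^sup>2) s' t"
    using st False by (intro tint_norm_square_le f) (auto simp: s'_def)
   also have "\<dots> \<le> (t - s) * N\<^sup>2" using st False tint_norm2_le[OF f, of s' t]
    by (intro mult_mono tint_nonneg) (auto simp: s'_def N_def)
   finally show "(tint (\<lambda>r. norm (f r)) s' t)\<^sup>2 \<le> (sqrt (t - s) * N)\<^sup>2" using st by (simp add: power_mult_distrib)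
  qed (use st in \<open>auto simp: N_def\<close>)
  finally show ?thesis .
 qed
 have le': "dist (tint f a s) (tint f a t) \<le> sqrt \<bar>s - t\<bar> * N" for s t
  using le[of s t] le[of t s] by (cases "s \<le> t") (auto simp: dist_norm norm_minus_commute abs_if)
 show ?thesis unfolding continuous_on_def proof
  fix x :: real
  have "((\<lambda>s. sqrt \<bar>s - x\<bar> * N) \<longlongrightarrow> sqrt \<bar>x - x\<bar> * N) (at x within UNIV)" by (intro tendsto_intros)
  then have "((\<lambda>s. sqrt \<bar>s - x\<bar> * N) \<longlongrightarrow> 0) (at x within UNIV)" by simp
  then show "(tint f a \<longlongrightarrow> tint f a x) (at x within UNIV)"
   by (rule metric_tendsto_imp_tendsto) (use le' in \<open>auto intro!: always_eventually simp: N_def\<close>)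
 qed
qed

text \<open>Over a subdivision into \<open>n\<close> equal parts the increments telescope to at most \<open>(b - a) / n\<close> times
 that of \<open>m\<close>.\<close>

lemma constant_if_superlinear:
 fixes \<Phi> :: "real => 'b::real_normed_vector" and m :: "real => real"
 assumes le: "\<And>s t. a \<le> s ==> s \<le> t ==> t \<le> b ==> norm (\<Phi> t - \<Phi> s) \<le> (t - s) * (m t - m s)"
  and ab: "a \<le> b"
 shows "\<Phi> b = \<Phi> a"
proof -
 have bd: "norm (\<Phi> b - \<Phi> a) \<le> (b - a) / real (Suc n) * (m b - m a)" for n proof -
  define h where "h = (b - a) / real (Suc n)"
  have h: "h \<ge> 0" using ab by (simp add: h_def)
  have top: "a + real (Suc n) * h = b" by (simp add: h_def)
  have "norm (\<Phi> (a + real k * h) - \<Phi> a) \<le> h * (m (a + real k * h) - m a)" if "k \<le> Suc n" for k using that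
  proof (induction k)
   case (Suc k)
   have kb: "a + real (Suc k) * h \<le> b"
    using Suc.prems h by (subst top[symmetric]) (intro add_left_mono mult_right_mono, auto)
   have "norm (\<Phi> (a + real (Suc k) * h) - \<Phi> (a + real k * h))
     \<le> ((a + real (Suc k) * h) - (a + real k * h)) * (m (a + real (Suc k) * h) - m (a + real k * h))"
    by (rule le) (use h kb in \<open>auto simp: algebra_simps\<close>)
   also have "(a + real (Suc k) * h) - (a + real k * h) = h" by (simp add: algebra_simps)
   finally have "norm (\<Phi> (a + real (Suc k) * h) - \<Phi> (a + real k * h))
     \<le> h * (m (a + real (Suc k) * h) - m (a + real k * h))" .
   moreover have "norm (\<Phi> (a + real k * h) - \<Phi> a) \<le> h * (m (a + real k * h) - m a)" using Suc by simp
   ultimately have "norm (\<Phi> (a + real (Suc k) * h) - \<Phi> (a + real k * h)) + norm (\<Phi> (a + real k * h) - \<Phi> a)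
     \<le> h * (m (a + real (Suc k) * h) - m a)" by (simp add: algebra_simps)
   then show ?case
    using norm_triangle_ineq[of "\<Phi> (a + real (Suc k) * h) - \<Phi> (a + real k * h)" "\<Phi> (a + real k * h) - \<Phi> a"]
    by simp
  qed simp
  from this[of "Suc n"] show ?thesis unfolding top by (simp add: h_def)
 qed
 have "(\<lambda>n. (b - a) / real (Suc n) * (m b - m a)) \<longlonglongrightarrow> 0 * (m b - m a)"
  by (intro tendsto_intros LIMSEQ_Suc[OF lim_const_over_n])
 then have "norm (\<Phi> b - \<Phi> a) \<le> 0" by (intro LIMSEQ_le_const[of _ 0 "norm (\<Phi> b - \<Phi> a)"]) (use bd in auto)
 then show ?thesis by simp
qed

text \<open>The product rule for antiderivatives of square integrable functions, which are not differentiable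
 in the classical sense. Over \<open>[p, q]\<close> the defect of the identity is at most twice the product of the
 integrals of \<open>|u|\<close> and \<open>|v|\<close>, hence by Cauchy-Schwarz at most \<open>q - p\<close> times an increment of a monotone
 function, and such a defect vanishes.\<close>

lemma tint_product_rule:
 fixes u v :: "real => 'b::{real_inner,banach,second_countable_topology}" and x y :: 'b
 assumes u: "sqint u" and v: "sqint v" and "s \<le> t" "t0 \<le> s"
 defines "U \<equiv> \<lambda>r. x + tint u t0 r" and "V \<equiv> \<lambda>r. y + tint v t0 r"
 shows "U t \<bullet> V t - U s \<bullet> V s = tint (\<lambda>r. u r \<bullet> V r + U r \<bullet> v r) s t"
  and "tintegrable (\<lambda>r. u r \<bullet> V r + U r \<bullet> v r) s t"
proof -
 have cU: "continuous_on UNIV U" and cV: "continuous_on UNIV V"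
  unfolding U_def V_def by (intro continuous_intros continuous_on_tint u v)+
 note sU = sqint_continuous_indicator[OF cU] and sV = sqint_continuous_indicator[OF cV]
 have iuV: "tintegrable (\<lambda>r. u r \<bullet> V r) a b" for a b
  using sqint_inner_integrable[OF u sV[of a b]] by (simp add: tintegrable_def)
 have iUv: "tintegrable (\<lambda>r. U r \<bullet> v r) a b" for a b
  using sqint_inner_integrable[OF sU[of a b] v] by (simp add: tintegrable_def)
 have int: "tintegrable (\<lambda>r. u r \<bullet> V r + U r \<bullet> v r) a b" for a b
  using iuV[of a b] iUv[of a b] by (simp add: tintegrable_def distrib_left)
 then show "tintegrable (\<lambda>r. u r \<bullet> V r + U r \<bullet> v r) s t" .
 define \<Phi> where "\<Phi> r = U r \<bullet> V r - tint (\<lambda>r. u r \<bullet> V r + U r \<bullet> v r) s r" for r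
 define m where "m r = tint (\<lambda>r. (norm (u r))\<^sup>2 + (norm (v r))\<^sup>2) s r" for r
 have im: "tintegrable (\<lambda>r. (norm (u r))\<^sup>2 + (norm (v r))\<^sup>2) a b" for a b
  using tintegrable_norm2[OF u, of a b] tintegrable_norm2[OF v, of a b] by (simp add: tintegrable_def distrib_left)
 have "\<Phi> t = \<Phi> s" proof (rule constant_if_superlinear[where m = m and \<Phi> = \<Phi> and a = s and b = t])
  fix p q assume pq: "s \<le> p" "p \<le> q" "q \<le> t"
  have Uq: "U r = U p + tint u p r" and Vq: "V q = V r + tint v r q" if "p \<le> r" "r \<le> q" for r unfolding U_def V_def
   using tint_combine[OF sqint_tintegrable[OF u], of t0 p r] tint_combine[OF sqint_tintegrable[OF v], of t0 r q] that pq assms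
   by auto
  have Iu: "tint (\<lambda>r. norm (u r)) p' r \<le> tint (\<lambda>r. norm (u r)) p q"
   and Iv: "tint (\<lambda>r. norm (v r)) p' r \<le> tint (\<lambda>r. norm (v r)) p q" if "p \<le> p'" "r \<le> q" for p' r
   unfolding tint_def using that
    tintegrable_norm[OF sqint_tintegrable[OF u]] tintegrable_norm[OF sqint_tintegrable[OF v]]
   by (auto intro!: integral_mono_AE simp: tintegrable_def indicator_def)
  define a where "a = tint (\<lambda>r. norm (u r)) p q"
  define b where "b = tint (\<lambda>r. norm (v r)) p q"
  have ab: "a \<ge> 0" "b \<ge> 0" unfolding a_def b_def by (auto intro!: tint_nonneg)
  have i1: "tintegrable (\<lambda>r. u r \<bullet> V q) p q" and i2: "tintegrable (\<lambda>r. U p \<bullet> v r) p q"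
   using tint_bounded_linear(2)[OF bounded_linear_inner_left sqint_tintegrable[OF u]]
    tint_bounded_linear(2)[OF bounded_linear_inner_right sqint_tintegrable[OF v]] by auto
  have e1: "tint u p q \<bullet> V q = tint (\<lambda>r. u r \<bullet> V q) p q"
   using tint_bounded_linear(1)[OF bounded_linear_inner_left sqint_tintegrable[OF u]] by simp
  have e2: "U p \<bullet> tint v p q = tint (\<lambda>r. U p \<bullet> v r) p q"
   using tint_bounded_linear(1)[OF bounded_linear_inner_right sqint_tintegrable[OF v]] by simp
  have "U q \<bullet> V q - U p \<bullet> V p = tint u p q \<bullet> V q + U p \<bullet> tint v p q"
   using Uq[of q] Vq[of p] pq by (simp add: inner_add_left inner_add_right)
  then have "\<Phi> q - \<Phi> p = tint (\<lambda>r. u r \<bullet> V q) p q + tint (\<lambda>r. U p \<bullet> v r) p q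
    - tint (\<lambda>r. u r \<bullet> V r + U r \<bullet> v r) p q"
   unfolding \<Phi>_def e1 e2 using tint_combine[OF int, of s p q] pq by simp
  also have "\<dots> = tint (\<lambda>r. (u r \<bullet> V q + U p \<bullet> v r) - (u r \<bullet> V r + U r \<bullet> v r)) p q"
   using i1 i2 int by (subst tint_diff) (auto simp: tint_add tintegrable_def distrib_left)
  finally have eq: "\<Phi> q - \<Phi> p = tint (\<lambda>r. (u r \<bullet> V q + U p \<bullet> v r) - (u r \<bullet> V r + U r \<bullet> v r)) p q" .
  have "norm (\<Phi> q - \<Phi> p) \<le> tint (\<lambda>r. norm ((u r \<bullet> V q + U p \<bullet> v r) - (u r \<bullet> V r + U r \<bullet> v r))) p q"
   unfolding eq by (rule norm_tint_le)
  also have "\<dots> \<le> tint (\<lambda>r. norm (u r) * b + a * norm (v r)) p q" proof (rule tint_mono)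
   show "tintegrable (\<lambda>r. norm ((u r \<bullet> V q + U p \<bullet> v r) - (u r \<bullet> V r + U r \<bullet> v r))) p q" by (rule tintegrable_norm)
      (use i1 i2 int[of p q] in \<open>simp add: tintegrable_def distrib_left right_diff_distrib\<close>)
   show "tintegrable (\<lambda>r. norm (u r) * b + a * norm (v r)) p q"
    using tintegrable_norm[OF sqint_tintegrable[OF u], of p q] tintegrable_norm[OF sqint_tintegrable[OF v], of p q]
     Bochner_Integration.integrable_add[of lebesgue "\<lambda>r. b * (indicator {p<..q} r * norm (u r))" "\<lambda>r. a * (indicator {p<..q} r * norm (v r))"]
    by (simp add: tintegrable_def algebra_simps)
   show "AE r in lebesgue. r \<in> {p<..q} \<longrightarrow>
     norm ((u r \<bullet> V q + U p \<bullet> v r) - (u r \<bullet> V r + U r \<bullet> v r)) \<le> norm (u r) * b + a * norm (v r)"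
   proof (intro AE_I2 impI)
    fix r assume r: "r \<in> {p<..q}"
    have "(u r \<bullet> V q + U p \<bullet> v r) - (u r \<bullet> V r + U r \<bullet> v r) = u r \<bullet> tint v r q - tint u p r \<bullet> v r"
     using Uq[of r] Vq[of r] r by (simp add: inner_add_left inner_add_right)
    moreover have "\<bar>u r \<bullet> tint v r q\<bar> \<le> norm (u r) * b"
     using Cauchy_Schwarz_ineq2[of "u r" "tint v r q"] norm_tint_le[of v r q] Iv[of r q] r
      mult_left_mono[of "norm (tint v r q)" b "norm (u r)"] by (auto simp: b_def)
    moreover have "\<bar>tint u p r \<bullet> v r\<bar> \<le> a * norm (v r)"
     using Cauchy_Schwarz_ineq2[of "tint u p r" "v r"] norm_tint_le[of u p r] Iu[of p r] r
      mult_right_mono[of "norm (tint u p r)" a "norm (v r)"] by (auto simp: a_def)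
    ultimately show "norm ((u r \<bullet> V q + U p \<bullet> v r) - (u r \<bullet> V r + U r \<bullet> v r)) \<le> norm (u r) * b + a * norm (v r)"
     by simp
   qed
  qed
  also have "\<dots> = 2 * a * b" proof -
   have "tint (\<lambda>r. norm (u r) * b + a * norm (v r)) p q = tint (\<lambda>r. b * norm (u r)) p q + tint (\<lambda>r. a * norm (v r)) p q"
    using tintegrable_norm[OF sqint_tintegrable[OF u], of p q] tintegrable_norm[OF sqint_tintegrable[OF v], of p q]
    by (subst tint_add[symmetric]) (simp_all add: tintegrable_cmult mult.commute)
   then show ?thesis by (simp add: tint_cmult a_def b_def)
  qed
  (* Squares of integrals over [p, q] cost only a factor q - p, by Cauchy-Schwarz. *)
  also have "\<dots> \<le> a\<^sup>2 + b\<^sup>2" by (rule sum_squares_bound)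
  also have "\<dots> \<le> (q - p) * tint (\<lambda>r. (norm (u r))\<^sup>2) p q + (q - p) * tint (\<lambda>r. (norm (v r))\<^sup>2) p q"
   unfolding a_def b_def using pq by (intro add_mono tint_norm_square_le u v)
  also have "\<dots> = (q - p) * (m q - m p)" unfolding m_def using tint_combine[OF im, of s p q] pq
   by (simp add: tint_add tintegrable_norm2 u v distrib_left)
  finally show "norm (\<Phi> q - \<Phi> p) \<le> (q - p) * (m q - m p)" .
 qed fact
 then show "U t \<bullet> V t - U s \<bullet> V s = tint (\<lambda>r. u r \<bullet> V r + U r \<bullet> v r) s t" by (simp add: \<Phi>_def tint_empty)
qed

lemma norm_square_tint:
 fixes u :: "real => 'b::{real_inner,banach,second_countable_topology}"
 assumes u: "sqint u" and t: "0 \<le> t" and q: "\<And>r. r \<in> {0<..t} ==> u r \<bullet> (x + tint u 0 r) = q r"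
 shows "(norm (x + tint u 0 t))\<^sup>2 = (norm x)\<^sup>2 + 2 * tint q 0 t"
proof -
 have "(norm (x + tint u 0 t))\<^sup>2 - (norm x)\<^sup>2
   = (x + tint u 0 t) \<bullet> (x + tint u 0 t) - (x + tint u 0 0) \<bullet> (x + tint u 0 0)"
  by (simp add: power2_norm_eq_inner tint_empty)
 also have "\<dots> = tint (\<lambda>r. u r \<bullet> (x + tint u 0 r) + (x + tint u 0 r) \<bullet> u r) 0 t"
  by (rule tint_product_rule(1)[OF u u]) (use t in auto)
 also have "\<dots> = tint (\<lambda>r. 2 * q r) 0 t" by (rule tint_cong) (simp add: q inner_commute[of _ "u _"])
 finally show ?thesis by (simp add: tint_cmult)
qed

lemma tint_FTC:
 fixes F :: "real => real"
 assumes F: "\<And>t. (F has_real_derivative F' t) (at t)" and c: "continuous_on UNIV F'" and t: "0 \<le> t"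
 shows "F t - F 0 = tint F' 0 t"
proof -
 have "has_bochner_integral lborel (\<lambda>r. indicator {0..t} r *\<^sub>R F' r) (F t - F 0)"
  by (rule has_bochner_integral_FTC_Icc)
    (use t F in \<open>auto intro: continuous_on_subset[OF c] has_vector_derivative_at_within simp: has_real_derivative_iff_has_vector_derivative\<close>)
 then have "F t - F 0 = (\<integral>r. indicator {0..t} r *\<^sub>R F' r \<partial>lborel)" by (simp add: has_bochner_integral_iff)
 also have "\<dots> = (\<integral>r. indicator {0<..t} r *\<^sub>R F' r \<partial>lborel)"
  by (rule integral_discrete_difference[where X = "{0}"]) (auto simp: indicator_def)
 also have "\<dots> = tint F' 0 t" unfolding tint_def
  by (intro integral_completion[symmetric] borel_measurable_scaleR borel_measurable_indicator)
   (auto intro: borel_measurable_continuous_onI c)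
 finally show ?thesis .
qed

lemma exp_eq_tint:
 fixes k :: real
 assumes "0 \<le> t" "t \<le> T"
 shows "exp (k * t) = 1 + tint (\<lambda>r. indicator {0<..T} r *\<^sub>R (k * exp (k * r))) 0 t"
  and "sqint (\<lambda>r. indicator {0<..T} r *\<^sub>R (k * exp (k * r)))"
proof -
 have "exp (k * t) - exp (k * 0) = tint (\<lambda>r. k * exp (k * r)) 0 t" by (rule tint_FTC[where F = "\<lambda>r. exp (k * r)"])
    (use assms in \<open>auto intro!: derivative_eq_intros continuous_intros\<close>)
 also have "\<dots> = tint (\<lambda>r. indicator {0<..T} r *\<^sub>R (k * exp (k * r))) 0 t" by (rule tint_cong) (use assms in auto)
 finally show "exp (k * t) = 1 + tint (\<lambda>r. indicator {0<..T} r *\<^sub>R (k * exp (k * r))) 0 t" by simp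
 show "sqint (\<lambda>r. indicator {0<..T} r *\<^sub>R (k * exp (k * r)))" by (intro sqint_continuous_indicator continuous_intros)
qed

lemma sqint_continuous_interval:
 fixes F :: "real => 'b::{real_inner,banach,second_countable_topology}"
 assumes c: "continuous_on {0..T} F"
 shows "sqint (\<lambda>t. indicator {0<..T} t *\<^sub>R F t)"
proof -
 have "compact (F ` {0..T})" using c by (rule compact_continuous_image) auto
 from compact_imp_bounded[OF this] obtain B where B: "\<forall>z\<in>F ` {0..T}. norm z \<le> B" unfolding bounded_iff by blast
 have meas: "(\<lambda>r. indicator {0..T} r *\<^sub>R F r) \<in> borel_measurable lebesgue"
  using borel_measurable_continuous_on_indicator[OF _ c] by (intro measurable_completion) simp
 have "sqint (\<lambda>r. indicator {0<..T} r *\<^sub>R (indicator {0..T} r *\<^sub>R F r))"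
  by (rule sqint_bounded_indicator[OF meas, of _ _ B]) (use B in auto)
 also have "(\<lambda>r. indicator {0<..T} r *\<^sub>R (indicator {0..T} r *\<^sub>R F r)) = (\<lambda>t. indicator {0<..T} t *\<^sub>R F t)"
  by (auto simp: indicator_def fun_eq_iff)
 finally show ?thesis .
qed

text \<open>The function \<open>exp (- k t)\<close> times the integral of \<open>y\<close> over \<open>[0, t]\<close> is nonincreasing and starts at
 \<open>0\<close>.\<close>

lemma gronwall_zero:
 fixes y :: "real => real"
 assumes c: "continuous_on {0..T} y" and y0: "\<And>t. t \<in> {0..T} ==> y t \<ge> 0"
  and le: "\<And>t. t \<in> {0..T} ==> y t \<le> k * tint y 0 t" and t: "t \<in> {0..T}" and k: "k \<ge> 0"
 shows "y t = 0"
proof -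
 define u where "u r = indicator {0<..T} r *\<^sub>R y r" for r
 have u: "sqint u" unfolding u_def[abs_def] by (rule sqint_continuous_interval[OF c])
 have uy: "tint u 0 s = tint y 0 s" if "s \<in> {0..T}" for s by (rule tint_cong) (use that in \<open>auto simp: u_def\<close>)
 have G0: "tint y 0 s \<ge> 0" if "s \<in> {0..T}" for s by (rule tint_nonneg) (use that y0 in auto)
 let ?e = "\<lambda>r. indicator {0<..T} r *\<^sub>R (- k * exp (- k * r))"
 have T0: "0 \<le> t" "t \<le> T" using t by auto
 have se: "sqint ?e" by (rule exp_eq_tint(2)[OF T0])
 have "tint u 0 t * exp (- k * t) = (0 + tint u 0 t) \<bullet> (1 + tint ?e 0 t) - (0 + tint u 0 0) \<bullet> (1 + tint ?e 0 0)"
  using exp_eq_tint(1)[of t T "- k"] T0 by (simp add: tint_empty)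
 also have "\<dots> = tint (\<lambda>r. u r \<bullet> (1 + tint ?e 0 r) + (0 + tint u 0 r) \<bullet> ?e r) 0 t"
  by (rule tint_product_rule(1)[OF u se]) (use T0 in auto)
 also have "\<dots> \<le> tint (\<lambda>r. 0) 0 t" proof (rule tint_mono)
  show "tintegrable (\<lambda>r. u r \<bullet> (1 + tint ?e 0 r) + (0 + tint u 0 r) \<bullet> ?e r) 0 t"
   by (rule tint_product_rule(2)[OF u se]) (use T0 in auto)
  show "AE r in lebesgue. r \<in> {0<..t} \<longrightarrow> u r \<bullet> (1 + tint ?e 0 r) + (0 + tint u 0 r) \<bullet> ?e r \<le> 0"
  proof (intro AE_I2 impI)
   fix r assume "r \<in> {0<..t}"
   then have r: "0 < r" "r \<le> T" "r \<in> {0..T}" using T0 by auto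
   have "u r \<bullet> (1 + tint ?e 0 r) + (0 + tint u 0 r) \<bullet> ?e r = (y r - k * tint y 0 r) * exp (- k * r)"
    using exp_eq_tint(1)[of r T "- k"] r uy[of r] by (simp add: u_def algebra_simps)
   also have "\<dots> \<le> 0" using le[of r] r by (intro mult_nonpos_nonneg) auto
   finally show "u r \<bullet> (1 + tint ?e 0 r) + (0 + tint u 0 r) \<bullet> ?e r \<le> 0" .
  qed
 qed (simp add: tintegrable_def)
 finally have "tint u 0 t * exp (- k * t) \<le> 0" by (simp add: tint_def)
 then have "tint y 0 t \<le> 0" using uy[OF t] by (simp add: mult_le_0_iff)
 then show ?thesis using le[OF t] y0[OF t] k G0[OF t] by (smt (verit) mult_nonneg_nonneg mult_not_zero)
qed

section \<open>Regularisation by resolvents\<close>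

text \<open>The solution represents \<open>y\<close> in the inner product \<open>e x \<bullet> v + \<iota> x \<bullet> \<iota> v\<close> of \<open>x\<close> and \<open>v\<close>, which is
 that of the product space on the graph of \<open>\<iota>\<close>.\<close>

lemma resolvent_exists:
 fixes \<iota> :: "'x::{real_inner,complete_space} => 'h::{real_inner,complete_space}"
 assumes \<iota>: "bounded_linear \<iota>" and e: "e > 0"
 shows "\<exists>x. e *\<^sub>R x + adjoint \<iota> (\<iota> x) = y"
proof -
 interpret \<iota>: bounded_linear \<iota> by fact
 define S where "S = range (\<lambda>x. (sqrt e *\<^sub>R x, \<iota> x))"
 have S: "subspace S" unfolding S_def by (rule linear_subspace_image[OF _ subspace_UNIV])
    (auto intro!: linearI simp: \<iota>.add \<iota>.scaleR scaleR_add_right)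
 have "\<exists>p\<in>closure S. \<forall>s\<in>S. y \<bullet> fst s / sqrt e = p \<bullet> s" proof (rule riesz_subspace[OF S, where C = "norm y / sqrt e"])
  fix s :: "'x \<times> 'h"
  have "\<bar>y \<bullet> fst s\<bar> \<le> norm y * norm s"
   using Cauchy_Schwarz_ineq2[of y "fst s"] norm_fst_le[of "fst s" "snd s"] mult_left_mono[of "norm (fst s)" "norm s" "norm y"]
   by simp
  then show "\<bar>y \<bullet> fst s / sqrt e\<bar> \<le> norm y / sqrt e * norm s" using e by (simp add: abs_divide divide_right_mono)
 qed (auto simp: inner_add_right add_divide_distrib)
 then obtain p where p: "p \<in> closure S" "\<And>s. s \<in> S ==> y \<bullet> fst s / sqrt e = p \<bullet> s" by blast
 define x where "x = (1 / sqrt e) *\<^sub>R fst p"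
 have p1: "fst p = sqrt e *\<^sub>R x" using e by (simp add: x_def)
 have p2: "snd p = \<iota> x" proof -
  obtain s where s: "\<forall>n. s n \<in> S" "s \<longlonglongrightarrow> p" using p(1) unfolding closure_sequential by blast
  have "snd (s n) = \<iota> ((1 / sqrt e) *\<^sub>R fst (s n))" for n using s(1)[rule_format, of n] e by (auto simp: S_def)
  moreover have "(\<lambda>n. \<iota> ((1 / sqrt e) *\<^sub>R fst (s n))) \<longlonglongrightarrow> \<iota> x"
   unfolding x_def by (intro \<iota>.tendsto tendsto_intros s(2))
  ultimately have "(\<lambda>n. snd (s n)) \<longlonglongrightarrow> \<iota> x" by simp
  then show ?thesis using tendsto_snd[OF s(2)] LIMSEQ_unique by blast
 qed
 have "v \<bullet> (e *\<^sub>R x + adjoint \<iota> (\<iota> x)) = v \<bullet> y" for v proof -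
  have "y \<bullet> v = e * (x \<bullet> v) + \<iota> x \<bullet> \<iota> v"
   using p(2)[of "(sqrt e *\<^sub>R v, \<iota> v)"] e p1 p2 by (cases p) (simp add: S_def field_simps)
  then show ?thesis using adjoint_inner[OF \<iota>, of v "\<iota> x"] by (simp add: inner_add_right inner_commute)
 qed
 then show ?thesis using vector_eq_ldot by blast
qed

lemma contractions_tendsto_closure:
 fixes B :: "nat => 'a::real_normed_vector => 'b::real_normed_vector"
 assumes lin: "\<And>n. linear (B n)" and bd: "\<And>n y. norm (B n y) \<le> norm y"
  and L: "linear L" "\<And>y. norm (L y) \<le> norm y"
  and D: "\<And>y. y \<in> D ==> (\<lambda>n. B n y) \<longlonglongrightarrow> L y" and y: "y \<in> closure D"
 shows "(\<lambda>n. B n y) \<longlonglongrightarrow> L y"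
proof (rule LIMSEQ_I)
 fix r :: real assume r: "r > 0"
 obtain d where d: "d \<in> D" "dist d y < r / 3"
  using y r unfolding closure_approachable by (metis zero_less_divide_iff zero_less_numeral)
 obtain N where N: "\<And>n. n \<ge> N ==> norm (B n d - L d) < r / 3" using LIMSEQ_D[OF D[OF d(1)], of "r/3"] r by auto
 have "norm (B n y - L y) < r" if "n \<ge> N" for n proof -
  have "B n y - L y = B n (y - d) + (B n d - L d) + L (d - y)"
   using linear_diff[OF lin] linear_diff[OF L(1)] by simp
  also have "norm \<dots> \<le> norm (B n (y - d)) + norm (B n d - L d) + norm (L (d - y))"
   using norm_triangle_ineq[of "B n (y - d) + (B n d - L d)" "L (d - y)"]
    norm_triangle_ineq[of "B n (y - d)" "B n d - L d"] by linarith
  also have "\<dots> < r"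
   using bd[of n "y - d"] L(2)[of "d - y"] N[OF that] d(2) by (simp add: dist_norm norm_minus_commute)
  finally show ?thesis .
 qed
 then show "\<exists>no. \<forall>n\<ge>no. norm (B n y - L y) < r" by blast
qed

text \<open>A Hilbert space \<open>V\<close> embedded in \<open>H\<close>. Here \<open>V\<close> is the range of the orthogonal projection \<open>P\<close> of a
 larger space, and \<open>\<iota>\<close> is the embedding, extended by zero to the orthogonal complement of \<open>V\<close>. With the
 dual of \<open>V\<close> identified with \<open>V\<close>, the composition of \<open>\<iota>\<close> and its adjoint is the inclusion of \<open>V\<close> in its
 dual.\<close>

locale hilbert_pair =
 fixes \<iota> :: "'x::{real_inner,banach,second_countable_topology} => 'h::{real_inner,banach,second_countable_topology}"
  and P :: "'x => 'x"
 assumes \<iota>: "bounded_linear \<iota>" and P: "bounded_linear P"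
  and P_sym: "\<And>x y. P x \<bullet> y = x \<bullet> P y" and P_idem: "\<And>x. P (P x) = P x"
  and \<iota>_P: "\<And>x. \<iota> (P x) = \<iota> x" and \<iota>_inj: "\<And>x. \<iota> x = 0 ==> P x = 0"
begin

abbreviation "\<iota>\<^sub>a \<equiv> adjoint \<iota>"

lemma adj: "\<iota> x \<bullet> y = x \<bullet> \<iota>\<^sub>a y" by (rule adjoint_inner[OF \<iota>])

lemma bl_adj: "bounded_linear \<iota>\<^sub>a" by (rule bounded_linear_adjoint[OF \<iota>])

sublocale \<iota>: bounded_linear \<iota> by (rule \<iota>)
sublocale \<iota>a: bounded_linear \<iota>\<^sub>a by (rule bl_adj)
sublocale P: bounded_linear P by (rule P)

lemma P_adj: "P (\<iota>\<^sub>a y) = \<iota>\<^sub>a y"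
 by (rule vector_eq_ldot[THEN iffD1]) (metis P_sym \<iota>_P adj)

lemma norm_P_le: "norm (P x) \<le> norm x" by (rule norm_projection_le[OF P_sym P_idem])

text \<open>The resolvent \<open>(1/n + \<iota>* \<iota>)^(-1)\<close>, with \<open>n\<close> shifted by one. It maps the dual of \<open>V\<close> back to \<open>V\<close>
 and commutes with \<open>\<iota>* \<iota>\<close>, so it regularises an equation for \<open>\<iota>* \<iota> w\<close> without disturbing its form.\<close>

definition resolv :: "nat => 'x => 'x" where
 "resolv n y = (SOME x. (1 / real (Suc n)) *\<^sub>R x + \<iota>\<^sub>a (\<iota> x) = y)"

lemma resolv: "(1 / real (Suc n)) *\<^sub>R resolv n y + \<iota>\<^sub>a (\<iota> (resolv n y)) = y"
 unfolding resolv_def by (rule someI_ex[OF resolvent_exists[OF \<iota>]]) simp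

lemma resolv_energy:
 "(norm (resolv n y))\<^sup>2 / real (Suc n) + (norm (\<iota> (resolv n y)))\<^sup>2 = y \<bullet> resolv n y"
proof -
 have "y \<bullet> resolv n y = ((1 / real (Suc n)) *\<^sub>R resolv n y + \<iota>\<^sub>a (\<iota> (resolv n y))) \<bullet> resolv n y"
  by (simp only: resolv)
 also have "\<dots> = (norm (resolv n y))\<^sup>2 / real (Suc n) + (norm (\<iota> (resolv n y)))\<^sup>2"
  using adj[of "resolv n y" "\<iota> (resolv n y)"]
  by (simp add: inner_add_left inner_add_right power2_norm_eq_inner inner_commute)
 finally show ?thesis by simp
qed

lemma resolv_eqI:
 assumes "(1 / real (Suc n)) *\<^sub>R x + \<iota>\<^sub>a (\<iota> x) = y"
 shows "resolv n y = x"
proof -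
 define d where "d = resolv n y - x"
 have "(1 / real (Suc n)) *\<^sub>R d + \<iota>\<^sub>a (\<iota> d) = 0"
  using resolv[of n y] assms by (simp add: d_def \<iota>.diff \<iota>a.diff algebra_simps)
 then have "((1 / real (Suc n)) *\<^sub>R d + \<iota>\<^sub>a (\<iota> d)) \<bullet> d = 0" by simp
 then have "(norm d)\<^sup>2 / real (Suc n) + (norm (\<iota> d))\<^sup>2 = 0"
  using adj[of d "\<iota> d"] by (simp add: inner_add_left inner_add_right power2_norm_eq_inner inner_commute)
 then have "(norm d)\<^sup>2 / real (Suc n) = 0" by (smt (verit) divide_nonneg_nonneg of_nat_0_le_iff zero_le_power2)
 then have "d = 0" by simp
 then show ?thesis by (simp add: d_def)
qed

lemma norm_resolv_le: "norm (resolv n y) \<le> real (Suc n) * norm y"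
proof (cases "resolv n y = 0")
 case False
 have "(norm (resolv n y))\<^sup>2 / real (Suc n) \<le> y \<bullet> resolv n y"
  using resolv_energy[of n y] by (smt (verit) zero_le_power2)
 also have "\<dots> \<le> norm y * norm (resolv n y)" by (rule norm_cauchy_schwarz)
 finally have "norm (resolv n y) * norm (resolv n y) \<le> norm (resolv n y) * (real (Suc n) * norm y)"
  by (simp add: field_simps power2_eq_square)
 then show ?thesis using False by simp
qed simp

lemma bl_resolv: "bounded_linear (resolv n)"
proof (rule bounded_linear_intro[where K = "real (Suc n)"])
 show "resolv n (x + y) = resolv n x + resolv n y" for x y proof (rule resolv_eqI)
  have "(1 / real (Suc n)) *\<^sub>R (resolv n x + resolv n y) + \<iota>\<^sub>a (\<iota> (resolv n x + resolv n y))
    = ((1 / real (Suc n)) *\<^sub>R resolv n x + \<iota>\<^sub>a (\<iota> (resolv n x)))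
    + ((1 / real (Suc n)) *\<^sub>R resolv n y + \<iota>\<^sub>a (\<iota> (resolv n y)))"
   by (simp add: \<iota>.add \<iota>a.add scaleR_add_right)
  then show "(1 / real (Suc n)) *\<^sub>R (resolv n x + resolv n y) + \<iota>\<^sub>a (\<iota> (resolv n x + resolv n y)) = x + y"
   by (simp only: resolv)
 qed
 show "resolv n (r *\<^sub>R x) = r *\<^sub>R resolv n x" for r x proof (rule resolv_eqI)
  have "(1 / real (Suc n)) *\<^sub>R (r *\<^sub>R resolv n x) + \<iota>\<^sub>a (\<iota> (r *\<^sub>R resolv n x))
    = r *\<^sub>R ((1 / real (Suc n)) *\<^sub>R resolv n x + \<iota>\<^sub>a (\<iota> (resolv n x)))"
   by (simp add: \<iota>.scaleR \<iota>a.scaleR scaleR_add_right mult.commute)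
  then show "(1 / real (Suc n)) *\<^sub>R (r *\<^sub>R resolv n x) + \<iota>\<^sub>a (\<iota> (r *\<^sub>R resolv n x)) = r *\<^sub>R x"
   by (simp only: resolv)
 qed
 show "norm (resolv n y) \<le> norm y * real (Suc n)" for y using norm_resolv_le[of n y] by (simp add: mult.commute)
qed

lemma resolv_commute: "resolv n (\<iota>\<^sub>a (\<iota> y)) = \<iota>\<^sub>a (\<iota> (resolv n y))"
proof (rule resolv_eqI)
 have "\<iota>\<^sub>a (\<iota> ((1 / real (Suc n)) *\<^sub>R resolv n y + \<iota>\<^sub>a (\<iota> (resolv n y)))) = \<iota>\<^sub>a (\<iota> y)" by (simp only: resolv)
 then show "(1 / real (Suc n)) *\<^sub>R \<iota>\<^sub>a (\<iota> (resolv n y)) + \<iota>\<^sub>a (\<iota> (\<iota>\<^sub>a (\<iota> (resolv n y)))) = \<iota>\<^sub>a (\<iota> y)"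
  by (simp add: \<iota>.add \<iota>a.add \<iota>.scaleR \<iota>a.scaleR)
qed

definition approx :: "nat => 'x => 'x" where "approx n y = \<iota>\<^sub>a (\<iota> (resolv n y))"

lemma bl_approx: "bounded_linear (approx n)"
 unfolding approx_def by (intro bounded_linear_compose[OF bl_adj] bounded_linear_compose[OF \<iota>] bl_resolv)

lemma norm_approx_le: "norm (approx n y) \<le> norm y"
proof (rule power2_le_imp_le)
 let ?x = "resolv n y" and ?e = "1 / real (Suc n)"
 have "(norm y)\<^sup>2 = (norm (?e *\<^sub>R ?x + approx n y))\<^sup>2" unfolding approx_def by (simp only: resolv)
 also have "\<dots> = ?e\<^sup>2 * (norm ?x)\<^sup>2 + 2 * ?e * (?x \<bullet> approx n y) + (norm (approx n y))\<^sup>2"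
  unfolding power2_norm_eq_inner by (simp add: inner_simps inner_commute power2_eq_square)
 also have "?x \<bullet> approx n y = (norm (\<iota> ?x))\<^sup>2"
  unfolding approx_def adj[symmetric] by (simp add: power2_norm_eq_inner)
 finally show "(norm (approx n y))\<^sup>2 \<le> (norm y)\<^sup>2" by simp
qed simp

text \<open>On the range of \<open>\<iota>* \<iota>\<close>, which is dense in \<open>V\<close>, the error is of order \<open>1/n\<close>; the approximations
 being contractions, convergence extends to the closure.\<close>

lemma approx_tendsto: "(\<lambda>n. approx n y) \<longlonglongrightarrow> P y" if "P y = y"
proof -
 define D where "D = range (\<lambda>v. \<iota>\<^sub>a (\<iota> v))"
 have D: "subspace D" unfolding D_def by (rule linear_subspace_image[OF _ subspace_UNIV])
    (auto intro!: linearI simp: \<iota>.add \<iota>.scaleR \<iota>a.add \<iota>a.scaleR)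
 have PD: "P d = d" if "d \<in> closure D" for d proof -
  obtain s where s: "\<forall>n. s n \<in> D" "s \<longlonglongrightarrow> d" using \<open>d \<in> closure D\<close> unfolding closure_sequential by blast
  have "(\<lambda>n. P (s n)) \<longlonglongrightarrow> P d" by (rule P.tendsto[OF s(2)])
  moreover have "P (s n) = s n" for n using s(1)[rule_format, of n] by (auto simp: D_def P_adj)
  ultimately show ?thesis using LIMSEQ_unique s(2) by simp
 qed
 have yD: "y \<in> closure D" proof -
  define d where "d = y - proj D y"
  have "\<iota>\<^sub>a (\<iota> d) \<in> closure D" using closure_subset[of D] by (auto simp: D_def)
  from proj_inner[OF D this, of y] have "d \<bullet> \<iota>\<^sub>a (\<iota> d) = 0" by (simp add: inner_diff_left d_def)
  then have "\<iota> d = 0" by (simp add: adj[symmetric])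
  then have "P d = 0" by (rule \<iota>_inj)
  moreover have "P d = d" unfolding d_def P.diff using that PD[OF proj_in_closure[OF D]] by simp
  ultimately show ?thesis using proj_in_closure[OF D, of y] by (simp add: d_def)
 qed
 have lim: "(\<lambda>n. approx n d) \<longlonglongrightarrow> P d" if "d \<in> D" for d proof -
  obtain v where v: "d = \<iota>\<^sub>a (\<iota> v)" using \<open>d \<in> D\<close> by (auto simp: D_def)
  have eq: "approx n d - d = - ((1 / real (Suc n)) *\<^sub>R approx n v)" for n
   using resolv[of n d] unfolding approx_def v resolv_commute by (metis add_diff_cancel_right' add_uminus_conv_diff diff_add_cancel minus_diff_eq)
  have "(\<lambda>n. approx n d - d) \<longlonglongrightarrow> 0" proof (rule Lim_null_comparison[of _ "\<lambda>n. 1 / real (Suc n) * norm v"])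
   show "eventually (\<lambda>n. norm (approx n d - d) \<le> 1 / real (Suc n) * norm v) sequentially"
    unfolding eq using norm_approx_le by (auto intro!: always_eventually divide_right_mono)
   show "(\<lambda>n. 1 / real (Suc n) * norm v) \<longlonglongrightarrow> 0"
    using tendsto_mult_right[OF LIMSEQ_Suc[OF lim_const_over_n[of "1::real"]], of "norm v"] by simp
  qed
  then have "(\<lambda>n. approx n d) \<longlonglongrightarrow> d" by (rule LIM_zero_cancel)
  moreover have "P d = d" by (rule PD) (rule subsetD[OF closure_subset \<open>d \<in> D\<close>])
  ultimately show ?thesis by metis
 qed
 show ?thesis by (rule contractions_tendsto_closure[OF bounded_linear.linear[OF bl_approx] norm_approx_le
     bounded_linear.linear[OF P] norm_P_le lim yD])
qed

text \<open>The same regularisation on the pivot space \<open>H\<close>.\<close>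

definition happrox :: "nat => 'h => 'h" where "happrox n z = \<iota> (resolv n (\<iota>\<^sub>a z))"

lemma happrox_tendsto: "(\<lambda>n. happrox n z) \<longlonglongrightarrow> z" if "z \<in> closure (range \<iota>)"
proof -
 have bl: "bounded_linear (happrox n)" for n unfolding happrox_def
  by (intro bounded_linear_compose[OF \<iota>] bounded_linear_compose[OF bl_resolv] bl_adj)
 have le: "norm (happrox n z) \<le> norm z" for n z proof -
  have "(norm (happrox n z))\<^sup>2 \<le> \<iota>\<^sub>a z \<bullet> resolv n (\<iota>\<^sub>a z)" using resolv_energy[of n "\<iota>\<^sub>a z"] unfolding happrox_def
   by (smt (verit) divide_nonneg_nonneg of_nat_0_le_iff zero_le_power2)
  also have "\<dots> = z \<bullet> happrox n z"
   unfolding happrox_def using adj[of "resolv n (\<iota>\<^sub>a z)" z] by (simp add: inner_commute)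
  also have "\<dots> \<le> norm z * norm (happrox n z)" by (rule norm_cauchy_schwarz)
  finally show ?thesis by (cases "happrox n z = 0") (auto simp: power2_eq_square)
 qed
 have "(\<lambda>n. happrox n (\<iota> x)) \<longlonglongrightarrow> \<iota> x" for x proof -
  have "happrox n (\<iota> x) = \<iota> (approx n (P x))" for n
   unfolding happrox_def approx_def resolv_commute[symmetric] \<iota>_P ..
  moreover have "(\<lambda>n. \<iota> (approx n (P x))) \<longlonglongrightarrow> \<iota> (P x)"
   using bounded_linear.tendsto[OF \<iota> approx_tendsto[of "P x"]] by (simp add: P_idem)
  ultimately show ?thesis by (simp add: \<iota>_P)
 qed
 then show ?thesis using contractions_tendsto_closure[of happrox "\<lambda>z. z" "range \<iota>" z] that le
  by (auto simp: bounded_linear.linear[OF bl] linear_ident)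
qed

end

lemma l2_dominated_convergence:
 assumes s: "\<And>n. sqint (s n)" and f: "sqint f" and g: "sqint g"
  and lim: "AE x in lebesgue. (\<lambda>n. s n x) \<longlonglongrightarrow> f x"
  and bd: "\<And>n. AE x in lebesgue. norm (s n x) \<le> norm (g x)"
 shows "(\<lambda>n. abs_l2 (s n)) \<longlonglongrightarrow> abs_l2 f"
proof -
 have bd': "AE x in lebesgue. \<forall>n. norm (s n x) \<le> norm (g x)" using bd by (simp add: AE_all_countable)
 have fg: "AE x in lebesgue. norm (f x) \<le> norm (g x)" using lim bd' proof eventually_elim
  case (elim x)
  show ?case by (rule LIMSEQ_le_const2[OF tendsto_norm[OF elim(1)]]) (use elim(2) in auto)
 qed
 have "(\<lambda>n. \<integral>x. (norm (s n x - f x))\<^sup>2 \<partial>lebesgue) \<longlonglongrightarrow> integral\<^sup>L (lebesgue :: 'a measure) (\<lambda>x. 0)"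
 proof (rule integral_dominated_convergence[where w = "\<lambda>x. 4 * (norm (g x))\<^sup>2"])
  have [measurable]: "s n \<in> borel_measurable lebesgue" "f \<in> borel_measurable lebesgue" for n
   using s f by (auto simp: sqint_def)
  show "(\<lambda>x. (norm (s n x - f x))\<^sup>2) \<in> borel_measurable lebesgue" for n by measurable
  show "integrable lebesgue (\<lambda>x. 4 * (norm (g x))\<^sup>2)" using sqint_integrable[OF g] by simp
  show "AE x in lebesgue. (\<lambda>n. (norm (s n x - f x))\<^sup>2) \<longlonglongrightarrow> 0"
   using lim by eventually_elim (auto intro!: tendsto_eq_intros)
  show "AE x in lebesgue. norm ((norm (s n x - f x))\<^sup>2) \<le> 4 * (norm (g x))\<^sup>2" for n using fg bd[of n]
  proof eventually_elim
   case (elim x)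
   have "norm (s n x - f x) \<le> 2 * norm (g x)" using norm_triangle_ineq4[of "s n x" "f x"] elim by linarith
   then have "(norm (s n x - f x))\<^sup>2 \<le> (2 * norm (g x))\<^sup>2" by (intro power_mono) auto
   then show ?case by (simp add: power_mult_distrib)
  qed
 qed simp
 then have "(\<lambda>n. (norm (abs_l2 (s n) - abs_l2 f))\<^sup>2) \<longlonglongrightarrow> 0" by (simp add: norm_abs_l2 diff_abs_l2 s f sqint_diff)
 then have "(\<lambda>n. sqrt ((norm (abs_l2 (s n) - abs_l2 f))\<^sup>2)) \<longlonglongrightarrow> sqrt 0" by (rule tendsto_real_sqrt)
 then show ?thesis by (simp add: tendsto_norm_zero_iff LIM_zero_iff)
qed

lemma sqint_bounded_linear: "bounded_linear B ==> sqint f ==> sqint (\<lambda>t. B (f t))"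
proof -
 assume B: "bounded_linear B" and f: "sqint f"
 obtain K where K: "\<And>x. norm (B x) \<le> norm x * K" using bounded_linear.bounded[OF B] by blast
 show "sqint (\<lambda>t. B (f t))" by (rule sqint_bound[OF f, of _ K])
    (use K borel_measurable_continuous_on[OF linear_continuous_on[OF B] sqintD[OF f]] in \<open>auto simp: mult.commute\<close>)
qed

context hilbert_pair begin

text \<open>Theorem of Lions and Magenes. Applying the resolvents to the equation gives regular functions
 \<open>w_n\<close> that are antiderivatives of square integrable functions, to which the product rule applies. The
 energy identity for differences bounds the oscillation of \<open>y_n = \<iota> w_n\<close> uniformly in time by the
 initial values and by \<open>L2\<close> norms that tend to zero; so \<open>y_n\<close> converges uniformly, to the continuous
 representative \<open>z\<close>.\<close>

lemma energy_identity:
 fixes w f :: "real => 'x"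
 assumes w: "sqint w" and f: "sqint f" and Pw: "\<And>t. P (w t) = w t" and Pf: "\<And>t. P (f t) = f t"
  and z0: "z0 \<in> closure (range \<iota>)" and T: "T > 0"
  and eq: "AE t in lebesgue. t \<in> {0<..T} \<longrightarrow> \<iota>\<^sub>a (\<iota> (w t)) = \<iota>\<^sub>a z0 + tint f 0 t"
 obtains z where "continuous_on {0..T} z" "z 0 = z0"
  "AE t in lebesgue. t \<in> {0<..T} \<longrightarrow> z t = \<iota> (w t)"
  "\<And>t. t \<in> {0..T} ==> \<iota>\<^sub>a (z t) = \<iota>\<^sub>a z0 + tint f 0 t"
  "\<And>t. t \<in> {0..T} ==> (norm (z t))\<^sup>2 = (norm z0)\<^sup>2 + 2 * tint (\<lambda>r. f r \<bullet> w r) 0 t"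
proof -
 (* Regularised forcing, velocity and pivot value; yn turns out to be \<iota> wn. *)
 define fn where "fn n t = approx n (f t)" for n t
 define wn where "wn n t = resolv n (\<iota>\<^sub>a z0) + tint (\<lambda>r. resolv n (f r)) 0 t" for n t
 define yn where "yn n t = happrox n z0 + tint (\<lambda>r. \<iota> (resolv n (f r))) 0 t" for n t
 have fnsq: "sqint (fn n)" for n unfolding fn_def by (rule sqint_bounded_linear[OF bl_approx f])
 have rf: "sqint (\<lambda>r. resolv n (f r))" for n by (rule sqint_bounded_linear[OF bl_resolv f])
 have \<iota>rf: "sqint (\<lambda>r. \<iota> (resolv n (f r)))" for n by (rule sqint_bounded_linear[OF \<iota> rf])
 have wn_eq: "wn n t = resolv n (\<iota>\<^sub>a z0 + tint f 0 t)" for n t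
  unfolding wn_def using tint_bounded_linear(1)[OF bl_resolv sqint_tintegrable[OF f]]
  by (simp add: linear_add[OF bounded_linear.linear[OF bl_resolv]])
 have yn_wn: "yn n t = \<iota> (wn n t)" for n t
  unfolding yn_def wn_def happrox_def \<iota>.add using tint_bounded_linear(1)[OF \<iota> sqint_tintegrable[OF rf]] by simp
 have wn_w: "AE t in lebesgue. t \<in> {0<..T} \<longrightarrow> (\<forall>n. wn n t = approx n (w t))"
  using eq by eventually_elim (auto simp: wn_eq approx_def resolv_commute[symmetric])
 have cwn: "continuous_on UNIV (wn n)" for n unfolding wn_def by (intro continuous_intros continuous_on_tint rf)
 define Wn where "Wn n = (\<lambda>t. indicator {0<..T} t *\<^sub>R wn n t)" for n
 define W where "W = (\<lambda>t. indicator {0<..T} t *\<^sub>R w t)"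
 have Wnsq: "sqint (Wn n)" for n unfolding Wn_def by (rule sqint_continuous_indicator[OF cwn])
 have Wsq: "sqint W" unfolding W_def by (rule sqint_indicator[OF w])
 have limf: "(\<lambda>n. abs_l2 (fn n)) \<longlonglongrightarrow> abs_l2 f" proof (rule l2_dominated_convergence[OF fnsq f f])
  show "AE x in lebesgue. (\<lambda>n. fn n x) \<longlonglongrightarrow> f x" unfolding fn_def using approx_tendsto[OF Pf] by (simp add: Pf)
  show "AE x in lebesgue. norm (fn n x) \<le> norm (f x)" for n unfolding fn_def by (simp add: norm_approx_le)
 qed
 have limW: "(\<lambda>n. abs_l2 (Wn n)) \<longlonglongrightarrow> abs_l2 W" proof (rule l2_dominated_convergence[OF Wnsq Wsq w])
  show "AE x in lebesgue. (\<lambda>n. Wn n x) \<longlonglongrightarrow> W x" using wn_w proof eventually_elim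
   case (elim t)
   show ?case using elim approx_tendsto[OF Pw, of t] by (cases "t \<in> {0<..T}") (auto simp: Wn_def W_def Pw)
  qed
  show "AE x in lebesgue. norm (Wn n x) \<le> norm (w x)" for n
   using wn_w by eventually_elim (auto simp: Wn_def norm_approx_le split: split_indicator)
 qed
 have limtint: "(\<lambda>n. tint (\<lambda>r. fn n r \<bullet> Wn n r) 0 t) \<longlonglongrightarrow> tint (\<lambda>r. f r \<bullet> W r) 0 t" for t proof -
  define I :: "real => 'x => 'x" where "I = (\<lambda>r x. indicator {0<..t} r *\<^sub>R x)"
  note I = l2_map_abs[of I 1] bounded_linear_l2_map[of I 1]
  have I': "\<And>f. f \<in> borel_measurable lebesgue ==> (\<lambda>t. I t (f t)) \<in> borel_measurable lebesgue"
    "\<And>t. linear (I t)" "\<And>t y. norm (I t y) \<le> 1 * norm y"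
   by (auto simp: I_def intro!: linearI borel_measurable_scaleR borel_measurable_indicator
      simp: scaleR_add_right split: split_indicator)
  have e: "tint (\<lambda>r. a r \<bullet> b r) 0 t = l2_map I (abs_l2 a) \<bullet> l2_map I (abs_l2 b)" if "sqint a" "sqint b" for a b
   using tint_inner_eq[OF that, of 0 t] I(1)[OF I' _ that(1)] I(1)[OF I' _ that(2)] by (simp add: I_def)
  show ?thesis unfolding e[OF fnsq Wnsq] e[OF f Wsq]
   by (intro tendsto_inner bounded_linear.tendsto[OF I(2)[OF I']] limf limW) auto
 qed
 have energy: "(norm (yn n t - yn m t))\<^sup>2 = (norm (happrox n z0 - happrox m z0))\<^sup>2
    + 2 * tint (\<lambda>r. (fn n r - fn m r) \<bullet> (Wn n r - Wn m r)) 0 t" if t: "t \<in> {0..T}" for n m t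
 proof -
  define u where "u r = \<iota> (resolv n (f r)) - \<iota> (resolv m (f r))" for r
  have u: "sqint u" unfolding u_def by (intro sqint_diff \<iota>rf)
  define x0 where "x0 = happrox n z0 - happrox m z0"
  have U: "yn n r - yn m r = x0 + tint u 0 r" for r
   unfolding yn_def u_def x0_def using tint_diff[OF sqint_tintegrable[OF \<iota>rf] sqint_tintegrable[OF \<iota>rf]] by simp
  have "(norm (x0 + tint u 0 t))\<^sup>2 = (norm x0)\<^sup>2 + 2 * tint (\<lambda>r. (fn n r - fn m r) \<bullet> (Wn n r - Wn m r)) 0 t"
  proof (rule norm_square_tint[OF u])
   show "0 \<le> t" using t by simp
   fix r assume "r \<in> {0<..t}"
   then have r: "Wn n r = wn n r" "Wn m r = wn m r" using t by (auto simp: Wn_def)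
   have "u r \<bullet> (x0 + tint u 0 r) = \<iota> (resolv n (f r) - resolv m (f r)) \<bullet> \<iota> (wn n r - wn m r)"
    unfolding U[symmetric] yn_wn by (simp add: u_def \<iota>.diff)
   also have "\<dots> = (fn n r - fn m r) \<bullet> (Wn n r - Wn m r)"
    using adj[of "wn n r - wn m r" "\<iota> (resolv n (f r) - resolv m (f r))"]
    by (simp add: r fn_def approx_def \<iota>.diff \<iota>a.diff inner_commute)
   finally show "u r \<bullet> (x0 + tint u 0 r) = (fn n r - fn m r) \<bullet> (Wn n r - Wn m r)" .
  qed
  then show ?thesis by (simp only: U x0_def)
 qed
 (* The differences of initial values, forcings and solutions are each made smaller than e / 2. *)
 have cauchy: "uniformly_Cauchy_on {0..T} yn" unfolding uniformly_Cauchy_on_def proof (intro allI impI)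
  fix e :: real assume e: "e > 0"
  have "Cauchy (\<lambda>n. happrox n z0)" "Cauchy (\<lambda>n. abs_l2 (fn n))" "Cauchy (\<lambda>n. abs_l2 (Wn n))"
   using happrox_tendsto[OF z0] limf limW by (auto intro: LIMSEQ_imp_Cauchy)
  then obtain M1 M2 M3 where M:
   "\<And>n m. n \<ge> M1 ==> m \<ge> M1 ==> norm (happrox n z0 - happrox m z0) < e / 2"
   "\<And>n m. n \<ge> M2 ==> m \<ge> M2 ==> norm (abs_l2 (fn n) - abs_l2 (fn m)) < e / 2"
   "\<And>n m. n \<ge> M3 ==> m \<ge> M3 ==> norm (abs_l2 (Wn n) - abs_l2 (Wn m)) < e / 2"
   using e unfolding Cauchy_iff by (metis half_gt_zero)
  have "dist (yn m t) (yn n t) < e" if t: "t \<in> {0..T}" and nm: "m \<ge> max M1 (max M2 M3)" "n \<ge> max M1 (max M2 M3)" for t m n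
  proof -
   have "tint (\<lambda>r. (fn m r - fn n r) \<bullet> (Wn m r - Wn n r)) 0 t
     \<le> norm (abs_l2 (\<lambda>r. indicator {0<..t} r *\<^sub>R (fn m r - fn n r))) * norm (abs_l2 (\<lambda>r. indicator {0<..t} r *\<^sub>R (Wn m r - Wn n r)))"
    unfolding tint_inner_eq[OF sqint_diff[OF fnsq fnsq] sqint_diff[OF Wnsq Wnsq]] by (rule norm_cauchy_schwarz)
   also have "\<dots> \<le> (1 * norm (abs_l2 (\<lambda>r. fn m r - fn n r))) * (1 * norm (abs_l2 (\<lambda>r. Wn m r - Wn n r)))"
    by (intro mult_mono norm_l2_mono sqint_indicator sqint_diff fnsq Wnsq)
      (auto simp: indicator_def)
   also have "\<dots> \<le> e / 2 * (e / 2)" using M(2)[of m n] M(3)[of m n] nm e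
    by (intro mult_mono) (auto simp: diff_abs_l2[symmetric] fnsq Wnsq)
   finally have "(norm (yn m t - yn n t))\<^sup>2 \<le> (norm (happrox m z0 - happrox n z0))\<^sup>2 + 2 * (e / 2 * (e / 2))"
    unfolding energy[OF t] by simp
   also have "(norm (happrox m z0 - happrox n z0))\<^sup>2 < (e / 2)\<^sup>2"
    using M(1)[of m n] nm e by (intro power_strict_mono) auto
   also have "(e / 2)\<^sup>2 + 2 * (e / 2 * (e / 2)) \<le> e\<^sup>2" using e by (simp add: power2_eq_square)
   finally show ?thesis using e by (simp add: dist_norm power_less_imp_less_base)
  qed
  then show "\<exists>M. \<forall>x\<in>{0..T}. \<forall>m\<ge>M. \<forall>n\<ge>M. dist (yn m x) (yn n x) < e" by blast
 qed
 then obtain z where z: "uniform_limit {0..T} yn z sequentially"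
  using Cauchy_uniformly_convergent uniformly_convergent_on_def by blast
 have cont: "continuous_on {0..T} z" proof (rule uniform_limit_theorem[OF _ z])
  show "eventually (\<lambda>n. continuous_on {0..T} (yn n)) sequentially" unfolding yn_def
   by (intro always_eventually allI continuous_intros continuous_on_subset[OF continuous_on_tint[OF \<iota>rf]]) auto
 qed simp
 have lim: "(\<lambda>n. yn n t) \<longlonglongrightarrow> z t" if "t \<in> {0..T}" for t using tendsto_uniform_limitI[OF z that] .
 have r1: "z 0 = z0" using lim[of 0] T happrox_tendsto[OF z0] LIMSEQ_unique by (auto simp: yn_def tint_empty)
 have r2: "AE t in lebesgue. t \<in> {0<..T} \<longrightarrow> z t = \<iota> (w t)" using wn_w proof eventually_elim
  case (elim t)
  show ?case proof
   assume t: "t \<in> {0<..T}"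
   have "(\<lambda>n. yn n t) \<longlonglongrightarrow> \<iota> (P (w t))" using elim t \<iota>.tendsto[OF approx_tendsto[OF Pw[of t]]] by (simp add: yn_wn)
   then show "z t = \<iota> (w t)" using lim[of t] t LIMSEQ_unique by (auto simp: Pw)
  qed
 qed
 have r3: "\<iota>\<^sub>a (z t) = \<iota>\<^sub>a z0 + tint f 0 t" if t: "t \<in> {0..T}" for t proof -
  have "P (tint f 0 t) = tint f 0 t"
   using tint_bounded_linear(1)[OF P sqint_tintegrable[OF f], of 0 t] unfolding Pf by (rule sym)
  then have PF: "P (\<iota>\<^sub>a z0 + tint f 0 t) = \<iota>\<^sub>a z0 + tint f 0 t" by (simp add: P.add P_adj)
  have "(\<lambda>n. \<iota>\<^sub>a (yn n t)) \<longlonglongrightarrow> \<iota>\<^sub>a (z t)" by (rule \<iota>a.tendsto[OF lim[OF t]])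
  moreover have "\<iota>\<^sub>a (yn n t) = approx n (\<iota>\<^sub>a z0 + tint f 0 t)" for n by (simp add: yn_wn wn_eq approx_def)
  ultimately show ?thesis using approx_tendsto[OF PF] LIMSEQ_unique by (simp add: PF)
 qed
 have r4: "(norm (z t))\<^sup>2 = (norm z0)\<^sup>2 + 2 * tint (\<lambda>r. f r \<bullet> w r) 0 t" if t: "t \<in> {0..T}" for t proof -
  have "(norm (yn n t))\<^sup>2 = (norm (happrox n z0))\<^sup>2 + 2 * tint (\<lambda>r. fn n r \<bullet> Wn n r) 0 t" for n unfolding yn_def
  proof (rule norm_square_tint[OF \<iota>rf])
   show "0 \<le> t" using t by simp
   fix r assume "r \<in> {0<..t}"
   then have r: "Wn n r = wn n r" using t by (auto simp: Wn_def)
   show "\<iota> (resolv n (f r)) \<bullet> (happrox n z0 + tint (\<lambda>r. \<iota> (resolv n (f r))) 0 r) = fn n r \<bullet> Wn n r"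
    unfolding yn_def[symmetric] yn_wn r fn_def approx_def
    using adj[of "wn n r" "\<iota> (resolv n (f r))"] by (simp add: inner_commute)
  qed
  then have "(\<lambda>n. (norm (yn n t))\<^sup>2) \<longlonglongrightarrow> (norm z0)\<^sup>2 + 2 * tint (\<lambda>r. f r \<bullet> W r) 0 t"
   by (simp only:) (intro tendsto_intros limtint happrox_tendsto[OF z0])
  moreover have "(\<lambda>n. (norm (yn n t))\<^sup>2) \<longlonglongrightarrow> (norm (z t))\<^sup>2" by (intro tendsto_intros lim[OF t])
  moreover have "tint (\<lambda>r. f r \<bullet> W r) 0 t = tint (\<lambda>r. f r \<bullet> w r) 0 t"
   by (rule tint_cong) (use t in \<open>auto simp: W_def\<close>)
  ultimately show ?thesis by (metis LIMSEQ_unique)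
 qed
 show ?thesis by (rule that[OF cont r1 r2 r3 r4])
qed

end

section \<open>Existence and uniqueness for abstract evolution equations\<close>

text \<open>Two continuous functions that differ at a point differ on an interval of positive measure.\<close>

lemma continuous_AE_eq:
 fixes y z :: "real => 'b::real_normed_vector"
 assumes y: "continuous_on {0..T} y" and z: "continuous_on {0..T} z" and T: "T > 0"
  and ae: "AE t in lebesgue. t \<in> {0<..T} \<longrightarrow> y t = z t" and t: "t \<in> {0..T}"
 shows "y t = z t"
proof (rule ccontr)
 assume ne: "y t \<noteq> z t"
 have "continuous_on {0..T} (\<lambda>t. norm (y t - z t))" by (intro continuous_intros y z)
 then have "\<exists>d>0. \<forall>s\<in>{0..T}. dist s t < d \<longrightarrow> dist (norm (y s - z s)) (norm (y t - z t)) < norm (y t - z t)"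
  using t ne unfolding continuous_on_iff by (auto dest!: bspec[of _ _ t])
 then obtain d where d: "d > 0"
  "\<And>s. s \<in> {0..T} ==> dist s t < d ==> dist (norm (y s - z s)) (norm (y t - z t)) < norm (y t - z t)" by blast
 define a where "a = max 0 (t - d)"
 define b where "b = min T (t + d)"
 have "a < b" using t d(1) T by (auto simp: a_def b_def)
 have "y s \<noteq> z s \<and> s \<in> {0<..T}" if "s \<in> {a<..<b}" for s proof -
  have "s \<in> {0..T}" "dist s t < d" using that t by (auto simp: a_def b_def dist_real_def)
  from d(2)[OF this] show ?thesis using that by (auto simp: a_def b_def)
 qed
 then have "AE s in lebesgue. s \<notin> {a<..<b}" using ae by (auto elim!: eventually_mono)
 then have "negligible {a<..<b}" by (simp add: negligible_iff_null_sets AE_iff_null_sets)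
 then show False using open_not_negligible[of "{a<..<b}"] \<open>a < b\<close> by auto
qed

lemma tintegrable_continuous:
 fixes f :: "real => 'b::{real_inner,banach,second_countable_topology}"
 assumes "continuous_on UNIV f"
 shows "tintegrable f a b"
proof -
 have "tintegrable (\<lambda>r. indicator {a<..b} r *\<^sub>R f r) a b"
  by (intro sqint_tintegrable sqint_continuous_indicator assms)
 moreover have "(\<lambda>r. indicator {a<..b} r *\<^sub>R (indicator {a<..b} r *\<^sub>R f r)) = (\<lambda>r. indicator {a<..b} r *\<^sub>R f r)"
  by (auto simp: indicator_def)
 ultimately show ?thesis by (simp only: tintegrable_def)
qed

lemma linear_tint_rep: "linear (\<lambda>\<psi>. tint (rep_l2 \<psi>) a b)"
proof (rule linearI)
 fix x y :: "(real, 'a) l2" and r :: real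
 have "tint (rep_l2 (x + y)) a b = tint (\<lambda>t. rep_l2 x t + rep_l2 y t) a b"
  by (rule tint_cong_AE) (use rep_add_l2[of x y] in \<open>auto simp: sqint_tintegrable sqint_add elim: eventually_mono\<close>)
 then show "tint (rep_l2 (x + y)) a b = tint (rep_l2 x) a b + tint (rep_l2 y) a b"
  by (simp add: tint_add sqint_tintegrable)
 have "tint (rep_l2 (r *\<^sub>R x)) a b = tint (\<lambda>t. r *\<^sub>R rep_l2 x t) a b"
  by (rule tint_cong_AE) (use rep_scaleR_l2[of r x] in \<open>auto simp: sqint_tintegrable sqint_scaleR elim: eventually_mono\<close>)
 then show "tint (rep_l2 (r *\<^sub>R x)) a b = r *\<^sub>R tint (rep_l2 x) a b" by (simp add: tint_scaleR)
qed

text \<open>The operators act on the larger space through \<open>P\<close>, and measurability in time is required along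
 measurable functions only. The constants \<open>c\<close> and \<open>lam\<close> are those of the Garding inequality.\<close>

locale evolution = hilbert_pair \<iota> P
 for \<iota> :: "'x::{real_inner,banach,second_countable_topology} => 'h::{real_inner,banach,second_countable_topology}"
  and P :: "'x => 'x" +
 fixes T :: real and A :: "real => 'x => 'x" and c lam C :: real
 assumes T: "T > 0"
  and A_lin: "\<And>t. linear (A t)" and A_bd: "\<And>t x. norm (A t x) \<le> C * norm x" and C: "C \<ge> 0"
  and A_meas: "\<And>f. f \<in> borel_measurable lebesgue ==> (\<lambda>t. A t (f t)) \<in> borel_measurable lebesgue"
  and PA: "\<And>t x. P (A t x) = A t x" and AP: "\<And>t x. A t (P x) = A t x"
  and c: "c > 0" and lam: "lam \<ge> 0"
  and garding: "\<And>t x. c * (norm (P x))\<^sup>2 \<le> A t x \<bullet> x + lam * (norm (\<iota> x))\<^sup>2"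
begin

lemma sqint_A: "sqint f ==> sqint (\<lambda>t. A t (f t))"
 by (rule sqint_map[OF A_meas A_lin A_bd C])

text \<open>With \<open>\<phi>\<close> the antiderivative of \<open>- \<psi>\<close> that vanishes at \<open>T\<close>, the weight \<open>exp (2 lam t)\<close> turns the
 time derivative term into a square at time \<open>0\<close> plus exactly the multiple of \<open>|\<iota> \<phi>|^2\<close> that the Garding
 inequality lacks.\<close>

lemma weighted_energy:
 fixes \<psi> :: "real => 'x"
 assumes \<psi>: "sqint \<psi>"
 defines "\<phi> \<equiv> \<lambda>t. tint \<psi> 0 T - tint \<psi> 0 t"
 shows "tint (\<lambda>r. exp (2 * lam * r) * (\<iota> (\<phi> r) \<bullet> \<iota> (\<psi> r))) 0 T
   = (norm (\<iota> (\<phi> 0)))\<^sup>2 / 2 + lam * tint (\<lambda>r. exp (2 * lam * r) * (norm (\<iota> (\<phi> r)))\<^sup>2) 0 T"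
  and "tintegrable (\<lambda>r. exp (2 * lam * r) * (\<iota> (\<phi> r) \<bullet> \<iota> (\<psi> r))) 0 T"
  and "tintegrable (\<lambda>r. exp (2 * lam * r) * (norm (\<iota> (\<phi> r)))\<^sup>2) 0 T"
proof -
 have \<iota>\<psi>: "sqint (\<lambda>r. - \<iota> (\<psi> r))" by (intro sqint_minus sqint_bounded_linear[OF \<iota> \<psi>])
 define y0 where "y0 = (norm (\<iota> (\<phi> 0)))\<^sup>2"
 have U: "\<iota> (\<phi> t) = \<iota> (\<phi> 0) + tint (\<lambda>r. - \<iota> (\<psi> r)) 0 t" for t
  using tint_bounded_linear(1)[OF bounded_linear_minus[OF \<iota>] sqint_tintegrable[OF \<psi>]]
  by (simp add: \<phi>_def \<iota>.diff tint_empty)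
 have "continuous_on UNIV (\<lambda>t. \<iota> (\<phi> 0) + tint (\<lambda>r. - \<iota> (\<psi> r)) 0 t)"
  by (intro continuous_intros continuous_on_tint \<iota>\<psi>)
 then have c\<phi>: "continuous_on UNIV (\<lambda>t. \<iota> (\<phi> t))" by (simp only: U[symmetric])
 define p where "p r = indicator {0<..T} r *\<^sub>R (- 2 * (\<iota> (\<phi> r) \<bullet> \<iota> (\<psi> r)))" for r
 have p: "sqint p" proof -
  have "compact ((\<lambda>t. \<iota> (\<phi> t)) ` {0..T})" by (rule compact_continuous_image) (use c\<phi> continuous_on_subset in auto)
  from compact_imp_bounded[OF this] obtain B where B: "\<forall>y\<in>(\<lambda>t. \<iota> (\<phi> t)) ` {0..T}. norm y \<le> B"
   unfolding bounded_iff by blast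
  have [measurable]: "(\<lambda>t. \<iota> (\<phi> t)) \<in> borel_measurable lebesgue" "(\<lambda>r. \<iota> (\<psi> r)) \<in> borel_measurable lebesgue"
   using c\<phi> sqint_bounded_linear[OF \<iota> \<psi>]
   by (auto intro!: measurable_completion borel_measurable_continuous_onI simp: sqint_def)
  show ?thesis proof (rule sqint_bound[OF \<iota>\<psi>, of _ "2 * B"])
   show "p \<in> borel_measurable lebesgue"
    unfolding p_def by (intro borel_measurable_scaleR borel_measurable_indicator) auto
   show "AE r in lebesgue. norm (p r) \<le> 2 * B * norm (- \<iota> (\<psi> r))" proof (rule AE_I2)
    fix r
    have "norm (\<iota> (\<phi> 0)) \<le> B" using B T by auto
    then have B0: "B \<ge> 0" by (rule order_trans[OF norm_ge_zero])
    show "norm (p r) \<le> 2 * B * norm (- \<iota> (\<psi> r))" proof (cases "r \<in> {0<..T}")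
     case True
     then have "norm (\<iota> (\<phi> r)) \<le> B" using B by auto
     then have "\<bar>\<iota> (\<phi> r) \<bullet> \<iota> (\<psi> r)\<bar> \<le> B * norm (\<iota> (\<psi> r))"
      using Cauchy_Schwarz_ineq2[of "\<iota> (\<phi> r)" "\<iota> (\<psi> r)"] mult_right_mono[of "norm (\<iota> (\<phi> r))" B "norm (\<iota> (\<psi> r))"]
      by simp
     then show ?thesis using True by (simp add: p_def abs_mult)
    qed (use B0 in \<open>simp add: p_def\<close>)
   qed
  qed
 qed
 have Y: "y0 + tint p 0 t = (norm (\<iota> (\<phi> t)))\<^sup>2" if t: "0 \<le> t" "t \<le> T" for t proof -
  have "(norm (\<iota> (\<phi> t)))\<^sup>2 = y0 + 2 * tint (\<lambda>r. - (\<iota> (\<phi> r) \<bullet> \<iota> (\<psi> r))) 0 t"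
   unfolding y0_def by (subst (1) U, rule norm_square_tint[OF \<iota>\<psi> t(1)]) (simp add: U[symmetric] inner_commute)
  also have "2 * tint (\<lambda>r. - (\<iota> (\<phi> r) \<bullet> \<iota> (\<psi> r))) 0 t = tint p 0 t"
   unfolding tint_cmult[symmetric] by (rule tint_cong) (use t in \<open>auto simp: p_def\<close>)
  finally show ?thesis by simp
 qed
 define e where "e r = indicator {0<..T} r *\<^sub>R ((2 * lam) * exp (2 * lam * r))" for r
 have e: "sqint e" and E: "\<And>t. 0 \<le> t ==> t \<le> T ==> 1 + tint e 0 t = exp (2 * lam * t)"
  unfolding e_def using exp_eq_tint[of _ T "2 * lam"] exp_eq_tint(2)[of T T "2 * lam"] T by auto
 have cexp: "continuous_on UNIV (\<lambda>r. exp (2 * lam * r))" for r :: real by (intro continuous_intros)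
 show i1: "tintegrable (\<lambda>r. exp (2 * lam * r) * (\<iota> (\<phi> r) \<bullet> \<iota> (\<psi> r))) 0 T" proof -
  have "sqint (\<lambda>r. indicator {0<..T} r *\<^sub>R (exp (2 * lam * r) *\<^sub>R \<iota> (\<phi> r)))"
   by (intro sqint_continuous_indicator continuous_intros c\<phi>)
  from sqint_inner_integrable[OF this sqint_bounded_linear[OF \<iota> \<psi>]] show ?thesis
   by (simp add: tintegrable_def mult.assoc)
 qed
 show i2: "tintegrable (\<lambda>r. exp (2 * lam * r) * (norm (\<iota> (\<phi> r)))\<^sup>2) 0 T"
  by (intro tintegrable_continuous continuous_intros c\<phi>)
 have "0 - y0 = (y0 + tint p 0 T) \<bullet> (1 + tint e 0 T) - (y0 + tint p 0 0) \<bullet> (1 + tint e 0 0)"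
  using Y[of T] T by (simp add: tint_empty \<phi>_def \<iota>.zero)
 also have "\<dots> = tint (\<lambda>r. p r \<bullet> (1 + tint e 0 r) + (y0 + tint p 0 r) \<bullet> e r) 0 T"
  by (rule tint_product_rule(1)[OF p e]) (use T in auto)
 also have "\<dots> = tint (\<lambda>r. (- 2) * (exp (2 * lam * r) * (\<iota> (\<phi> r) \<bullet> \<iota> (\<psi> r)))
   + (2 * lam) * (exp (2 * lam * r) * (norm (\<iota> (\<phi> r)))\<^sup>2)) 0 T"
  by (rule tint_cong) (auto simp: E Y p_def e_def)
 also have "\<dots> = (- 2) * tint (\<lambda>r. exp (2 * lam * r) * (\<iota> (\<phi> r) \<bullet> \<iota> (\<psi> r))) 0 T
   + (2 * lam) * tint (\<lambda>r. exp (2 * lam * r) * (norm (\<iota> (\<phi> r)))\<^sup>2) 0 T"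
  by (subst tint_add) (intro tintegrable_cmult i1 i2, intro tintegrable_cmult i1 i2, simp only: tint_cmult)
 finally show "tint (\<lambda>r. exp (2 * lam * r) * (\<iota> (\<phi> r) \<bullet> \<iota> (\<psi> r))) 0 T
   = (norm (\<iota> (\<phi> 0)))\<^sup>2 / 2 + lam * tint (\<lambda>r. exp (2 * lam * r) * (norm (\<iota> (\<phi> r)))\<^sup>2) 0 T"
  unfolding y0_def by simp
qed

text \<open>Tested with \<open>\<phi>\<close>, an antiderivative of \<open>- \<psi>\<close> that vanishes at \<open>T\<close>, the equation reads \<open>E w \<psi> = L
 \<psi>\<close>, where \<open>E w \<psi>\<close> is the integral of \<open>\<iota> w \<bullet> \<iota> \<psi> + A w \<bullet> \<phi>\<close> and no time derivative of \<open>w\<close> occurs. By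
 the weighted energy the form is coercive along \<open>w = exp (2 lam t) P \<phi>\<close>, so the projection lemma
 applies. The product rule turns the resulting identity, valid for all \<open>\<psi>\<close>, into the integrated
 equation.\<close>

lemma evolution_exists:
 fixes g :: "real => 'x"
 assumes g: "sqint g" and Pg: "\<And>t. P (g t) = g t" and z0: "z0 \<in> closure (range \<iota>)"
 obtains w z where "sqint w" "\<And>t. P (w t) = w t" "continuous_on {0..T} z" "z 0 = z0"
  "AE t in lebesgue. t \<in> {0<..T} \<longrightarrow> z t = \<iota> (w t)"
  "\<And>t. t \<in> {0..T} ==> \<iota>\<^sub>a (z t) = \<iota>\<^sub>a z0 + tint (\<lambda>r. g r - A r (w r)) 0 t"
proof -
 define ind where "ind = (indicator {0<..T} :: real => real)"
 obtain K where K: "\<And>x. norm (\<iota> x) \<le> norm x * K" "K \<ge> 0" using \<iota>.nonneg_bounded by blast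
 have ind1: "\<bar>ind t\<bar> \<le> 1" "ind t * ind t = ind t" for t by (auto simp: ind_def indicator_def)
 have ind_meas: "ind \<in> borel_measurable lebesgue" unfolding ind_def by (intro borel_measurable_indicator) auto
 define F1 where "F1 t x = ind t *\<^sub>R \<iota> x" for t x
 define F2 where "F2 t x = ind t *\<^sub>R A t x" for t x
 have F1: "\<And>f. f \<in> borel_measurable lebesgue ==> (\<lambda>t. F1 t (f t)) \<in> borel_measurable lebesgue"
  "\<And>t. linear (F1 t)" "\<And>t x. norm (F1 t x) \<le> K * norm x" "K \<ge> 0" proof -
  show "(\<lambda>t. F1 t (f t)) \<in> borel_measurable lebesgue" if "f \<in> borel_measurable lebesgue" for f unfolding F1_def
   using borel_measurable_continuous_on[OF linear_continuous_on[OF \<iota>] that] ind_meas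
   by (intro borel_measurable_scaleR) auto
  show "linear (F1 t)" for t unfolding F1_def by (rule linearI) (auto simp: \<iota>.add \<iota>.scaleR scaleR_add_right)
  show "norm (F1 t x) \<le> K * norm x" for t x
   using mult_mono[OF ind1(1)[of t] K(1)[of x]] by (simp add: F1_def mult.commute)
 qed fact
 have F2: "\<And>f. f \<in> borel_measurable lebesgue ==> (\<lambda>t. F2 t (f t)) \<in> borel_measurable lebesgue"
  "\<And>t. linear (F2 t)" "\<And>t x. norm (F2 t x) \<le> C * norm x" "C \<ge> 0" proof -
  show "(\<lambda>t. F2 t (f t)) \<in> borel_measurable lebesgue" if "f \<in> borel_measurable lebesgue" for f
   unfolding F2_def using A_meas[OF that] ind_meas by (intro borel_measurable_scaleR) auto
  show "linear (F2 t)" for t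
   unfolding F2_def using A_lin[of t] by (intro linearI) (auto simp: linear_add linear_scale scaleR_add_right)
  show "norm (F2 t x) \<le> C * norm x" for t x using mult_mono[OF ind1(1)[of t] A_bd[of t x]] by (simp add: F2_def)
 qed (rule C)
 define \<phi> where "\<phi> \<psi> t = tint (rep_l2 \<psi>) 0 T - tint (rep_l2 \<psi>) 0 t" for \<psi> :: "(real, 'x) l2" and t
 have lin\<phi>: "linear (\<lambda>\<psi>. \<phi> \<psi> t)" for t unfolding \<phi>_def by (intro linear_compose_sub linear_tint_rep)
 have c\<phi>: "continuous_on UNIV (\<phi> \<psi>)" for \<psi> unfolding \<phi>_def by (intro continuous_intros continuous_on_tint sqint_rep)
 have sq\<phi>: "sqint (\<lambda>t. ind t *\<^sub>R \<phi> \<psi> t)" for \<psi> unfolding ind_def by (rule sqint_continuous_indicator[OF c\<phi>])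
 have cP\<phi>: "continuous_on UNIV (\<lambda>t. P (\<phi> \<psi> t))" for \<psi> by (rule P.continuous_on[OF c\<phi>])
 have sqP\<phi>: "sqint (\<lambda>t. ind t *\<^sub>R P (\<phi> \<psi> t))" for \<psi> unfolding ind_def by (rule sqint_continuous_indicator[OF cP\<phi>])
 have sqe\<phi>: "sqint (\<lambda>t. ind t *\<^sub>R (exp (2 * lam * t) *\<^sub>R P (\<phi> \<psi> t)))" for \<psi>
  unfolding ind_def by (intro sqint_continuous_indicator continuous_intros cP\<phi>)
 define J where "J \<psi> = abs_l2 (\<lambda>t. ind t *\<^sub>R \<phi> \<psi> t)" for \<psi>
 define Q where "Q \<psi> = abs_l2 (\<lambda>t. ind t *\<^sub>R P (\<phi> \<psi> t))" for \<psi>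
 (* The trial function along which the form is coercive. *)
 define \<Phi> where "\<Phi> \<psi> = abs_l2 (\<lambda>t. ind t *\<^sub>R (exp (2 * lam * t) *\<^sub>R P (\<phi> \<psi> t)))" for \<psi>
 have linJ: "linear J" unfolding J_def
  by (rule linearI) (simp_all add: add_abs_l2 scaleR_abs_l2 sq\<phi> linear_add[OF lin\<phi>] linear_scale[OF lin\<phi>] scaleR_add_right mult.commute)
 (* F1 and F2 carry the indicator of the time interval, so that pointwise operators act on all of the
   line. *)
 define E where "E w \<psi> = l2_map F1 w \<bullet> l2_map F1 \<psi> + l2_map F2 w \<bullet> J \<psi>" for w \<psi>
 note bl1 = bounded_linear_l2_map[of F1 K, OF F1] and bl2 = bounded_linear_l2_map[of F2 C, OF F2]
 have E_abs: "E (abs_l2 a) \<psi> = tint (\<lambda>t. \<iota> (a t) \<bullet> \<iota> (rep_l2 \<psi> t)) 0 T + tint (\<lambda>t. A t (a t) \<bullet> \<phi> \<psi> t) 0 T"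
  if a: "sqint a" for a \<psi> proof -
  have s1: "sqint (\<lambda>t. F1 t (b t))" if "sqint b" for b by (rule sqint_map[of F1 K]) (use F1 that in auto)
  have s2: "sqint (\<lambda>t. F2 t (b t))" if "sqint b" for b by (rule sqint_map[of F2 C]) (use F2 that in auto)
  have m1: "l2_map F1 (abs_l2 b) = abs_l2 (\<lambda>t. F1 t (b t))" if "sqint b" for b
   by (rule l2_map_abs[of F1 K]) (use F1 that in auto)
  have m2: "l2_map F2 (abs_l2 b) = abs_l2 (\<lambda>t. F2 t (b t))" if "sqint b" for b
   by (rule l2_map_abs[of F2 C]) (use F2 that in auto)
  have "l2_map F1 (abs_l2 a) \<bullet> l2_map F1 (abs_l2 (rep_l2 \<psi>)) = (\<integral>t. F1 t (a t) \<bullet> F1 t (rep_l2 \<psi> t) \<partial>lebesgue)"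
   unfolding m1[OF a] m1[OF sqint_rep] by (rule inner_abs_l2[OF s1[OF a] s1[OF sqint_rep]])
  also have "\<dots> = tint (\<lambda>t. \<iota> (a t) \<bullet> \<iota> (rep_l2 \<psi> t)) 0 T"
   unfolding tint_def F1_def ind_def by (rule Bochner_Integration.integral_cong) (auto simp: indicator_def)
  finally have 1: "l2_map F1 (abs_l2 a) \<bullet> l2_map F1 \<psi> = tint (\<lambda>t. \<iota> (a t) \<bullet> \<iota> (rep_l2 \<psi> t)) 0 T" by simp
  have "l2_map F2 (abs_l2 a) \<bullet> J \<psi> = (\<integral>t. F2 t (a t) \<bullet> (ind t *\<^sub>R \<phi> \<psi> t) \<partial>lebesgue)"
   unfolding m2[OF a] J_def by (rule inner_abs_l2[OF s2[OF a] sq\<phi>])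
  also have "\<dots> = tint (\<lambda>t. A t (a t) \<bullet> \<phi> \<psi> t) 0 T"
   unfolding tint_def F2_def ind_def by (rule Bochner_Integration.integral_cong) (auto simp: indicator_def)
  finally show ?thesis using 1 by (simp add: E_def)
 qed
 define q where "q \<psi> = sqrt ((norm (Q \<psi>))\<^sup>2 + (norm (\<iota> (\<phi> \<psi> 0)))\<^sup>2)" for \<psi>
 have q1: "norm (Q \<psi>) \<le> q \<psi>" and q2: "norm (\<iota> (\<phi> \<psi> 0)) \<le> q \<psi>" for \<psi> unfolding q_def by (auto intro!: real_le_rsqrt)
 have G: "sqint (\<lambda>t. ind t *\<^sub>R g t)" unfolding ind_def by (rule sqint_indicator[OF g])
 define L where "L \<psi> = abs_l2 (\<lambda>t. ind t *\<^sub>R g t) \<bullet> J \<psi> + z0 \<bullet> \<iota> (\<phi> \<psi> 0)" for \<psi>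
 have GQ: "abs_l2 (\<lambda>t. ind t *\<^sub>R g t) \<bullet> J \<psi> = abs_l2 (\<lambda>t. ind t *\<^sub>R g t) \<bullet> Q \<psi>" for \<psi>
  unfolding J_def Q_def inner_abs_l2[OF G sq\<phi>] inner_abs_l2[OF G sqP\<phi>]
  using P_sym Pg by (intro Bochner_Integration.integral_cong) (auto, metis P_sym Pg)
 define C' where "C' = max (exp (2 * lam * T)) (norm (abs_l2 (\<lambda>t. ind t *\<^sub>R g t)) + norm z0)"
 have C'0: "C' \<ge> 0" unfolding C'_def by (rule max.coboundedI1) simp
 have "\<exists>w. \<forall>\<psi>. E w \<psi> = L \<psi>" proof (rule lions_projection[where \<Phi> = \<Phi> and q = q and C = C' and c = "min c (1/2)"])
  show "bounded_linear (\<lambda>w. E w \<psi>)" for \<psi> unfolding E_def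
   by (intro bounded_linear_add bounded_linear_inner_left_comp bl1 bl2)
  show "linear (E w)" for w
   unfolding E_def using linear_add[OF bounded_linear.linear[OF bl1]] linear_scale[OF bounded_linear.linear[OF bl1]]
    linear_add[OF linJ] linear_scale[OF linJ] by (intro linearI) (auto simp: inner_add_right distrib_left)
  show "linear L"
   unfolding L_def using linear_add[OF linJ] linear_scale[OF linJ] linear_add[OF lin\<phi>] linear_scale[OF lin\<phi>]
   by (intro linearI) (auto simp: inner_add_right distrib_left \<iota>.add \<iota>.scaleR)
  show "min c (1/2) > 0" using c by simp
  show "C' \<ge> 0" unfolding C'_def by (rule max.coboundedI1) simp
  show "q \<psi> \<ge> 0" for \<psi> by (simp add: q_def)
  show "norm (\<Phi> \<psi>) \<le> C' * q \<psi>" for \<psi> proof -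
   have "norm (\<Phi> \<psi>) \<le> exp (2 * lam * T) * norm (Q \<psi>)" unfolding \<Phi>_def Q_def proof (rule norm_l2_mono[OF sqe\<phi> sqP\<phi>])
    show "AE t in lebesgue. norm (ind t *\<^sub>R exp (2 * lam * t) *\<^sub>R P (\<phi> \<psi> t)) \<le> exp (2 * lam * T) * norm (ind t *\<^sub>R P (\<phi> \<psi> t))"
     using lam by (intro AE_I2) (auto simp: ind_def indicator_def intro!: mult_right_mono mult_left_mono)
   qed simp
   also have "\<dots> \<le> C' * q \<psi>" by (intro mult_mono q1 C'0) (auto simp: C'_def)
   finally show ?thesis .
  qed
  show "\<bar>L \<psi>\<bar> \<le> C' * q \<psi>" for \<psi> proof -
   let ?G = "abs_l2 (\<lambda>t. ind t *\<^sub>R g t)"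
   have "\<bar>L \<psi>\<bar> \<le> \<bar>?G \<bullet> Q \<psi>\<bar> + \<bar>z0 \<bullet> \<iota> (\<phi> \<psi> 0)\<bar>" unfolding L_def GQ by simp
   also have "\<dots> \<le> norm ?G * norm (Q \<psi>) + norm z0 * norm (\<iota> (\<phi> \<psi> 0))" by (intro add_mono Cauchy_Schwarz_ineq2)
   also have "\<dots> \<le> norm ?G * q \<psi> + norm z0 * q \<psi>" by (intro add_mono mult_left_mono q1 q2) auto
   also have "\<dots> = (norm ?G + norm z0) * q \<psi>" by (simp add: distrib_right)
   also have "\<dots> \<le> C' * q \<psi>" by (intro mult_right_mono) (auto simp: C'_def q_def)
   finally show ?thesis .
  qed
  show "min c (1/2) * (q \<psi>)\<^sup>2 \<le> E (\<Phi> \<psi>) \<psi>" for \<psi> proof -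
   note we = weighted_energy[OF sqint_rep[of \<psi>], folded \<phi>_def]
   let ?e = "\<lambda>t. exp (2 * lam * t)"
   have 1: "E (\<Phi> \<psi>) \<psi> = tint (\<lambda>t. ?e t * (\<iota> (\<phi> \<psi> t) \<bullet> \<iota> (rep_l2 \<psi> t))) 0 T + tint (\<lambda>t. ?e t * (A t (\<phi> \<psi> t) \<bullet> \<phi> \<psi> t)) 0 T"
    unfolding \<Phi>_def E_abs[OF sqe\<phi>] by (intro arg_cong2[of _ _ _ _ "(+)"] tint_cong)
      (auto simp: ind_def \<iota>.scaleR \<iota>_P AP linear_scale[OF A_lin])
   have sA: "sqint (\<lambda>t. A t (ind t *\<^sub>R \<phi> \<psi> t))" by (rule sqint_A[OF sq\<phi>])
   have sE: "sqint (\<lambda>t. ind t *\<^sub>R (?e t *\<^sub>R \<phi> \<psi> t))"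
    unfolding ind_def by (intro sqint_continuous_indicator continuous_intros c\<phi>)
   have iA: "tintegrable (\<lambda>t. ?e t * (A t (\<phi> \<psi> t) \<bullet> \<phi> \<psi> t)) 0 T" proof -
    have eq: "(\<lambda>t. A t (ind t *\<^sub>R \<phi> \<psi> t) \<bullet> (ind t *\<^sub>R (?e t *\<^sub>R \<phi> \<psi> t))) = (\<lambda>t. ind t *\<^sub>R (?e t * (A t (\<phi> \<psi> t) \<bullet> \<phi> \<psi> t)))"
     by (auto simp: fun_eq_iff linear_scale[OF A_lin] ind_def indicator_def linear_0[OF A_lin])
    show ?thesis using sqint_inner_integrable[OF sA sE] unfolding eq by (simp add: tintegrable_def ind_def)
   qed
   have iP: "tintegrable (\<lambda>t. c * (norm (P (\<phi> \<psi> t)))\<^sup>2) 0 T"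
    by (intro tintegrable_continuous continuous_intros cP\<phi>)
   have Eeq: "E (\<Phi> \<psi>) \<psi> = (norm (\<iota> (\<phi> \<psi> 0)))\<^sup>2 / 2
     + tint (\<lambda>t. lam * (?e t * (norm (\<iota> (\<phi> \<psi> t)))\<^sup>2) + ?e t * (A t (\<phi> \<psi> t) \<bullet> \<phi> \<psi> t)) 0 T"
    unfolding 1 we(1) by (subst tint_add[OF tintegrable_cmult[OF we(3)] iA]) (simp add: tint_cmult)
   have Ege: "tint (\<lambda>t. lam * (?e t * (norm (\<iota> (\<phi> \<psi> t)))\<^sup>2) + ?e t * (A t (\<phi> \<psi> t) \<bullet> \<phi> \<psi> t)) 0 T
     \<ge> tint (\<lambda>t. c * (norm (P (\<phi> \<psi> t)))\<^sup>2) 0 T"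
   proof (rule tint_mono[OF iP])
    show "tintegrable (\<lambda>t. lam * (?e t * (norm (\<iota> (\<phi> \<psi> t)))\<^sup>2) + ?e t * (A t (\<phi> \<psi> t) \<bullet> \<phi> \<psi> t)) 0 T"
     using tintegrable_cmult[OF we(3), of lam] iA by (simp add: tintegrable_def distrib_left)
    show "AE t in lebesgue. t \<in> {0<..T} \<longrightarrow> c * (norm (P (\<phi> \<psi> t)))\<^sup>2
      \<le> lam * (?e t * (norm (\<iota> (\<phi> \<psi> t)))\<^sup>2) + ?e t * (A t (\<phi> \<psi> t) \<bullet> \<phi> \<psi> t)"
    proof (intro AE_I2 impI)
     fix t :: real assume t: "t \<in> {0<..T}"
     have "1 * (c * (norm (P (\<phi> \<psi> t)))\<^sup>2) \<le> ?e t * (c * (norm (P (\<phi> \<psi> t)))\<^sup>2)"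
      using t lam c by (intro mult_right_mono) auto
     also have "\<dots> \<le> ?e t * (A t (\<phi> \<psi> t) \<bullet> \<phi> \<psi> t + lam * (norm (\<iota> (\<phi> \<psi> t)))\<^sup>2)"
      by (intro mult_left_mono garding) auto
     finally show "c * (norm (P (\<phi> \<psi> t)))\<^sup>2
      \<le> lam * (?e t * (norm (\<iota> (\<phi> \<psi> t)))\<^sup>2) + ?e t * (A t (\<phi> \<psi> t) \<bullet> \<phi> \<psi> t)"
      by (simp add: algebra_simps)
    qed
   qed
   have "E (\<Phi> \<psi>) \<psi> \<ge> (norm (\<iota> (\<phi> \<psi> 0)))\<^sup>2 / 2 + tint (\<lambda>t. c * (norm (P (\<phi> \<psi> t)))\<^sup>2) 0 T" using Eeq Ege by linarith
   moreover have "tint (\<lambda>t. c * (norm (P (\<phi> \<psi> t)))\<^sup>2) 0 T = c * (norm (Q \<psi>))\<^sup>2"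
    unfolding Q_def norm_abs_l2[OF sqP\<phi>] tint_cmult unfolding tint_def ind_def
    by (intro arg_cong[of _ _ "(*) c"] Bochner_Integration.integral_cong) (auto simp: indicator_def)
   moreover have "min c (1/2) * (q \<psi>)\<^sup>2 \<le> (norm (\<iota> (\<phi> \<psi> 0)))\<^sup>2 / 2 + c * (norm (Q \<psi>))\<^sup>2" proof -
    have "min c (1/2) * (q \<psi>)\<^sup>2 = min c (1/2) * (norm (Q \<psi>))\<^sup>2 + min c (1/2) * (norm (\<iota> (\<phi> \<psi> 0)))\<^sup>2"
     by (simp add: q_def distrib_left)
    also have "\<dots> \<le> c * (norm (Q \<psi>))\<^sup>2 + 1/2 * (norm (\<iota> (\<phi> \<psi> 0)))\<^sup>2" by (intro add_mono mult_right_mono) auto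
    finally show ?thesis by simp
   qed
   ultimately show ?thesis by linarith
  qed
 qed
 then obtain w0 where w0: "\<And>\<psi>. E w0 \<psi> = L \<psi>" by blast
 (* E sees w0 only through P; projecting selects the representative with values in V. *)
 define w where "w t = P (rep_l2 w0 t)" for t
 have w: "sqint w" unfolding w_def by (rule sqint_bounded_linear[OF P sqint_rep])
 have Pw: "P (w t) = w t" for t by (simp add: w_def P_idem)
 define f where "f t = g t - A t (w t)" for t
 have f: "sqint f" unfolding f_def by (intro sqint_diff g sqint_A w)
 have Pf: "P (f t) = f t" for t by (simp add: f_def P.diff PA Pg)
 define F where "F t = \<iota>\<^sub>a z0 + tint f 0 t" for t
 have cF: "continuous_on UNIV F" unfolding F_def by (intro continuous_intros continuous_on_tint f)
 define d where "d t = ind t *\<^sub>R (\<iota>\<^sub>a (\<iota> (w t)) - F t)" for t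
 have sqK: "sqint (\<lambda>t. \<iota>\<^sub>a (\<iota> (w t)))" by (intro sqint_bounded_linear[OF bl_adj] sqint_bounded_linear[OF \<iota>] w)
 have sqF: "sqint (\<lambda>t. ind t *\<^sub>R F t)" unfolding ind_def by (rule sqint_continuous_indicator[OF cF])
 have sqd: "sqint d"
  using sqint_diff[OF sqint_indicator[OF sqK, of 0 T] sqF] by (simp add: d_def[abs_def] ind_def scaleR_diff_right)
 have "abs_l2 d \<bullet> \<psi> = 0" for \<psi> proof -
  let ?\<psi> = "rep_l2 \<psi>"
  define \<Psi> where "\<Psi> t = tint ?\<psi> 0 t" for t
  have \<phi>\<Psi>: "\<phi> \<psi> t = \<Psi> T - \<Psi> t" for t by (simp add: \<phi>_def \<Psi>_def)
  have c\<Psi>: "continuous_on UNIV \<Psi>" unfolding \<Psi>_def by (intro continuous_on_tint sqint_rep)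
  have sq\<Psi>: "sqint (\<lambda>t. ind t *\<^sub>R \<Psi> t)" unfolding ind_def by (rule sqint_continuous_indicator[OF c\<Psi>])
  have if\<Psi>: "tintegrable (\<lambda>t. f t \<bullet> \<Psi> t) 0 T"
   using sqint_inner_integrable[OF f sq\<Psi>] by (simp add: tintegrable_def ind_def)
  have iF\<psi>: "tintegrable (\<lambda>t. F t \<bullet> ?\<psi> t) 0 T"
   using sqint_inner_integrable[OF sqF sqint_rep[of \<psi>]] by (simp add: tintegrable_def ind_def)
  have if\<Psi>T: "tintegrable (\<lambda>t. f t \<bullet> \<Psi> T) 0 T"
   using tint_bounded_linear(2)[OF bounded_linear_inner_left sqint_tintegrable[OF f]] .
  have ig: "tintegrable (\<lambda>t. g t \<bullet> \<phi> \<psi> t) 0 T"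
   using sqint_inner_integrable[OF g sq\<phi>[of \<psi>]] by (simp add: tintegrable_def ind_def)
  have iA: "tintegrable (\<lambda>t. A t (w t) \<bullet> \<phi> \<psi> t) 0 T"
   using sqint_inner_integrable[OF sqint_A[OF w] sq\<phi>[of \<psi>]] by (simp add: tintegrable_def ind_def)
  have "E w0 \<psi> = tint (\<lambda>t. \<iota> (w t) \<bullet> \<iota> (?\<psi> t)) 0 T + tint (\<lambda>t. A t (w t) \<bullet> \<phi> \<psi> t) 0 T"
   using E_abs[OF sqint_rep[of w0], of \<psi>] by (simp add: w_def \<iota>_P AP)
  moreover have "L \<psi> = tint (\<lambda>t. g t \<bullet> \<phi> \<psi> t) 0 T + z0 \<bullet> \<iota> (\<Psi> T)" proof -
   have "abs_l2 (\<lambda>t. ind t *\<^sub>R g t) \<bullet> J \<psi> = tint (\<lambda>t. g t \<bullet> \<phi> \<psi> t) 0 T"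
    unfolding J_def inner_abs_l2[OF G sq\<phi>] unfolding tint_def ind_def
    by (rule Bochner_Integration.integral_cong) (auto simp: indicator_def)
   then show ?thesis by (simp add: L_def \<phi>\<Psi> \<Psi>_def tint_empty)
  qed
  ultimately have "tint (\<lambda>t. \<iota> (w t) \<bullet> \<iota> (?\<psi> t)) 0 T
    = tint (\<lambda>t. g t \<bullet> \<phi> \<psi> t) 0 T - tint (\<lambda>t. A t (w t) \<bullet> \<phi> \<psi> t) 0 T + z0 \<bullet> \<iota> (\<Psi> T)"
   using w0[of \<psi>] by simp
  also have "tint (\<lambda>t. g t \<bullet> \<phi> \<psi> t) 0 T - tint (\<lambda>t. A t (w t) \<bullet> \<phi> \<psi> t) 0 T = tint (\<lambda>t. f t \<bullet> \<Psi> T - f t \<bullet> \<Psi> t) 0 T"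
   unfolding tint_diff[OF ig iA, symmetric]
   by (rule tint_cong) (simp add: f_def \<phi>\<Psi> inner_diff_left inner_diff_right)
  also have "\<dots> = tint f 0 T \<bullet> \<Psi> T - tint (\<lambda>t. f t \<bullet> \<Psi> t) 0 T"
   unfolding tint_diff[OF if\<Psi>T if\<Psi>] using tint_bounded_linear(1)[OF bounded_linear_inner_left sqint_tintegrable[OF f]] by simp
  also have "z0 \<bullet> \<iota> (\<Psi> T) = \<iota>\<^sub>a z0 \<bullet> \<Psi> T" using adj[of "\<Psi> T" z0] by (simp add: inner_commute)
  finally have "tint (\<lambda>t. \<iota> (w t) \<bullet> \<iota> (?\<psi> t)) 0 T = F T \<bullet> \<Psi> T - tint (\<lambda>t. f t \<bullet> \<Psi> t) 0 T"
   by (simp add: F_def inner_add_left)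
  moreover have "F T \<bullet> \<Psi> T = tint (\<lambda>t. f t \<bullet> \<Psi> t + F t \<bullet> ?\<psi> t) 0 T"
   using tint_product_rule(1)[OF f sqint_rep[of \<psi>], of 0 T 0 "\<iota>\<^sub>a z0" 0] T by (simp add: F_def \<Psi>_def tint_empty)
  moreover have "\<dots> = tint (\<lambda>t. f t \<bullet> \<Psi> t) 0 T + tint (\<lambda>t. F t \<bullet> ?\<psi> t) 0 T" by (rule tint_add[OF if\<Psi> iF\<psi>])
  ultimately have e: "tint (\<lambda>t. \<iota> (w t) \<bullet> \<iota> (?\<psi> t)) 0 T = tint (\<lambda>t. F t \<bullet> ?\<psi> t) 0 T" by simp
  have iK: "tintegrable (\<lambda>t. \<iota>\<^sub>a (\<iota> (w t)) \<bullet> ?\<psi> t) 0 T" by (rule tintegrable_inner[OF sqK sqint_rep])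
  have "abs_l2 d \<bullet> abs_l2 ?\<psi> = tint (\<lambda>t. \<iota>\<^sub>a (\<iota> (w t)) \<bullet> ?\<psi> t - F t \<bullet> ?\<psi> t) 0 T"
   unfolding inner_abs_l2[OF sqd sqint_rep] unfolding tint_def d_def ind_def
   by (rule Bochner_Integration.integral_cong) (auto simp: inner_diff_left)
  also have "\<dots> = tint (\<lambda>t. \<iota>\<^sub>a (\<iota> (w t)) \<bullet> ?\<psi> t) 0 T - tint (\<lambda>t. F t \<bullet> ?\<psi> t) 0 T" by (rule tint_diff[OF iK iF\<psi>])
  also have "(\<lambda>t. \<iota>\<^sub>a (\<iota> (w t)) \<bullet> ?\<psi> t) = (\<lambda>t. \<iota> (w t) \<bullet> \<iota> (?\<psi> t))" using adj by (simp add: inner_commute)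
  finally show ?thesis using e by simp
 qed
 from this[of "abs_l2 d"] have "abs_l2 d = abs_l2 (\<lambda>t. 0)" by (simp add: zero_abs_l2)
 then have "AE t in lebesgue. d t = 0" by (simp add: abs_l2_eq_iff sqd)
 then have "AE t in lebesgue. t \<in> {0<..T} \<longrightarrow> \<iota>\<^sub>a (\<iota> (w t)) = \<iota>\<^sub>a z0 + tint f 0 t"
  by eventually_elim (auto simp: d_def ind_def F_def)
 then obtain z where z: "continuous_on {0..T} z" "z 0 = z0"
  "AE t in lebesgue. t \<in> {0<..T} \<longrightarrow> z t = \<iota> (w t)"
  "\<And>t. t \<in> {0..T} ==> \<iota>\<^sub>a (z t) = \<iota>\<^sub>a z0 + tint f 0 t"
  "\<And>t. t \<in> {0..T} ==> (norm (z t))\<^sup>2 = (norm z0)\<^sup>2 + 2 * tint (\<lambda>r. f r \<bullet> w r) 0 t"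
  by (rule energy_identity[OF w f Pw Pf z0 T]) (rule that)
 show ?thesis by (rule that[OF w Pw z(1-3)]) (use z(4) in \<open>simp add: f_def[abs_def]\<close>)
qed

text \<open>The energy identity and the Garding inequality bound the squared norm of \<open>z\<close> by a multiple of its
 own time integral.\<close>

lemma evolution_unique:
 fixes w :: "real => 'x" and z :: "real => 'h"
 assumes w: "sqint w" and Pw: "\<And>t. P (w t) = w t" and z: "continuous_on {0..T} z"
  and zw: "AE t in lebesgue. t \<in> {0<..T} \<longrightarrow> z t = \<iota> (w t)"
  and eq: "\<And>t. t \<in> {0..T} ==> \<iota>\<^sub>a (z t) = tint (\<lambda>r. - A r (w r)) 0 t"
  and t: "t \<in> {0..T}"
 shows "z t = 0"
proof -
 define f where "f t = - A t (w t)" for t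
 have f: "sqint f" unfolding f_def by (intro sqint_minus sqint_A w)
 have Pf: "P (f t) = f t" for t by (simp add: f_def P.neg PA)
 have "range \<iota> \<subseteq> closure (range \<iota>)" by (rule closure_subset)
 then have z0: "0 \<in> closure (range \<iota>)" using \<iota>.zero by (metis rangeI subsetD)
 have "AE t in lebesgue. t \<in> {0<..T} \<longrightarrow> \<iota>\<^sub>a (\<iota> (w t)) = \<iota>\<^sub>a 0 + tint f 0 t" using zw proof eventually_elim
  case (elim t)
  show ?case proof
   assume t: "t \<in> {0<..T}"
   then have "\<iota>\<^sub>a (z t) = tint f 0 t" using eq[of t] by (simp add: f_def[abs_def])
   then show "\<iota>\<^sub>a (\<iota> (w t)) = \<iota>\<^sub>a 0 + tint f 0 t" using elim t by (simp add: \<iota>a.zero)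
  qed
 qed
 then obtain z' where z': "continuous_on {0..T} z'" "z' 0 = 0"
  "AE t in lebesgue. t \<in> {0<..T} \<longrightarrow> z' t = \<iota> (w t)"
  "\<And>t. t \<in> {0..T} ==> \<iota>\<^sub>a (z' t) = \<iota>\<^sub>a 0 + tint f 0 t"
  "\<And>t. t \<in> {0..T} ==> (norm (z' t))\<^sup>2 = (norm (0::'h))\<^sup>2 + 2 * tint (\<lambda>r. f r \<bullet> w r) 0 t"
  by (rule energy_identity[OF w f Pw Pf z0 T]) (rule that)
 have "AE t in lebesgue. t \<in> {0<..T} \<longrightarrow> z' t = z t" using zw z'(3) by eventually_elim auto
 then have zz': "z' t = z t" if "t \<in> {0..T}" for t using continuous_AE_eq[OF z'(1) z T] that by blast
 have "(norm (z t))\<^sup>2 = 0" proof (rule gronwall_zero[where T = T and k = "2 * lam" and y = "\<lambda>t. (norm (z t))\<^sup>2"])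
  show "continuous_on {0..T} (\<lambda>t. (norm (z t))\<^sup>2)" by (intro continuous_intros z)
  show "(norm (z s))\<^sup>2 \<le> 2 * lam * tint (\<lambda>t. (norm (z t))\<^sup>2) 0 s" if s: "s \<in> {0..T}" for s proof -
   have \<iota>w: "sqint (\<lambda>r. \<iota> (w r))" by (rule sqint_bounded_linear[OF \<iota> w])
   have "tint (\<lambda>r. f r \<bullet> w r) 0 s \<le> tint (\<lambda>r. lam * (norm (\<iota> (w r)))\<^sup>2) 0 s" proof (rule tint_mono)
    show "AE r in lebesgue. r \<in> {0<..s} \<longrightarrow> f r \<bullet> w r \<le> lam * (norm (\<iota> (w r)))\<^sup>2" proof (intro AE_I2 impI)
     fix r
     have "0 \<le> c * (norm (P (w r)))\<^sup>2" using c by simp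
     also have "\<dots> \<le> A r (w r) \<bullet> w r + lam * (norm (\<iota> (w r)))\<^sup>2" by (rule garding)
     finally show "f r \<bullet> w r \<le> lam * (norm (\<iota> (w r)))\<^sup>2" by (simp add: f_def)
    qed
   qed (intro tintegrable_inner f w tintegrable_cmult tintegrable_norm2 \<iota>w)+
   also have "\<dots> = lam * tint (\<lambda>r. (norm (\<iota> (w r)))\<^sup>2) 0 s" by (rule tint_cmult)
   also have "tint (\<lambda>r. (norm (\<iota> (w r)))\<^sup>2) 0 s = tint (\<lambda>r. (norm (z r))\<^sup>2) 0 s" proof -
    have *: "AE r in lebesgue. indicator {0<..s} r *\<^sub>R (norm (\<iota> (w r)))\<^sup>2 = indicator {0<..s} r *\<^sub>R (norm (z r))\<^sup>2"
     using zw by eventually_elim (use s in \<open>auto simp: indicator_def\<close>)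
    have m: "(\<lambda>r. indicator {0<..s} r *\<^sub>R (norm (\<iota> (w r)))\<^sup>2) \<in> borel_measurable lebesgue"
     using tintegrable_norm2[OF \<iota>w, of 0 s] by (auto simp: tintegrable_def)
    show ?thesis unfolding tint_def by (rule integral_cong_AE[OF m borel_measurable_AE[OF m *] *])
   qed
   finally show ?thesis using z'(5)[OF s] zz'[OF s] by simp
  qed
 qed (use t lam in auto)
 then show ?thesis by simp
qed

end

section \<open>Smooth functions with compact support\<close>

text \<open>For \<open>p = 1\<close> this is the classical smooth function that is flat at the origin. The polynomial makes
 the family closed under differentiation (\<open>DERIV_flat\<close>).\<close>

definition flat :: "real poly => real => real" where
 "flat p x = (if x > 0 then poly p (1 / x) * exp (- 1 / x) else 0)"

lemma poly_exp_tendsto_0: "((\<lambda>y::real. poly p y * exp (- y)) \<longlongrightarrow> 0) at_top"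
proof -
 have "((\<lambda>y::real. \<Sum>i\<le>degree p. coeff p i * (y ^ i / exp y)) \<longlongrightarrow> (\<Sum>i\<le>degree p. coeff p i * 0)) at_top"
  by (intro tendsto_sum tendsto_mult_left tendsto_power_div_exp_0)
 also have "(\<lambda>y. \<Sum>i\<le>degree p. coeff p i * (y ^ i / exp y)) = (\<lambda>y. poly p y * exp (- y))"
  by (simp add: fun_eq_iff poly_altdef exp_minus divide_inverse sum_distrib_right mult.assoc)
 finally show ?thesis by simp
qed

lemma DERIV_flat: "DERIV (flat p) x :> flat ([:0, 0, 1:] * (p - pderiv p)) x"
proof -
 let ?q = "[:0, 0, 1:] * (p - pderiv p)"
 consider "x > 0" | "x < 0" | "x = 0" by linarith
 then show ?thesis proof cases
  case 1
  have "DERIV (\<lambda>x. poly p (1 / x) * exp (- 1 / x)) x :> flat ?q x" using 1 unfolding flat_def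
   by (auto intro!: derivative_eq_intros simp: field_simps power2_eq_square)
  then show ?thesis
   by (rule has_field_derivative_transform_within_open[of _ _ _ "{0<..}"]) (use 1 in \<open>auto simp: flat_def\<close>)
 next
  case 2
  have "DERIV (\<lambda>x. 0) x :> flat ?q x" using 2 by (simp add: flat_def)
  then show ?thesis
   by (rule has_field_derivative_transform_within_open[of _ _ _ "{..<0}"]) (use 2 in \<open>auto simp: flat_def\<close>)
 next
  case 3
  have "((\<lambda>h. flat p h / h) \<longlongrightarrow> 0) (at_right 0)" proof -
   have "((\<lambda>y. poly ([:0, 1:] * p) y * exp (- y)) \<longlongrightarrow> 0) at_top" by (rule poly_exp_tendsto_0)
   then have "((\<lambda>h. poly ([:0, 1:] * p) (inverse h) * exp (- inverse h)) \<longlongrightarrow> 0) (at_right 0)"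
    by (rule filterlim_compose[OF _ filterlim_inverse_at_top_right])
   moreover have "eventually (\<lambda>h. poly ([:0, 1:] * p) (inverse h) * exp (- inverse h) = flat p h / h) (at_right 0)"
    using eventually_at_right_less[of "0::real"]
    by eventually_elim (simp add: flat_def field_simps inverse_eq_divide)
   ultimately show ?thesis by (rule Lim_transform_eventually)
  qed
  moreover have "((\<lambda>h. flat p h / h) \<longlongrightarrow> 0) (at_left 0)"
   by (rule tendsto_eventually) (auto simp: flat_def eventually_at_left_field intro: exI[of _ "-1"])
  ultimately have "((\<lambda>h. flat p h / h) \<longlongrightarrow> 0) (at 0)" by (intro filterlim_split_at)
  then show ?thesis using 3 by (simp add: DERIV_def flat_def)
 qed
qed

text \<open>A class of functions that contains its own directional derivatives; smoothness of all its members
 follows by induction on the order of differentiation.\<close>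

inductive_set bumps :: "('a::real_inner => 'b::real_normed_vector) set" where
 const: "(\<lambda>x. e) \<in> bumps"
| mult: "f \<in> bumps ==> (\<lambda>x. flat p (l \<bullet> x + c) *\<^sub>R f x) \<in> bumps"
| add: "f \<in> bumps ==> g \<in> bumps ==> (\<lambda>x. f x + g x) \<in> bumps"
| scale: "f \<in> bumps ==> (\<lambda>x. r *\<^sub>R f x) \<in> bumps"

lemma bumps_derivative:
 "f \<in> bumps ==> \<exists>D. (\<forall>x. (f has_derivative D x) (at x)) \<and> (\<forall>v. (\<lambda>x. D x v) \<in> bumps)"
proof (induction rule: bumps.induct)
 case (const e)
 show ?case by (rule exI[of _ "\<lambda>x v. 0"]) (auto intro: bumps.const)
next
 case (mult f p l c)
 then obtain D where D: "\<And>x. (f has_derivative D x) (at x)" "\<And>v. (\<lambda>x. D x v) \<in> bumps" by blast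
 let ?q = "[:0, 0, 1:] * (p - pderiv p)"
 have der: "((\<lambda>x. flat p (l \<bullet> x + c)) has_derivative (\<lambda>v. (l \<bullet> v) * flat ?q (l \<bullet> x + c))) (at x)" for x proof -
  have "((\<lambda>x. l \<bullet> x + c) has_derivative (\<lambda>v. l \<bullet> v)) (at x)" by (auto intro!: derivative_eq_intros)
  moreover have "(flat p has_derivative (\<lambda>v. flat ?q (l \<bullet> x + c) * v)) (at (l \<bullet> x + c))"
   using DERIV_flat[of p "l \<bullet> x + c"] unfolding has_field_derivative_def .
  ultimately show ?thesis
   by (rule has_derivative_eq_rhs[OF has_derivative_compose]) (simp add: fun_eq_iff mult.commute)
 qed
 have "((\<lambda>x. flat p (l \<bullet> x + c) *\<^sub>R f x) has_derivative
   (\<lambda>v. (l \<bullet> v) *\<^sub>R (flat ?q (l \<bullet> x + c) *\<^sub>R f x) + flat p (l \<bullet> x + c) *\<^sub>R D x v)) (at x)" for x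
  by (rule has_derivative_eq_rhs[OF has_derivative_scaleR[OF der D(1)]]) (simp add: fun_eq_iff)
 moreover have "(\<lambda>x. (l \<bullet> v) *\<^sub>R (flat ?q (l \<bullet> x + c) *\<^sub>R f x) + flat p (l \<bullet> x + c) *\<^sub>R D x v) \<in> bumps" for v
  by (intro bumps.add bumps.scale bumps.mult D mult)
 ultimately show ?case
  by (intro exI[of _ "\<lambda>x v. (l \<bullet> v) *\<^sub>R (flat ?q (l \<bullet> x + c) *\<^sub>R f x) + flat p (l \<bullet> x + c) *\<^sub>R D x v"]) blast
next
 case (add f g)
 then obtain D E where "\<And>x. (f has_derivative D x) (at x)" "\<And>v. (\<lambda>x. D x v) \<in> bumps"
  "\<And>x. (g has_derivative E x) (at x)" "\<And>v. (\<lambda>x. E x v) \<in> bumps" by blast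
 then show ?case by (intro exI[of _ "\<lambda>x v. D x v + E x v"]) (auto intro!: derivative_eq_intros bumps.add)
next
 case (scale f r)
 then obtain D where "\<And>x. (f has_derivative D x) (at x)" "\<And>v. (\<lambda>x. D x v) \<in> bumps" by blast
 then show ?case by (intro exI[of _ "\<lambda>x v. r *\<^sub>R D x v"]) (auto intro!: derivative_eq_intros bumps.scale)
qed

lemma bumps_Ck: "f \<in> bumps ==> Ck_on k UNIV f"
proof (induction k arbitrary: f)
 case 0
 then obtain D where "\<And>x. (f has_derivative D x) (at x)" using bumps_derivative by blast
 then show ?case by (auto intro: has_derivative_continuous_on has_derivative_at_withinI)
next
 case (Suc k)
 obtain D where D: "\<And>x. (f has_derivative D x) (at x)" "\<And>v. (\<lambda>x. D x v) \<in> bumps"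
  using bumps_derivative[OF Suc.prems] by blast
 have "frechet_derivative f (at x) = D x" for x using frechet_derivative_at[OF D(1)] by simp
 then show ?case using D Suc.IH by (auto simp: differentiable_def)
qed

text \<open>Smooth functions supported in the closed box that increase to the indicator of the open box as \<open>n\<close>
 grows.\<close>

definition box_bump :: "'a::euclidean_space => 'a => nat => 'a => real" where
 "box_bump a b n x = (\<Prod>i\<in>Basis. flat 1 (real (Suc n) * (x \<bullet> i - a \<bullet> i)) * flat 1 (real (Suc n) * (b \<bullet> i - x \<bullet> i)))"

lemma flat_1: "0 \<le> flat 1 x" "flat 1 x \<le> 1" "x \<le> 0 ==> flat 1 x = 0"
 by (auto simp: flat_def)

lemma flat_1_tendsto: "(\<lambda>n. flat 1 (real (Suc n) * x)) \<longlonglongrightarrow> (if x > 0 then 1 else 0)"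
proof (cases "x > 0")
 case True
 have "(\<lambda>n. exp (- (1 / real (Suc n) * (1 / x)))) \<longlonglongrightarrow> exp (- (0 * (1 / x)))"
  by (intro tendsto_intros LIMSEQ_Suc[OF lim_const_over_n])
 then show ?thesis using True by (simp add: flat_def)
next
 case False
 then have "flat 1 (real (Suc n) * x) = 0" for n by (intro flat_1(3)) (simp add: mult_le_0_iff)
 then show ?thesis using False by simp
qed

lemma box_bump_range: "0 \<le> box_bump a b n x" "box_bump a b n x \<le> 1"
 unfolding box_bump_def using flat_1 by (auto intro!: prod_nonneg prod_le_1 mult_le_one)

lemma box_bump_support: "box_bump a b n x \<noteq> 0 ==> x \<in> box a b"
proof -
 assume *: "box_bump a b n x \<noteq> 0"
 have "a \<bullet> i < x \<bullet> i \<and> x \<bullet> i < b \<bullet> i" if "i \<in> Basis" for i proof -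
  have "flat 1 (real (Suc n) * (x \<bullet> i - a \<bullet> i)) \<noteq> 0" "flat 1 (real (Suc n) * (b \<bullet> i - x \<bullet> i)) \<noteq> 0"
   using * that by (auto simp: box_bump_def)
  then have "real (Suc n) * (x \<bullet> i - a \<bullet> i) > 0" "real (Suc n) * (b \<bullet> i - x \<bullet> i) > 0"
   using flat_1(3) not_le by blast+
  then show ?thesis by (simp add: zero_less_mult_iff)
 qed
 then show ?thesis by (simp add: mem_box)
qed

lemma box_bump_tendsto: "(\<lambda>n. box_bump a b n x) \<longlonglongrightarrow> indicator (box a b) x"
proof -
 have "(\<lambda>n. box_bump a b n x) \<longlonglongrightarrow> (\<Prod>i\<in>Basis. (if x \<bullet> i - a \<bullet> i > 0 then 1 else 0) * (if b \<bullet> i - x \<bullet> i > 0 then 1 else 0))"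
  unfolding box_bump_def by (intro tendsto_intros flat_1_tendsto)
 also have "(\<Prod>i\<in>Basis. (if x \<bullet> i - a \<bullet> i > 0 then 1 else 0) * (if b \<bullet> i - x \<bullet> i > 0 then 1 else (0::real))) = indicator (box a b) x"
 proof (cases "x \<in> box a b")
  case True then show ?thesis by (auto simp: mem_box intro!: prod.neutral)
 next
  case False
  then obtain i where "i \<in> Basis" "\<not> (a \<bullet> i < x \<bullet> i \<and> x \<bullet> i < b \<bullet> i)" by (auto simp: mem_box)
  then show ?thesis using False by (auto intro!: prod_zero bexI[of _ i])
 qed
 finally show ?thesis .
qed

lemma box_bump_bumps: "(\<lambda>x. box_bump a b n x *\<^sub>R e) \<in> bumps"
proof -
 have "(\<lambda>x. (\<Prod>i\<in>I. flat 1 (real (Suc n) * (x \<bullet> i - a \<bullet> i)) * flat 1 (real (Suc n) * (b \<bullet> i - x \<bullet> i))) *\<^sub>R e) \<in> bumps"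
  if "finite I" for I using that proof (induction I)
  case empty show ?case using bumps.const by simp
 next
  case (insert i I)
  let ?g = "\<lambda>x. (\<Prod>i\<in>I. flat 1 (real (Suc n) * (x \<bullet> i - a \<bullet> i)) * flat 1 (real (Suc n) * (b \<bullet> i - x \<bullet> i))) *\<^sub>R e"
  have "(\<lambda>x. flat 1 ((real (Suc n) *\<^sub>R i) \<bullet> x + (- real (Suc n) * (a \<bullet> i))) *\<^sub>R
    (flat 1 ((- real (Suc n) *\<^sub>R i) \<bullet> x + real (Suc n) * (b \<bullet> i)) *\<^sub>R ?g x)) \<in> bumps"
   by (intro bumps.mult insert.IH)
  then show ?case using insert.hyps by (simp add: algebra_simps inner_commute)
 qed
 then show ?thesis unfolding box_bump_def by simp
qed

lemma box_bump_test:
 assumes "cbox a b \<subseteq> S"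
 shows "(\<lambda>x. box_bump a b n x *\<^sub>R e) \<in> test_functions S"
proof -
 have "closure {x. box_bump a b n x *\<^sub>R e \<noteq> 0} \<subseteq> cbox a b"
  by (rule closure_minimal) (use box_bump_support[of a b n] box_subset_cbox[of a b] in auto)
 moreover from this have "compact (closure {x. box_bump a b n x *\<^sub>R e \<noteq> 0})"
  by (metis closed_closure compact_cbox compact_Int_closed inf.absorb_iff2)
 ultimately show ?thesis using assms bumps_Ck[OF box_bump_bumps] by (auto simp: test_functions_def smooth_on_def)
qed

lemma box_bump_test_real: "cbox a b \<subseteq> S ==> box_bump a b n \<in> test_functions S"
 using box_bump_test[of a b S n "1::real"] by simp

lemma box_bump_measurable: "box_bump a b n \<in> borel_measurable lebesgue"
proof -
 have "continuous_on UNIV (\<lambda>x. box_bump a b n x *\<^sub>R (1::real))"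
  using bumps_Ck[OF box_bump_bumps[of a b n "1::real"], of 0] by simp
 then show ?thesis by (auto intro!: measurable_completion borel_measurable_continuous_onI)
qed

text \<open>Bump functions converge boundedly to indicators of boxes, so the integrals of \<open>f\<close> over boxes
 inside \<open>S\<close> vanish; countably many boxes cover \<open>S\<close>.\<close>

lemma fundamental_lemma:
 fixes f :: "'a::euclidean_space => real"
 assumes f: "sqint f" and S: "open S"
  and z: "\<And>\<phi>. \<phi> \<in> test_functions S ==> (\<integral>x. f x * \<phi> x \<partial>lebesgue) = 0"
 shows "AE x in lebesgue. x \<in> S \<longrightarrow> f x = 0"
proof -
 have [measurable]: "f \<in> borel_measurable lebesgue" using f by (simp add: sqint_def)
 have fi: "integrable lebesgue (\<lambda>x. indicator (box a b) x * f x)" for a b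
  using sqint_indicator_integrable[OF f, of "box a b"] emeasure_lborel_box_finite[of a b] by simp
 have zbox: "(\<integral>x. indicator (box a b) x * f x \<partial>lebesgue) = 0" if "cbox a b \<subseteq> S" for a b proof -
  have "(\<lambda>n. \<integral>x. f x * box_bump a b n x \<partial>lebesgue) \<longlonglongrightarrow> (\<integral>x. indicator (box a b) x * f x \<partial>lebesgue)"
  proof (rule integral_dominated_convergence[where w = "\<lambda>x. norm (indicator (box a b) x * f x)"])
   show "integrable lebesgue (\<lambda>x. norm (indicator (box a b) x * f x))" by (intro integrable_norm fi)
   show "AE x in lebesgue. (\<lambda>n. f x * box_bump a b n x) \<longlonglongrightarrow> indicator (box a b) x * f x" proof (rule AE_I2)
    fix x
    show "(\<lambda>n. f x * box_bump a b n x) \<longlonglongrightarrow> indicator (box a b) x * f x"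
     using tendsto_mult_left[OF box_bump_tendsto[of a b x], of "f x"] by (simp only: mult.commute)
   qed
   show "AE x in lebesgue. norm (f x * box_bump a b n x) \<le> norm (indicator (box a b) x * f x)" for n
    using box_bump_range[of a b n] box_bump_support[of a b n]
    by (intro AE_I2) (force simp: indicator_def abs_mult intro: mult_left_le)
  qed (auto intro!: borel_measurable_times borel_measurable_indicator box_bump_measurable)
  moreover have "(\<integral>x. f x * box_bump a b n x \<partial>lebesgue) = 0" for n by (rule z[OF box_bump_test_real[OF that]])
  ultimately show ?thesis by (simp add: LIMSEQ_const_iff)
 qed
 have AEb: "AE x in lebesgue. x \<in> cbox a b \<longrightarrow> f x = 0" if ab: "cbox a b \<subseteq> S" for a b proof -
  have "AE x in lebesgue. indicator (box a b) x * f x = 0" proof (rule AE_zero_if_box_integrals_zero[OF fi])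
   fix c d :: 'a
   have "(\<lambda>x. indicator (box c d) x * (indicator (box a b) x * f x)) = (\<lambda>x. indicator (box c d \<inter> box a b) x * f x)"
    by (auto simp: indicator_def fun_eq_iff)
   moreover obtain p q where pq: "box c d \<inter> box a b = box p q" using box_Int_box by blast
   moreover have "(\<integral>x. indicator (box p q) x * f x \<partial>lebesgue) = 0" proof (cases "box p q = {}")
    case False
    then have "closure (box p q) \<subseteq> closure (box a b)" using pq by (metis closure_mono inf_le2)
    then have "cbox p q \<subseteq> S" using False ab box_eq_empty(1) closure_box[OF False] closure_minimal[OF box_subset_cbox closed_cbox, of a b]
     by blast
    then show ?thesis by (rule zbox)
   qed simp
   ultimately show "(\<integral>x. indicator (box c d) x * (indicator (box a b) x * f x) \<partial>lebesgue) = 0" by simp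
  qed
  moreover have "AE x in lebesgue. x \<notin> cbox a b - box a b"
   using negligible_frontier_interval[of a b] by (intro AE_not_in) (simp add: negligible_iff_null_sets)
  ultimately show ?thesis by eventually_elim (auto simp: indicator_def)
 qed
 obtain \<D> where \<D>: "countable \<D>" "\<D> \<subseteq> Pow S" "\<And>X. X \<in> \<D> ==> \<exists>a b. X = cbox a b" "\<Union>\<D> = S"
  using open_countable_Union_open_cbox[OF S] by metis
 have "AE x in lebesgue. \<forall>X\<in>\<D>. x \<in> X \<longrightarrow> f x = 0" using \<D> AEb by (subst AE_ball_countable) (auto, metis PowD subsetD)
 then show ?thesis by eventually_elim (use \<D>(4) in blast)
qed

section \<open>Integration by parts and two Sobolev inequalities\<close>

lemma
 fixes \<phi> :: "'a::euclidean_space => 'b::real_normed_vector"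
 assumes \<phi>: "\<phi> \<in> test_functions S"
 shows test_has_derivative: "(\<phi> has_derivative frechet_derivative \<phi> (at x)) (at x)"
  and test_derivative_continuous: "continuous_on UNIV (\<lambda>x. frechet_derivative \<phi> (at x) v)"
  and test_continuous: "continuous_on UNIV \<phi>"
  and test_compact: "compact (closure {x. \<phi> x \<noteq> 0})"
  and test_support: "closure {x. \<phi> x \<noteq> 0} \<subseteq> S"
  and test_zero: "x \<notin> closure {x. \<phi> x \<noteq> 0} ==> \<phi> x = 0"
  and test_derivative_zero: "x \<notin> closure {x. \<phi> x \<noteq> 0} ==> frechet_derivative \<phi> (at x) v = 0"
proof -
 have sm: "Ck_on k UNIV \<phi>" for k using \<phi> by (auto simp: test_functions_def smooth_on_def)
 have d: "(\<phi> has_derivative frechet_derivative \<phi> (at x)) (at x)" for x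
  using sm[of "Suc 0"] by (auto simp: frechet_derivative_works)
 then show "(\<phi> has_derivative frechet_derivative \<phi> (at x)) (at x)" .
 show "continuous_on UNIV (\<lambda>x. frechet_derivative \<phi> (at x) v)" using sm[of "Suc 0"] by auto
 show "continuous_on UNIV \<phi>" using sm[of 0] by auto
 show "compact (closure {x. \<phi> x \<noteq> 0})" "closure {x. \<phi> x \<noteq> 0} \<subseteq> S" using \<phi> by (auto simp: test_functions_def)
 have z: "\<phi> x = 0" if "x \<notin> closure {x. \<phi> x \<noteq> 0}" for x using that closure_subset[of "{x. \<phi> x \<noteq> 0}"] by auto
 then show "x \<notin> closure {x. \<phi> x \<noteq> 0} ==> \<phi> x = 0" .
 show "frechet_derivative \<phi> (at x) v = 0" if x: "x \<notin> closure {x. \<phi> x \<noteq> 0}" proof -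
  have "(\<phi> has_derivative (\<lambda>v. 0)) (at x)" proof (rule has_derivative_transform_within_open[of "\<lambda>x. 0"])
   show "open (- closure {x. \<phi> x \<noteq> 0})" by auto
   show "x \<in> - closure {x. \<phi> x \<noteq> 0}" using x by blast
   show "0 = \<phi> y" if "y \<in> - closure {x. \<phi> x \<noteq> 0}" for y using z[OF ComplD[OF that]] by (rule sym)
  qed (rule has_derivative_const)
  then show ?thesis using has_derivative_unique[OF d] by metis
 qed
qed

lemma continuous_compact_support_integrable:
 fixes f :: "'a::euclidean_space => 'b::{banach,second_countable_topology}"
 assumes f: "continuous_on UNIV f" and K: "compact K" and z: "\<And>x. x \<notin> K ==> f x = 0"
 shows "integrable lborel f" "integrable lebesgue f"
proof -
 have "integrable lborel (\<lambda>x. indicator K x *\<^sub>R f x)"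
  by (rule borel_integrable_compact[OF K continuous_on_subset[OF f]]) simp
 also have "(\<lambda>x. indicator K x *\<^sub>R f x) = f" using z by (auto simp: indicator_def fun_eq_iff)
 finally show 1: "integrable lborel f" .
 then show "integrable lebesgue f" by (simp add: integrable_completion borel_measurable_integrable)
qed

lemma continuous_compact_support_sqint:
 fixes f :: "'a::euclidean_space => 'b::{real_inner,banach,second_countable_topology}"
 assumes f: "continuous_on UNIV f" and K: "compact K" and z: "\<And>x. x \<notin> K ==> f x = 0"
 shows "sqint f"
 unfolding sqint_def
proof
 show "f \<in> borel_measurable lebesgue" using f by (auto intro!: measurable_completion borel_measurable_continuous_onI)
 show "integrable lebesgue (\<lambda>x. (norm (f x))\<^sup>2)"
  by (rule continuous_compact_support_integrable(2)[OF _ K]) (auto intro!: continuous_intros f simp: z)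
qed

lemma integral_lborel_translate:
 fixes f :: "'a::euclidean_space => real"
 assumes f: "f \<in> borel_measurable borel"
 shows "(\<integral>x. f (c + x) \<partial>lborel) = (\<integral>x. f x \<partial>lborel)"
  and "integrable lborel (\<lambda>x. f (c + x)) \<longleftrightarrow> integrable lborel f"
proof -
 have "(\<integral>x. f x \<partial>distr lborel borel ((+) c)) = (\<integral>x. f (c + x) \<partial>lborel)" by (rule integral_distr) (use f in auto)
 then show "(\<integral>x. f (c + x) \<partial>lborel) = (\<integral>x. f x \<partial>lborel)" by (simp add: lborel_distr_plus)
 have "integrable (distr lborel borel ((+) c)) f \<longleftrightarrow> integrable lborel (\<lambda>x. f (c + x))"
  by (rule integrable_distr_eq) (use f in auto)
 then show "integrable lborel (\<lambda>x. f (c + x)) \<longleftrightarrow> integrable lborel f" by (simp add: lborel_distr_plus)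
qed

text \<open>The difference quotients have integral zero by translation invariance of Lebesgue measure, and by
 the mean value theorem they converge dominatedly.\<close>

lemma integral_directional_derivative_zero:
 fixes F :: "'a::euclidean_space => real"
 assumes F: "\<And>x. (F has_derivative F' x) (at x)" and K: "compact K"
  and z: "\<And>x. x \<notin> K ==> F x = 0" and z': "\<And>x. x \<notin> K ==> F' x v = 0"
  and c: "continuous_on UNIV (\<lambda>x. F' x v)"
 shows "(\<integral>x. F' x v \<partial>lebesgue) = 0"
proof -
 have cF: "continuous_on UNIV F" by (rule has_derivative_continuous_on, rule has_derivative_at_withinI, rule F)
 have Fm: "F \<in> borel_measurable borel" by (rule borel_measurable_continuous_onI[OF cF])
 have Fi: "integrable lborel F" by (rule continuous_compact_support_integrable(1)[OF cF K z])
 have "compact ((\<lambda>x. F' x v) ` K)" by (rule compact_continuous_image[OF continuous_on_subset[OF c] K]) simp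
 from compact_imp_bounded[OF this] obtain B where B0: "\<forall>y\<in>(\<lambda>x. F' x v) ` K. norm y \<le> B"
  unfolding bounded_iff by blast
 have B: "\<bar>F' x v\<bar> \<le> max B 0" for x proof (cases "x \<in> K")
  case True
  then have "norm (F' x v) \<le> B" using B0 by blast
  then show ?thesis by simp
 qed (simp add: z')
 define C where "C = max B 0"
 have der: "((\<lambda>s. F (x + s *\<^sub>R v)) has_real_derivative F' (x + s *\<^sub>R v) v) (at s)" for x s proof -
  have "((\<lambda>s. x + s *\<^sub>R v) has_derivative (\<lambda>h. h *\<^sub>R v)) (at s)" by (auto intro!: derivative_eq_intros)
  from has_derivative_compose[OF this F] have "((\<lambda>s. F (x + s *\<^sub>R v)) has_derivative (\<lambda>h. F' (x + s *\<^sub>R v) (h *\<^sub>R v))) (at s)" .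
  moreover have "(\<lambda>h. F' (x + s *\<^sub>R v) (h *\<^sub>R v)) = (*) (F' (x + s *\<^sub>R v) v)"
   using linear_scale[OF has_derivative_linear[OF F]] by (simp add: fun_eq_iff mult.commute)
  ultimately show ?thesis by (simp add: has_field_derivative_def)
 qed
 define K' where "K' = (\<lambda>(k, s). k - s *\<^sub>R v) ` (K \<times> {0..1::real})"
 (* K' contains the supports of all difference quotients with steps in [0, 1]. *)
 have K': "compact K'" unfolding K'_def by (rule compact_continuous_image)
    (auto intro!: continuous_intros compact_Times K simp: case_prod_unfold)
 define f where "f n x = (F (x + (1 / real (Suc n)) *\<^sub>R v) - F x) / (1 / real (Suc n))" for n x
 have K'z: "F (x + s *\<^sub>R v) = 0" if "x \<notin> K'" "0 \<le> s" "s \<le> 1" for x s proof (rule z, rule)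
  assume "x + s *\<^sub>R v \<in> K"
  then have "x \<in> K'" unfolding K'_def using that by (intro image_eqI[of _ _ "(x + s *\<^sub>R v, s)"]) auto
  with that show False by blast
 qed
 have fb: "norm (f n x) \<le> C * indicator K' x" for n x proof (cases "x \<in> K'")
  case True
  define h where "h = 1 / real (Suc n)"
  have h: "h > 0" by (simp add: h_def)
  obtain s where "F (x + h *\<^sub>R v) - F (x + 0 *\<^sub>R v) = (h - 0) * F' (x + s *\<^sub>R v) v"
   using MVT2[of 0 h "\<lambda>s. F (x + s *\<^sub>R v)" "\<lambda>s. F' (x + s *\<^sub>R v) v"] h der by auto
  moreover have "f n x = (F (x + h *\<^sub>R v) - F x) / h" by (simp add: f_def h_def)
  ultimately have "f n x = F' (x + s *\<^sub>R v) v" using h by simp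
  then show ?thesis using True B by (simp add: C_def)
 next
  case False
  then show ?thesis using K'z[of x "1 / real (Suc n)"] K'z[of x 0] by (simp add: f_def)
 qed
 have "(\<lambda>n. \<integral>x. f n x \<partial>lborel) \<longlonglongrightarrow> (\<integral>x. F' x v \<partial>lborel)"
 proof (rule integral_dominated_convergence[where w = "\<lambda>x. C * indicator K' x"])
  show "integrable lborel (\<lambda>x. C * indicator K' x)" using emeasure_compact_finite[OF K'] K'
   by (intro integrable_mult_right integrable_real_indicator) (auto simp: borel_compact)
  show "AE x in lborel. (\<lambda>n. f n x) \<longlonglongrightarrow> F' x v" proof (rule AE_I2)
   fix x
   have "((\<lambda>h. (F (x + (0 + h) *\<^sub>R v) - F (x + 0 *\<^sub>R v)) / h) \<longlongrightarrow> F' (x + 0 *\<^sub>R v) v) (at 0)"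
    using der[of x 0] unfolding DERIV_def .
   moreover have "filterlim (\<lambda>n. 1 / real (Suc n)) (at 0) sequentially"
    by (intro filterlim_atI LIMSEQ_Suc[OF lim_const_over_n]) auto
   ultimately have "(\<lambda>n. (F (x + (0 + 1 / real (Suc n)) *\<^sub>R v) - F (x + 0 *\<^sub>R v)) / (1 / real (Suc n))) \<longlonglongrightarrow> F' (x + 0 *\<^sub>R v) v"
    by (rule filterlim_compose)
   then show "(\<lambda>n. f n x) \<longlonglongrightarrow> F' x v" by (simp add: f_def)
  qed
  show "(\<lambda>x. F' x v) \<in> borel_measurable lborel" using c by (simp add: borel_measurable_continuous_onI)
  show "f n \<in> borel_measurable lborel" for n unfolding f_def using Fm by simp
 qed (use fb in auto)
 moreover have "(\<integral>x. f n x \<partial>lborel) = 0" for n proof -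
  let ?c = "(1 / real (Suc n)) *\<^sub>R v"
  have "f n = (\<lambda>x. (F (?c + x) - F x) / (1 / real (Suc n)))" by (simp add: f_def fun_eq_iff add.commute)
  then show ?thesis using integral_lborel_translate[OF Fm, of ?c] Fi by simp
 qed
 ultimately have "(\<integral>x. F' x v \<partial>lborel) = 0" by (simp add: LIMSEQ_const_iff)
 then show ?thesis using c by (subst integral_completion) (auto simp: borel_measurable_continuous_onI)
qed

lemma continuous_glue:
 fixes g p :: "'a::euclidean_space => real"
 assumes S: "open S" and g: "continuous_on S g" and p: "continuous_on UNIV p"
  and K: "compact K" "K \<subseteq> S" and z: "\<And>x. x \<notin> K ==> p x = 0"
 shows "continuous_on UNIV (\<lambda>x. if x \<in> S then g x * p x else 0)"
proof -
 have "continuous_on (S \<union> - K) (\<lambda>x. if x \<in> S then g x * p x else 0)" proof (rule continuous_on_open_Un)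
  show "open (- K)" using K by (auto simp: compact_imp_closed)
  have "continuous_on S (\<lambda>x. g x * p x)" by (intro continuous_intros g continuous_on_subset[OF p]) auto
  then show "continuous_on S (\<lambda>x. if x \<in> S then g x * p x else 0)" by (rule continuous_on_eq) auto
  have "continuous_on (- K) (\<lambda>x. 0::real)" by simp
  then show "continuous_on (- K) (\<lambda>x. if x \<in> S then g x * p x else 0)" by (rule continuous_on_eq) (use z in auto)
 qed fact
 moreover have "S \<union> - K = UNIV" using K by auto
 ultimately show ?thesis by simp
qed

text \<open>The function \<open>a\<close> lives on \<open>S\<close> only; its product with a test function extends by zero to a
 differentiable function with compact support, whose derivative has integral zero.\<close>

lemma integration_by_parts:
 fixes a :: "'a::euclidean_space => real"
 assumes S: "open S" and a: "\<And>x. x \<in> S ==> (a has_derivative a' x) (at x)"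
  and a'c: "continuous_on S (\<lambda>x. a' x v)" and \<psi>: "\<psi> \<in> test_functions S"
 shows "(\<integral>x. indicator S x * (a x * frechet_derivative \<psi> (at x) v) \<partial>lebesgue)
   = - (\<integral>x. indicator S x * (a' x v * \<psi> x) \<partial>lebesgue)"
  and "sqint (\<lambda>x. indicator S x * (a x * \<psi> x))"
proof -
 define K where "K = closure {x. \<psi> x \<noteq> 0}"
 define D where "D x = frechet_derivative \<psi> (at x)" for x
 have K: "compact K" "K \<subseteq> S" unfolding K_def using test_compact[OF \<psi>] test_support[OF \<psi>] by auto
 have z: "\<And>x. x \<notin> K ==> \<psi> x = 0" and z': "\<And>x w. x \<notin> K ==> D x w = 0"
  unfolding K_def D_def by (rule test_zero[OF \<psi>], assumption) (rule test_derivative_zero[OF \<psi>])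
 have \<psi>d: "(\<psi> has_derivative D x) (at x)" for x unfolding D_def by (rule test_has_derivative[OF \<psi>])
 have ac: "continuous_on S a" by (rule has_derivative_continuous_on, rule has_derivative_at_withinI, rule a)
 have c0: "continuous_on UNIV (\<lambda>x. if x \<in> S then a x * \<psi> x else 0)"
  by (rule continuous_glue[OF S ac test_continuous[OF \<psi>] K z])
 have c1: "continuous_on UNIV (\<lambda>x. if x \<in> S then a x * D x v else 0)"
  by (rule continuous_glue[OF S ac _ K z']) (use test_derivative_continuous[OF \<psi>] in \<open>simp add: D_def\<close>)
 have c2: "continuous_on UNIV (\<lambda>x. if x \<in> S then a' x v * \<psi> x else 0)"
  by (rule continuous_glue[OF S a'c test_continuous[OF \<psi>] K z])
 have e0: "(\<lambda>x. if x \<in> S then a x * \<psi> x else 0) = (\<lambda>x. indicator S x * (a x * \<psi> x))"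
  and e1: "(\<lambda>x. if x \<in> S then a x * D x v else 0) = (\<lambda>x. indicator S x * (a x * D x v))"
  and e2: "(\<lambda>x. if x \<in> S then a' x v * \<psi> x else 0) = (\<lambda>x. indicator S x * (a' x v * \<psi> x))"
  by (auto simp: fun_eq_iff)
 have i1: "integrable lebesgue (\<lambda>x. indicator S x * (a x * D x v))"
  by (rule continuous_compact_support_integrable(2)[OF c1[unfolded e1] K(1)]) (simp only: z' mult_zero_right not_False_eq_True)
 have i2: "integrable lebesgue (\<lambda>x. indicator S x * (a' x v * \<psi> x))"
  by (rule continuous_compact_support_integrable(2)[OF c2[unfolded e2] K(1)]) (simp only: z mult_zero_right not_False_eq_True)
 show "sqint (\<lambda>x. indicator S x * (a x * \<psi> x))"
  by (rule continuous_compact_support_sqint[OF c0[unfolded e0] K(1)]) (simp only: z mult_zero_right not_False_eq_True)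
 define F where "F x = (if x \<in> S then a x * \<psi> x else 0)" for x
 define F' where "F' x w = (if x \<in> S then a x * D x w + a' x w * \<psi> x else 0)" for x w
 have "(\<integral>x. F' x v \<partial>lebesgue) = 0" proof (rule integral_directional_derivative_zero[of F F' K v])
  show "(F has_derivative F' x) (at x)" for x proof (cases "x \<in> S")
   case True
   have "((\<lambda>x. a x * \<psi> x) has_derivative (\<lambda>w. a x * D x w + a' x w * \<psi> x)) (at x)"
    by (rule has_derivative_mult[OF a[OF True] \<psi>d])
   then have "(F has_derivative (\<lambda>w. a x * D x w + a' x w * \<psi> x)) (at x)"
    by (rule has_derivative_transform_within_open[OF _ S True]) (simp add: F_def)
   then show ?thesis using True by (simp add: F'_def[abs_def])
  next
   case False
   have "((\<lambda>x. 0) has_derivative (\<lambda>w. 0)) (at x)" by simp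
   then have "(F has_derivative (\<lambda>w. 0)) (at x)" proof (rule has_derivative_transform_within_open)
    show "open (- K)" using K by (auto simp: compact_imp_closed)
   qed (use False K z in \<open>auto simp: F_def\<close>)
   then show ?thesis using False by (simp add: F'_def[abs_def])
  qed
  have F'v: "(\<lambda>x. F' x v) = (\<lambda>x. (if x \<in> S then a x * D x v else 0) + (if x \<in> S then a' x v * \<psi> x else 0))"
   by (auto simp: F'_def fun_eq_iff)
  show "continuous_on UNIV (\<lambda>x. F' x v)" unfolding F'v by (rule continuous_on_add[OF c1 c2])
 qed (use K z z' in \<open>auto simp: F_def F'_def\<close>)
 also have "(\<lambda>x. F' x v) = (\<lambda>x. indicator S x * (a x * D x v) + indicator S x * (a' x v * \<psi> x))"
  by (auto simp: F'_def fun_eq_iff)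
 finally show "(\<integral>x. indicator S x * (a x * frechet_derivative \<psi> (at x) v) \<partial>lebesgue)
   = - (\<integral>x. indicator S x * (a' x v * \<psi> x) \<partial>lebesgue)"
  using i1 i2 by (simp add: D_def)
qed

lemma
 fixes \<phi> :: "'a::euclidean_space => 'b::{real_inner,banach,second_countable_topology}"
 assumes \<phi>: "\<phi> \<in> test_functions S"
 shows sqint_test: "sqint \<phi>" and sqint_test_derivative: "sqint (\<lambda>x. frechet_derivative \<phi> (at x) v)"
 using continuous_compact_support_sqint[OF test_continuous[OF \<phi>] test_compact[OF \<phi>] test_zero[OF \<phi>]]
  continuous_compact_support_sqint[OF test_derivative_continuous[OF \<phi>] test_compact[OF \<phi>] test_derivative_zero[OF \<phi>]]
 by auto

text \<open>Integration by parts of \<open>(x \<bullet> v) g\<close> against \<open>g\<close> gives that the integral of \<open>g^2\<close> equals \<open>- 2\<close>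
 times the integral of \<open>(x \<bullet> v) g\<close> times the derivative of \<open>g\<close> along \<open>v\<close>.\<close>

lemma poincare_test:
 fixes g :: "'a::euclidean_space => real"
 assumes S: "open S" and g: "g \<in> test_functions S" and v: "v \<in> Basis" and R: "\<And>x. x \<in> S ==> \<bar>x \<bullet> v\<bar> \<le> R" "R \<ge> 0"
 shows "norm (abs_l2 g) \<le> 2 * R * norm (abs_l2 (\<lambda>x. frechet_derivative g (at x) v))"
proof -
 define D where "D x = frechet_derivative g (at x)" for x
 have gd: "(g has_derivative D x) (at x)" for x unfolding D_def by (rule test_has_derivative[OF g])
 have gS: "g x = 0" if "x \<notin> S" for x by (rule test_zero[OF g contra_subsetD[OF test_support[OF g] that]])
 have DS: "D x v = 0" if "x \<notin> S" for x
  unfolding D_def by (rule test_derivative_zero[OF g contra_subsetD[OF test_support[OF g] that]])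
 have a: "((\<lambda>x. (x \<bullet> v) * g x) has_derivative (\<lambda>w. (x \<bullet> v) * D x w + (w \<bullet> v) * g x)) (at x)" for x
  by (rule has_derivative_mult[OF _ gd]) (auto intro!: derivative_eq_intros)
 have cD: "continuous_on S (\<lambda>x. D x v)" unfolding D_def
  by (rule continuous_on_subset[OF test_derivative_continuous[OF g]]) simp
 have cg: "continuous_on S g" by (rule continuous_on_subset[OF test_continuous[OF g]]) simp
 have "continuous_on S (\<lambda>x. (x \<bullet> v) * D x v + (v \<bullet> v) * g x)" by (intro continuous_intros cD cg)
 note ibp = integration_by_parts[OF S a this g]
 have sg: "sqint g" and sD: "sqint (\<lambda>x. D x v)"
  unfolding D_def by (rule sqint_test[OF g], rule sqint_test_derivative[OF g])
 have le: "norm ((x \<bullet> v) * g x) \<le> R * norm (g x)" for x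
  using R(1)[of x] gS[of x] by (cases "x \<in> S") (auto simp: abs_mult intro: mult_right_mono)
 have s1: "sqint (\<lambda>x. (x \<bullet> v) * g x)" proof (rule sqint_bound[OF sg, of _ R])
  show "(\<lambda>x. (x \<bullet> v) * g x) \<in> borel_measurable lebesgue" using test_continuous[OF g]
   by (auto intro!: measurable_completion borel_measurable_continuous_onI continuous_intros)
  show "AE x in lebesgue. norm ((x \<bullet> v) * g x) \<le> R * norm (g x)" by (intro AE_I2 le)
 qed
 have e1: "(\<lambda>x. indicator S x * ((x \<bullet> v) * g x * frechet_derivative g (at x) v)) = (\<lambda>x. ((x \<bullet> v) * g x) \<bullet> D x v)"
  using gS by (auto simp: fun_eq_iff D_def indicator_def)
 have e2: "(\<lambda>x. indicator S x * (((x \<bullet> v) * D x v + (v \<bullet> v) * g x) * g x)) = (\<lambda>x. ((x \<bullet> v) * g x) \<bullet> D x v + g x \<bullet> g x)"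
  using gS v by (auto simp: fun_eq_iff indicator_def algebra_simps)
 have "(\<integral>x. ((x \<bullet> v) * g x) \<bullet> D x v \<partial>lebesgue) = - (\<integral>x. ((x \<bullet> v) * g x) \<bullet> D x v + g x \<bullet> g x \<partial>lebesgue)"
  using ibp(1) unfolding e1 e2 .
 also have "\<dots> = - ((\<integral>x. ((x \<bullet> v) * g x) \<bullet> D x v \<partial>lebesgue) + (\<integral>x. g x \<bullet> g x \<partial>lebesgue))"
  by (subst Bochner_Integration.integral_add[OF sqint_inner_integrable[OF s1 sD] sqint_inner_integrable[OF sg sg]]) simp
 finally have "abs_l2 g \<bullet> abs_l2 g = - 2 * (abs_l2 (\<lambda>x. (x \<bullet> v) * g x) \<bullet> abs_l2 (\<lambda>x. D x v))"
  by (simp add: inner_abs_l2 sg s1 sD)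
 also have "\<dots> \<le> 2 * (norm (abs_l2 (\<lambda>x. (x \<bullet> v) * g x)) * norm (abs_l2 (\<lambda>x. D x v)))"
  using Cauchy_Schwarz_ineq2[of "abs_l2 (\<lambda>x. (x \<bullet> v) * g x)" "abs_l2 (\<lambda>x. D x v)"] by linarith
 also have "\<dots> \<le> 2 * ((R * norm (abs_l2 g)) * norm (abs_l2 (\<lambda>x. D x v)))"
 proof (intro mult_left_mono mult_right_mono norm_l2_mono s1 sg R)
  show "AE x in lebesgue. norm ((x \<bullet> v) * g x) \<le> R * norm (g x)" by (intro AE_I2 le)
 qed auto
 finally have "norm (abs_l2 g) * norm (abs_l2 g) \<le> norm (abs_l2 g) * (2 * R * norm (abs_l2 (\<lambda>x. D x v)))"
  by (simp add: power2_norm_eq_inner[symmetric] power2_eq_square algebra_simps)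
 then show ?thesis using R(2) unfolding D_def by (cases "norm (abs_l2 g) = 0") auto
qed

subsection \<open>The plane\<close>

definition pair2 :: "real \<times> real => real^2" where "pair2 p = vector [fst p, snd p]"

lemma pair2_nth [simp]: "pair2 p $ 1 = fst p" "pair2 p $ 2 = snd p"
 by (simp_all add: pair2_def)

lemma pair2_eq: "pair2 (x, y) = x *\<^sub>R axis 1 1 + y *\<^sub>R axis 2 1"
 by (simp add: vec_eq_iff forall_2 axis_def)

lemma continuous_pair2: "continuous_on UNIV pair2"
proof -
 have "continuous_on UNIV (\<lambda>p. fst p *\<^sub>R axis 1 1 + snd p *\<^sub>R axis 2 1 :: real^2)" by (intro continuous_intros)
 then show ?thesis by (simp add: pair2_eq[symmetric])
qed

lemma pair2_measurable [measurable]: "pair2 \<in> borel_measurable borel"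
 by (rule borel_measurable_continuous_onI[OF continuous_pair2])

lemma lborel_pair2: "lborel = distr lborel borel pair2"
proof (rule lborel_eqI)
 fix l u :: "real^2" assume le: "\<And>b. b \<in> Basis ==> l \<bullet> b \<le> u \<bullet> b"
 have le': "l $ i \<le> u $ i" for i using le[of "axis i 1"] by (simp add: inner_axis)
 have "pair2 -` box l u = box (l $ 1, l $ 2) (u $ 1, u $ 2)"
  by (auto simp: mem_box_cart forall_2 box_prod set_eq_iff mem_box)
 then have "emeasure (distr lborel borel pair2) (box l u) = emeasure lborel (box (l $ 1, l $ 2) (u $ 1, u $ 2))"
  by (simp add: emeasure_distr)
 also have "\<dots> = (\<Prod>b\<in>Basis. ((u $ 1, u $ 2) - (l $ 1, l $ 2)) \<bullet> b)"
  by (rule emeasure_lborel_box) (use le' in \<open>auto simp: Basis_prod_def\<close>)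
 also have "(\<Prod>b\<in>Basis. ((u $ 1, u $ 2) - (l $ 1, l $ 2)) \<bullet> b) = (u $ 1 - l $ 1) * (u $ 2 - l $ 2)"
  by (simp add: Basis_prod_def prod.union_disjoint prod.reindex inj_on_def)
 also have "\<dots> = (\<Prod>b\<in>Basis. (u - l) \<bullet> b)" proof -
  have "(\<Prod>b\<in>Basis. (u - l) \<bullet> b) = (\<Prod>i\<in>UNIV. (u - l) $ i)" unfolding Basis_vec_def
   by (subst prod.UNION_disjoint) (auto simp: axis_eq_axis inner_axis)
  then show ?thesis by (simp add: UNIV_2)
 qed
 finally show "emeasure (distr lborel borel pair2) (box l u) = ennreal (\<Prod>b\<in>Basis. (u - l) \<bullet> b)" .
qed simp

lemma nn_integral_plane:
 fixes f :: "real^2 => ennreal"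
 assumes [measurable]: "f \<in> borel_measurable borel"
 shows "(\<integral>\<^sup>+z. f z \<partial>lborel) = (\<integral>\<^sup>+x. \<integral>\<^sup>+y. f (pair2 (x, y)) \<partial>lborel \<partial>lborel)"
  and "(\<integral>\<^sup>+z. f z \<partial>lborel) = (\<integral>\<^sup>+y. \<integral>\<^sup>+x. f (pair2 (x, y)) \<partial>lborel \<partial>lborel)"
proof -
 have "(\<integral>\<^sup>+z. f z \<partial>lborel) = (\<integral>\<^sup>+p. f (pair2 p) \<partial>lborel)" by (subst lborel_pair2, subst nn_integral_distr) auto
 also have "\<dots> = (\<integral>\<^sup>+p. f (pair2 p) \<partial>(lborel \<Otimes>\<^sub>M lborel))" by (simp add: lborel_prod)
 finally have *: "(\<integral>\<^sup>+z. f z \<partial>lborel) = (\<integral>\<^sup>+p. f (pair2 p) \<partial>(lborel \<Otimes>\<^sub>M lborel))" .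
 have m: "(\<lambda>p. f (pair2 p)) \<in> borel_measurable (lborel \<Otimes>\<^sub>M lborel)" by (simp add: lborel_prod)
 show "(\<integral>\<^sup>+z. f z \<partial>lborel) = (\<integral>\<^sup>+x. \<integral>\<^sup>+y. f (pair2 (x, y)) \<partial>lborel \<partial>lborel)"
  unfolding * by (rule lborel.nn_integral_fst[symmetric, OF m])
 show "(\<integral>\<^sup>+z. f z \<partial>lborel) = (\<integral>\<^sup>+y. \<integral>\<^sup>+x. f (pair2 (x, y)) \<partial>lborel \<partial>lborel)"
  unfolding * by (rule lborel_pair.nn_integral_snd[symmetric, OF m])
qed

text \<open>The fundamental theorem of calculus for \<open>g^2\<close> along the line, from a point outside the support.\<close>

lemma square_le_line_integral:
 fixes g :: "'a::euclidean_space => real"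
 assumes g: "g \<in> test_functions S" and v: "v \<noteq> 0"
 shows "ennreal ((g (p + x *\<^sub>R v))\<^sup>2)
   \<le> (\<integral>\<^sup>+s. ennreal (2 * \<bar>g (p + s *\<^sub>R v) * frechet_derivative g (at (p + s *\<^sub>R v)) v\<bar>) \<partial>lborel)"
proof -
 define D where "D x = frechet_derivative g (at x)" for x
 have gd: "(g has_derivative D x) (at x)" for x unfolding D_def by (rule test_has_derivative[OF g])
 have der: "((\<lambda>s. (g (p + s *\<^sub>R v))\<^sup>2) has_real_derivative (2 * (g (p + s *\<^sub>R v) * D (p + s *\<^sub>R v) v))) (at s)" for s
 proof -
  have "((\<lambda>s. p + s *\<^sub>R v) has_derivative (\<lambda>h. h *\<^sub>R v)) (at s)" by (auto intro!: derivative_eq_intros)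
  from has_derivative_compose[OF this gd] have "((\<lambda>s. g (p + s *\<^sub>R v)) has_derivative (\<lambda>h. D (p + s *\<^sub>R v) (h *\<^sub>R v))) (at s)" .
  moreover have "(\<lambda>h. D (p + s *\<^sub>R v) (h *\<^sub>R v)) = (*) (D (p + s *\<^sub>R v) v)"
   using linear_scale[OF has_derivative_linear[OF gd]] by (simp add: fun_eq_iff mult.commute)
  ultimately have "((\<lambda>s. g (p + s *\<^sub>R v)) has_real_derivative D (p + s *\<^sub>R v) v) (at s)"
   by (simp add: has_field_derivative_def)
  then show ?thesis by (auto intro!: derivative_eq_intros)
 qed
 have cl: "continuous_on A (\<lambda>s. p + s *\<^sub>R v)" for A by (intro continuous_intros)
 have cont: "continuous_on A (\<lambda>s. 2 * (g (p + s *\<^sub>R v) * D (p + s *\<^sub>R v) v))" for A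
  using continuous_on_compose2[OF test_continuous[OF g] cl] continuous_on_compose2[OF test_derivative_continuous[OF g, of v] cl]
  by (auto intro!: continuous_intros simp: D_def)
 obtain B where B: "\<And>y. y \<in> closure {x. g x \<noteq> 0} ==> norm y \<le> B"
  using compact_imp_bounded[OF test_compact[OF g]] unfolding bounded_iff by blast
 (* A parameter so negative that the point lies outside the support. *)
 define s0 where "s0 = min x (- ((\<bar>B\<bar> + norm p + 1) / norm v))"
 have "norm (p + s0 *\<^sub>R v) > B" proof -
  have "s0 \<le> - ((\<bar>B\<bar> + norm p + 1) / norm v)" by (simp add: s0_def)
  then have "s0 * norm v \<le> - ((\<bar>B\<bar> + norm p + 1) / norm v) * norm v" by (intro mult_right_mono) auto
  then have "s0 * norm v \<le> - (\<bar>B\<bar> + norm p + 1)" using v by simp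
  moreover have "norm (s0 *\<^sub>R v) \<ge> - (s0 * norm v)" by (simp add: abs_if)
  ultimately show ?thesis using norm_triangle_ineq2[of "s0 *\<^sub>R v" "- p"] by (simp add: add.commute)
 qed
 then have z: "g (p + s0 *\<^sub>R v) = 0" using B test_zero[OF g] by (meson not_le)
 let ?f = "\<lambda>s. indicator {s0..x} s *\<^sub>R (2 * (g (p + s *\<^sub>R v) * D (p + s *\<^sub>R v) v))"
 have "has_bochner_integral lborel ?f ((g (p + x *\<^sub>R v))\<^sup>2 - (g (p + s0 *\<^sub>R v))\<^sup>2)"
  by (rule has_bochner_integral_FTC_Icc)
    (use der cont in \<open>auto simp: s0_def has_real_derivative_iff_has_vector_derivative intro: has_vector_derivative_at_within\<close>)
 then have I: "integrable lborel ?f" "(\<integral>s. ?f s \<partial>lborel) = (g (p + x *\<^sub>R v))\<^sup>2"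
  using z by (auto simp: has_bochner_integral_iff)
 have "ennreal (norm (\<integral>s. ?f s \<partial>lborel)) \<le> (\<integral>\<^sup>+s. ennreal (norm (?f s)) \<partial>lborel)"
  by (rule integral_norm_bound_ennreal[OF I(1)])
 also have "\<dots> \<le> (\<integral>\<^sup>+s. ennreal (2 * \<bar>g (p + s *\<^sub>R v) * D (p + s *\<^sub>R v) v\<bar>) \<partial>lborel)"
  by (intro nn_integral_mono ennreal_leI) (auto simp: indicator_def abs_mult)
 finally show ?thesis unfolding I(2) unfolding D_def by simp
qed

text \<open>At \<open>(x, y)\<close> the value \<open>g^2\<close> is bounded both by an integral \<open>A y\<close> along the horizontal and by an
 integral \<open>B x\<close> along the vertical line; so \<open>g^4 \<le> A y * B x\<close>, and the product integrates to a product
 of two double integrals.\<close>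

lemma ladyzhenskaya_test:
 fixes g :: "real^2 => real"
 assumes g: "g \<in> test_functions S"
 shows "(\<integral>\<^sup>+x. ennreal ((g x) ^ 4) \<partial>lborel) \<le> ennreal (4 * (norm (abs_l2 g))\<^sup>2
  * norm (abs_l2 (\<lambda>x. frechet_derivative g (at x) (axis 1 1))) * norm (abs_l2 (\<lambda>x. frechet_derivative g (at x) (axis 2 1))))"
proof -
 define D where "D i x = frechet_derivative g (at x) (axis i 1)" for i :: 2 and x
 define h where "h i x = ennreal (2 * \<bar>g x * D i x\<bar>)" for i x
 have [measurable]: "g \<in> borel_measurable borel" "D i \<in> borel_measurable borel" for i
  unfolding D_def[abs_def] using test_continuous[OF g] test_derivative_continuous[OF g, of "axis i 1"]
  by (auto intro: borel_measurable_continuous_onI)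
 have [measurable]: "h i \<in> borel_measurable borel" for i unfolding h_def[abs_def] by measurable
 have "(\<lambda>p. h i (pair2 p)) \<in> borel_measurable borel" for i by measurable
 then have [measurable]: "(\<lambda>(x, y). h i (pair2 (x, y))) \<in> borel_measurable (lborel \<Otimes>\<^sub>M lborel)" for i
  by (simp add: lborel_prod case_prod_unfold)
 define A where "A y = (\<integral>\<^sup>+s. h 1 (pair2 (s, y)) \<partial>lborel)" for y
 define B where "B x = (\<integral>\<^sup>+s. h 2 (pair2 (x, s)) \<partial>lborel)" for x
 have a1: "axis 1 1 \<noteq> (0::real^2)" "axis 2 1 \<noteq> (0::real^2)" by (simp_all add: axis_eq_0_iff)
 have gA: "ennreal ((g (pair2 (x, y)))\<^sup>2) \<le> A y" for x y
  using square_le_line_integral[OF g a1(1), of "y *\<^sub>R axis 2 1" x]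
  by (simp add: A_def h_def D_def pair2_eq add.commute)
 have gB: "ennreal ((g (pair2 (x, y)))\<^sup>2) \<le> B x" for x y
  using square_le_line_integral[OF g a1(2), of "x *\<^sub>R axis 1 1" y] by (simp add: B_def h_def D_def pair2_eq)
 have [measurable]: "A \<in> borel_measurable borel" "B \<in> borel_measurable borel" proof -
  have "continuous_on UNIV (\<lambda>p::real\<times>real. pair2 (snd p, fst p))"
   by (rule continuous_on_compose2[OF continuous_pair2]) (auto intro!: continuous_intros)
  then have [measurable]: "(\<lambda>p::real\<times>real. pair2 (snd p, fst p)) \<in> borel_measurable borel"
   by (rule borel_measurable_continuous_onI)
  have "(\<lambda>p. h 1 (pair2 (snd p, fst p))) \<in> borel_measurable borel"
   "(\<lambda>p. h 2 (pair2 p)) \<in> borel_measurable borel" by measurable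
  then have "(\<lambda>(y, s). h 1 (pair2 (s, y))) \<in> borel_measurable (lborel \<Otimes>\<^sub>M lborel)"
   "(\<lambda>(x, s). h 2 (pair2 (x, s))) \<in> borel_measurable (lborel \<Otimes>\<^sub>M lborel)"
   by (simp_all add: lborel_prod case_prod_unfold)
  then show "A \<in> borel_measurable borel" "B \<in> borel_measurable borel" unfolding A_def[abs_def] B_def[abs_def]
   by (auto dest!: lborel.borel_measurable_nn_integral)
 qed
 have hle: "(\<integral>\<^sup>+z. h i z \<partial>lborel) \<le> ennreal (2 * (norm (abs_l2 g) * norm (abs_l2 (D i))))" for i proof -
  have sg: "sqint g" and sD: "sqint (D i)"
   unfolding D_def by (rule sqint_test[OF g], rule sqint_test_derivative[OF g])
  note sn = sqint_norm[OF sg] sqint_norm[OF sD]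
  have int: "integrable lebesgue (\<lambda>x. norm (g x) * norm (D i x))" by (rule sqint_mult_norm_integrable[OF sg sD])
  have "(\<integral>\<^sup>+z. h i z \<partial>lborel) = (\<integral>\<^sup>+z. ennreal (2 * (norm (g z) * norm (D i z))) \<partial>lebesgue)"
   by (subst nn_integral_completion) (simp add: h_def[abs_def] abs_mult)
  also have "\<dots> = ennreal (2 * (abs_l2 (\<lambda>x. norm (g x)) \<bullet> abs_l2 (\<lambda>x. norm (D i x))))"
   using int inner_abs_l2[OF sn] by (subst nn_integral_eq_integral) auto
  also have "\<dots> \<le> ennreal (2 * (norm (abs_l2 g) * norm (abs_l2 (D i))))" proof (intro ennreal_leI mult_left_mono)
   have "norm (abs_l2 (\<lambda>x. norm (g x))) \<le> 1 * norm (abs_l2 g)" "norm (abs_l2 (\<lambda>x. norm (D i x))) \<le> 1 * norm (abs_l2 (D i))"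
    by (intro norm_l2_mono sn sg sD; simp)+
   then show "abs_l2 (\<lambda>x. norm (g x)) \<bullet> abs_l2 (\<lambda>x. norm (D i x)) \<le> norm (abs_l2 g) * norm (abs_l2 (D i))"
    by (intro order_trans[OF norm_cauchy_schwarz] mult_mono) auto
  qed simp
  finally show ?thesis .
 qed
 have "(\<integral>\<^sup>+x. ennreal ((g x) ^ 4) \<partial>lborel) = (\<integral>\<^sup>+x. \<integral>\<^sup>+y. ennreal ((g (pair2 (x, y))) ^ 4) \<partial>lborel \<partial>lborel)"
  by (rule nn_integral_plane(1)) simp
 also have "\<dots> \<le> (\<integral>\<^sup>+x. \<integral>\<^sup>+y. B x * A y \<partial>lborel \<partial>lborel)" proof (intro nn_integral_mono)
  fix x y
  have "ennreal ((g (pair2 (x, y))) ^ 4) = ennreal ((g (pair2 (x, y)))\<^sup>2) * ennreal ((g (pair2 (x, y)))\<^sup>2)"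
   by (simp flip: ennreal_mult add: power_add[symmetric])
  also have "\<dots> \<le> B x * A y" by (intro mult_mono gA gB) auto
  finally show "ennreal ((g (pair2 (x, y))) ^ 4) \<le> B x * A y" .
 qed
 also have "\<dots> = (\<integral>\<^sup>+x. B x \<partial>lborel) * (\<integral>\<^sup>+y. A y \<partial>lborel)" by (simp add: nn_integral_cmult nn_integral_multc)
 also have "(\<integral>\<^sup>+x. B x \<partial>lborel) = (\<integral>\<^sup>+z. h 2 z \<partial>lborel)"
  unfolding B_def by (rule nn_integral_plane(1)[symmetric]) simp
 also have "(\<integral>\<^sup>+y. A y \<partial>lborel) = (\<integral>\<^sup>+z. h 1 z \<partial>lborel)"
  unfolding A_def by (rule nn_integral_plane(2)[symmetric]) simp
 also have "(\<integral>\<^sup>+z. h 2 z \<partial>lborel) * (\<integral>\<^sup>+z. h 1 z \<partial>lborel)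
   \<le> ennreal (2 * (norm (abs_l2 g) * norm (abs_l2 (D 2)))) * ennreal (2 * (norm (abs_l2 g) * norm (abs_l2 (D 1))))"
  by (intro mult_mono hle) auto
 also have "\<dots> = ennreal (4 * (norm (abs_l2 g))\<^sup>2 * norm (abs_l2 (D 1)) * norm (abs_l2 (D 2)))"
  by (simp flip: ennreal_mult add: power2_eq_square algebra_simps)
 finally show ?thesis unfolding D_def .
qed

section \<open>The spaces on the domain as subspaces of Hilbert spaces\<close>

text \<open>A function on the domain, seen as the class of its extension by zero. Spaces of functions on
 different domains thus share one Hilbert space type.\<close>

definition cls :: "(real^2) set => (real^2 => 'b::euclidean_space) => (real^2, 'b) l2" where
 "cls \<Omega> f = abs_l2 (\<lambda>x. indicator \<Omega> x *\<^sub>R f x)"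

lemma Ck_bounded_linear:
 assumes L: "bounded_linear L"
 shows "Ck_on k UNIV f ==> Ck_on k UNIV (\<lambda>x. L (f x))"
proof (induction k arbitrary: f)
 case 0
 then show ?case using bounded_linear.continuous_on[OF L] by auto
next
 case (Suc k)
 have d: "((\<lambda>x. L (f x)) has_derivative (\<lambda>v. L (frechet_derivative f (at x) v))) (at x)" for x
  using Suc.prems by (intro bounded_linear.has_derivative[OF L]) (auto simp: frechet_derivative_works)
 have "frechet_derivative (\<lambda>x. L (f x)) (at x) = (\<lambda>v. L (frechet_derivative f (at x) v))" for x
  using frechet_derivative_at[OF d[of x]] by simp
 then show ?case using d Suc by (auto simp: differentiable_def)
qed

locale bounded_open =
 fixes \<Omega> :: "(real^2) set"
 assumes op: "open \<Omega>" and bd: "bounded \<Omega>"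
begin

lemma \<Omega>_sets [simp]: "\<Omega> \<in> sets lebesgue" using op by auto

lemma \<Omega>_sets' [simp]: "\<Omega> \<inter> space lebesgue \<in> sets lebesgue" by simp

lemma L2_iff: "f \<in> L2 \<Omega> \<longleftrightarrow> sqint (\<lambda>x. indicator \<Omega> x *\<^sub>R f x)"
proof -
 have "(\<lambda>x. (norm (indicator \<Omega> x *\<^sub>R f x))\<^sup>2) = (\<lambda>x. indicator \<Omega> x *\<^sub>R (norm (f x))\<^sup>2)"
  by (auto simp: indicator_def fun_eq_iff)
 then show ?thesis by (simp only: L2_def sqint_def mem_Collect_eq borel_measurable_restrict_space_iff[OF \<Omega>_sets']
     integrable_restrict_space[OF \<Omega>_sets'])
qed

lemma L2_sqint: "f \<in> L2 \<Omega> ==> sqint (\<lambda>x. indicator \<Omega> x *\<^sub>R f x)" by (simp add: L2_iff)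

lemma sqint_L2: "sqint f ==> f \<in> L2 \<Omega>"
 unfolding L2_iff by (rule sqint_bound[of f _ 1])
   (auto simp: sqint_def intro!: borel_measurable_scaleR borel_measurable_indicator split: split_indicator)

lemma integral_\<Omega>: "(LINT x|lebesgue_on \<Omega>. f x) = (\<integral>x. indicator \<Omega> x *\<^sub>R f x \<partial>lebesgue)"
 for f :: "_ => real" by (rule integral_restrict_space[OF \<Omega>_sets'])

lemma L2_inner_cls: "f \<in> L2 \<Omega> ==> g \<in> L2 \<Omega> ==> L2_inner \<Omega> f g = cls \<Omega> f \<bullet> cls \<Omega> g"
 unfolding L2_inner_def cls_def integral_\<Omega>
 by (simp add: inner_abs_l2 L2_sqint) (rule Bochner_Integration.integral_cong, auto simp: indicator_def)

lemma L2_norm_cls: "f \<in> L2 \<Omega> ==> L2_norm \<Omega> f = norm (cls \<Omega> f)"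
proof -
 assume f: "f \<in> L2 \<Omega>"
 have "(L2_norm \<Omega> f)\<^sup>2 = L2_inner \<Omega> f f" by (simp add: L2_norm_def L2_inner_def power2_norm_eq_inner)
 then have "(L2_norm \<Omega> f)\<^sup>2 = (norm (cls \<Omega> f))\<^sup>2" by (simp add: L2_inner_cls f power2_norm_eq_inner)
 moreover have "L2_norm \<Omega> f \<ge> 0" by (simp add: L2_norm_def)
 ultimately show ?thesis by simp
qed

lemma L2_add: "f \<in> L2 \<Omega> ==> g \<in> L2 \<Omega> ==> (\<lambda>x. f x + g x) \<in> L2 \<Omega>"
 using sqint_add[OF L2_sqint L2_sqint, of f g] by (simp add: L2_iff scaleR_add_right)

lemma L2_diff: "f \<in> L2 \<Omega> ==> g \<in> L2 \<Omega> ==> (\<lambda>x. f x - g x) \<in> L2 \<Omega>"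
 using sqint_diff[OF L2_sqint L2_sqint, of f g] by (simp add: L2_iff scaleR_diff_right)

lemma L2_scaleR: "f \<in> L2 \<Omega> ==> (\<lambda>x. c *\<^sub>R f x) \<in> L2 \<Omega>"
 using sqint_scaleR[OF L2_sqint, of f c] by (simp add: L2_iff mult.commute)

lemma L2_zero: "(\<lambda>x. 0) \<in> L2 \<Omega>" by (simp add: L2_iff)

lemma cls_add: "f \<in> L2 \<Omega> ==> g \<in> L2 \<Omega> ==> cls \<Omega> (\<lambda>x. f x + g x) = cls \<Omega> f + cls \<Omega> g"
 by (simp add: cls_def add_abs_l2 L2_sqint scaleR_add_right)

lemma cls_diff: "f \<in> L2 \<Omega> ==> g \<in> L2 \<Omega> ==> cls \<Omega> (\<lambda>x. f x - g x) = cls \<Omega> f - cls \<Omega> g"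
 by (simp add: cls_def diff_abs_l2 L2_sqint scaleR_diff_right)

lemma cls_scaleR: "f \<in> L2 \<Omega> ==> cls \<Omega> (\<lambda>x. c *\<^sub>R f x) = c *\<^sub>R cls \<Omega> f"
 by (simp add: cls_def scaleR_abs_l2 L2_sqint mult.commute)

lemma cls_zero: "cls \<Omega> (\<lambda>x. 0) = 0"
 by (simp add: cls_def zero_abs_l2)

lemma AE_\<Omega>: "(AE x in lebesgue_on \<Omega>. Q x) \<longleftrightarrow> (AE x in lebesgue. x \<in> \<Omega> \<longrightarrow> Q x)"
 by (rule AE_restrict_space_iff) simp

lemma cls_eq_iff: "f \<in> L2 \<Omega> ==> g \<in> L2 \<Omega> ==> cls \<Omega> f = cls \<Omega> g \<longleftrightarrow> (AE x in lebesgue_on \<Omega>. f x = g x)"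
proof -
 assume fg: "f \<in> L2 \<Omega>" "g \<in> L2 \<Omega>"
 have "(\<lambda>x. indicator \<Omega> x *\<^sub>R f x = indicator \<Omega> x *\<^sub>R g x) = (\<lambda>x. x \<in> \<Omega> \<longrightarrow> f x = g x)"
  by (auto simp: fun_eq_iff indicator_def)
 then show ?thesis unfolding cls_def AE_\<Omega> abs_l2_eq_iff[OF L2_sqint[OF fg(1)] L2_sqint[OF fg(2)]] by (simp only:)
qed

lemma rep_cls: "f \<in> L2 \<Omega> ==> AE x in lebesgue. rep_l2 (cls \<Omega> f) x = indicator \<Omega> x *\<^sub>R f x"
 unfolding cls_def by (rule rep_abs_l2) (rule L2_sqint)

lemma rep_L2: "rep_l2 x \<in> L2 \<Omega>" by (rule sqint_L2) simp

lemma cls_rep_cls: "f \<in> L2 \<Omega> ==> cls \<Omega> (rep_l2 (cls \<Omega> f)) = cls \<Omega> f"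
 unfolding cls_eq_iff[OF rep_L2] AE_\<Omega> using rep_cls[of f] by (auto elim: eventually_mono)

lemma bounded_linear_cls_rep: "bounded_linear (\<lambda>x::(real^2, 'b::euclidean_space) l2. cls \<Omega> (rep_l2 x))"
proof -
 have "(\<lambda>x::(real^2, 'b) l2. cls \<Omega> (rep_l2 x)) = l2_map (\<lambda>t y. indicator \<Omega> t *\<^sub>R y)"
  by (simp add: cls_def l2_map_def fun_eq_iff)
 moreover have "bounded_linear (l2_map (\<lambda>t (y::'b). indicator \<Omega> t *\<^sub>R y))"
  by (rule bounded_linear_l2_map[where C = 1])
    (auto intro!: borel_measurable_scaleR borel_measurable_indicator linearI simp: scaleR_add_right split: split_indicator)
 ultimately show ?thesis by simp
qed

lemma cls_rep_inner: "f \<in> L2 \<Omega> ==> cls \<Omega> (rep_l2 x) \<bullet> cls \<Omega> f = x \<bullet> cls \<Omega> f"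
proof -
 assume f: "f \<in> L2 \<Omega>"
 have "cls \<Omega> (rep_l2 x) \<bullet> cls \<Omega> f = (\<integral>t. rep_l2 x t \<bullet> indicator \<Omega> t *\<^sub>R f t \<partial>lebesgue)"
  unfolding cls_def inner_abs_l2[OF L2_sqint[OF rep_L2] L2_sqint[OF f]]
  by (rule Bochner_Integration.integral_cong) (auto simp: indicator_def)
 also have "\<dots> = abs_l2 (rep_l2 x) \<bullet> cls \<Omega> f"
  unfolding cls_def by (rule inner_abs_l2[symmetric]) (auto simp: L2_sqint f)
 finally show ?thesis by simp
qed

subsection \<open>Weak derivatives\<close>

lemma L2_nth: "G \<in> L2 \<Omega> ==> (\<lambda>x. G x $ i) \<in> L2 \<Omega>" for G :: "real^2 => 'b::euclidean_space^'n"
proof -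
 assume "G \<in> L2 \<Omega>"
 from sqint_bounded_linear[OF bounded_linear_vec_nth[of i] L2_sqint[OF this]]
 show ?thesis by (simp add: L2_iff)
qed

definition axis2 :: "2 => 2 => real^2^2" where "axis2 i j = axis i (axis j 1)"

lemma inner_axis2: "G \<bullet> axis2 i j = G $ i $ j"
 by (simp add: axis2_def inner_axis)

lemma test_L2: "\<psi> \<in> test_functions \<Omega> ==> \<psi> \<in> L2 \<Omega>" for \<psi> :: "real^2 => 'b::euclidean_space"
 by (intro sqint_L2 sqint_test)

lemma test_deriv_L2: "\<psi> \<in> test_functions \<Omega> ==> (\<lambda>x. frechet_derivative \<psi> (at x) v) \<in> L2 \<Omega>"
 for \<psi> :: "real^2 => 'b::euclidean_space" by (intro sqint_L2 sqint_test_derivative)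

lemma L2_scaleR_vec: "f \<in> L2 \<Omega> ==> (\<lambda>x. f x *\<^sub>R e) \<in> L2 \<Omega>" for f :: "real^2 => real"
 using sqint_bounded_linear[OF bounded_linear_scaleR_left L2_sqint, of f e] by (simp add: L2_iff)

text \<open>Written with inner products of classes, the definition of the weak derivative is visibly stable
 under \<open>L2\<close> limits.\<close>

lemma has_weak_jacobian_iff:
 assumes u: "u \<in> L2 \<Omega>" and G: "G \<in> L2 \<Omega>"
 shows "has_weak_jacobian \<Omega> u G \<longleftrightarrow> (\<forall>\<psi> \<in> test_functions \<Omega>. \<forall>i j.
   cls \<Omega> u \<bullet> cls \<Omega> (\<lambda>x. frechet_derivative \<psi> (at x) (axis j 1) *\<^sub>R axis i 1)
   = - (cls \<Omega> G \<bullet> cls \<Omega> (\<lambda>x. \<psi> x *\<^sub>R axis2 i j)))"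
proof -
 have "cls \<Omega> u \<bullet> cls \<Omega> (\<lambda>x. frechet_derivative \<psi> (at x) (axis j 1) *\<^sub>R axis i 1)
   = (LINT x|lebesgue_on \<Omega>. u x $ i * frechet_derivative \<psi> (at x) (axis j 1))"
  if "\<psi> \<in> test_functions \<Omega>" for i j and \<psi> :: "real^2 => real"
  using L2_inner_cls[OF u L2_scaleR_vec[OF test_deriv_L2[OF that]], of "axis j 1" "axis i 1"]
  by (simp add: L2_inner_def inner_axis mult.commute)
 moreover have "cls \<Omega> G \<bullet> cls \<Omega> (\<lambda>x. \<psi> x *\<^sub>R axis2 i j) = (LINT x|lebesgue_on \<Omega>. G x $ i $ j * \<psi> x)"
  if "\<psi> \<in> test_functions \<Omega>" for i j and \<psi> :: "real^2 => real"
  using L2_inner_cls[OF G L2_scaleR_vec[OF test_L2[OF that]], of "axis2 i j"]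
  by (simp add: L2_inner_def inner_axis2 mult.commute)
 ultimately show ?thesis unfolding has_weak_jacobian_def by simp
qed

lemma weak_jacobian_unique:
 assumes G: "G \<in> L2 \<Omega>" "G' \<in> L2 \<Omega>" and w: "has_weak_jacobian \<Omega> u G" "has_weak_jacobian \<Omega> u G'"
 shows "cls \<Omega> G = cls \<Omega> G'"
proof -
 define f where "f i j x = indicator \<Omega> x * (G x $ i $ j - G' x $ i $ j)" for i j x
 have "AE x in lebesgue. x \<in> \<Omega> \<longrightarrow> f i j x = 0" for i j proof (rule fundamental_lemma[OF _ op])
  have L: "(\<lambda>x. G x $ i $ j) \<in> L2 \<Omega>" "(\<lambda>x. G' x $ i $ j) \<in> L2 \<Omega>" by (intro L2_nth G)+
  show "sqint (f i j)" using L2_sqint[OF L2_diff[OF L]] by (simp add: f_def[abs_def])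
  fix \<phi> :: "real^2 => real" assume \<phi>: "\<phi> \<in> test_functions \<Omega>"
  have "L2_inner \<Omega> (\<lambda>x. G x $ i $ j - G' x $ i $ j) \<phi> = L2_inner \<Omega> (\<lambda>x. G x $ i $ j) \<phi> - L2_inner \<Omega> (\<lambda>x. G' x $ i $ j) \<phi>"
   by (simp add: L2_inner_cls L2_diff L test_L2 \<phi> cls_diff inner_diff_left)
  also have "\<dots> = 0" using w \<phi> unfolding has_weak_jacobian_def L2_inner_def by simp
  finally show "(\<integral>x. f i j x * \<phi> x \<partial>lebesgue) = 0" by (simp add: L2_inner_def integral_\<Omega> f_def mult.assoc)
 qed
 then have "AE x in lebesgue. \<forall>i j. x \<in> \<Omega> \<longrightarrow> f i j x = 0" unfolding AE_all_countable by blast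
 then show ?thesis unfolding cls_eq_iff[OF G] AE_\<Omega> by eventually_elim (auto simp: f_def vec_eq_iff)
qed

definition grad :: "(real^2 => real^2) => (real^2, real^2^2) l2" where
 "grad u = cls \<Omega> (weak_jacobian \<Omega> u)"

lemma
 assumes "u \<in> H1 \<Omega>"
 shows H1_L2: "u \<in> L2 \<Omega>" and H1_jacobian_L2: "weak_jacobian \<Omega> u \<in> L2 \<Omega>"
  and H1_jacobian: "has_weak_jacobian \<Omega> u (weak_jacobian \<Omega> u)"
proof -
 show "u \<in> L2 \<Omega>" using assms by (simp add: H1_def)
 have "\<exists>G. G \<in> L2 \<Omega> \<and> has_weak_jacobian \<Omega> u G" using assms by (auto simp: H1_def)
 then have "weak_jacobian \<Omega> u \<in> L2 \<Omega> \<and> has_weak_jacobian \<Omega> u (weak_jacobian \<Omega> u)"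
  unfolding weak_jacobian_def by (rule someI_ex)
 then show "weak_jacobian \<Omega> u \<in> L2 \<Omega>" "has_weak_jacobian \<Omega> u (weak_jacobian \<Omega> u)" by auto
qed

lemma H1_I:
 assumes "u \<in> L2 \<Omega>" "G \<in> L2 \<Omega>" "has_weak_jacobian \<Omega> u G"
 shows "u \<in> H1 \<Omega>" "grad u = cls \<Omega> G"
proof -
 show "u \<in> H1 \<Omega>" using assms by (auto simp: H1_def)
 then show "grad u = cls \<Omega> G" unfolding grad_def using weak_jacobian_unique H1_jacobian H1_jacobian_L2 assms by blast
qed

lemma
 assumes u: "u \<in> H1 \<Omega>" and v: "v \<in> H1 \<Omega>"
 shows H1_add: "(\<lambda>x. u x + v x) \<in> H1 \<Omega>" and grad_add: "grad (\<lambda>x. u x + v x) = grad u + grad v"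
  and H1_diff: "(\<lambda>x. u x - v x) \<in> H1 \<Omega>" and grad_diff: "grad (\<lambda>x. u x - v x) = grad u - grad v"
  and H1_scaleR: "(\<lambda>x. c *\<^sub>R u x) \<in> H1 \<Omega>" and grad_scaleR: "grad (\<lambda>x. c *\<^sub>R u x) = c *\<^sub>R grad u"
proof -
 note uL = H1_L2[OF u] H1_jacobian_L2[OF u] and vL = H1_L2[OF v] H1_jacobian_L2[OF v]
 have uw: "cls \<Omega> u \<bullet> cls \<Omega> (\<lambda>x. frechet_derivative \<psi> (at x) (axis j 1) *\<^sub>R axis i 1)
   = - (grad u \<bullet> cls \<Omega> (\<lambda>x. \<psi> x *\<^sub>R axis2 i j))" if "\<psi> \<in> test_functions \<Omega>" for \<psi> i j
  using H1_jacobian[OF u] that unfolding grad_def has_weak_jacobian_iff[OF uL] by blast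
 have vw: "cls \<Omega> v \<bullet> cls \<Omega> (\<lambda>x. frechet_derivative \<psi> (at x) (axis j 1) *\<^sub>R axis i 1)
   = - (grad v \<bullet> cls \<Omega> (\<lambda>x. \<psi> x *\<^sub>R axis2 i j))" if "\<psi> \<in> test_functions \<Omega>" for \<psi> i j
  using H1_jacobian[OF v] that unfolding grad_def has_weak_jacobian_iff[OF vL] by blast
 let ?a = "\<lambda>x. weak_jacobian \<Omega> u x + weak_jacobian \<Omega> v x"
 have "has_weak_jacobian \<Omega> (\<lambda>x. u x + v x) ?a"
  using uw vw by (subst has_weak_jacobian_iff) (auto simp: L2_add uL vL cls_add inner_add_left grad_def)
 note a = H1_I[OF L2_add[OF uL(1) vL(1)] L2_add[OF uL(2) vL(2)] this]
 show "(\<lambda>x. u x + v x) \<in> H1 \<Omega>" by (rule a)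
 show "grad (\<lambda>x. u x + v x) = grad u + grad v" using a(2) by (simp add: cls_add uL vL grad_def)
 let ?d = "\<lambda>x. weak_jacobian \<Omega> u x - weak_jacobian \<Omega> v x"
 have "has_weak_jacobian \<Omega> (\<lambda>x. u x - v x) ?d"
  using uw vw by (subst has_weak_jacobian_iff) (auto simp: L2_diff uL vL cls_diff inner_diff_left grad_def)
 note d = H1_I[OF L2_diff[OF uL(1) vL(1)] L2_diff[OF uL(2) vL(2)] this]
 show "(\<lambda>x. u x - v x) \<in> H1 \<Omega>" by (rule d)
 show "grad (\<lambda>x. u x - v x) = grad u - grad v" using d(2) by (simp add: cls_diff uL vL grad_def)
 let ?c = "\<lambda>x. c *\<^sub>R weak_jacobian \<Omega> u x"
 have "has_weak_jacobian \<Omega> (\<lambda>x. c *\<^sub>R u x) ?c"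
  using uw by (subst has_weak_jacobian_iff) (auto simp: L2_scaleR uL cls_scaleR grad_def)
 note c = H1_I[OF L2_scaleR[OF uL(1)] L2_scaleR[OF uL(2)] this]
 show "(\<lambda>x. c *\<^sub>R u x) \<in> H1 \<Omega>" by (rule c)
 show "grad (\<lambda>x. c *\<^sub>R u x) = c *\<^sub>R grad u" using c(2) by (simp add: cls_scaleR uL grad_def)
qed

lemma H1_norm_eq: "u \<in> H1 \<Omega> ==> H1_norm \<Omega> u = sqrt ((norm (cls \<Omega> u))\<^sup>2 + (norm (grad u))\<^sup>2)"
 by (simp add: H1_norm_def L2_norm_cls H1_L2 H1_jacobian_L2 grad_def)

lemma H10_norm_eq: "u \<in> H1 \<Omega> ==> H10_norm \<Omega> u = norm (grad u)"
 by (simp add: H10_norm_def L2_norm_cls H1_jacobian_L2 grad_def)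

subsection \<open>Test functions\<close>

definition jac :: "(real^2 => real^2) => real^2 => real^2^2" where
 "jac \<phi> x = (\<chi> i j. frechet_derivative \<phi> (at x) (axis j 1) $ i)"

lemma jac_test_L2:
 assumes "\<phi> \<in> test_functions \<Omega>"
 shows "jac \<phi> \<in> L2 \<Omega>"
proof -
 have "jac \<phi> = (\<lambda>x. \<Sum>j\<in>UNIV. \<Sum>i\<in>UNIV. (frechet_derivative \<phi> (at x) (axis j 1) $ i) *\<^sub>R axis2 i j)"
  by (simp add: fun_eq_iff jac_def vec_eq_iff UNIV_2 axis2_def axis_def forall_2)
 moreover have "sqint (\<lambda>x. \<Sum>j\<in>UNIV. \<Sum>i\<in>UNIV. (frechet_derivative \<phi> (at x) (axis j 1) $ i) *\<^sub>R axis2 i j)"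
  by (intro sqint_sum sqint_bounded_linear[OF bounded_linear_scaleR_left]
     sqint_bounded_linear[OF bounded_linear_vec_nth] sqint_test_derivative[OF assms])
 ultimately show ?thesis by (simp add: sqint_L2)
qed

text \<open>Integration by parts with a factor that, like the depth of the water, is differentiable inside the
 domain only.\<close>

lemma smooth_multiple_jacobian:
 fixes k :: "real^2 => real" and dk :: "real^2 => real^2"
 assumes \<phi>: "\<phi> \<in> test_functions \<Omega>" and k: "\<And>x. x \<in> \<Omega> ==> (k has_derivative (\<lambda>w. dk x \<bullet> w)) (at x)"
  and dk: "continuous_on \<Omega> dk"
 shows "has_weak_jacobian \<Omega> (\<lambda>x. k x *\<^sub>R \<phi> x) (\<lambda>x. k x *\<^sub>R jac \<phi> x + (\<chi> i j. \<phi> x $ i * dk x $ j))"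
 unfolding has_weak_jacobian_def
proof (intro ballI allI)
 fix \<psi> :: "real^2 => real" and i j assume \<psi>: "\<psi> \<in> test_functions \<Omega>"
 define D where "D x = frechet_derivative \<phi> (at x)" for x
 have \<phi>d: "((\<lambda>x. \<phi> x $ i) has_derivative (\<lambda>w. D x w $ i)) (at x)" for x
  using bounded_linear.has_derivative[OF bounded_linear_vec_nth[of i] test_has_derivative[OF \<phi>, of x]] by (simp add: D_def)
 have a: "((\<lambda>x. k x * \<phi> x $ i) has_derivative (\<lambda>w. k x * D x w $ i + (dk x \<bullet> w) * \<phi> x $ i)) (at x)" if "x \<in> \<Omega>" for x
  by (rule has_derivative_mult[OF k[OF that] \<phi>d])
 have kc: "continuous_on \<Omega> k" by (rule has_derivative_continuous_on, rule has_derivative_at_withinI, rule k)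
 have c1: "continuous_on \<Omega> (\<lambda>x. D x (axis j 1))"
  unfolding D_def by (rule continuous_on_subset[OF test_derivative_continuous[OF \<phi>]]) simp
 have c2: "continuous_on \<Omega> \<phi>" by (rule continuous_on_subset[OF test_continuous[OF \<phi>]]) simp
 have "continuous_on \<Omega> (\<lambda>x. k x * D x (axis j 1) $ i + (dk x \<bullet> axis j 1) * \<phi> x $ i)"
  by (intro continuous_intros kc c1 c2 dk)
 from integration_by_parts(1)[OF op a this \<psi>]
 show "(LINT x|lebesgue_on \<Omega>. (k x *\<^sub>R \<phi> x) $ i * frechet_derivative \<psi> (at x) (axis j 1))
   = - (LINT x|lebesgue_on \<Omega>. (k x *\<^sub>R jac \<phi> x + (\<chi> i j. \<phi> x $ i * dk x $ j)) $ i $ j * \<psi> x)"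
  by (simp add: integral_\<Omega> jac_def D_def inner_axis mult.commute[of "\<phi> _ $ i" "dk _ $ j"])
qed

lemma
 assumes \<phi>: "\<phi> \<in> test_functions \<Omega>"
 shows test_H1: "\<phi> \<in> H1 \<Omega>" and grad_test: "grad \<phi> = cls \<Omega> (jac \<phi>)"
proof -
 have "has_weak_jacobian \<Omega> (\<lambda>x. 1 *\<^sub>R \<phi> x) (\<lambda>x. 1 *\<^sub>R jac \<phi> x + (\<chi> i j. \<phi> x $ i * (\<lambda>x. 0) x $ j))"
  by (rule smooth_multiple_jacobian[OF \<phi>]) auto
 moreover have "(\<lambda>x. 1 *\<^sub>R jac \<phi> x + (\<chi> i j. \<phi> x $ i * (\<lambda>x. 0) x $ j)) = jac \<phi>" by (simp add: fun_eq_iff vec_eq_iff)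
 ultimately have "has_weak_jacobian \<Omega> \<phi> (jac \<phi>)" by simp
 from H1_I[OF test_L2[OF \<phi>] jac_test_L2[OF \<phi>] this] show "\<phi> \<in> H1 \<Omega>" "grad \<phi> = cls \<Omega> (jac \<phi>)" by auto
qed

lemma
 fixes \<phi> :: "'a::euclidean_space => real^'n"
 assumes \<phi>: "\<phi> \<in> test_functions S"
 shows test_nth: "(\<lambda>x. \<phi> x $ i) \<in> test_functions S"
  and test_nth_derivative: "frechet_derivative (\<lambda>x. \<phi> x $ i) (at x) v = frechet_derivative \<phi> (at x) v $ i"
proof -
 have sub: "closure {x. \<phi> x $ i \<noteq> 0} \<subseteq> closure {x. \<phi> x \<noteq> 0}" by (rule closure_mono) auto
 then have "compact (closure {x. \<phi> x $ i \<noteq> 0})"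
  using test_compact[OF \<phi>] by (metis closed_closure compact_Int_closed inf.absorb_iff2)
 then show "(\<lambda>x. \<phi> x $ i) \<in> test_functions S"
  using \<phi> sub Ck_bounded_linear[OF bounded_linear_vec_nth[of i], of _ \<phi>] unfolding test_functions_def smooth_on_def by auto
 have d: "((\<lambda>x. \<phi> x $ i) has_derivative (\<lambda>v. frechet_derivative \<phi> (at x) v $ i)) (at x)"
  by (rule bounded_linear.has_derivative[OF bounded_linear_vec_nth test_has_derivative[OF \<phi>]])
 show "frechet_derivative (\<lambda>x. \<phi> x $ i) (at x) v = frechet_derivative \<phi> (at x) v $ i"
  using frechet_derivative_at[OF d] by metis
qed

lemma cls_test: "\<phi> \<in> test_functions \<Omega> ==> cls \<Omega> \<phi> = abs_l2 \<phi>" for \<phi> :: "real^2 => 'b::euclidean_space"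
proof -
 assume \<phi>: "\<phi> \<in> test_functions \<Omega>"
 have z: "\<phi> x = 0" if "x \<notin> \<Omega>" for x by (rule test_zero[OF \<phi> contra_subsetD[OF test_support[OF \<phi>] that]])
 have "(\<lambda>x. indicator \<Omega> x *\<^sub>R \<phi> x) = \<phi>" by (auto simp: fun_eq_iff indicator_def z)
 then show ?thesis by (simp only: cls_def)
qed

lemma cls_test_deriv: "\<phi> \<in> test_functions \<Omega> ==> cls \<Omega> (\<lambda>x. frechet_derivative \<phi> (at x) v) = abs_l2 (\<lambda>x. frechet_derivative \<phi> (at x) v)"
 for \<phi> :: "real^2 => 'b::euclidean_space"
proof -
 assume \<phi>: "\<phi> \<in> test_functions \<Omega>"
 have z: "frechet_derivative \<phi> (at x) v = 0" if "x \<notin> \<Omega>" for x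
  by (rule test_derivative_zero[OF \<phi> contra_subsetD[OF test_support[OF \<phi>] that]])
 have "(\<lambda>x. indicator \<Omega> x *\<^sub>R frechet_derivative \<phi> (at x) v) = (\<lambda>x. frechet_derivative \<phi> (at x) v)"
  by (auto simp: fun_eq_iff indicator_def z)
 then show ?thesis by (simp only: cls_def)
qed

lemma norm_deriv_le_grad:
 assumes \<phi>: "\<phi> \<in> test_functions \<Omega>"
 shows "norm (abs_l2 (\<lambda>x. frechet_derivative (\<lambda>x. \<phi> x $ i) (at x) (axis j 1))) \<le> norm (grad \<phi>)"
proof -
 have "norm (cls \<Omega> (\<lambda>x. frechet_derivative (\<lambda>x. \<phi> x $ i) (at x) (axis j 1))) \<le> 1 * norm (cls \<Omega> (jac \<phi>))"
  unfolding cls_def proof (rule norm_l2_mono[OF L2_sqint L2_sqint])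
  show "(\<lambda>x. frechet_derivative (\<lambda>x. \<phi> x $ i) (at x) (axis j 1)) \<in> L2 \<Omega>" by (rule test_deriv_L2[OF test_nth[OF \<phi>]])
  have "\<bar>frechet_derivative \<phi> (at x) (axis j 1) $ i\<bar> \<le> norm (jac \<phi> x)" for x
   using order_trans[OF component_le_norm_cart[of "jac \<phi> x $ i" j] Finite_Cartesian_Product.norm_nth_le[of "jac \<phi> x" i]]
   by (simp add: jac_def)
  then show "AE x in lebesgue. norm (indicator \<Omega> x *\<^sub>R frechet_derivative (\<lambda>x. \<phi> x $ i) (at x) (axis j 1))
    \<le> 1 * norm (indicator \<Omega> x *\<^sub>R jac \<phi> x)"
   by (intro AE_I2) (auto simp: test_nth_derivative[OF \<phi>] indicator_def)
 qed (auto simp: jac_test_L2 \<phi>)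
 then show ?thesis by (simp add: cls_test_deriv[OF test_nth[OF \<phi>]] grad_test \<phi>)
qed

definition Rad :: real where "Rad = (SOME R. R > 0 \<and> (\<forall>x\<in>\<Omega>. norm x \<le> R))"

lemma Rad: "Rad > 0" "x \<in> \<Omega> ==> norm x \<le> Rad"
proof -
 have "\<exists>R. R > 0 \<and> (\<forall>x\<in>\<Omega>. norm x \<le> R)" using bd by (simp add: bounded_pos)
 then have "Rad > 0 \<and> (\<forall>x\<in>\<Omega>. norm x \<le> Rad)" unfolding Rad_def by (rule someI_ex)
 then show "Rad > 0" "x \<in> \<Omega> ==> norm x \<le> Rad" by auto
qed

lemma poincare_nth:
 assumes \<phi>: "\<phi> \<in> test_functions \<Omega>"
 shows "norm (abs_l2 (\<lambda>x. \<phi> x $ i)) \<le> 2 * Rad * norm (grad \<phi>)"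
proof -
 have "norm (abs_l2 (\<lambda>x. \<phi> x $ i)) \<le> 2 * Rad * norm (abs_l2 (\<lambda>x. frechet_derivative (\<lambda>x. \<phi> x $ i) (at x) (axis 1 1)))"
 proof (rule poincare_test[OF op test_nth[OF \<phi>]])
  show "\<bar>x \<bullet> axis 1 1\<bar> \<le> Rad" if "x \<in> \<Omega>" for x
   using component_le_norm_cart[of x 1] Rad(2)[OF that] by (simp add: inner_axis)
 qed (use Rad in auto)
 also have "\<dots> \<le> 2 * Rad * norm (grad \<phi>)" using norm_deriv_le_grad[OF \<phi>] Rad(1) by (intro mult_left_mono) auto
 finally show ?thesis .
qed

lemma poincare_vec:
 assumes \<phi>: "\<phi> \<in> test_functions \<Omega>"
 shows "norm (cls \<Omega> \<phi>) \<le> 4 * Rad * norm (grad \<phi>)"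
proof -
 have s: "sqint (\<lambda>x. \<phi> x $ i)" for i by (rule sqint_test[OF test_nth[OF \<phi>]])
 have s': "sqint (\<lambda>x. \<phi> x $ i *\<^sub>R (axis i 1 :: real^2))" for i
  by (rule sqint_bounded_linear[OF bounded_linear_scaleR_left s])
 have "\<phi> = (\<lambda>x. \<Sum>i\<in>UNIV. \<phi> x $ i *\<^sub>R axis i 1)" by (simp add: fun_eq_iff vec_eq_iff UNIV_2 axis_def forall_2)
 then have "norm (abs_l2 \<phi>) = norm (abs_l2 (\<lambda>x. \<Sum>i\<in>UNIV. \<phi> x $ i *\<^sub>R (axis i 1 :: real^2)))" by simp
 also have "\<dots> \<le> (\<Sum>i\<in>UNIV. norm (abs_l2 (\<lambda>x. \<phi> x $ i *\<^sub>R (axis i 1 :: real^2))))" by (rule norm_abs_l2_sum) (rule s')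
 also have "\<dots> \<le> (\<Sum>i\<in>(UNIV :: 2 set). 2 * Rad * norm (grad \<phi>))" proof (rule sum_mono)
  fix i :: 2
  have "norm (abs_l2 (\<lambda>x. \<phi> x $ i *\<^sub>R (axis i 1 :: real^2))) \<le> 1 * norm (abs_l2 (\<lambda>x. \<phi> x $ i))"
   by (rule norm_l2_mono[OF s' s]) auto
  then show "norm (abs_l2 (\<lambda>x. \<phi> x $ i *\<^sub>R (axis i 1 :: real^2))) \<le> 2 * Rad * norm (grad \<phi>)"
   using poincare_nth[OF \<phi>, of i] by simp
 qed
 also have "\<dots> = 4 * Rad * norm (grad \<phi>)" by simp
 finally show ?thesis by (simp add: cls_test \<phi>)
qed

text \<open>Ladyzhenskaya's inequality for the components, with the lower norms eliminated by Poincare's.\<close>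

lemma quartic_test:
 assumes \<phi>: "\<phi> \<in> test_functions \<Omega>"
 shows "(\<integral>\<^sup>+x. ennreal ((norm (\<phi> x)) ^ 4) \<partial>lebesgue) \<le> ennreal (64 * Rad\<^sup>2 * (norm (grad \<phi>)) ^ 4)"
proof -
 let ?G = "norm (grad \<phi>)"
 define X where "X = 16 * Rad\<^sup>2 * ?G ^ 4"
 have [measurable]: "(\<lambda>x. \<phi> x $ i) \<in> borel_measurable lborel" for i
  using test_continuous[OF test_nth[OF \<phi>]] by (auto intro: borel_measurable_continuous_onI)
 have 1: "(\<integral>\<^sup>+x. ennreal ((\<phi> x $ i) ^ 4) \<partial>lborel) \<le> ennreal (16 * Rad\<^sup>2 * ?G ^ 4)" for i proof -
  let ?D = "\<lambda>j. norm (abs_l2 (\<lambda>x. frechet_derivative (\<lambda>x. \<phi> x $ i) (at x) (axis j 1)))"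
  have "4 * (norm (abs_l2 (\<lambda>x. \<phi> x $ i)))\<^sup>2 * ?D 1 * ?D 2 \<le> 4 * (2 * Rad * ?G)\<^sup>2 * ?G * ?G"
   using Rad(1) by (intro mult_mono power_mono poincare_nth norm_deriv_le_grad \<phi>) auto
  also have "\<dots> = 16 * Rad\<^sup>2 * ?G ^ 4" by (simp add: power2_eq_square power4_eq_xxxx)
  finally show ?thesis using ladyzhenskaya_test[OF test_nth[OF \<phi>, of i]] by (meson ennreal_leI order_trans)
 qed
 have "(\<integral>\<^sup>+x. ennreal ((norm (\<phi> x)) ^ 4) \<partial>lebesgue) \<le> (\<integral>\<^sup>+x. ennreal (2 * (\<phi> x $ 1) ^ 4) + ennreal (2 * (\<phi> x $ 2) ^ 4) \<partial>lebesgue)"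
 proof (intro nn_integral_mono)
  fix x
  have "(norm (\<phi> x))\<^sup>2 = (\<phi> x $ 1)\<^sup>2 + (\<phi> x $ 2)\<^sup>2" by (simp add: norm_vec_def L2_set_def UNIV_2)
  then have "(norm (\<phi> x)) ^ 4 = ((\<phi> x $ 1)\<^sup>2 + (\<phi> x $ 2)\<^sup>2)\<^sup>2"
   by (metis power_even_eq numeral_Bit0 mult_2 power_mult numeral_code(1) mult.commute numerals(1) one_add_one)
  also have "\<dots> \<le> 2 * (\<phi> x $ 1) ^ 4 + 2 * (\<phi> x $ 2) ^ 4"
   using sum_squares_bound[of "(\<phi> x $ 1)\<^sup>2" "(\<phi> x $ 2)\<^sup>2"] by (simp add: power2_sum power_mult[symmetric])
  finally show "ennreal ((norm (\<phi> x)) ^ 4) \<le> ennreal (2 * (\<phi> x $ 1) ^ 4) + ennreal (2 * (\<phi> x $ 2) ^ 4)"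
   by (simp flip: ennreal_plus add: ennreal_leI)
 qed
 also have "\<dots> = 2 * (\<integral>\<^sup>+x. ennreal ((\<phi> x $ 1) ^ 4) \<partial>lborel) + 2 * (\<integral>\<^sup>+x. ennreal ((\<phi> x $ 2) ^ 4) \<partial>lborel)"
  by (simp add: nn_integral_completion nn_integral_add nn_integral_cmult ennreal_mult)
 also have "\<dots> \<le> 2 * ennreal X + 2 * ennreal X" unfolding X_def by (intro add_mono mult_left_mono 1) auto
 also have "\<dots> = ennreal (64 * Rad\<^sup>2 * ?G ^ 4)" proof -
  have X0: "X \<ge> 0" by (simp add: X_def)
  then have "2 * ennreal X + 2 * ennreal X = ennreal (2 * X) + ennreal (2 * X)" by (simp add: ennreal_mult)
  also have "\<dots> = ennreal (2 * X + 2 * X)" by (rule ennreal_plus[symmetric]) (use X0 in auto)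
  finally have "2 * ennreal X + 2 * ennreal X = ennreal (4 * X)" by simp
  then show ?thesis by (simp only: X_def mult.assoc[symmetric]) simp
 qed
 finally show ?thesis .
qed

end

lemma compact_if_closed_subset: "compact K ==> closed C ==> C \<subseteq> K ==> compact C"
 for K C :: "'a::t2_space set" by (metis compact_Int_closed inf.absorb_iff2)

lemma tendsto_const_diff_iff: "(\<lambda>n. a - b n) \<longlonglongrightarrow> 0 \<longleftrightarrow> b \<longlonglongrightarrow> a"
 for a :: "'c::real_normed_vector" using tendsto_diff[OF tendsto_const[of a], of "\<lambda>n. a - b n" 0 sequentially]
  tendsto_diff[OF tendsto_const[of a], of b a sequentially] by auto

lemma tendsto_if_close:
 fixes a b :: "nat => 'c::real_normed_vector"
 assumes a: "a \<longlonglongrightarrow> l" and ab: "\<And>n. norm (a n - b n) < 1 / real (Suc n)"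
 shows "b \<longlonglongrightarrow> l"
proof -
 have "(\<lambda>n. a n - b n) \<longlonglongrightarrow> 0" by (rule Lim_null_comparison[OF _ LIMSEQ_Suc[OF lim_const_over_n[of "1::real"]]])
    (use ab in \<open>auto intro!: always_eventually less_imp_le\<close>)
 from tendsto_diff[OF a this] show ?thesis by simp
qed

lemma
 fixes \<phi> \<psi> :: "'a::euclidean_space => 'b::real_normed_vector"
 assumes \<phi>: "\<phi> \<in> test_functions S" and \<psi>: "\<psi> \<in> test_functions S"
 shows test_add: "(\<lambda>x. \<phi> x + \<psi> x) \<in> test_functions S"
  and test_bounded_linear: "bounded_linear L ==> (\<lambda>x. L (\<phi> x)) \<in> test_functions S"
proof -
 have Ck: "Ck_on k UNIV (\<lambda>x. f x + g x)" if "Ck_on k UNIV f" "Ck_on k UNIV g" for k and f g :: "'a => 'b" using that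
 proof (induction k arbitrary: f g)
  case 0 then show ?case by (auto intro: continuous_on_add)
 next
  case (Suc k)
  have "f differentiable at x" "g differentiable at x" for x using Suc.prems by simp_all
  then have d: "((\<lambda>x. f x + g x) has_derivative (\<lambda>v. frechet_derivative f (at x) v + frechet_derivative g (at x) v)) (at x)" for x
   by (intro has_derivative_add) (simp_all only: frechet_derivative_works[symmetric])
  have fd: "frechet_derivative (\<lambda>x. f x + g x) (at x) = (\<lambda>v. frechet_derivative f (at x) v + frechet_derivative g (at x) v)" for x
   using frechet_derivative_at[OF d[of x]] by simp
  have "Ck_on k UNIV (\<lambda>x. frechet_derivative f (at x) v + frechet_derivative g (at x) v)" for v
   by (rule Suc.IH) (use Suc.prems in simp_all)
  then show ?case unfolding Ck_on.simps fd by (intro conjI ballI allI differentiableI[OF d])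
 qed
 have sm: "Ck_on k UNIV \<phi>" "Ck_on k UNIV \<psi>" for k using \<phi> \<psi> by (simp_all add: test_functions_def smooth_on_def)
 have sub: "closure {x. \<phi> x + \<psi> x \<noteq> 0} \<subseteq> closure {x. \<phi> x \<noteq> 0} \<union> closure {x. \<psi> x \<noteq> 0}"
  unfolding closure_Un[symmetric] by (rule closure_mono) auto
 have c: "compact (closure {x. \<phi> x + \<psi> x \<noteq> 0})"
  by (rule compact_if_closed_subset[OF compact_Un[OF test_compact[OF \<phi>] test_compact[OF \<psi>]] closed_closure sub])
 show "(\<lambda>x. \<phi> x + \<psi> x) \<in> test_functions S" unfolding test_functions_def mem_Collect_eq smooth_on_def
  by (intro conjI allI Ck sm c order_trans[OF sub Un_least[OF test_support[OF \<phi>] test_support[OF \<psi>]]])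
 assume L: "bounded_linear L"
 have sub: "closure {x. L (\<phi> x) \<noteq> 0} \<subseteq> closure {x. \<phi> x \<noteq> 0}"
  by (rule closure_mono) (auto simp: linear_0[OF bounded_linear.linear[OF L]])
 have c: "compact (closure {x. L (\<phi> x) \<noteq> 0})"
  by (rule compact_if_closed_subset[OF test_compact[OF \<phi>] closed_closure sub])
 show "(\<lambda>x. L (\<phi> x)) \<in> test_functions S" unfolding test_functions_def mem_Collect_eq smooth_on_def
  by (intro conjI allI Ck_bounded_linear[OF L] sm c order_trans[OF sub test_support[OF \<phi>]])
qed

context bounded_open begin

subsection \<open>The space with zero boundary values\<close>

lemma H10_iff:
 "u \<in> H10 \<Omega> \<longleftrightarrow> u \<in> H1 \<Omega> \<and> (\<exists>\<phi>. (\<forall>n. \<phi> n \<in> test_functions \<Omega>) \<and>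
   (\<lambda>n. cls \<Omega> (\<phi> n)) \<longlonglongrightarrow> cls \<Omega> u \<and> (\<lambda>n. grad (\<phi> n)) \<longlonglongrightarrow> grad u)"
proof -
 have "(\<lambda>n. H1_norm \<Omega> (\<lambda>x. u x - \<phi> n x)) \<longlonglongrightarrow> 0 \<longleftrightarrow>
   (\<lambda>n. cls \<Omega> (\<phi> n)) \<longlonglongrightarrow> cls \<Omega> u \<and> (\<lambda>n. grad (\<phi> n)) \<longlonglongrightarrow> grad u"
  if u: "u \<in> H1 \<Omega>" and \<phi>: "\<And>n. \<phi> n \<in> test_functions \<Omega>" for \<phi> proof -
  have eq: "H1_norm \<Omega> (\<lambda>x. u x - \<phi> n x) = norm (cls \<Omega> u - cls \<Omega> (\<phi> n), grad u - grad (\<phi> n))" for n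
   using H1_diff[OF u test_H1[OF \<phi>]]
   by (simp add: H1_norm_eq grad_diff[OF u test_H1[OF \<phi>]] cls_diff H1_L2 u test_L2 \<phi> norm_Pair)
  have "(\<lambda>n. (cls \<Omega> u - cls \<Omega> (\<phi> n), grad u - grad (\<phi> n))) \<longlonglongrightarrow> (0, 0) \<longleftrightarrow>
   (\<lambda>n. cls \<Omega> u - cls \<Omega> (\<phi> n)) \<longlonglongrightarrow> 0 \<and> (\<lambda>n. grad u - grad (\<phi> n)) \<longlonglongrightarrow> 0"
   by (auto dest: tendsto_fst tendsto_snd intro: tendsto_Pair)
  then show ?thesis unfolding eq tendsto_norm_zero_iff by (simp add: zero_prod_def tendsto_const_diff_iff)
 qed
 then show ?thesis unfolding H10_def by blast
qed

lemma H10_H1: "u \<in> H10 \<Omega> ==> u \<in> H1 \<Omega>" by (simp add: H10_def)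

lemma H10_L2: "u \<in> H10 \<Omega> ==> u \<in> L2 \<Omega>" by (intro H1_L2 H10_H1)

lemma test_H10: "\<phi> \<in> test_functions \<Omega> ==> \<phi> \<in> H10 \<Omega>"
 unfolding H10_iff by (auto simp: test_H1 intro!: exI[of _ "\<lambda>n. \<phi>"])

lemma H10_add:
 assumes u: "u \<in> H10 \<Omega>" and v: "v \<in> H10 \<Omega>"
 shows "(\<lambda>x. u x + v x) \<in> H10 \<Omega>"
proof -
 obtain \<phi> \<psi> where \<phi>: "\<And>n. \<phi> n \<in> test_functions \<Omega>" "(\<lambda>n. cls \<Omega> (\<phi> n)) \<longlonglongrightarrow> cls \<Omega> u" "(\<lambda>n. grad (\<phi> n)) \<longlonglongrightarrow> grad u"
  and \<psi>: "\<And>n. \<psi> n \<in> test_functions \<Omega>" "(\<lambda>n. cls \<Omega> (\<psi> n)) \<longlonglongrightarrow> cls \<Omega> v" "(\<lambda>n. grad (\<psi> n)) \<longlonglongrightarrow> grad v"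
  using u v unfolding H10_iff by blast
 have "(\<lambda>n. cls \<Omega> (\<lambda>x. \<phi> n x + \<psi> n x)) \<longlonglongrightarrow> cls \<Omega> (\<lambda>x. u x + v x)"
  by (simp add: cls_add test_L2 \<phi> \<psi> H10_L2 u v tendsto_add)
 moreover have "(\<lambda>n. grad (\<lambda>x. \<phi> n x + \<psi> n x)) \<longlonglongrightarrow> grad (\<lambda>x. u x + v x)"
  by (simp add: grad_add test_H1 \<phi> \<psi> H10_H1 u v tendsto_add)
 ultimately show ?thesis unfolding H10_iff using H1_add[OF H10_H1[OF u] H10_H1[OF v]] test_add[OF \<phi>(1) \<psi>(1)]
  by (intro conjI exI[of _ "\<lambda>n x. \<phi> n x + \<psi> n x"]) auto
qed

lemma H10_scaleR:
 assumes u: "u \<in> H10 \<Omega>"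
 shows "(\<lambda>x. c *\<^sub>R u x) \<in> H10 \<Omega>"
proof -
 obtain \<phi> where \<phi>: "\<And>n. \<phi> n \<in> test_functions \<Omega>" "(\<lambda>n. cls \<Omega> (\<phi> n)) \<longlonglongrightarrow> cls \<Omega> u" "(\<lambda>n. grad (\<phi> n)) \<longlonglongrightarrow> grad u"
  using u unfolding H10_iff by blast
 have "(\<lambda>n. cls \<Omega> (\<lambda>x. c *\<^sub>R \<phi> n x)) \<longlonglongrightarrow> cls \<Omega> (\<lambda>x. c *\<^sub>R u x)"
  by (simp add: cls_scaleR test_L2 \<phi> H10_L2 u tendsto_scaleR)
 moreover have "(\<lambda>n. grad (\<lambda>x. c *\<^sub>R \<phi> n x)) \<longlonglongrightarrow> grad (\<lambda>x. c *\<^sub>R u x)"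
  by (simp add: grad_scaleR[OF test_H1[OF \<phi>(1)] test_H1[OF \<phi>(1)]] grad_scaleR[OF H10_H1[OF u] H10_H1[OF u]] \<phi> tendsto_scaleR)
 ultimately show ?thesis
  unfolding H10_iff using H1_scaleR[OF H10_H1[OF u] H10_H1[OF u]] test_bounded_linear[OF \<phi>(1) \<phi>(1) bounded_linear_scaleR_right]
  by (intro conjI exI[of _ "\<lambda>n x. c *\<^sub>R \<phi> n x"]) auto
qed

lemma H10_diff: "u \<in> H10 \<Omega> ==> v \<in> H10 \<Omega> ==> (\<lambda>x. u x - v x) \<in> H10 \<Omega>"
 using H10_add[OF _ H10_scaleR, of u v "-1"] by simp

lemma H10_zero: "(\<lambda>x. 0) \<in> H10 \<Omega>"
proof -
 have "(\<lambda>x. 0 :: real^2) \<in> test_functions \<Omega>"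
  using bumps_Ck[OF bumps.const[of 0]] by (auto simp: test_functions_def smooth_on_def)
 then show ?thesis by (rule test_H10)
qed

lemma grad_scale: "u \<in> H1 \<Omega> ==> grad (\<lambda>x. c *\<^sub>R u x) = c *\<^sub>R grad u"
 by (rule grad_scaleR)

lemma poincare:
 assumes u: "u \<in> H10 \<Omega>"
 shows "norm (cls \<Omega> u) \<le> 4 * Rad * norm (grad u)"
proof -
 obtain \<phi> where \<phi>: "\<And>n. \<phi> n \<in> test_functions \<Omega>" "(\<lambda>n. cls \<Omega> (\<phi> n)) \<longlonglongrightarrow> cls \<Omega> u" "(\<lambda>n. grad (\<phi> n)) \<longlonglongrightarrow> grad u"
  using u unfolding H10_iff by blast
 show ?thesis by (rule LIMSEQ_le[OF tendsto_norm[OF \<phi>(2)] tendsto_mult_left[OF tendsto_norm[OF \<phi>(3)]]])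
    (use poincare_vec \<phi>(1) in auto)
qed

text \<open>By Poincare's inequality the fields converge together with their gradients; a diagonal sequence of
 test functions approximates the limit.\<close>

lemma H10_complete:
 assumes u: "\<And>n. u n \<in> H10 \<Omega>" and G: "(\<lambda>n. grad (u n)) \<longlonglongrightarrow> G"
 obtains v where "v \<in> H10 \<Omega>" "grad v = G"
proof -
 have "Cauchy (\<lambda>n. cls \<Omega> (u n))" proof (rule CauchyI)
  fix e :: real assume e: "e > 0"
  have "e / (4 * Rad) > 0" using e Rad(1) by simp
  from CauchyD[OF LIMSEQ_imp_Cauchy[OF G] this] obtain N where
   N: "\<And>m n. m \<ge> N ==> n \<ge> N ==> norm (grad (u m) - grad (u n)) < e / (4 * Rad)" by blast
  have "norm (cls \<Omega> (u m) - cls \<Omega> (u n)) < e" if "m \<ge> N" "n \<ge> N" for m n proof -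
   have "norm (cls \<Omega> (u m) - cls \<Omega> (u n)) \<le> 4 * Rad * norm (grad (u m) - grad (u n))"
    using poincare[OF H10_diff[OF u u], of m n] grad_diff[OF H10_H1[OF u] H10_H1[OF u], of m n]
    by (simp add: cls_diff H10_L2 u)
   also have "\<dots> < 4 * Rad * (e / (4 * Rad))" using N[OF that] Rad(1) by (intro mult_strict_left_mono) auto
   finally show ?thesis using Rad(1) by simp
  qed
  then show "\<exists>M. \<forall>m\<ge>M. \<forall>n\<ge>M. norm (cls \<Omega> (u m) - cls \<Omega> (u n)) < e" by blast
 qed
 then obtain y where y: "(\<lambda>n. cls \<Omega> (u n)) \<longlonglongrightarrow> y" using Cauchy_convergent convergent_def by blast
 have Gy: "cls \<Omega> (rep_l2 y) = y" "cls \<Omega> (rep_l2 G) = G" proof -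
  have "(\<lambda>n. cls \<Omega> (rep_l2 (cls \<Omega> (u n)))) \<longlonglongrightarrow> cls \<Omega> (rep_l2 y)"
   by (rule bounded_linear.tendsto[OF bounded_linear_cls_rep y])
  then show "cls \<Omega> (rep_l2 y) = y" using y LIMSEQ_unique by (simp add: cls_rep_cls H10_L2 u)
  have "(\<lambda>n. cls \<Omega> (rep_l2 (grad (u n)))) \<longlonglongrightarrow> cls \<Omega> (rep_l2 G)"
   by (rule bounded_linear.tendsto[OF bounded_linear_cls_rep G])
  then show "cls \<Omega> (rep_l2 G) = G" using G LIMSEQ_unique by (simp add: grad_def cls_rep_cls H1_jacobian_L2 H10_H1 u)
 qed
 have "has_weak_jacobian \<Omega> (rep_l2 y) (rep_l2 G)" unfolding has_weak_jacobian_iff[OF rep_L2 rep_L2] Gy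
 proof (intro ballI allI)
  fix \<psi> :: "real^2 => real" and i j assume \<psi>: "\<psi> \<in> test_functions \<Omega>"
  let ?D = "cls \<Omega> (\<lambda>x. frechet_derivative \<psi> (at x) (axis j 1) *\<^sub>R axis i 1) :: (real^2, real^2) l2"
  have "cls \<Omega> (u n) \<bullet> ?D = - (grad (u n) \<bullet> cls \<Omega> (\<lambda>x. \<psi> x *\<^sub>R axis2 i j))" for n
   using H1_jacobian[OF H10_H1[OF u[of n]]] \<psi>
   unfolding grad_def has_weak_jacobian_iff[OF H10_L2[OF u] H1_jacobian_L2[OF H10_H1[OF u]]] by blast
  moreover have "(\<lambda>n. cls \<Omega> (u n) \<bullet> ?D) \<longlonglongrightarrow> y \<bullet> ?D" by (intro tendsto_intros y)
  moreover have "(\<lambda>n. - (grad (u n) \<bullet> cls \<Omega> (\<lambda>x. \<psi> x *\<^sub>R axis2 i j))) \<longlonglongrightarrow> - (G \<bullet> cls \<Omega> (\<lambda>x. \<psi> x *\<^sub>R axis2 i j))"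
   by (intro tendsto_intros G)
  ultimately show "y \<bullet> ?D = - (G \<bullet> cls \<Omega> (\<lambda>x. \<psi> x *\<^sub>R axis2 i j))" using LIMSEQ_unique by simp
 qed
 note vH = H1_I[OF rep_L2 rep_L2 this, unfolded Gy]
 have "\<exists>\<phi>. \<phi> \<in> test_functions \<Omega> \<and> norm (cls \<Omega> (u n) - cls \<Omega> \<phi>) < 1 / real (Suc n)
   \<and> norm (grad (u n) - grad \<phi>) < 1 / real (Suc n)" for n
 proof -
  obtain \<phi> where \<phi>: "\<And>k. \<phi> k \<in> test_functions \<Omega>" "(\<lambda>k. cls \<Omega> (\<phi> k)) \<longlonglongrightarrow> cls \<Omega> (u n)" "(\<lambda>k. grad (\<phi> k)) \<longlonglongrightarrow> grad (u n)"
   using u[of n] unfolding H10_iff by blast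
  obtain M where M: "\<And>k. k \<ge> M ==> norm (cls \<Omega> (\<phi> k) - cls \<Omega> (u n)) < 1 / real (Suc n)"
   using LIMSEQ_D[OF \<phi>(2), of "1 / real (Suc n)"] by auto
  obtain M' where M': "\<And>k. k \<ge> M' ==> norm (grad (\<phi> k) - grad (u n)) < 1 / real (Suc n)"
   using LIMSEQ_D[OF \<phi>(3), of "1 / real (Suc n)"] by auto
  show ?thesis using \<phi>(1)[of "max M M'"] M[of "max M M'"] M'[of "max M M'"]
   by (intro exI[of _ "\<phi> (max M M')"]) (simp add: norm_minus_commute)
 qed
 then obtain \<phi> where \<phi>: "\<And>n. \<phi> n \<in> test_functions \<Omega>" "\<And>n. norm (cls \<Omega> (u n) - cls \<Omega> (\<phi> n)) < 1 / real (Suc n)"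
  "\<And>n. norm (grad (u n) - grad (\<phi> n)) < 1 / real (Suc n)" by metis
 have "rep_l2 y \<in> H10 \<Omega>" unfolding H10_iff vH(2) Gy
  using vH(1) \<phi>(1) tendsto_if_close[OF y \<phi>(2)] tendsto_if_close[OF G \<phi>(3)] by blast
 then show ?thesis using that vH(2) by blast
qed

text \<open>The space \<open>H10\<close>, represented by gradients; the norm of \<open>H10\<close> becomes the norm of the ambient
 space.\<close>

definition V0 :: "(real^2, real^2^2) l2 set" where "V0 = grad ` H10 \<Omega>"

lemma subspace_V0: "subspace V0"
proof (rule subspaceI)
 have "grad (\<lambda>x. 0 *\<^sub>R (0::real^2)) = 0 *\<^sub>R grad (\<lambda>x. 0)" by (rule grad_scale[OF H10_H1[OF H10_zero]])
 then show "0 \<in> V0" using H10_zero unfolding V0_def by (intro image_eqI[of _ _ "\<lambda>x. 0"]) auto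
 show "x + y \<in> V0" if "x \<in> V0" "y \<in> V0" for x y
  using that unfolding V0_def by (auto simp: grad_add[OF H10_H1 H10_H1, symmetric] intro!: imageI H10_add)
 show "c *\<^sub>R x \<in> V0" if "x \<in> V0" for c x
  using that unfolding V0_def by (auto simp: grad_scale[OF H10_H1, symmetric] intro!: imageI H10_scaleR)
qed

lemma closure_V0: "closure V0 = V0"
proof
 show "closure V0 \<subseteq> V0" proof
  fix G assume "G \<in> closure V0"
  then obtain s where s: "\<forall>n. s n \<in> V0" "s \<longlonglongrightarrow> G" unfolding closure_sequential by blast
  then have "\<forall>n. \<exists>u. u \<in> H10 \<Omega> \<and> s n = grad u" by (auto simp: V0_def)
  then obtain u where u: "\<And>n. u n \<in> H10 \<Omega>" "\<And>n. s n = grad (u n)" by metis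
  have "s = (\<lambda>n. grad (u n))" using u(2) by (rule ext)
  then have "(\<lambda>n. grad (u n)) \<longlonglongrightarrow> G" using s(2) by simp
  then obtain v where "v \<in> H10 \<Omega>" "grad v = G" by (rule H10_complete[OF u(1)])
  then show "G \<in> V0" by (auto simp: V0_def)
 qed
qed (rule closure_subset)

definition PV :: "(real^2, real^2^2) l2 => (real^2, real^2^2) l2" where "PV = proj V0"

lemma PV: "bounded_linear PV" "PV x \<bullet> y = x \<bullet> PV y" "PV x \<in> V0" "x \<in> V0 ==> PV x = x" "PV (PV x) = PV x"
proof -
 show "bounded_linear PV" unfolding PV_def by (rule bounded_linear_proj[OF subspace_V0])
 show "PV x \<bullet> y = x \<bullet> PV y" unfolding PV_def by (rule proj_symmetric[OF subspace_V0])
 show 1: "PV x \<in> V0" for x unfolding PV_def using proj_in_closure[OF subspace_V0] closure_V0 by auto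
 show 2: "x \<in> V0 ==> PV x = x" for x unfolding PV_def using proj_id[OF subspace_V0] closure_V0 by auto
 show "PV (PV x) = PV x" by (rule 2[OF 1])
qed

lemma PV_grad: "u \<in> H10 \<Omega> ==> PV (grad u) = grad u" by (rule PV(4)) (simp add: V0_def)

definition lift :: "(real^2, real^2^2) l2 => real^2 => real^2" where
 "lift x = (SOME u. u \<in> H10 \<Omega> \<and> grad u = PV x)"

lemma lift: "lift x \<in> H10 \<Omega>" "grad (lift x) = PV x"
proof -
 have "\<exists>u. u \<in> H10 \<Omega> \<and> grad u = PV x" using PV(3)[of x] by (auto simp: V0_def)
 then have "lift x \<in> H10 \<Omega> \<and> grad (lift x) = PV x" unfolding lift_def by (rule someI_ex)
 then show "lift x \<in> H10 \<Omega>" "grad (lift x) = PV x" by auto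
qed

text \<open>The embedding of \<open>H10\<close> in \<open>L2\<close>, as an operator on gradients. It is independent of the choice of
 the lift by Poincare's inequality.\<close>

definition iota :: "(real^2, real^2^2) l2 => (real^2, real^2) l2" where "iota x = cls \<Omega> (lift x)"

lemma iota_grad: "u \<in> H10 \<Omega> ==> grad u = PV x ==> iota x = cls \<Omega> u"
proof -
 assume u: "u \<in> H10 \<Omega>" "grad u = PV x"
 have "norm (cls \<Omega> (\<lambda>t. lift x t - u t)) \<le> 4 * Rad * norm (grad (\<lambda>t. lift x t - u t))"
  by (rule poincare[OF H10_diff[OF lift(1) u(1)]])
 also have "\<dots> = 0" by (simp add: grad_diff[OF H10_H1[OF lift(1)] H10_H1[OF u(1)]] u lift)
 finally show ?thesis by (simp add: iota_def cls_diff H10_L2 lift u)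
qed

lemma bounded_linear_iota: "bounded_linear iota"
proof (rule bounded_linear_intro[where K = "4 * Rad"])
 interpret P: bounded_linear PV by (rule PV)
 show "iota (x + y) = iota x + iota y" for x y proof -
  have "iota (x + y) = cls \<Omega> (\<lambda>t. lift x t + lift y t)" by (rule iota_grad[OF H10_add[OF lift(1) lift(1)]])
     (simp add: grad_add[OF H10_H1[OF lift(1)] H10_H1[OF lift(1)]] lift P.add)
  then show ?thesis by (simp add: iota_def cls_add H10_L2 lift)
 qed
 show "iota (r *\<^sub>R x) = r *\<^sub>R iota x" for r x proof -
  have "iota (r *\<^sub>R x) = cls \<Omega> (\<lambda>t. r *\<^sub>R lift x t)" by (rule iota_grad[OF H10_scaleR[OF lift(1)]])
     (simp add: grad_scale[OF H10_H1[OF lift(1)]] lift P.scaleR)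
  then show ?thesis by (simp add: iota_def cls_scaleR H10_L2 lift)
 qed
 show "norm (iota x) \<le> norm x * (4 * Rad)" for x proof -
  have "norm (iota x) \<le> 4 * Rad * norm (PV x)" using poincare[OF lift(1), of x] by (simp add: iota_def lift)
  also have "\<dots> \<le> 4 * Rad * norm x" using Rad(1) by (intro mult_left_mono norm_projection_le PV) auto
  finally show ?thesis by (simp add: mult.commute)
 qed
qed

lemma iota_PV: "iota (PV x) = iota x"
 by (simp add: iota_def lift_def PV(5))

text \<open>The weak gradient of the zero class is zero.\<close>

lemma iota_inj: "iota x = 0 ==> PV x = 0"
proof -
 assume 0: "iota x = 0"
 have z: "has_weak_jacobian \<Omega> (lift x) (\<lambda>x. 0)"
  using 0 unfolding has_weak_jacobian_iff[OF H10_L2[OF lift(1)] L2_zero] by (simp add: iota_def cls_zero)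
 show ?thesis using H1_I(2)[OF H10_L2[OF lift(1)] L2_zero z] by (simp add: lift cls_zero)
qed

text \<open>A class orthogonal to all test functions vanishes on the domain by the fundamental lemma.\<close>

lemma dense_iota:
 assumes f: "f \<in> L2 \<Omega>"
 shows "cls \<Omega> f \<in> closure (range iota)"
proof -
 let ?S = "range iota"
 have S: "subspace ?S"
  by (rule linear_subspace_image[OF bounded_linear.linear[OF bounded_linear_iota] subspace_UNIV])
 define d where "d = cls \<Omega> f - proj ?S (cls \<Omega> f)"
 have dS: "d \<bullet> s = 0" if "s \<in> closure ?S" for s
  unfolding d_def using proj_inner[OF S that] by (simp add: inner_diff_left)
 have "AE x in lebesgue. x \<in> \<Omega> \<longrightarrow> rep_l2 d x $ i = 0" for i proof (rule fundamental_lemma[OF _ op])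
  show "sqint (\<lambda>x. rep_l2 d x $ i)" by (intro sqint_bounded_linear[OF bounded_linear_vec_nth] sqint_rep)
  fix \<psi> :: "real^2 => real" assume \<psi>: "\<psi> \<in> test_functions \<Omega>"
  have \<psi>i: "(\<lambda>x. \<psi> x *\<^sub>R (axis i 1 :: real^2)) \<in> test_functions \<Omega>"
   by (rule test_bounded_linear[OF \<psi> \<psi> bounded_linear_scaleR_left])
  have "cls \<Omega> (\<lambda>x. \<psi> x *\<^sub>R axis i 1) = iota (grad (\<lambda>x. \<psi> x *\<^sub>R axis i 1))"
   by (rule iota_grad[symmetric]) (use test_H10[OF \<psi>i] PV_grad in auto)
  then have "cls \<Omega> (\<lambda>x. \<psi> x *\<^sub>R axis i 1) \<in> range iota" by (rule range_eqI)
  then have "cls \<Omega> (\<lambda>x. \<psi> x *\<^sub>R axis i 1) \<in> closure ?S" by (rule subsetD[OF closure_subset])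
  from dS[OF this] have "abs_l2 (rep_l2 d) \<bullet> abs_l2 (\<lambda>x. \<psi> x *\<^sub>R (axis i 1 :: real^2)) = 0"
   by (simp add: cls_test \<psi>i)
  then show "(\<integral>x. rep_l2 d x $ i * \<psi> x \<partial>lebesgue) = 0"
   by (subst (asm) inner_abs_l2) (auto simp: sqint_test[OF \<psi>i] inner_axis mult.commute)
 qed
 then have "AE x in lebesgue. \<forall>i. x \<in> \<Omega> \<longrightarrow> rep_l2 d x $ i = 0" unfolding AE_all_countable by blast
 then have "AE x in lebesgue_on \<Omega>. rep_l2 d x = 0" unfolding AE_\<Omega> by eventually_elim (auto simp: vec_eq_iff)
 then have "cls \<Omega> (rep_l2 d) = 0" by (simp add: cls_eq_iff[OF rep_L2 L2_zero, unfolded cls_zero])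
 then have "d \<bullet> cls \<Omega> f = 0" using cls_rep_inner[OF f, of d] by simp
 moreover have "d \<bullet> proj ?S (cls \<Omega> f) = 0" by (rule dS[OF proj_in_closure[OF S]])
 ultimately have "d \<bullet> d = 0" by (simp add: d_def inner_diff_right)
 then have "cls \<Omega> f = proj ?S (cls \<Omega> f)" by (simp add: d_def)
 then show ?thesis using proj_in_closure[OF S] by metis
qed

subsection \<open>Fourth powers\<close>

text \<open>The bound for test functions passes to \<open>H10\<close> by Fatou's lemma along a subsequence that converges
 almost everywhere.\<close>

lemma quartic_iota:
 shows "sqint (\<lambda>t. (norm (rep_l2 (iota x) t))\<^sup>2)"
  and "norm (abs_l2 (\<lambda>t. (norm (rep_l2 (iota x) t))\<^sup>2)) \<le> 8 * Rad * (norm (PV x))\<^sup>2"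
proof -
 obtain \<phi> where \<phi>: "\<And>n. \<phi> n \<in> test_functions \<Omega>" "(\<lambda>n. cls \<Omega> (\<phi> n)) \<longlonglongrightarrow> iota x" "(\<lambda>n. grad (\<phi> n)) \<longlonglongrightarrow> PV x"
  using lift[of x] unfolding H10_iff iota_def by auto
 obtain r where r: "strict_mono r" "AE t in lebesgue. (\<lambda>n. rep_l2 (cls \<Omega> (\<phi> (r n))) t) \<longlonglongrightarrow> rep_l2 (iota x) t"
  using l2_tendsto_AE_subseq[OF \<phi>(2)] by blast
 have "AE t in lebesgue. \<forall>n. rep_l2 (cls \<Omega> (\<phi> n)) t = \<phi> n t"
  unfolding AE_all_countable using rep_abs_l2[OF sqint_test[OF \<phi>(1)]] by (simp add: cls_test \<phi>)
 with r(2) have lim: "AE t in lebesgue. (\<lambda>n. \<phi> (r n) t) \<longlonglongrightarrow> rep_l2 (iota x) t" by eventually_elim simp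
 have [measurable]: "\<phi> n \<in> borel_measurable lebesgue" for n by (rule sqintD[OF sqint_test[OF \<phi>(1)]])
 let ?X = "64 * Rad\<^sup>2 * (norm (PV x)) ^ 4"
 have "(\<integral>\<^sup>+t. ennreal ((norm (rep_l2 (iota x) t)) ^ 4) \<partial>lebesgue)
   = (\<integral>\<^sup>+t. liminf (\<lambda>n. ennreal ((norm (\<phi> (r n) t)) ^ 4)) \<partial>lebesgue)"
 proof (rule nn_integral_cong_AE)
  show "AE t in lebesgue. ennreal ((norm (rep_l2 (iota x) t)) ^ 4) = liminf (\<lambda>n. ennreal ((norm (\<phi> (r n) t)) ^ 4))"
   using lim proof eventually_elim
   case (elim t)
   have "(\<lambda>n. ennreal ((norm (\<phi> (r n) t)) ^ 4)) \<longlonglongrightarrow> ennreal ((norm (rep_l2 (iota x) t)) ^ 4)"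
    by (intro tendsto_ennrealI tendsto_power tendsto_norm elim)
   from lim_imp_Liminf[OF _ this] show ?case by simp
  qed
 qed
 also have "\<dots> \<le> liminf (\<lambda>n. \<integral>\<^sup>+t. ennreal ((norm (\<phi> (r n) t)) ^ 4) \<partial>lebesgue)" by (rule nn_integral_liminf) simp
 also have "\<dots> \<le> liminf (\<lambda>n. ennreal (64 * Rad\<^sup>2 * (norm (grad (\<phi> (r n)))) ^ 4))"
  by (intro Liminf_mono always_eventually allI quartic_test \<phi>)
 also have "\<dots> = ennreal ?X" proof (rule lim_imp_Liminf)
  have "(\<lambda>n. grad (\<phi> (r n))) \<longlonglongrightarrow> PV x" using LIMSEQ_subseq_LIMSEQ[OF \<phi>(3) r(1)] by (simp add: o_def)
  then show "(\<lambda>n. ennreal (64 * Rad\<^sup>2 * (norm (grad (\<phi> (r n)))) ^ 4)) \<longlonglongrightarrow> ennreal ?X"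
   by (intro tendsto_ennrealI tendsto_intros)
 qed simp
 finally have le: "(\<integral>\<^sup>+t. ennreal ((norm (rep_l2 (iota x) t)) ^ 4) \<partial>lebesgue) \<le> ennreal ?X" .
 have p4: "(norm ((norm (rep_l2 (iota x) t))\<^sup>2))\<^sup>2 = (norm (rep_l2 (iota x) t)) ^ 4" for t
  by (simp add: power_mult[symmetric])
 show s: "sqint (\<lambda>t. (norm (rep_l2 (iota x) t))\<^sup>2)" unfolding sqint_def p4 proof
  show "integrable lebesgue (\<lambda>t. (norm (rep_l2 (iota x) t)) ^ 4)"
   using le by (intro integrableI_nonneg) (auto simp: less_top[symmetric] top_unique order_le_less_trans)
 qed simp
 show "norm (abs_l2 (\<lambda>t. (norm (rep_l2 (iota x) t))\<^sup>2)) \<le> 8 * Rad * (norm (PV x))\<^sup>2" proof (rule power2_le_imp_le)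
  have i: "integrable lebesgue (\<lambda>t. (norm (rep_l2 (iota x) t)) ^ 4)" using sqint_integrable[OF s] unfolding p4 .
  have "ennreal ((norm (abs_l2 (\<lambda>t. (norm (rep_l2 (iota x) t))\<^sup>2)))\<^sup>2) \<le> ennreal ?X"
   using le unfolding norm_abs_l2[OF s] p4 by (subst (asm) nn_integral_eq_integral[OF i]) auto
  then have "(norm (abs_l2 (\<lambda>t. (norm (rep_l2 (iota x) t))\<^sup>2)))\<^sup>2 \<le> ?X" by (subst (asm) ennreal_le_iff) auto
  also have "?X = (8 * Rad * (norm (PV x))\<^sup>2)\<^sup>2" by (simp add: power_mult_distrib power_mult[symmetric])
  finally show "(norm (abs_l2 (\<lambda>t. (norm (rep_l2 (iota x) t))\<^sup>2)))\<^sup>2 \<le> (8 * Rad * (norm (PV x))\<^sup>2)\<^sup>2" .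
 qed (use Rad(1) in auto)
qed

text \<open>The pointwise inner product of two fields, which is square integrable because their fourth powers
 are integrable.\<close>

definition dotx :: "(real^2, real^2^2) l2 => (real^2, real^2^2) l2 => (real^2, real) l2" where
 "dotx x y = abs_l2 (\<lambda>t. rep_l2 (iota x) t \<bullet> rep_l2 (iota y) t)"

lemma sqint_dotx: "sqint (\<lambda>t. rep_l2 (iota x) t \<bullet> rep_l2 (iota y) t)"
proof (rule sqint_bound[OF sqint_add[OF quartic_iota(1)[of x] quartic_iota(1)[of y]], of _ 1])
 show "AE t in lebesgue. norm (rep_l2 (iota x) t \<bullet> rep_l2 (iota y) t)
   \<le> 1 * norm ((norm (rep_l2 (iota x) t))\<^sup>2 + (norm (rep_l2 (iota y) t))\<^sup>2)"
 proof (rule AE_I2)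
  fix t
  let ?a = "norm (rep_l2 (iota x) t)" and ?b = "norm (rep_l2 (iota y) t)"
  have "\<bar>rep_l2 (iota x) t \<bullet> rep_l2 (iota y) t\<bar> \<le> ?a * ?b" by (rule Cauchy_Schwarz_ineq2)
  moreover have "2 * (?a * ?b) \<le> ?a\<^sup>2 + ?b\<^sup>2" using sum_squares_bound[of ?a ?b] by (simp add: mult.assoc)
  moreover have "0 \<le> ?a * ?b" by simp
  ultimately have "\<bar>rep_l2 (iota x) t \<bullet> rep_l2 (iota y) t\<bar> \<le> ?a\<^sup>2 + ?b\<^sup>2" by linarith
  then show "norm (rep_l2 (iota x) t \<bullet> rep_l2 (iota y) t) \<le> 1 * norm (?a\<^sup>2 + ?b\<^sup>2)" by simp
 qed
qed simp

lemma bounded_bilinear_dotx: "bounded_bilinear dotx"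
proof
 interpret i: bounded_linear iota by (rule bounded_linear_iota)
 fix a a' b b' :: "(real^2, real^2^2) l2" and r :: real
 show "dotx (a + a') b = dotx a b + dotx a' b" unfolding dotx_def add_abs_l2[OF sqint_dotx sqint_dotx]
  by (subst abs_l2_eq_iff) (auto simp: sqint_dotx sqint_add intro: eventually_mono[OF rep_add_l2[of "iota a" "iota a'", folded i.add]] simp: inner_add_left)
 show "dotx a (b + b') = dotx a b + dotx a b'" unfolding dotx_def add_abs_l2[OF sqint_dotx sqint_dotx]
  by (subst abs_l2_eq_iff) (auto simp: sqint_dotx sqint_add intro: eventually_mono[OF rep_add_l2[of "iota b" "iota b'", folded i.add]] simp: inner_add_right)
 show "dotx (r *\<^sub>R a) b = r *\<^sub>R dotx a b" unfolding dotx_def scaleR_abs_l2[OF sqint_dotx]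
  by (subst abs_l2_eq_iff) (use sqint_scaleR[OF sqint_dotx] in \<open>auto simp: sqint_dotx intro: eventually_mono[OF rep_scaleR_l2[of r "iota a", folded i.scaleR]]\<close>)
 show "dotx a (r *\<^sub>R b) = r *\<^sub>R dotx a b" unfolding dotx_def scaleR_abs_l2[OF sqint_dotx]
  by (subst abs_l2_eq_iff) (use sqint_scaleR[OF sqint_dotx] in \<open>auto simp: sqint_dotx intro: eventually_mono[OF rep_scaleR_l2[of r "iota b", folded i.scaleR]]\<close>)
 have "norm (dotx a b) \<le> norm a * norm b * (8 * Rad)" for a b proof (rule power2_le_imp_le)
  let ?A = "\<lambda>t. (norm (rep_l2 (iota a) t))\<^sup>2" and ?B = "\<lambda>t. (norm (rep_l2 (iota b) t))\<^sup>2"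
  have PVle: "norm (PV x) \<le> norm x" for x by (rule norm_projection_le[OF PV(2) PV(5)])
  have "(norm (dotx a b))\<^sup>2 = (\<integral>t. (norm (rep_l2 (iota a) t \<bullet> rep_l2 (iota b) t))\<^sup>2 \<partial>lebesgue)"
   unfolding dotx_def by (rule norm_abs_l2[OF sqint_dotx])
  also have "\<dots> \<le> (\<integral>t. ?A t \<bullet> ?B t \<partial>lebesgue)" proof (rule integral_mono_AE)
   show "integrable lebesgue (\<lambda>t. (norm (rep_l2 (iota a) t \<bullet> rep_l2 (iota b) t))\<^sup>2)" by (rule sqint_integrable[OF sqint_dotx])
   show "integrable lebesgue (\<lambda>t. ?A t \<bullet> ?B t)" by (rule sqint_inner_integrable[OF quartic_iota(1) quartic_iota(1)])
   show "AE t in lebesgue. (norm (rep_l2 (iota a) t \<bullet> rep_l2 (iota b) t))\<^sup>2 \<le> ?A t \<bullet> ?B t"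
    using Cauchy_Schwarz_ineq by (intro AE_I2) (simp add: power2_norm_eq_inner)
  qed
  also have "\<dots> = abs_l2 ?A \<bullet> abs_l2 ?B" by (rule inner_abs_l2[OF quartic_iota(1) quartic_iota(1), symmetric])
  also have "\<dots> \<le> norm (abs_l2 ?A) * norm (abs_l2 ?B)" by (rule norm_cauchy_schwarz)
  also have "\<dots> \<le> (8 * Rad * (norm a)\<^sup>2) * (8 * Rad * (norm b)\<^sup>2)" using Rad(1) PVle
   by (intro mult_mono order_trans[OF quartic_iota(2)] mult_left_mono power_mono) auto
  also have "\<dots> = (norm a * norm b * (8 * Rad))\<^sup>2" by (simp add: power2_eq_square algebra_simps)
  finally show "(norm (dotx a b))\<^sup>2 \<le> (norm a * norm b * (8 * Rad))\<^sup>2" .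
 qed (use Rad(1) in auto)
 then show "\<exists>K. \<forall>a b. norm (dotx a b) \<le> norm a * norm b * K" by blast
qed

text \<open>The friction operator with a square integrable coefficient \<open>a\<close>: it represents the functional that
 sends \<open>y\<close> to the integral of \<open>a\<close> times the pointwise inner product of the two fields.\<close>

definition Qop :: "(real^2, real) l2 => (real^2, real^2^2) l2 => (real^2, real^2^2) l2" where
 "Qop a x = adjoint (dotx x) a"

lemma Qop: "Qop a x \<bullet> y = a \<bullet> dotx x y"
 unfolding Qop_def using adjoint_inner[OF bounded_bilinear.bounded_linear_right[OF bounded_bilinear_dotx, of x], of y a]
 by (simp add: inner_commute)

lemma bounded_bilinear_Qop: "bounded_bilinear Qop"
proof
 interpret d: bounded_bilinear dotx by (rule bounded_bilinear_dotx)
 fix a a' :: "(real^2, real) l2" and x x' :: "(real^2, real^2^2) l2" and r :: real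
 show "Qop (a + a') x = Qop a x + Qop a' x" by (rule vector_eq_rdot[THEN iffD1]) (simp add: Qop inner_add_left)
 show "Qop a (x + x') = Qop a x + Qop a x'"
  by (rule vector_eq_rdot[THEN iffD1]) (simp add: Qop inner_add_left inner_add_right d.add_left)
 show "Qop (r *\<^sub>R a) x = r *\<^sub>R Qop a x" by (rule vector_eq_rdot[THEN iffD1]) (simp add: Qop)
 show "Qop a (r *\<^sub>R x) = r *\<^sub>R Qop a x" by (rule vector_eq_rdot[THEN iffD1]) (simp add: Qop d.scaleR_left)
 obtain K where K: "\<And>a b. norm (dotx a b) \<le> norm a * norm b * K" "K \<ge> 0" using d.nonneg_bounded by blast
 have "norm (Qop a x) \<le> norm a * norm x * K" for a x proof -
  have "norm (Qop a x) * norm (Qop a x) = a \<bullet> dotx x (Qop a x)"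
   by (simp add: Qop[symmetric] power2_norm_eq_inner[symmetric] power2_eq_square)
  also have "\<dots> \<le> norm a * norm (dotx x (Qop a x))" by (rule norm_cauchy_schwarz)
  also have "\<dots> \<le> norm a * (norm x * norm (Qop a x) * K)" by (intro mult_left_mono K) auto
  finally have "norm (Qop a x) * norm (Qop a x) \<le> norm (Qop a x) * (norm a * norm x * K)" by (simp add: algebra_simps)
  then show ?thesis using K(2) by (cases "Qop a x = 0") auto
 qed
 then show "\<exists>K. \<forall>a b. norm (Qop a b) \<le> norm a * norm b * K" by blast
qed

lemma dotx_PV: "dotx (PV x) y = dotx x y" "dotx x (PV y) = dotx x y"
 by (simp_all add: dotx_def iota_PV)

lemma Qop_PV: "Qop a (PV x) = Qop a x" "PV (Qop a x) = Qop a x"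
proof -
 show "Qop a (PV x) = Qop a x" by (rule vector_eq_rdot[THEN iffD1]) (simp add: Qop dotx_PV)
 show "PV (Qop a x) = Qop a x" by (rule vector_eq_rdot[THEN iffD1]) (simp add: Qop dotx_PV PV(2))
qed

lemma dotx_grad:
 assumes u: "u \<in> H10 \<Omega>" and v: "v \<in> H10 \<Omega>"
 shows "(\<lambda>t. u t \<bullet> v t) \<in> L2 \<Omega>" "dotx (grad u) (grad v) = cls \<Omega> (\<lambda>t. u t \<bullet> v t)"
proof -
 have iu: "iota (grad u) = cls \<Omega> u" "iota (grad v) = cls \<Omega> v" by (intro iota_grad; simp add: u v PV_grad)+
 have ae: "AE t in lebesgue. rep_l2 (iota (grad u)) t \<bullet> rep_l2 (iota (grad v)) t = indicator \<Omega> t *\<^sub>R (u t \<bullet> v t)"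
  using rep_cls[OF H10_L2[OF u]] rep_cls[OF H10_L2[OF v]] unfolding iu by eventually_elim (auto simp: indicator_def)
 have m: "(\<lambda>t. indicator \<Omega> t *\<^sub>R (u t \<bullet> v t)) \<in> borel_measurable lebesgue"
  by (rule borel_measurable_AE[OF sqintD[OF sqint_dotx[of "grad u" "grad v"]] ae])
 have s: "sqint (\<lambda>t. indicator \<Omega> t *\<^sub>R (u t \<bullet> v t))" by (rule sqint_cong_AE[OF sqint_dotx m ae])
 then show "(\<lambda>t. u t \<bullet> v t) \<in> L2 \<Omega>" by (simp add: L2_iff)
 show "dotx (grad u) (grad v) = cls \<Omega> (\<lambda>t. u t \<bullet> v t)"
  unfolding dotx_def cls_def using ae s by (subst abs_l2_eq_iff) (auto simp: sqint_dotx)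
qed

end

section \<open>Functions of time\<close>

lemma lebesgue_measurable_AE:
 fixes f :: "'a::euclidean_space => 'b::topological_space"
 assumes h: "h \<in> borel_measurable lebesgue" and ae: "AE x in lebesgue. h x = f x"
 shows "f \<in> borel_measurable lebesgue"
proof (rule borel_measurableI)
 fix S :: "'b set" assume S: "open S"
 obtain N where N: "N \<in> null_sets lebesgue" "{x. h x \<noteq> f x} \<subseteq> N" using ae by (auto simp: eventually_ae_filter)
 have "f -` S \<inter> N \<in> null_sets lebesgue" using N(1) by (rule null_sets_completion_subset[rotated]) auto
 then have "f -` S \<inter> N \<in> sets lebesgue" by (rule null_setsD2)
 moreover have "h -` S \<inter> space lebesgue \<in> sets lebesgue" by (rule measurable_sets[OF h]) (use S in auto)
 moreover have "N \<in> sets lebesgue" using N(1) by (rule null_setsD2)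
 moreover have "f -` S \<inter> space lebesgue = ((h -` S \<inter> space lebesgue) - N) \<union> (f -` S \<inter> N)"
  using N(2) by (auto, (metis (mono_tags, lifting) mem_Collect_eq subsetD)+)
 ultimately show "f -` S \<inter> space lebesgue \<in> sets lebesgue" by (simp only:) blast
qed

lemma AE_interval_iff:
 "(AE t in lebesgue_on {0..T}. Q t) \<longleftrightarrow> (AE t in lebesgue. t \<in> {0<..T} \<longrightarrow> Q t)" for T :: real
proof -
 have "AE t in lebesgue. t \<noteq> (0::real)" using AE_lborel_singleton by (rule AE_completion)
 then have "AE t in lebesgue. (t \<in> {0..T} \<longrightarrow> Q t) = (t \<in> {0<..T} \<longrightarrow> Q t)" by eventually_elim auto
 then have "(AE t in lebesgue. t \<in> {0..T} \<longrightarrow> Q t) \<longleftrightarrow> (AE t in lebesgue. t \<in> {0<..T} \<longrightarrow> Q t)" by (rule eventually_subst)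
 then show ?thesis by (simp add: AE_restrict_space_iff)
qed

lemma integral_interval_eq_tint:
 fixes f :: "real => 'b::{banach,second_countable_topology}"
 shows "integral\<^sup>L (lebesgue_on {0..T}) f = tint f 0 T"
proof -
 have "integral\<^sup>L (lebesgue_on {0..T}) f = (\<integral>t. indicator {0..T} t *\<^sub>R f t \<partial>lebesgue)"
  by (rule integral_restrict_space) simp
 also have "\<dots> = tint f 0 T" unfolding tint_def
  by (rule integral_discrete_difference[where X = "{0}"]) (auto simp: indicator_def)
 finally show ?thesis .
qed

lemma integrable_interval_iff:
 fixes f :: "real => 'b::{banach,second_countable_topology}"
 shows "integrable (lebesgue_on {0..T}) f \<longleftrightarrow> tintegrable f 0 T"
proof -
 have "integrable (lebesgue_on {0..T}) f \<longleftrightarrow> integrable lebesgue (\<lambda>t. indicator {0..T} t *\<^sub>R f t)"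
  by (rule integrable_restrict_space) simp
 also have "\<dots> \<longleftrightarrow> tintegrable f 0 T" unfolding tintegrable_def
  by (rule integrable_discrete_difference[where X = "{0}"]) (auto simp: indicator_def)
 finally show ?thesis .
qed

text \<open>The map \<open>e\<close> represents the elements of \<open>V\<close> in a separable Banach space, where almost everywhere
 limits of simple functions are measurable.\<close>

lemma strongly_measurable_imp_measurable:
 fixes e :: "('a => 'c::real_normed_vector) => 'b::{banach,second_countable_topology}"
 assumes sm: "strongly_measurable T V N f" and fV: "AE t in lebesgue_on {0..T}. f t \<in> V"
  and e: "\<And>a b. a \<in> V ==> b \<in> V ==> norm (e a - e b) \<le> N (\<lambda>x. a x - b x)"
 shows "(\<lambda>t. indicator {0<..T} t *\<^sub>R e (f t)) \<in> borel_measurable lebesgue"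
proof -
 obtain s where fin: "\<And>n. finite (s n ` {0..T})" and sV: "\<And>n. s n ` {0..T} \<subseteq> V"
  and lev: "\<And>n c. {t \<in> {0..T}. s n t = c} \<in> sets lebesgue"
  and lim: "AE t in lebesgue_on {0..T}. (\<lambda>n. N (\<lambda>x. f t x - s n t x)) \<longlonglongrightarrow> 0"
  using sm unfolding strongly_measurable_def by blast
 define g where "g n t = indicator {0<..T} t *\<^sub>R e (s n t)" for n t
 have [measurable]: "g n \<in> borel_measurable lebesgue" for n proof -
  have "g n = (\<lambda>t. \<Sum>c\<in>s n ` {0..T}. indicator ({t \<in> {0..T}. s n t = c} \<inter> {0<..T}) t *\<^sub>R e c)" proof
   fix t show "g n t = (\<Sum>c\<in>s n ` {0..T}. indicator ({t \<in> {0..T}. s n t = c} \<inter> {0<..T}) t *\<^sub>R e c)"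
   proof (cases "t \<in> {0<..T}")
    case True
    then have "(\<Sum>c\<in>s n ` {0..T}. indicator ({t \<in> {0..T}. s n t = c} \<inter> {0<..T}) t *\<^sub>R e c)
     = (\<Sum>c\<in>s n ` {0..T}. if c = s n t then e c else 0)"
     by (intro sum.cong) (auto simp: indicator_def)
    also have "\<dots> = e (s n t)" using True fin[of n] by (simp add: sum.delta)
    finally show ?thesis using True by (simp add: g_def)
   qed (simp add: g_def)
  qed
  moreover have "(\<lambda>t. \<Sum>c\<in>s n ` {0..T}. indicator ({t \<in> {0..T}. s n t = c} \<inter> {0<..T}) t *\<^sub>R e c) \<in> borel_measurable lebesgue"
   by (intro borel_measurable_sum borel_measurable_scaleR borel_measurable_indicator sets.Int lev) auto
  ultimately show ?thesis by simp
 qed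
 have "AE t in lebesgue. (\<lambda>n. g n t) \<longlonglongrightarrow> indicator {0<..T} t *\<^sub>R e (f t)" using lim fV unfolding AE_interval_iff
 proof eventually_elim
  case (elim t)
  show ?case proof (cases "t \<in> {0<..T}")
   case True
   have "(\<lambda>n. e (f t) - e (s n t)) \<longlonglongrightarrow> 0" proof (rule Lim_null_comparison)
    have "s n t \<in> V" for n using sV[of n] True by auto
    then show "eventually (\<lambda>n. norm (e (f t) - e (s n t)) \<le> N (\<lambda>x. f t x - s n t x)) sequentially"
     using e elim True by auto
   qed (use elim True in auto)
   then show ?thesis using True by (simp add: g_def tendsto_const_diff_iff)
  qed (simp add: g_def)
 qed
 then have "AE t in lebesgue. lim (\<lambda>n. g n t) = indicator {0<..T} t *\<^sub>R e (f t)" by eventually_elim (rule limI)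
 then show ?thesis by (rule lebesgue_measurable_AE[rotated]) (rule borel_measurable_lim_metric, simp)
qed

text \<open>Simple functions with values in the larger space are projected onto the range of \<open>e\<close> by \<open>Pr\<close> and
 lifted to \<open>V\<close>.\<close>

lemma measurable_imp_strongly_measurable:
 fixes e :: "('a => 'c::real_normed_vector) => 'b::{banach,second_countable_topology}"
 assumes g: "g \<in> borel_measurable lebesgue" and fg: "AE t in lebesgue_on {0..T}. f t \<in> V \<and> e (f t) = g t"
  and e: "\<And>a b. a \<in> V ==> b \<in> V ==> N (\<lambda>x. a x - b x) \<le> norm (e a - e b)"
  and N: "\<And>a b. a \<in> V ==> b \<in> V ==> 0 \<le> N (\<lambda>x. a x - b x)"
  and Pr: "bounded_linear Pr" "\<And>y. Pr y \<in> e ` V" "\<And>v. v \<in> V ==> Pr (e v) = e v"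
 shows "strongly_measurable T V N f"
proof -
 obtain F where F: "\<And>i. simple_function lebesgue (F i)" "\<And>x. (\<lambda>i. F i x) \<longlonglongrightarrow> g x"
  using borel_measurable_implies_sequence_metric[OF g, of 0] by auto
 define iv where "iv y = (SOME v. v \<in> V \<and> e v = Pr y)" for y
 have iv: "iv y \<in> V \<and> e (iv y) = Pr y" for y proof -
  obtain v where "Pr y = e v" "v \<in> V" by (rule imageE[OF Pr(2)[of y]])
  then have "v \<in> V \<and> e v = Pr y" by simp
  then show ?thesis unfolding iv_def by (rule someI[where P = "\<lambda>v. v \<in> V \<and> e v = Pr y"])
 qed
 define s where "s n t = iv (F n t)" for n t
 show ?thesis unfolding strongly_measurable_def proof (intro exI[of _ s] conjI allI)
  fix n c
  have "finite (range (F n))" using simple_functionD(1)[OF F(1)[of n]] by simp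
  then have "finite (iv ` range (F n))" by simp
  then show "finite (s n ` {0..T})" by (rule finite_subset[rotated]) (auto simp: s_def)
  show "s n ` {0..T} \<subseteq> V" using iv by (auto simp: s_def)
  have "{t \<in> {0..T}. s n t = c} = {0..T} \<inter> (F n -` {y. iv y = c} \<inter> space lebesgue)" by (auto simp: s_def)
  also have "\<dots> \<in> sets lebesgue" by (intro sets.Int simple_functionD(2)[OF F(1)]) auto
  finally show "{t \<in> {0..T}. s n t = c} \<in> sets lebesgue" .
 next
  show "AE t in lebesgue_on {0..T}. (\<lambda>n. N (\<lambda>x. f t x - s n t x)) \<longlonglongrightarrow> 0" using fg proof eventually_elim
   case (elim t)
   have "(\<lambda>n. Pr (F n t)) \<longlonglongrightarrow> Pr (g t)" by (rule bounded_linear.tendsto[OF Pr(1) F(2)])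
   then have "(\<lambda>n. Pr (F n t)) \<longlonglongrightarrow> g t" using elim Pr(3) by metis
   then have "(\<lambda>n. g t - Pr (F n t)) \<longlonglongrightarrow> 0" by (simp add: tendsto_const_diff_iff)
   then have l: "(\<lambda>n. norm (g t - Pr (F n t))) \<longlonglongrightarrow> 0" by (rule tendsto_norm_zero)
   have "N (\<lambda>x. f t x - s n t x) \<le> norm (g t - Pr (F n t))" for n
    using e[of "f t" "s n t"] elim iv[of "F n t"] by (simp add: s_def)
   moreover have "0 \<le> N (\<lambda>x. f t x - s n t x)" for n
    using N[of "f t" "s n t"] elim iv[of "F n t"] by (simp add: s_def)
   ultimately show ?case by (intro tendsto_sandwich[OF _ _ tendsto_const l]) (auto intro!: always_eventually)
  qed
 qed
qed

lemma
 fixes \<phi> :: "real => real"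
 assumes \<phi>: "\<phi> \<in> test_functions {0<..<T}"
 shows test_deriv_continuous: "continuous_on UNIV (deriv \<phi>)"
  and sqint_test_deriv: "sqint (deriv \<phi>)"
  and test_tint: "0 \<le> t ==> \<phi> t = tint (deriv \<phi>) 0 t"
  and test_ends: "\<phi> 0 = 0" "\<phi> T = 0"
proof -
 have z: "\<phi> x = 0" if "x \<notin> {0<..<T}" for x by (rule test_zero[OF \<phi> contra_subsetD[OF test_support[OF \<phi>] that]])
 show e: "\<phi> 0 = 0" "\<phi> T = 0" using z by auto
 have d: "(\<phi> has_real_derivative frechet_derivative \<phi> (at t) 1) (at t)" for t proof -
  have "frechet_derivative \<phi> (at t) = (*) (frechet_derivative \<phi> (at t) 1)" proof (rule ext)
   fix v :: real
   have "frechet_derivative \<phi> (at t) (v *\<^sub>R 1) = v *\<^sub>R frechet_derivative \<phi> (at t) 1"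
    by (rule linear_scale[OF has_derivative_linear[OF test_has_derivative[OF \<phi>]]])
   then show "frechet_derivative \<phi> (at t) v = frechet_derivative \<phi> (at t) 1 * v" by (simp add: mult.commute)
  qed
  then show ?thesis using test_has_derivative[OF \<phi>, of t] by (simp add: has_field_derivative_def)
 qed
 have eq: "deriv \<phi> = (\<lambda>t. frechet_derivative \<phi> (at t) 1)" using DERIV_imp_deriv[OF d] by (rule ext)
 have D: "(\<phi> has_real_derivative deriv \<phi> t) (at t)" for t using d[of t] unfolding eq .
 show c: "continuous_on UNIV (deriv \<phi>)" unfolding eq by (rule test_derivative_continuous[OF \<phi>])
 show "sqint (deriv \<phi>)" unfolding eq by (rule sqint_test_derivative[OF \<phi>])
 show "0 \<le> t ==> \<phi> t = tint (deriv \<phi>) 0 t" using tint_FTC[OF D c, of t] e by simp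
qed

lemma tint_weak_derivative:
 fixes f :: "real => real"
 assumes f: "sqint f" and T: "T > 0" and \<phi>: "\<phi> \<in> test_functions {0<..<T}"
 shows "tint (\<lambda>t. deriv \<phi> t * (c + tint f 0 t)) 0 T = - tint (\<lambda>t. \<phi> t * f t) 0 T"
proof -
 note \<phi>' = sqint_test_deriv[OF \<phi>]
 have cF: "continuous_on UNIV (\<lambda>t. c + tint f 0 t)" by (intro continuous_intros continuous_on_tint f)
 have "0 = (0 + tint (deriv \<phi>) 0 T) \<bullet> (c + tint f 0 T) - (0 + tint (deriv \<phi>) 0 0) \<bullet> (c + tint f 0 0)"
  using test_tint[OF \<phi>, of T] test_ends[OF \<phi>] T by (simp add: tint_empty)
 also have "\<dots> = tint (\<lambda>t. deriv \<phi> t \<bullet> (c + tint f 0 t) + (0 + tint (deriv \<phi>) 0 t) \<bullet> f t) 0 T"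
  by (rule tint_product_rule(1)[OF \<phi>' f]) (use T in auto)
 also have "\<dots> = tint (\<lambda>t. deriv \<phi> t * (c + tint f 0 t) + \<phi> t * f t) 0 T"
  by (rule tint_cong) (use test_tint[OF \<phi>] in auto)
 also have "\<dots> = tint (\<lambda>t. deriv \<phi> t * (c + tint f 0 t)) 0 T + tint (\<lambda>t. \<phi> t * f t) 0 T" proof (rule tint_add)
  show "tintegrable (\<lambda>t. deriv \<phi> t * (c + tint f 0 t)) 0 T"
   by (intro tintegrable_continuous continuous_intros cF test_deriv_continuous[OF \<phi>])
  show "tintegrable (\<lambda>t. \<phi> t * f t) 0 T" using tintegrable_inner[OF sqint_test[OF \<phi>] f, of 0 T] by simp
 qed
 finally show ?thesis by simp
qed

text \<open>The antiderivative is constant on either side of the support, and both constants are zero because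
 the mean is.\<close>

lemma zero_mean_antiderivative:
 fixes \<theta> :: "real => real"
 assumes \<theta>: "\<theta> \<in> test_functions {0<..<T}" and T: "T > 0" and m: "tint \<theta> 0 T = 0"
 shows "\<exists>\<Phi>\<in>test_functions {0<..<T}. deriv \<Phi> = \<theta>"
proof -
 have "\<exists>F. \<forall>x::real. -\<infinity> < ereal x \<longrightarrow> ereal x < \<infinity> \<longrightarrow> (F has_vector_derivative \<theta> x) (at x)"
  by (rule einterval_antiderivative) (use test_continuous[OF \<theta>] in \<open>auto simp: continuous_on_eq_continuous_at\<close>)
 then obtain F where F: "\<And>x. (F has_real_derivative \<theta> x) (at x)"
  by (auto simp: has_real_derivative_iff_has_vector_derivative)
 define \<Phi> where "\<Phi> t = F t - F 0" for t
 have D: "(\<Phi> has_real_derivative \<theta> x) (at x)" for x unfolding \<Phi>_def by (auto intro!: derivative_eq_intros F)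
 have dPhi: "deriv \<Phi> = \<theta>" using DERIV_imp_deriv[OF D] by (rule ext)
 obtain a b where ab: "0 < a" "a \<le> b" "b < T" "closure {x. \<theta> x \<noteq> 0} \<subseteq> {a..b}"
 proof (cases "closure {x. \<theta> x \<noteq> 0} = {}")
  case True
  then show ?thesis using that[of "T/2" "T/2"] T by auto
 next
  case False
  obtain p where p: "p \<in> closure {x. \<theta> x \<noteq> 0}" "\<And>x. x \<in> closure {x. \<theta> x \<noteq> 0} ==> p \<le> x"
   using compact_attains_inf[OF test_compact[OF \<theta>] False] by metis
  obtain q where q: "q \<in> closure {x. \<theta> x \<noteq> 0}" "\<And>x. x \<in> closure {x. \<theta> x \<noteq> 0} ==> x \<le> q"
   using compact_attains_sup[OF test_compact[OF \<theta>] False] by metis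
  have "p \<in> {0<..<T}" "q \<in> {0<..<T}" by (rule subsetD[OF test_support[OF \<theta>]], rule p q)+
  moreover have "p \<le> q" by (rule p(2)[OF q(1)])
  moreover have "closure {x. \<theta> x \<noteq> 0} \<subseteq> {p..q}" by (rule subsetI) (simp only: atLeastAtMost_iff p(2) q(2) simp_thms)
  ultimately show ?thesis using that[of p q] by (simp only: greaterThanLessThan_iff)
 qed
 have z: "\<theta> x = 0" if "x \<notin> {a..b}" for x by (rule test_zero[OF \<theta> contra_subsetD[OF ab(4) that]])
 have low: "\<Phi> t = 0" if "t < a" for t proof -
  have "\<Phi> s = \<Phi> r" if "r < s" "s < a" for r s proof -
   obtain x where "x > r" "x < s" "\<Phi> s - \<Phi> r = (s - r) * \<theta> x" using MVT2[OF \<open>r < s\<close>, of \<Phi> \<theta>] D by blast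
   then show ?thesis using z[of x] that by simp
  qed
  from this[of t 0] this[of 0 t] show ?thesis using that ab(1) by (cases t "0::real" rule: linorder_cases) (auto simp: \<Phi>_def)
 qed
 have "\<Phi> T - \<Phi> 0 = 0" using tint_FTC[OF D test_continuous[OF \<theta>], of T] T m by simp
 then have \<Phi>T: "\<Phi> T = 0" by (simp add: \<Phi>_def)
 have high: "\<Phi> t = 0" if "t > b" for t proof -
  have "\<Phi> s = \<Phi> r" if "r < s" "b < r" for r s proof -
   obtain x where "x > r" "x < s" "\<Phi> s - \<Phi> r = (s - r) * \<theta> x" using MVT2[OF \<open>r < s\<close>, of \<Phi> \<theta>] D by blast
   then show ?thesis using z[of x] that by simp
  qed
  from this[of t T] this[of T t] show ?thesis using that ab(3) \<Phi>T by (cases t T rule: linorder_cases) auto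
 qed
 have supp: "closure {x. \<Phi> x \<noteq> 0} \<subseteq> {a..b}" proof (rule closure_minimal)
  show "{x. \<Phi> x \<noteq> 0} \<subseteq> {a..b}" proof
   fix x assume "x \<in> {x. \<Phi> x \<noteq> 0}"
   then have "\<not> x < a" "\<not> x > b" using low[of x] high[of x] by auto
   then show "x \<in> {a..b}" by simp
  qed
 qed simp
 have smooth: "Ck_on k UNIV \<Phi>" for k proof (cases k)
  case 0
  have "continuous_on UNIV \<Phi>" by (rule DERIV_continuous_on[of _ _ \<theta>]) (use D in \<open>auto intro: has_field_derivative_at_within\<close>)
  then show ?thesis using 0 by simp
 next
  case (Suc n)
  have d: "(\<Phi> has_derivative (\<lambda>v. \<theta> x * v)) (at x)" for x using D[of x] by (simp add: has_field_derivative_def)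
  have fd: "frechet_derivative \<Phi> (at x) = (\<lambda>v. \<theta> x * v)" for x using frechet_derivative_at[OF d[of x]] by simp
  have "Ck_on n UNIV (\<lambda>x. \<theta> x * v)" for v
   by (rule Ck_bounded_linear[OF bounded_linear_mult_left]) (use \<theta> in \<open>simp add: test_functions_def smooth_on_def\<close>)
  then show ?thesis unfolding Suc Ck_on.simps fd by (intro conjI ballI allI differentiableI[OF d])
 qed
 have "\<Phi> \<in> test_functions {0<..<T}" unfolding test_functions_def mem_Collect_eq smooth_on_def
 proof (intro conjI allI smooth)
  show "compact (closure {x. \<Phi> x \<noteq> 0})" by (rule compact_if_closed_subset[OF _ closed_closure supp]) simp
  show "closure {x. \<Phi> x \<noteq> 0} \<subseteq> {0<..<T}" by (rule order_trans[OF supp]) (use ab in auto)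
 qed
 with dPhi show ?thesis by blast
qed

text \<open>The difference \<open>G\<close> of \<open>F\<close> and the integral of \<open>f\<close> is orthogonal to derivatives of test functions,
 hence to test functions of mean zero. Subtracting a multiple of one fixed test function \<open>\<psi>\<close> from an
 arbitrary one shows that \<open>G\<close> minus its \<open>\<psi>\<close>-average is orthogonal to all of them.\<close>

lemma du_bois_reymond:
 fixes F f :: "real => real"
 assumes F: "continuous_on {0..T} F" and f: "sqint f" and T: "T > 0"
  and w: "\<And>\<phi>. \<phi> \<in> test_functions {0<..<T} ==> tint (\<lambda>t. deriv \<phi> t * F t) 0 T = - tint (\<lambda>t. \<phi> t * f t) 0 T"
  and t: "t \<in> {0..T}"
 shows "F t = F 0 + tint f 0 t"
proof -
 define G where "G t = F t - tint f 0 t" for t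
 have cG: "continuous_on {0..T} G"
  unfolding G_def by (intro continuous_intros F continuous_on_subset[OF continuous_on_tint[OF f]]) auto
 define g where "g t = indicator {0<..T} t *\<^sub>R G t" for t
 have g: "sqint g" unfolding g_def[abs_def] by (rule sqint_continuous_interval[OF cG])
 have gz: "tint (\<lambda>t. deriv \<phi> t * g t) 0 T = 0" if \<phi>: "\<phi> \<in> test_functions {0<..<T}" for \<phi> proof -
  have "tint (\<lambda>t. deriv \<phi> t * F t) 0 T = tint (\<lambda>t. deriv \<phi> t * g t + deriv \<phi> t * (0 + tint f 0 t)) 0 T"
   by (rule tint_cong) (auto simp: g_def G_def algebra_simps)
  also have "\<dots> = tint (\<lambda>t. deriv \<phi> t * g t) 0 T + tint (\<lambda>t. deriv \<phi> t * (0 + tint f 0 t)) 0 T" proof (rule tint_add)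
   show "tintegrable (\<lambda>t. deriv \<phi> t * g t) 0 T" using tintegrable_inner[OF sqint_test_deriv[OF \<phi>] g] by simp
   show "tintegrable (\<lambda>t. deriv \<phi> t * (0 + tint f 0 t)) 0 T"
    by (intro tintegrable_continuous continuous_intros continuous_on_tint f test_deriv_continuous[OF \<phi>])
  qed
  finally show ?thesis using w[OF \<phi>] tint_weak_derivative[OF f T \<phi>, of 0] by simp
 qed
 obtain \<psi> :: "real => real" where \<psi>: "\<psi> \<in> test_functions {0<..<T}" and m\<psi>: "tint \<psi> 0 T \<noteq> 0" proof -
  have "\<exists>n. tint (box_bump (T/3) (2*T/3) n) 0 T \<noteq> 0" proof (rule ccontr)
   assume "\<nexists>n. tint (box_bump (T/3) (2*T/3) n) 0 T \<noteq> 0"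
   then have z: "tint (box_bump (T/3) (2*T/3) n) 0 T = 0" for n by simp
   have "(\<lambda>n. tint (box_bump (T/3) (2*T/3) n) 0 T) \<longlonglongrightarrow> tint (indicator (box (T/3) (2*T/3))) 0 T" unfolding tint_def
   proof (rule integral_dominated_convergence[where w = "indicator {0<..T}"])
    show "integrable lebesgue (indicator {0<..T} :: real => real)"
     using emeasure_Ioc_finite[of 0 T] by (simp add: integrable_indicator_iff)
    show "AE x in lebesgue. (\<lambda>n. indicator {0<..T} x *\<^sub>R box_bump (T/3) (2*T/3) n x)
      \<longlonglongrightarrow> indicator {0<..T} x *\<^sub>R indicator (box (T/3) (2*T/3)) x"
     by (intro AE_I2 tendsto_intros box_bump_tendsto)
    show "AE x in lebesgue. norm (indicator {0<..T} x *\<^sub>R box_bump (T/3) (2*T/3) n x) \<le> indicator {0<..T} x" for n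
     using box_bump_range[of "T/3" "2*T/3" n] by (intro AE_I2) (simp add: indicator_def)
   qed (auto intro!: borel_measurable_times borel_measurable_indicator box_bump_measurable)
   moreover have "tint (indicator (box (T/3) (2*T/3)) :: real => real) 0 T = T / 3" proof -
    have "tint (indicator (box (T/3) (2*T/3)) :: real => real) 0 T = (\<integral>t. indicator {T/3<..<2*T/3} t \<partial>lebesgue)"
     unfolding tint_def by (rule Bochner_Integration.integral_cong) (use T in \<open>auto simp: indicator_def box_real\<close>)
    also have "\<dots> = T / 3" using T by simp
    finally show ?thesis .
   qed
   ultimately show False using z T by (simp add: LIMSEQ_const_iff)
  qed
  then obtain n where n: "tint (box_bump (T/3) (2*T/3) n) 0 T \<noteq> 0" by blast
  have "box_bump (T/3) (2*T/3) n \<in> test_functions {0<..<T}" by (rule box_bump_test_real) (use T in auto)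
  then show ?thesis using that n by blast
 qed
 define m where "m = tint (\<lambda>t. \<psi> t * g t) 0 T / tint \<psi> 0 T"
 have ae: "AE t in lebesgue. t \<in> {0<..<T} \<longrightarrow> g t - indicator {0<..T} t *\<^sub>R m = 0" proof (rule fundamental_lemma)
  show "sqint (\<lambda>t. g t - indicator {0<..T} t *\<^sub>R m)" by (intro sqint_diff g sqint_indicator_const)
  show "open {0<..<T}" by simp
  fix \<phi> :: "real => real" assume \<phi>: "\<phi> \<in> test_functions {0<..<T}"
  define k where "k = tint \<phi> 0 T / tint \<psi> 0 T"
  define \<theta> where "\<theta> t = \<phi> t + (- k) *\<^sub>R \<psi> t" for t
  have \<theta>: "\<theta> \<in> test_functions {0<..<T}"
   unfolding \<theta>_def by (rule test_add[OF \<phi> test_bounded_linear[OF \<psi> \<psi> bounded_linear_scaleR_right]])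
  have i: "tintegrable \<phi> 0 T" "tintegrable \<psi> 0 T" by (intro sqint_tintegrable sqint_test[OF \<phi>] sqint_test[OF \<psi>])+
  have "tint \<theta> 0 T = tint \<phi> 0 T + tint (\<lambda>t. (- k) *\<^sub>R \<psi> t) 0 T"
   unfolding \<theta>_def by (rule tint_add) (use i tintegrable_cmult[OF i(2), of "- k"] in auto)
  then have "tint \<theta> 0 T = 0" using m\<psi> by (simp only: tint_scaleR k_def) simp
  then obtain \<Phi> where "\<Phi> \<in> test_functions {0<..<T}" "deriv \<Phi> = \<theta>" using zero_mean_antiderivative[OF \<theta> T] by blast
  with gz have "tint (\<lambda>t. \<theta> t * g t) 0 T = 0" by metis
  have ip: "tintegrable (\<lambda>t. \<phi> t * g t) 0 T" "tintegrable (\<lambda>t. \<psi> t * g t) 0 T"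
   using tintegrable_inner[OF sqint_test[OF \<phi>] g] tintegrable_inner[OF sqint_test[OF \<psi>] g] by simp_all
  have "tint (\<lambda>t. \<theta> t * g t) 0 T = tint (\<lambda>t. \<phi> t * g t + (- k) * (\<psi> t * g t)) 0 T"
   by (rule tint_cong) (simp add: \<theta>_def algebra_simps)
  also have "\<dots> = tint (\<lambda>t. \<phi> t * g t) 0 T + (- k) * tint (\<lambda>t. \<psi> t * g t) 0 T"
   by (subst tint_add[OF ip(1) tintegrable_cmult[OF ip(2)]]) (simp only: tint_cmult)
  finally have main: "tint (\<lambda>t. \<phi> t * g t) 0 T = k * tint (\<lambda>t. \<psi> t * g t) 0 T"
   using \<open>tint (\<lambda>t. \<theta> t * g t) 0 T = 0\<close> by simp
  have "(\<integral>t. (g t - indicator {0<..T} t *\<^sub>R m) * \<phi> t \<partial>lebesgue) = tint (\<lambda>t. \<phi> t * g t + (- m) * \<phi> t) 0 T"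
   unfolding tint_def by (rule Bochner_Integration.integral_cong) (auto simp: g_def indicator_def algebra_simps)
  also have "\<dots> = tint (\<lambda>t. \<phi> t * g t) 0 T + (- m) * tint \<phi> 0 T"
   by (subst tint_add[OF ip(1) tintegrable_cmult[OF i(1)]]) (simp only: tint_cmult)
  also have "\<dots> = 0" unfolding main by (simp add: k_def m_def)
  finally show "(\<integral>t. (g t - indicator {0<..T} t *\<^sub>R m) * \<phi> t \<partial>lebesgue) = 0" .
 qed
 have "AE t in lebesgue. t \<noteq> T" using AE_lborel_singleton by (rule AE_completion)
 with ae have ae': "AE t in lebesgue. t \<in> {0<..T} \<longrightarrow> G t = m" by eventually_elim (auto simp: g_def)
 have Gm: "G s = m" if "s \<in> {0..T}" for s by (rule continuous_AE_eq[OF cG continuous_on_const T ae' that])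
 have "G t = G 0" using Gm[OF t] Gm[of 0] T by simp
 then show ?thesis by (simp add: G_def tint_empty)
qed

section \<open>The spatial operators\<close>

context bounded_open begin

text \<open>Pointwise bilinear multiplication by a bounded coefficient on the domain.\<close>

definition coef :: "('c::euclidean_space => 'b::euclidean_space => 'd::euclidean_space) => (real^2 => 'c) =>
  (real^2, 'b) l2 => (real^2, 'd) l2" where
 "coef B m = l2_map (\<lambda>x y. B (indicator \<Omega> x *\<^sub>R m x) y)"

lemma
 fixes B :: "'c::euclidean_space => 'b::euclidean_space => 'd::euclidean_space"
 assumes B: "bounded_bilinear B" and m: "(\<lambda>x. indicator \<Omega> x *\<^sub>R m x) \<in> borel_measurable lebesgue"
  and C: "\<And>x. x \<in> \<Omega> ==> norm (m x) \<le> C"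
 shows bounded_linear_coef: "bounded_linear (coef B m)"
  and L2_coef: "f \<in> L2 \<Omega> ==> (\<lambda>x. B (m x) (f x)) \<in> L2 \<Omega>"
  and coef_cls: "f \<in> L2 \<Omega> ==> coef B m (cls \<Omega> f) = cls \<Omega> (\<lambda>x. B (m x) (f x))"
proof -
 interpret B: bounded_bilinear B by (rule B)
 obtain K where K: "\<And>a b. norm (B a b) \<le> norm a * norm b * K" "K \<ge> 0" using B.nonneg_bounded by blast
 define F where "F x y = B (indicator \<Omega> x *\<^sub>R m x) y" for x y
 have 1: "(\<lambda>t. F t (f t)) \<in> borel_measurable lebesgue" if "f \<in> borel_measurable lebesgue" for f unfolding F_def
  by (rule borel_measurable_continuous_Pair[OF m that]) (intro B.continuous_on continuous_intros)
 have 2: "linear (F t)" for t unfolding F_def by (intro linearI B.add_right B.scaleR_right)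
 have 3: "norm (F x y) \<le> (max C 0 * K) * norm y" for x y proof -
  have "norm (indicator \<Omega> x *\<^sub>R m x) \<le> max C 0" using C[of x] by (auto simp: indicator_def)
  then have "norm (indicator \<Omega> x *\<^sub>R m x) * norm y * K \<le> max C 0 * norm y * K"
   using K(2) by (intro mult_right_mono) auto
  then show ?thesis unfolding F_def using K(1)[of "indicator \<Omega> x *\<^sub>R m x" y] by (simp add: mult_ac)
 qed
 have 4: "max C 0 * K \<ge> 0" using K(2) by simp
 have Fm: "coef B m = l2_map F" by (simp add: coef_def F_def[abs_def])
 show "bounded_linear (coef B m)" unfolding Fm by (rule bounded_linear_l2_map[OF 1 2 3 4])
 have eq: "(\<lambda>t. F t (indicator \<Omega> t *\<^sub>R f t)) = (\<lambda>t. indicator \<Omega> t *\<^sub>R B (m t) (f t))" for f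
  by (auto simp: F_def indicator_def B.zero_left)
 show "(\<lambda>x. B (m x) (f x)) \<in> L2 \<Omega>" if f: "f \<in> L2 \<Omega>"
  using sqint_map[OF 1 2 3 4 L2_sqint[OF f]] unfolding eq by (simp add: L2_iff)
 show "coef B m (cls \<Omega> f) = cls \<Omega> (\<lambda>x. B (m x) (f x))" if f: "f \<in> L2 \<Omega>"
  unfolding Fm cls_def using l2_map_abs[OF 1 2 3 4 L2_sqint[OF f]] unfolding eq by simp
qed

definition clin :: "('b::euclidean_space => 'd::euclidean_space) => (real^2, 'b) l2 => (real^2, 'd) l2" where
 "clin L = coef (\<lambda>c y. c *\<^sub>R L y) (\<lambda>x. 1 :: real)"

lemma
 fixes L :: "'b::euclidean_space => 'd::euclidean_space"
 assumes L: "linear L"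
 shows bounded_linear_clin: "bounded_linear (clin L)"
  and L2_clin: "f \<in> L2 \<Omega> ==> (\<lambda>x. L (f x)) \<in> L2 \<Omega>"
  and clin_cls: "f \<in> L2 \<Omega> ==> clin L (cls \<Omega> f) = cls \<Omega> (\<lambda>x. L (f x))"
proof -
 have bl: "bounded_linear L" using L linear_conv_bounded_linear by blast
 have B: "bounded_bilinear (\<lambda>(c::real) y. c *\<^sub>R L y)"
  by (rule bounded_bilinear.comp[OF bounded_bilinear_scaleR bounded_linear_ident bl])
 have m: "(\<lambda>x. indicator \<Omega> x *\<^sub>R (1::real)) \<in> borel_measurable lebesgue"
  by (intro borel_measurable_scaleR borel_measurable_indicator) auto
 have C: "norm (1::real) \<le> 1" by simp
 show "bounded_linear (clin L)" unfolding clin_def by (rule bounded_linear_coef[OF B m C])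
 show "(\<lambda>x. L (f x)) \<in> L2 \<Omega>" if "f \<in> L2 \<Omega>" using L2_coef[OF B m C that] by simp
 show "clin L (cls \<Omega> f) = cls \<Omega> (\<lambda>x. L (f x))" if "f \<in> L2 \<Omega>" unfolding clin_def using coef_cls[OF B m C that] by simp
qed

lemma linear_trace: "linear (trace :: real^2^2 => real)"
 by (rule linearI) (simp_all add: trace_def sum.distrib sum_distrib_left)

lemma linear_k_cross: "linear k_cross"
 by (rule linearI) (simp_all add: k_cross_def vec_eq_iff forall_2)

definition outer :: "real^2 => real^2 => real^2^2" where "outer d y = (\<chi> i j. y $ i * d $ j)"

lemma bounded_bilinear_outer: "bounded_bilinear outer"
proof -
 have "bilinear outer" unfolding bilinear_def by (auto intro!: linearI simp: outer_def vec_eq_iff algebra_simps)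
 then show ?thesis by (simp add: bilinear_conv_bounded_bilinear)
qed

lemma weak_div_cls: "u \<in> H1 \<Omega> ==> weak_div \<Omega> u \<in> L2 \<Omega>"
 "u \<in> H1 \<Omega> ==> cls \<Omega> (weak_div \<Omega> u) = clin trace (grad u)" unfolding weak_div_def grad_def
 by (auto simp: clin_cls[OF linear_trace] H1_jacobian_L2 intro!: L2_clin[OF linear_trace])

text \<open>The Riesz representative of a functional on \<open>H10\<close>. It is an isometry from \<open>Hminus1\<close> onto \<open>V0\<close>.\<close>

definition rho :: "((real^2 => real^2) => real) => (real^2, real^2^2) l2" where
 "rho F = (SOME r. r \<in> V0 \<and> (\<forall>v\<in>H10 \<Omega>. F v = r \<bullet> grad v))"

lemma
 assumes F: "F \<in> Hminus1 \<Omega>"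
 shows rho_V0: "rho F \<in> V0" and rho: "v \<in> H10 \<Omega> ==> F v = rho F \<bullet> grad v"
proof -
 have add: "\<And>u v. u \<in> H10 \<Omega> ==> v \<in> H10 \<Omega> ==> F (\<lambda>x. u x + v x) = F u + F v"
  and sc: "\<And>u c. u \<in> H10 \<Omega> ==> F (\<lambda>x. c *\<^sub>R u x) = c * F u"
  using F by (auto simp: Hminus1_def)
 obtain C where C: "\<And>u. u \<in> H10 \<Omega> ==> \<bar>F u\<bar> \<le> C * norm (grad u)" proof -
  obtain C where "\<forall>u\<in>H10 \<Omega>. \<bar>F u\<bar> \<le> C * H10_norm \<Omega> u" using F unfolding Hminus1_def by blast
  then show ?thesis by (intro that[of C]) (simp add: H10_norm_eq[OF H10_H1, symmetric])
 qed
 have wd: "F u = F v" if u: "u \<in> H10 \<Omega>" and v: "v \<in> H10 \<Omega>" and e: "grad u = grad v" for u v proof -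
  have "F (\<lambda>x. u x + (- 1) *\<^sub>R v x) = F u - F v" by (simp only: add[OF u H10_scaleR[OF v]] sc[OF v])
  moreover have "grad (\<lambda>x. u x - v x) = 0" using grad_diff[OF H10_H1[OF u] H10_H1[OF v]] e by simp
  then have "F (\<lambda>x. u x - v x) = 0" using C[OF H10_diff[OF u v]] by simp
  ultimately show ?thesis by simp
 qed
 have V: "PV x = x" if "x \<in> V0" for x using PV(4) that by blast
 have "\<exists>r\<in>closure V0. \<forall>x\<in>V0. F (lift x) = r \<bullet> x" proof (rule riesz_subspace[OF subspace_V0, where C = C])
  fix x y assume x: "x \<in> V0" and y: "y \<in> V0"
  have "F (lift (x + y)) = F (\<lambda>t. lift x t + lift y t)" by (rule wd[OF lift(1) H10_add[OF lift(1) lift(1)]])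
     (simp add: grad_add[OF H10_H1[OF lift(1)] H10_H1[OF lift(1)]] lift V x y subspace_add[OF subspace_V0 x y])
  then show "F (lift (x + y)) = F (lift x) + F (lift y)" by (simp add: add lift)
 next
  fix c x assume x: "x \<in> V0"
  have "F (lift (c *\<^sub>R x)) = F (\<lambda>t. c *\<^sub>R lift x t)" by (rule wd[OF lift(1) H10_scaleR[OF lift(1)]])
     (simp add: grad_scale[OF H10_H1[OF lift(1)]] lift V x subspace_scale[OF subspace_V0 x])
  then show "F (lift (c *\<^sub>R x)) = c * F (lift x)" by (simp add: sc lift)
 next
  fix x assume x: "x \<in> V0"
  show "\<bar>F (lift x)\<bar> \<le> C * norm x" using C[OF lift(1), of x] by (simp add: lift V x)
 qed
 then obtain r where r: "r \<in> V0" "\<And>x. x \<in> V0 ==> F (lift x) = r \<bullet> x" unfolding closure_V0 by blast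
 have "F v = r \<bullet> grad v" if v: "v \<in> H10 \<Omega>" for v proof -
  have g: "grad v \<in> V0" using v by (simp add: V0_def)
  have "F v = F (lift (grad v))" by (rule wd[OF v lift(1)]) (simp add: lift V g)
  then show ?thesis by (simp add: r(2)[OF g])
 qed
 with r(1) have "r \<in> V0 \<and> (\<forall>v\<in>H10 \<Omega>. F v = r \<bullet> grad v)" by blast
 then have "rho F \<in> V0 \<and> (\<forall>v\<in>H10 \<Omega>. F v = rho F \<bullet> grad v)" unfolding rho_def by (rule someI)
 then show "rho F \<in> V0" "v \<in> H10 \<Omega> ==> F v = rho F \<bullet> grad v" by auto
qed

lemma V0_eqI: "x \<in> V0 ==> y \<in> V0 ==> (\<And>v. v \<in> H10 \<Omega> ==> x \<bullet> grad v = y \<bullet> grad v) ==> x = y"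
 by (rule subspace_inner_eqI[OF subspace_V0]) (auto simp: V0_def)

lemma inner_Hminus1: "(\<lambda>v. r \<bullet> grad v) \<in> Hminus1 \<Omega>"
 unfolding Hminus1_def
proof (intro CollectI conjI ballI allI exI[of _ "norm r"])
 fix u v and c :: real assume u: "u \<in> H10 \<Omega>"
 show "r \<bullet> grad (\<lambda>x. c *\<^sub>R u x) = c * (r \<bullet> grad u)" by (simp add: grad_scale H10_H1 u)
 show "\<bar>r \<bullet> grad u\<bar> \<le> norm r * H10_norm \<Omega> u" by (simp add: H10_norm_eq H10_H1 u Cauchy_Schwarz_ineq2)
 assume v: "v \<in> H10 \<Omega>"
 show "r \<bullet> grad (\<lambda>x. u x + v x) = r \<bullet> grad u + r \<bullet> grad v" by (simp add: grad_add H10_H1 u v inner_add_right)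
qed

lemma rho_inner: "r \<in> V0 ==> rho (\<lambda>v. r \<bullet> grad v) = r"
 by (rule V0_eqI[OF rho_V0[OF inner_Hminus1]]) (auto simp: rho[OF inner_Hminus1, symmetric])

lemma Hminus1_diff: "F \<in> Hminus1 \<Omega> ==> G \<in> Hminus1 \<Omega> ==> (\<lambda>v. F v - G v) \<in> Hminus1 \<Omega>"
proof -
 assume F: "F \<in> Hminus1 \<Omega>" and G: "G \<in> Hminus1 \<Omega>"
 obtain C D where C: "\<And>u. u \<in> H10 \<Omega> ==> \<bar>F u\<bar> \<le> C * H10_norm \<Omega> u" and D: "\<And>u. u \<in> H10 \<Omega> ==> \<bar>G u\<bar> \<le> D * H10_norm \<Omega> u"
  using F G unfolding Hminus1_def by blast
 show ?thesis unfolding Hminus1_def proof (intro CollectI conjI ballI allI exI[of _ "C + D"])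
  fix u v and c :: real assume u: "u \<in> H10 \<Omega>"
  show "F (\<lambda>x. c *\<^sub>R u x) - G (\<lambda>x. c *\<^sub>R u x) = c * (F u - G u)"
   using F G u by (auto simp: Hminus1_def right_diff_distrib)
  show "\<bar>F u - G u\<bar> \<le> (C + D) * H10_norm \<Omega> u" using C[OF u] D[OF u] by (simp add: distrib_right)
  assume v: "v \<in> H10 \<Omega>"
  show "F (\<lambda>x. u x + v x) - G (\<lambda>x. u x + v x) = F u - G u + (F v - G v)" using F G u v by (auto simp: Hminus1_def)
 qed
qed

lemma rho_diff: "F \<in> Hminus1 \<Omega> ==> G \<in> Hminus1 \<Omega> ==> rho (\<lambda>v. F v - G v) = rho F - rho G"
 by (rule V0_eqI)
   (auto simp: rho_V0 Hminus1_diff subspace_diff[OF subspace_V0] rho[symmetric] inner_diff_left)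

text \<open>The supremum is attained at the normalised representative.\<close>

lemma Hminus1_norm_eq:
 assumes F: "F \<in> Hminus1 \<Omega>"
 shows "Hminus1_norm \<Omega> F = norm (rho F)"
proof -
 let ?S = "{v \<in> H10 \<Omega>. H10_norm \<Omega> v \<le> 1}"
 have le: "\<bar>F v\<bar> \<le> norm (rho F)" if "v \<in> ?S" for v proof -
  have v: "v \<in> H10 \<Omega>" "norm (grad v) \<le> 1" using that by (auto simp: H10_norm_eq H10_H1)
  have "\<bar>F v\<bar> \<le> norm (rho F) * norm (grad v)" by (simp add: rho[OF F v(1)] Cauchy_Schwarz_ineq2)
  also have "\<dots> \<le> norm (rho F) * 1" using v(2) by (intro mult_left_mono) auto
  finally show ?thesis by simp
 qed
 have bdd: "bdd_above ((\<lambda>v. \<bar>F v\<bar>) ` ?S)" using le by (rule bdd_aboveI2)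
 have "\<exists>v\<in>?S. \<bar>F v\<bar> = norm (rho F)" proof -
  define x where "x = (1 / norm (rho F)) *\<^sub>R rho F"
  have x: "PV x = x" unfolding x_def by (intro PV(4) subspace_scale[OF subspace_V0] rho_V0[OF F])
  have "norm x \<le> 1" by (simp add: x_def)
  then have S: "lift x \<in> ?S" by (simp add: lift H10_norm_eq H10_H1 x)
  have "F (lift x) = rho F \<bullet> x" by (simp add: rho[OF F lift(1)] lift x)
  also have "\<dots> = norm (rho F)" by (simp add: x_def power2_norm_eq_inner[symmetric] power2_eq_square)
  finally show ?thesis using S by (intro bexI[of _ "lift x"]) auto
 qed
 then obtain v where v: "v \<in> ?S" "\<bar>F v\<bar> = norm (rho F)" by blast
 have "norm (rho F) \<le> (SUP v\<in>?S. \<bar>F v\<bar>)" using cSUP_upper[OF v(1) bdd] v(2) by simp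
 moreover have "(SUP v\<in>?S. \<bar>F v\<bar>) \<le> norm (rho F)" using v(1) le by (intro cSUP_least) auto
 ultimately show ?thesis unfolding Hminus1_norm_def by linarith
qed

end

lemma bounded_bilinear_compose:
 assumes J: "bounded_linear J" and B: "bounded_bilinear B"
 shows "bounded_bilinear (\<lambda>x y. J (B x y))"
proof -
 interpret J: bounded_linear J by (rule J)
 interpret B: bounded_bilinear B by (rule B)
 obtain K where K: "\<And>a b. norm (B a b) \<le> norm a * norm b * K" "K \<ge> 0" using B.nonneg_bounded by blast
 obtain L where L: "\<And>x. norm (J x) \<le> norm x * L" "L \<ge> 0" using J.nonneg_bounded by blast
 show ?thesis
 proof (unfold_locales, simp_all add: B.add_left B.add_right B.scaleR_left B.scaleR_right J.add J.scaleR)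
  show "\<exists>C. \<forall>a b. norm (J (B a b)) \<le> norm a * norm b * C" proof (intro exI allI)
   fix a b
   have "norm (J (B a b)) \<le> norm (B a b) * L" by (rule L)
   also have "\<dots> \<le> norm a * norm b * K * L" by (intro mult_right_mono K L)
   finally show "norm (J (B a b)) \<le> norm a * norm b * (K * L)" by (simp add: mult.assoc)
  qed
 qed
qed

context bounded_open begin

lemma indicator_continuous_measurable:
 fixes f :: "real^2 => 'b::euclidean_space"
 assumes "continuous_on \<Omega> f"
 shows "(\<lambda>x. indicator \<Omega> x *\<^sub>R f x) \<in> borel_measurable lebesgue"
 using borel_measurable_continuous_on_indicator[of \<Omega> f] assms op by (intro measurable_completion) simp

lemma PV_adjoint:
 fixes L :: "_ => 'h::real_inner"
 assumes L: "bounded_linear L" and LP: "\<And>x. L (PV x) = L x"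
 shows "PV (adjoint L y) = adjoint L y"
proof -
 have "x \<bullet> PV (adjoint L y) = x \<bullet> adjoint L y" for x
  by (simp only: PV(2)[symmetric] adjoint_inner[OF L, symmetric] LP)
 then show ?thesis using vector_eq_ldot by blast
qed

text \<open>The pointwise norm of a class, restricted to the domain.\<close>

definition nrm :: "(real^2, real^2) l2 => (real^2, real) l2" where
 "nrm y = cls \<Omega> (\<lambda>x. norm (rep_l2 y x))"

lemma L2_norm_rep: "(\<lambda>x. norm (rep_l2 y x)) \<in> L2 \<Omega>"
 by (rule sqint_L2[OF sqint_norm[OF sqint_rep]])

lemma nrm_Lipschitz: "norm (nrm y - nrm z) \<le> norm (y - z)"
proof -
 have "nrm y - nrm z = cls \<Omega> (\<lambda>x. norm (rep_l2 y x) - norm (rep_l2 z x))"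
  unfolding nrm_def by (rule cls_diff[OF L2_norm_rep L2_norm_rep, symmetric])
 also have "norm \<dots> \<le> 1 * norm (abs_l2 (rep_l2 (y - z)))" unfolding cls_def proof (rule norm_l2_mono)
  show "sqint (\<lambda>x. indicator \<Omega> x *\<^sub>R (norm (rep_l2 y x) - norm (rep_l2 z x)))"
   by (rule L2_sqint[OF L2_diff[OF L2_norm_rep L2_norm_rep]])
  show "AE x in lebesgue. norm (indicator \<Omega> x *\<^sub>R (norm (rep_l2 y x) - norm (rep_l2 z x))) \<le> 1 * norm (rep_l2 (y - z) x)"
   using rep_diff_l2[of y z] by eventually_elim (auto simp: indicator_def norm_triangle_ineq3)
 qed auto
 finally show ?thesis by simp
qed

lemma continuous_nrm: "continuous_on UNIV nrm"
 unfolding continuous_on_iff dist_norm using nrm_Lipschitz by (metis le_less_trans)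

lemma norm_nrm_le: "norm (nrm y) \<le> norm y"
proof -
 have "nrm 0 = cls \<Omega> (\<lambda>x. 0)" proof -
  have "AE x in lebesgue. rep_l2 (0 :: (real^2, real^2) l2) x = 0"
   using rep_abs_l2[OF sqint_zero] by (simp add: zero_abs_l2[symmetric])
  then show ?thesis unfolding nrm_def by (subst cls_eq_iff[OF L2_norm_rep L2_zero]) (auto simp: AE_\<Omega>)
 qed
 then show ?thesis using nrm_Lipschitz[of y 0] by (simp add: cls_zero)
qed

lemma nrm_cls: "f \<in> L2 \<Omega> ==> nrm (cls \<Omega> f) = cls \<Omega> (\<lambda>x. norm (f x))"
proof -
 assume f: "f \<in> L2 \<Omega>"
 have m: "(\<lambda>x. norm (f x)) \<in> L2 \<Omega>" proof -
  have "sqint (\<lambda>x. norm (indicator \<Omega> x *\<^sub>R f x))" by (rule sqint_norm[OF L2_sqint[OF f]])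
  then show ?thesis by (simp add: L2_iff)
 qed
 have "AE x in lebesgue. x \<in> \<Omega> \<longrightarrow> norm (rep_l2 (cls \<Omega> f) x) = norm (f x)" using rep_cls[OF f] by eventually_elim simp
 then show ?thesis unfolding nrm_def by (subst cls_eq_iff[OF L2_norm_rep m]) (simp add: AE_\<Omega>)
qed

end

section \<open>The linearized system as an operator equation\<close>

text \<open>The coefficients of the linearized system, with the bounds on the open domain that its weak
 formulation uses.\<close>

locale linearized_tidal = bounded_open \<Omega> for \<Omega> +
 fixes \<alpha> \<beta> :: real and h \<gamma> :: "real^2 => real" and dh :: "real^2 => real^2" and Bh M G :: real
 assumes \<alpha>: "\<alpha> > 0"
  and h_deriv: "\<And>x. x \<in> \<Omega> ==> (h has_derivative (\<lambda>w. dh x \<bullet> w)) (at x)"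
  and dh_cont: "continuous_on \<Omega> dh"
  and h_bd: "\<And>x. x \<in> \<Omega> ==> norm (h x) \<le> Bh" and dh_bd: "\<And>x. x \<in> \<Omega> ==> norm (dh x) \<le> M"
  and \<gamma>_cont: "continuous_on \<Omega> \<gamma>"
  and \<gamma>_pos: "\<And>x. x \<in> \<Omega> ==> 0 \<le> \<gamma> x" and \<gamma>_bd: "\<And>x. x \<in> \<Omega> ==> norm (\<gamma> x) \<le> G"
begin

lemma h_meas: "(\<lambda>x. indicator \<Omega> x *\<^sub>R h x) \<in> borel_measurable lebesgue"
 by (rule indicator_continuous_measurable[OF has_derivative_continuous_on[OF has_derivative_at_withinI[OF h_deriv]]])

lemmas coef_h = bounded_bilinear_scaleR h_meas h_bd
lemmas coef_dh = bounded_bilinear_outer indicator_continuous_measurable[OF dh_cont] dh_bd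
lemmas coef_\<gamma> = bounded_bilinear_mult indicator_continuous_measurable[OF \<gamma>_cont] \<gamma>_bd

abbreviation "jach x y \<equiv> coef scaleR h x + coef outer dh y"

text \<open>The product rule for test functions passes to the limit, multiplication by \<open>h\<close> and by its gradient
 being bounded in \<open>L2\<close>. This makes \<open>div (h w)\<close> a bounded operator of the gradient of \<open>w\<close>.\<close>

lemma H10_multiple:
 assumes u: "u \<in> H10 \<Omega>"
 shows "(\<lambda>x. h x *\<^sub>R u x) \<in> H1 \<Omega>" "grad (\<lambda>x. h x *\<^sub>R u x) = jach (grad u) (cls \<Omega> u)"
proof -
 obtain \<phi> where \<phi>: "\<And>n. \<phi> n \<in> test_functions \<Omega>" "(\<lambda>n. cls \<Omega> (\<phi> n)) \<longlonglongrightarrow> cls \<Omega> u"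
  "(\<lambda>n. grad (\<phi> n)) \<longlonglongrightarrow> grad u" using u unfolding H10_iff by blast
 have clsG: "cls \<Omega> (\<lambda>x. h x *\<^sub>R D x + outer (dh x) (v x)) = jach (cls \<Omega> D) (cls \<Omega> v)"
  and LG: "(\<lambda>x. h x *\<^sub>R D x + outer (dh x) (v x)) \<in> L2 \<Omega>" if D: "D \<in> L2 \<Omega>" and v: "v \<in> L2 \<Omega>" for D v
  using cls_add[OF L2_coef[OF coef_h D] L2_coef[OF coef_dh v]] L2_add[OF L2_coef[OF coef_h D] L2_coef[OF coef_dh v]]
  by (simp_all add: coef_cls[OF coef_h D] coef_cls[OF coef_dh v])
 define G where "G x = h x *\<^sub>R weak_jacobian \<Omega> u x + outer (dh x) (u x)" for x
 note u1 = H10_H1[OF u] and u2 = H10_L2[OF u]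
 note J = H1_jacobian_L2[OF u1]
 have G: "G \<in> L2 \<Omega>" "cls \<Omega> G = jach (grad u) (cls \<Omega> u)"
  using LG[OF J u2] clsG[OF J u2] by (simp_all add: G_def[abs_def] grad_def)
 have hu: "(\<lambda>x. h x *\<^sub>R u x) \<in> L2 \<Omega>" by (rule L2_coef[OF coef_h u2])
 have "has_weak_jacobian \<Omega> (\<lambda>x. h x *\<^sub>R u x) G"
 proof (rule iffD2[OF has_weak_jacobian_iff[OF hu G(1)]], intro ballI allI)
  fix \<psi> :: "real^2 => real" and i j assume \<psi>: "\<psi> \<in> test_functions \<Omega>"
  let ?a = "cls \<Omega> (\<lambda>x. frechet_derivative \<psi> (at x) (axis j 1) *\<^sub>R axis i 1) :: (real^2, real^2) l2"
  let ?b = "cls \<Omega> (\<lambda>x. \<psi> x *\<^sub>R axis2 i j)"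
  have "cls \<Omega> (\<lambda>x. h x *\<^sub>R \<phi> n x) \<bullet> ?a = - (jach (grad (\<phi> n)) (cls \<Omega> (\<phi> n)) \<bullet> ?b)" for n proof -
   note t = test_L2[OF \<phi>(1)[of n]] and jt = jac_test_L2[OF \<phi>(1)[of n]]
   have w: "has_weak_jacobian \<Omega> (\<lambda>x. h x *\<^sub>R \<phi> n x) (\<lambda>x. h x *\<^sub>R jac (\<phi> n) x + outer (dh x) (\<phi> n x))"
    unfolding outer_def by (rule smooth_multiple_jacobian[OF \<phi>(1) h_deriv dh_cont])
   have ht: "(\<lambda>x. h x *\<^sub>R \<phi> n x) \<in> L2 \<Omega>" by (rule L2_coef[OF coef_h t])
   show ?thesis using w \<psi> unfolding has_weak_jacobian_iff[OF ht LG[OF jt t]] clsG[OF jt t] grad_test[OF \<phi>(1)]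
    by blast
  qed
  then have eq: "coef scaleR h (cls \<Omega> (\<phi> n)) \<bullet> ?a = - (jach (grad (\<phi> n)) (cls \<Omega> (\<phi> n)) \<bullet> ?b)" for n
   by (simp add: coef_cls[OF coef_h test_L2[OF \<phi>(1)]])
  have "(\<lambda>n. coef scaleR h (cls \<Omega> (\<phi> n)) \<bullet> ?a) \<longlonglongrightarrow> coef scaleR h (cls \<Omega> u) \<bullet> ?a"
   by (intro tendsto_inner bounded_linear.tendsto[OF bounded_linear_coef[OF coef_h]] \<phi> tendsto_const)
  moreover have "(\<lambda>n. coef scaleR h (cls \<Omega> (\<phi> n)) \<bullet> ?a) \<longlonglongrightarrow> - (jach (grad u) (cls \<Omega> u) \<bullet> ?b)" unfolding eq
   by (intro tendsto_minus tendsto_inner tendsto_add bounded_linear.tendsto[OF bounded_linear_coef[OF coef_h]]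
    bounded_linear.tendsto[OF bounded_linear_coef[OF coef_dh]] \<phi> tendsto_const)
  ultimately have "coef scaleR h (cls \<Omega> u) \<bullet> ?a = - (jach (grad u) (cls \<Omega> u) \<bullet> ?b)" by (rule LIMSEQ_unique)
  then show "cls \<Omega> (\<lambda>x. h x *\<^sub>R u x) \<bullet> ?a = - (cls \<Omega> G \<bullet> ?b)" by (simp only: G(2) coef_cls[OF coef_h u2])
 qed
 from H1_I[OF hu G(1) this] G(2) show "(\<lambda>x. h x *\<^sub>R u x) \<in> H1 \<Omega>"
  "grad (\<lambda>x. h x *\<^sub>R u x) = jach (grad u) (cls \<Omega> u)" by simp_all
qed

text \<open>The operator \<open>w \<mapsto> div (h w)\<close>, on gradients.\<close>

definition divh :: "(real^2, real^2^2) l2 => (real^2, real) l2" where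
 "divh x = clin trace (jach (PV x) (iota x))"

lemma bounded_linear_divh: "bounded_linear divh"
 unfolding divh_def[abs_def]
 by (intro bounded_linear_compose[OF bounded_linear_clin[OF linear_trace]] bounded_linear_add
  bounded_linear_compose[OF bounded_linear_coef[OF coef_h]] bounded_linear_compose[OF bounded_linear_coef[OF coef_dh]]
  PV(1) bounded_linear_iota)

lemma divh_PV: "divh (PV x) = divh x" by (simp add: divh_def PV(5) iota_PV)

lemma iota_grad': "u \<in> H10 \<Omega> ==> iota (grad u) = cls \<Omega> u"
 by (rule iota_grad) (simp_all add: PV_grad)

lemma divh_grad:
 assumes u: "u \<in> H10 \<Omega>"
 shows "weak_div \<Omega> (\<lambda>x. h x *\<^sub>R u x) \<in> L2 \<Omega>" "cls \<Omega> (weak_div \<Omega> (\<lambda>x. h x *\<^sub>R u x)) = divh (grad u)"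
 using weak_div_cls[OF H10_multiple(1)[OF u]]
 by (simp_all add: H10_multiple(2)[OF u] divh_def PV_grad[OF u] iota_grad'[OF u])

text \<open>The embedding and the projection for pairs of a gradient and an elevation. The elevation is its
 own representative: it is controlled in \<open>L2\<close> only, on both levels.\<close>

definition iota2 :: "(real^2, real^2^2) l2 \<times> (real^2, real) l2 => (real^2, real^2) l2 \<times> (real^2, real) l2" where
 "iota2 p = (iota (fst p), snd p)"

definition P2 :: "(real^2, real^2^2) l2 \<times> (real^2, real) l2 => (real^2, real^2^2) l2 \<times> (real^2, real) l2" where
 "P2 p = (PV (fst p), snd p)"

text \<open>The part of the operator with constant coefficients in time; its components are tested with
 gradients and with elevations.\<close>

definition Lop :: "(real^2, real^2^2) l2 \<times> (real^2, real) l2 => (real^2, real^2^2) l2 \<times> (real^2, real) l2" where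
 "Lop p = (\<alpha> *\<^sub>R PV (fst p) + \<beta> *\<^sub>R adjoint iota (clin k_cross (iota (fst p))) - PV (adjoint (clin trace) (snd p)), divh (fst p))"

text \<open>Friction, where \<open>a\<close> is the class of \<open>|u + w0|\<close>. The coefficient enters linearly, so that
 measurability in time of the operator is inherited from that of \<open>a\<close>.\<close>

definition Nop :: "(real^2, real) l2 => (real^2, real^2^2) l2 \<times> (real^2, real) l2 => (real^2, real^2^2) l2 \<times> (real^2, real) l2" where
 "Nop a p = (2 *\<^sub>R Qop (coef (*) \<gamma> a) (fst p), 0)"

definition Aop :: "(real^2, real) l2 => (real^2, real^2^2) l2 \<times> (real^2, real) l2 => (real^2, real^2^2) l2 \<times> (real^2, real) l2" where
 "Aop a p = Lop p + Nop a p"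

lemma bounded_linear_Lop: "bounded_linear Lop"
 unfolding Lop_def[abs_def] by (intro bounded_linear_Pair bounded_linear_add bounded_linear_sub
  bounded_linear_compose[OF bounded_linear_scaleR_right] bounded_linear_compose[OF PV(1)]
  bounded_linear_compose[OF bounded_linear_adjoint[OF bounded_linear_iota]]
  bounded_linear_compose[OF bounded_linear_clin[OF linear_k_cross]] bounded_linear_compose[OF bounded_linear_iota]
  bounded_linear_compose[OF bounded_linear_adjoint[OF bounded_linear_clin[OF linear_trace]]]
  bounded_linear_compose[OF bounded_linear_divh] bounded_linear_fst bounded_linear_snd)

lemma bounded_bilinear_Nop: "bounded_bilinear Nop"
proof -
 have "bounded_linear (\<lambda>x::(real^2, real^2^2) l2. (2 *\<^sub>R x, 0 :: (real^2, real) l2))"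
  by (intro bounded_linear_Pair bounded_linear_scaleR_right bounded_linear_zero)
 from bounded_bilinear_compose[OF this bounded_bilinear.comp[OF bounded_bilinear_Qop bounded_linear_coef[OF coef_\<gamma>] bounded_linear_fst]]
 show ?thesis unfolding Nop_def[abs_def] .
qed

lemma iota2:
 "bounded_linear iota2" "bounded_linear P2" "P2 p \<bullet> q = p \<bullet> P2 q" "P2 (P2 p) = P2 p"
 "iota2 (P2 p) = iota2 p" "iota2 p = 0 ==> P2 p = 0"
proof -
 show "bounded_linear iota2" unfolding iota2_def[abs_def]
  by (intro bounded_linear_Pair bounded_linear_compose[OF bounded_linear_iota] bounded_linear_fst bounded_linear_snd)
 show "bounded_linear P2" unfolding P2_def[abs_def]
  by (intro bounded_linear_Pair bounded_linear_compose[OF PV(1)] bounded_linear_fst bounded_linear_snd)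
qed (auto simp: iota2_def P2_def inner_prod_def PV iota_PV zero_prod_def iota_inj)

lemma adjoint_iota2: "adjoint iota2 q = (adjoint iota (fst q), snd q)"
proof -
 have "adjoint iota2 = (\<lambda>q. (adjoint iota (fst q), snd q))"
  by (rule adjoint_unique) (simp add: iota2_def inner_prod_def adjoint_inner[OF bounded_linear_iota])
 then show ?thesis by simp
qed

lemma P2_Aop: "P2 (Aop a p) = Aop a p" and Aop_P2: "Aop a (P2 p) = Aop a p"
proof -
 interpret PV: bounded_linear PV by (rule PV(1))
 show "P2 (Aop a p) = Aop a p"
  by (simp add: P2_def Aop_def Lop_def Nop_def PV.add PV.diff PV.scaleR PV(5) PV_adjoint[OF bounded_linear_iota iota_PV] Qop_PV)
 show "Aop a (P2 p) = Aop a p" by (simp add: P2_def Aop_def Lop_def Nop_def PV(5) iota_PV Qop_PV divh_PV)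
qed

lemma Aop_bounds:
 obtains C where "C \<ge> 0" "\<And>a p. norm a \<le> Ca ==> norm (Aop a p) \<le> C * norm p"
proof -
 obtain K where K: "\<And>p. norm (Lop p) \<le> norm p * K" "K \<ge> 0"
  using bounded_linear.nonneg_bounded[OF bounded_linear_Lop] by blast
 obtain L where L: "\<And>a p. norm (Nop a p) \<le> norm a * norm p * L" "L \<ge> 0"
  using bounded_bilinear.nonneg_bounded[OF bounded_bilinear_Nop] by blast
 show ?thesis proof (rule that[of "K + max Ca 0 * L"])
  show "K + max Ca 0 * L \<ge> 0" using K L by simp
  fix a p assume a: "norm (a :: (real^2, real) l2) \<le> Ca"
  have "norm (Aop a p) \<le> norm p * K + norm a * norm p * L"
   unfolding Aop_def by (rule order_trans[OF norm_triangle_ineq add_mono[OF K(1) L(1)]])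
  also have "\<dots> \<le> norm p * K + max Ca 0 * norm p * L" using a L(2) by (intro add_left_mono mult_right_mono) auto
  finally show "norm (Aop a p) \<le> (K + max Ca 0 * L) * norm p" by (simp add: algebra_simps)
 qed
qed

lemma Aop_linear: "linear (Aop a)"
proof -
 interpret L: bounded_linear Lop by (rule bounded_linear_Lop)
 interpret N: bounded_bilinear Nop by (rule bounded_bilinear_Nop)
 show ?thesis unfolding Aop_def[abs_def]
  by (rule linearI) (simp_all add: L.add L.scaleR N.add_right N.scaleR_right scaleR_add_right)
qed

lemma k_cross_orthogonal: "u \<in> L2 \<Omega> ==> clin k_cross (cls \<Omega> u) \<bullet> cls \<Omega> u = 0"
proof -
 assume u: "u \<in> L2 \<Omega>"
 have "clin k_cross (cls \<Omega> u) \<bullet> cls \<Omega> u = L2_inner \<Omega> (\<lambda>x. k_cross (u x)) u"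
  by (simp add: clin_cls[OF linear_k_cross u] L2_inner_cls[OF L2_clin[OF linear_k_cross u] u])
 also have "\<dots> = 0" by (simp add: L2_inner_def k_cross_def inner_vec_def sum_2)
 finally show ?thesis .
qed

lemma friction_nonneg:
 assumes f: "f \<in> L2 \<Omega>" and f0: "\<And>x. f x \<ge> 0"
 shows "coef (*) \<gamma> (cls \<Omega> f) \<bullet> dotx x x \<ge> 0"
proof -
 define u where "u = lift x"
 have u: "u \<in> H10 \<Omega>" "grad u = PV x" by (auto simp: u_def lift)
 have "coef (*) \<gamma> (cls \<Omega> f) \<bullet> dotx x x = cls \<Omega> (\<lambda>x. \<gamma> x * f x) \<bullet> dotx (grad u) (grad u)"
  by (simp add: u dotx_PV coef_cls[OF coef_\<gamma> f])
 also have "\<dots> = L2_inner \<Omega> (\<lambda>x. \<gamma> x * f x) (\<lambda>x. u x \<bullet> u x)"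
  by (simp add: dotx_grad(2)[OF u(1) u(1)] L2_inner_cls[OF L2_coef[OF coef_\<gamma> f] dotx_grad(1)[OF u(1) u(1)]])
 also have "\<dots> \<ge> 0" unfolding L2_inner_def by (rule Bochner_Integration.integral_nonneg) (use \<gamma>_pos f0 in auto)
 finally show ?thesis .
qed

text \<open>Rotation contributes nothing and friction a nonnegative amount. The coupling terms are at most \<open>K
 X Y\<close>, with \<open>X\<close> and \<open>Y\<close> the norms of gradient and elevation, and half of the viscosity absorbs them.
 The remaining \<open>\<alpha> / 2\<close> in \<open>lam\<close> pays for the elevation in the norm of the pair.\<close>

lemma Aop_garding:
 obtains c lam where "c > 0" "lam \<ge> 0"
  "\<And>f p. f \<in> L2 \<Omega> ==> (\<And>x. f x \<ge> 0) ==> c * (norm (P2 p))\<^sup>2 \<le> Aop (cls \<Omega> f) p \<bullet> p + lam * (norm (iota2 p))\<^sup>2"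
proof -
 obtain Kd where Kd: "\<And>x. norm (divh x) \<le> norm x * Kd" "Kd \<ge> 0"
  using bounded_linear.nonneg_bounded[OF bounded_linear_divh] by blast
 have bt: "bounded_linear (clin trace :: (real^2, real^2^2) l2 => (real^2, real) l2)"
  by (rule bounded_linear_clin[OF linear_trace])
 obtain Kt where Kt: "\<And>x. norm (clin trace x :: (real^2, real) l2) \<le> norm (x :: (real^2, real^2^2) l2) * Kt" "Kt \<ge> 0"
  using bounded_linear.nonneg_bounded[OF bt] by blast
 define K where "K = Kd + Kt"
 show ?thesis proof (rule that[of "\<alpha> / 2" "\<alpha> / 2 + K\<^sup>2 / (2 * \<alpha>)"])
  show "\<alpha> / 2 > 0" "\<alpha> / 2 + K\<^sup>2 / (2 * \<alpha>) \<ge> 0" using \<alpha> by auto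
  fix f :: "real^2 => real" and p :: "(real^2, real^2^2) l2 \<times> (real^2, real) l2"
  assume f: "f \<in> L2 \<Omega>" "\<And>x. f x \<ge> 0"
  obtain x \<eta> where p: "p = (x, \<eta>)" by (cases p)
  define X Y where "X = norm (PV x)" and "Y = norm \<eta>"
  have 1: "PV x \<bullet> x = X\<^sup>2"
   unfolding X_def power2_norm_eq_inner by (simp add: PV(2)[of x "PV x"] PV(5) inner_commute)
  have 2: "adjoint iota (clin k_cross (iota x)) \<bullet> x = 0" using k_cross_orthogonal[OF H10_L2[OF lift(1)], of x]
   by (simp add: inner_commute adjoint_inner[OF bounded_linear_iota, symmetric] iota_def)
  have 3: "Qop (coef (*) \<gamma> (cls \<Omega> f)) x \<bullet> x \<ge> 0" using friction_nonneg[OF f] by (simp add: Qop)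
  have "PV (adjoint (clin trace) \<eta>) \<bullet> x = clin trace (PV x) \<bullet> \<eta>"
   by (simp add: PV(2) inner_commute[of _ "PV x"] adjoint_inner[OF bt])
  also have "\<dots> \<le> norm (clin trace (PV x) :: (real^2, real) l2) * norm \<eta>" by (rule norm_cauchy_schwarz)
  also have "\<dots> \<le> X * Kt * Y" unfolding X_def Y_def by (intro mult_right_mono Kt) auto
  finally have 4: "PV (adjoint (clin trace) \<eta>) \<bullet> x \<le> X * Kt * Y" .
  have "- (divh x \<bullet> \<eta>) \<le> norm (divh (PV x)) * norm \<eta>"
   unfolding divh_PV using Cauchy_Schwarz_ineq2[of "divh x" \<eta>] by linarith
  also have "\<dots> \<le> X * Kd * Y" unfolding X_def Y_def by (intro mult_right_mono Kd) auto
  finally have 5: "- (X * Kd * Y) \<le> divh x \<bullet> \<eta>" by linarith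
  have "Aop (cls \<Omega> f) p \<bullet> p = \<alpha> * X\<^sup>2 + 2 * (Qop (coef (*) \<gamma> (cls \<Omega> f)) x \<bullet> x)
    - PV (adjoint (clin trace) \<eta>) \<bullet> x + divh x \<bullet> \<eta>"
   by (simp add: p Aop_def Lop_def Nop_def inner_prod_def inner_add_left inner_diff_left 1 2)
  also have "\<dots> \<ge> \<alpha> * X\<^sup>2 - K * X * Y" using 3 4 5 by (simp add: K_def algebra_simps)
  finally have A: "Aop (cls \<Omega> f) p \<bullet> p \<ge> \<alpha> * X\<^sup>2 - K * X * Y" .
  (* Young's inequality with the weight that leaves half of the viscosity. *)
  have "0 \<le> (\<alpha> * X - K * Y)\<^sup>2 / (2 * \<alpha>)" using \<alpha> by simp
  also have "\<dots> = \<alpha> / 2 * X\<^sup>2 - K * X * Y + K\<^sup>2 / (2 * \<alpha>) * Y\<^sup>2" using \<alpha> by (simp add: field_simps power2_eq_square)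
  finally have yng: "K * X * Y \<le> \<alpha> / 2 * X\<^sup>2 + K\<^sup>2 / (2 * \<alpha>) * Y\<^sup>2" by simp
  have nP: "(norm (P2 p))\<^sup>2 = X\<^sup>2 + Y\<^sup>2" by (simp add: P2_def p norm_prod_def X_def Y_def)
  have "Y\<^sup>2 \<le> (norm (iota2 p))\<^sup>2" by (simp add: iota2_def p norm_prod_def Y_def)
  then have "(\<alpha> / 2 + K\<^sup>2 / (2 * \<alpha>)) * Y\<^sup>2 \<le> (\<alpha> / 2 + K\<^sup>2 / (2 * \<alpha>)) * (norm (iota2 p))\<^sup>2"
   using \<alpha> by (intro mult_left_mono) auto
  then show "\<alpha> / 2 * (norm (P2 p))\<^sup>2 \<le> Aop (cls \<Omega> f) p \<bullet> p + (\<alpha> / 2 + K\<^sup>2 / (2 * \<alpha>)) * (norm (iota2 p))\<^sup>2"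
   using A yng unfolding nP distrib_left distrib_right by linarith
 qed
qed

text \<open>Paired with a gradient, the operator is the weak form of the left hand side of the momentum
 equation. The class \<open>y\<close> may differ from that of \<open>\<eta>\<close> outside the domain, where it is never tested.\<close>

lemma Aop_weak:
 assumes w: "w \<in> H10 \<Omega>" and v: "v \<in> H10 \<Omega>" and \<eta>: "\<eta> \<in> L2 \<Omega>" "cls \<Omega> (rep_l2 y) = cls \<Omega> \<eta>"
  and b: "(\<lambda>x. norm (u x + w0 x)) \<in> L2 \<Omega>" 
 shows "fst (Aop (cls \<Omega> (\<lambda>x. norm (u x + w0 x))) (grad w, y)) \<bullet> grad v
  = A_op \<Omega> \<alpha> \<beta> w v + L2_inner \<Omega> (B'_op \<gamma> w0 u w) v + grad_op \<Omega> \<eta> v"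
proof -
 note w2 = H10_L2[OF w] and v2 = H10_L2[OF v] and w1 = H10_H1[OF w] and v1 = H10_H1[OF v]
 have bt: "bounded_linear (clin trace :: (real^2, real^2^2) l2 => (real^2, real) l2)"
  by (rule bounded_linear_clin[OF linear_trace])
 have 1: "L2_inner \<Omega> (weak_jacobian \<Omega> w) (weak_jacobian \<Omega> v) = PV (grad w) \<bullet> grad v"
  by (simp add: L2_inner_cls H1_jacobian_L2 w1 v1 PV_grad w) (simp add: grad_def)
 have 2: "L2_inner \<Omega> (\<lambda>x. k_cross (w x)) v = adjoint iota (clin k_cross (iota (grad w))) \<bullet> grad v"
  by (simp add: inner_commute[of _ "grad v"] adjoint_inner[OF bounded_linear_iota, symmetric] iota_grad' w v
   clin_cls[OF linear_k_cross w2] L2_inner_cls[OF L2_clin[OF linear_k_cross w2] v2] inner_commute)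
 have 3: "L2_inner \<Omega> (B'_op \<gamma> w0 u w) v = 2 * (Qop (coef (*) \<gamma> (cls \<Omega> (\<lambda>x. norm (u x + w0 x)))) (grad w) \<bullet> grad v)"
 proof -
  have "Qop (coef (*) \<gamma> (cls \<Omega> (\<lambda>x. norm (u x + w0 x)))) (grad w) \<bullet> grad v
   = L2_inner \<Omega> (\<lambda>x. \<gamma> x * norm (u x + w0 x)) (\<lambda>x. w x \<bullet> v x)"
   by (simp add: Qop coef_cls[OF coef_\<gamma> b] dotx_grad(2)[OF w v] L2_inner_cls[OF L2_coef[OF coef_\<gamma> b] dotx_grad(1)[OF w v]])
  then show ?thesis unfolding L2_inner_def B'_op_def
   by (simp only: integral_mult_right_zero[symmetric]) (simp add: mult_ac)
 qed
 have 4: "grad_op \<Omega> \<eta> v = - (PV (adjoint (clin trace) y) \<bullet> grad v)" proof -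
  have "PV (adjoint (clin trace) y) \<bullet> grad v = grad v \<bullet> adjoint (clin trace) y"
   unfolding PV(2) PV_grad[OF v] by (rule inner_commute)
  also have "\<dots> = clin trace (grad v) \<bullet> y" by (rule adjoint_inner[OF bt, symmetric])
  also have "\<dots> = y \<bullet> cls \<Omega> (weak_div \<Omega> v)" unfolding weak_div_cls(2)[OF v1] by (rule inner_commute)
  also have "\<dots> = cls \<Omega> (rep_l2 y) \<bullet> cls \<Omega> (weak_div \<Omega> v)" by (rule cls_rep_inner[OF weak_div_cls(1)[OF v1], symmetric])
  also have "\<dots> = L2_inner \<Omega> \<eta> (weak_div \<Omega> v)" unfolding \<eta>(2) by (rule L2_inner_cls[OF \<eta>(1) weak_div_cls(1)[OF v1], symmetric])
  finally show ?thesis by (simp add: grad_op_def)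
 qed
 show ?thesis by (simp add: Aop_def Lop_def Nop_def A_op_def inner_add_left inner_diff_left 1 2 3 4)
qed

end

section \<open>Bochner spaces of classes\<close>

lemma sqint_Pair:
 fixes f :: "real => 'b::{real_inner,banach,second_countable_topology}"
  and g :: "real => 'c::{real_inner,banach,second_countable_topology}"
 assumes f: "sqint f" and g: "sqint g"
 shows "sqint (\<lambda>t. (f t, g t))"
proof -
 have bf: "bounded_linear (\<lambda>x::'b. (x, 0::'c))" and bg: "bounded_linear (\<lambda>x::'c. (0::'b, x))"
  by (intro bounded_linear_Pair bounded_linear_ident bounded_linear_zero)+
 have "sqint (\<lambda>t. (f t, 0) + (0, g t))"
  by (rule sqint_add[OF sqint_bounded_linear[OF bf f] sqint_bounded_linear[OF bg g]])
 then show ?thesis by simp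
qed

lemma tint_AE_eq:
 fixes f g :: "real => real"
 assumes f: "tintegrable f a b" and ae: "AE t in lebesgue. t \<in> {a<..b} \<longrightarrow> f t = g t"
 shows "tint f a b = tint g a b"
proof (rule tint_cong_AE[OF ae f])
 have m: "(\<lambda>t. indicator {a<..b} t *\<^sub>R f t) \<in> borel_measurable lebesgue"
  using f unfolding tintegrable_def by (rule borel_measurable_integrable)
 have ae': "AE t in lebesgue. indicator {a<..b} t *\<^sub>R f t = indicator {a<..b} t *\<^sub>R g t"
  using ae by eventually_elim (auto simp: indicator_def)
 show "tintegrable g a b" using f unfolding tintegrable_def
  by (rule integrable_cong_AE_imp) (use lebesgue_measurable_AE[OF m ae'] ae' in auto)
qed

text \<open>The vectors \<open>e a\<close> represent the elements of a normed space given by a carrier \<open>V\<close> and a norm \<open>N\<close>.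
 Bochner measurability speaks of distances alone, which \<open>e\<close> preserves.\<close>

definition embeds :: "('a => 'c::real_normed_vector) set => (('a => 'c) => real) =>
  (('a => 'c) => 'b::real_normed_vector) => bool" where
 "embeds V N e \<longleftrightarrow> (\<forall>a\<in>V. N a = norm (e a)) \<and> (\<forall>a\<in>V. \<forall>b\<in>V. N (\<lambda>x. a x - b x) = norm (e a - e b))"

lemma L2_time_sqint:
 fixes e :: "('a => 'c::real_normed_vector) => 'b::{real_inner,banach,second_countable_topology}"
 assumes f: "f \<in> L2_time T V N" and e: "embeds V N e"
 shows "sqint (\<lambda>t. indicator {0<..T} t *\<^sub>R e (f t))"
proof -
 have sm: "strongly_measurable T V N f" and fV: "AE t in lebesgue_on {0..T}. f t \<in> V"
  and i: "integrable (lebesgue_on {0..T}) (\<lambda>t. (N (f t))\<^sup>2)" using f by (auto simp: L2_time_def)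
 have m: "(\<lambda>t. indicator {0<..T} t *\<^sub>R e (f t)) \<in> borel_measurable lebesgue"
  by (rule strongly_measurable_imp_measurable[OF sm fV]) (use e in \<open>auto simp: embeds_def\<close>)
 have "integrable lebesgue (\<lambda>t. indicator {0<..T} t *\<^sub>R (N (f t))\<^sup>2)"
  using i unfolding integrable_interval_iff tintegrable_def .
 moreover have "(\<lambda>t. (norm (indicator {0<..T} t *\<^sub>R e (f t)))\<^sup>2) \<in> borel_measurable lebesgue"
  by (rule borel_measurable_continuous_on[OF _ m, of "\<lambda>x. (norm x)\<^sup>2"]) (intro continuous_intros)
 moreover have "AE t in lebesgue. indicator {0<..T} t *\<^sub>R (N (f t))\<^sup>2 = (norm (indicator {0<..T} t *\<^sub>R e (f t)))\<^sup>2"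
  using fV unfolding AE_interval_iff by eventually_elim (use e in \<open>auto simp: embeds_def indicator_def\<close>)
 ultimately show ?thesis unfolding sqint_def using m by (blast intro: integrable_cong_AE_imp)
qed

lemma sqint_L2_time:
 fixes e :: "('a => 'c::real_normed_vector) => 'b::{real_inner,banach,second_countable_topology}"
 assumes g: "sqint g" and e: "embeds V N e" and fg: "AE t in lebesgue_on {0..T}. f t \<in> V \<and> e (f t) = g t"
  and Pr: "bounded_linear Pr" "\<And>y. Pr y \<in> e ` V" "\<And>v. v \<in> V ==> Pr (e v) = e v"
 shows "f \<in> L2_time T V N"
proof -
 have "strongly_measurable T V N f"
  by (rule measurable_imp_strongly_measurable[OF sqintD[OF g] fg _ _ Pr]) (use e in \<open>auto simp: embeds_def\<close>)
 moreover have "AE t in lebesgue_on {0..T}. f t \<in> V" using fg by eventually_elim simp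
 moreover have "tintegrable (\<lambda>t. (N (f t))\<^sup>2) 0 T" proof -
  have t: "integrable lebesgue (\<lambda>t. indicator {0<..T} t *\<^sub>R (norm (g t))\<^sup>2)"
   using tintegrable_norm2[OF g, of 0 T] unfolding tintegrable_def .
  have ae: "AE t in lebesgue. indicator {0<..T} t *\<^sub>R (norm (g t))\<^sup>2 = indicator {0<..T} t *\<^sub>R (N (f t))\<^sup>2"
   using fg unfolding AE_interval_iff by eventually_elim (use e in \<open>auto simp: embeds_def indicator_def\<close>)
  show ?thesis unfolding tintegrable_def
   by (rule integrable_cong_AE_imp[OF t lebesgue_measurable_AE[OF borel_measurable_integrable[OF t] ae]])
     (use ae in auto)
 qed
 ultimately show ?thesis by (simp add: L2_time_def integrable_interval_iff)
qed

context bounded_open begin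

lemma embeds_L2: "embeds (L2 \<Omega>) (L2_norm \<Omega>) (cls \<Omega>)"
 by (simp add: embeds_def L2_norm_cls L2_diff cls_diff)

lemma embeds_H10: "embeds (H10 \<Omega>) (H10_norm \<Omega>) grad"
 by (simp add: embeds_def H10_norm_eq H10_H1 H10_diff grad_diff)

lemma embeds_Hminus1: "embeds (Hminus1 \<Omega>) (Hminus1_norm \<Omega>) rho"
 by (simp add: embeds_def Hminus1_norm_eq Hminus1_diff rho_diff)

lemma L2_L2_time:
 assumes g: "sqint g" and f: "AE t in lebesgue_on {0..T}. f t \<in> L2 \<Omega> \<and> cls \<Omega> (f t) = g t"
 shows "f \<in> L2_time T (L2 \<Omega>) (L2_norm \<Omega>)"
 by (rule sqint_L2_time[OF g embeds_L2 f bounded_linear_cls_rep]) (auto intro: rep_L2 cls_rep_cls)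

lemma H10_L2_time:
 assumes g: "sqint g" and f: "AE t in lebesgue_on {0..T}. f t \<in> H10 \<Omega> \<and> grad (f t) = g t"
 shows "f \<in> L2_time T (H10 \<Omega>) (H10_norm \<Omega>)"
 by (rule sqint_L2_time[OF g embeds_H10 f PV(1)]) (use PV(3) PV_grad in \<open>auto simp: V0_def\<close>)

lemma Hminus1_L2_time:
 assumes g: "sqint g" and f: "AE t in lebesgue_on {0..T}. f t \<in> Hminus1 \<Omega> \<and> rho (f t) = g t"
 shows "f \<in> L2_Hminus1 \<Omega> T"
proof (rule sqint_L2_time[OF g embeds_Hminus1 f PV(1)])
 fix y show "PV y \<in> rho ` Hminus1 \<Omega>" using rho_inner[OF PV(3)] inner_Hminus1 by (metis image_eqI)
qed (rule PV(4)[OF rho_V0])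

lemma C_time_iff:
 "f \<in> C_time T (L2 \<Omega>) (L2_norm \<Omega>) \<longleftrightarrow>
  (\<forall>t\<in>{0..T}. f t \<in> L2 \<Omega>) \<and> continuous_on {0..T} (\<lambda>t. cls \<Omega> (f t))"
proof -
 have "((\<lambda>s. L2_norm \<Omega> (\<lambda>x. f s x - f t x)) \<longlongrightarrow> 0) (at t within {0..T}) \<longleftrightarrow>
   ((\<lambda>s. cls \<Omega> (f s)) \<longlongrightarrow> cls \<Omega> (f t)) (at t within {0..T})"
  if L: "\<forall>t\<in>{0..T}. f t \<in> L2 \<Omega>" and t: "t \<in> {0..T}" for t proof -
  have "eventually (\<lambda>s. s \<in> {0..T}) (at t within {0..T})" by (simp add: eventually_at_filter)
  then have "eventually (\<lambda>s. L2_norm \<Omega> (\<lambda>x. f s x - f t x) = dist (cls \<Omega> (f s)) (cls \<Omega> (f t))) (at t within {0..T})"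
  proof eventually_elim
   case (elim s)
   have "f s \<in> L2 \<Omega>" "f t \<in> L2 \<Omega>" using L t elim by blast+
   then show ?case by (simp add: L2_norm_cls L2_diff cls_diff dist_norm)
  qed
  from tendsto_cong[OF this] show ?thesis unfolding tendsto_dist_iff[of _ "cls \<Omega> (f t)"] .
 qed
 then show ?thesis unfolding C_time_def continuous_on_def by auto
qed

end

section \<open>Existence\<close>

context linearized_tidal begin

text \<open>The friction coefficient is bounded at almost every time only. Replacing it by \<open>0\<close> where the bound
 \<open>Ca\<close> fails gives operators that are bounded uniformly at every time.\<close>

definition cut :: "real => (real^2, real) l2 => (real^2, real) l2" where
 "cut Ca y = (if norm y \<le> Ca then y else 0)"

lemma evolution_tidal:
 assumes T: "T > 0" and s: "s \<in> borel_measurable lebesgue"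
 obtains c lam C where "evolution iota2 P2 T (\<lambda>t. Aop (cut Ca (nrm (s t)))) c lam C"
proof -
 obtain C where C: "C \<ge> 0" "\<And>a p. norm a \<le> max Ca 0 ==> norm (Aop a p) \<le> C * norm p" using Aop_bounds by blast
 obtain c lam where G: "c > 0" "lam \<ge> 0"
  "\<And>f p. f \<in> L2 \<Omega> ==> (\<And>x. f x \<ge> 0) ==> c * (norm (P2 p))\<^sup>2 \<le> Aop (cls \<Omega> f) p \<bullet> p + lam * (norm (iota2 p))\<^sup>2"
  by (rule Aop_garding) (rule that; blast)
 have cb: "norm (cut Ca y) \<le> max Ca 0" for y by (auto simp: cut_def)
 have "\<exists>f\<in>L2 \<Omega>. (\<forall>x. f x \<ge> 0) \<and> cut Ca (nrm y) = cls \<Omega> f" for y proof (cases "norm (nrm y) \<le> Ca")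
  case True
  then show ?thesis using L2_norm_rep[of y] by (intro bexI[of _ "\<lambda>x. norm (rep_l2 y x)"]) (auto simp: cut_def nrm_def)
 next
  case False
  then show ?thesis using L2_zero by (intro bexI[of _ "\<lambda>x. 0"]) (auto simp: cut_def cls_zero)
 qed
 then have gard: "c * (norm (P2 p))\<^sup>2 \<le> Aop (cut Ca (nrm y)) p \<bullet> p + lam * (norm (iota2 p))\<^sup>2" for y p
  using G(3) by metis
 have m: "(\<lambda>t. nrm (s t)) \<in> borel_measurable lebesgue" by (rule borel_measurable_continuous_on[OF continuous_nrm s])
 have m': "(\<lambda>t. cut Ca (nrm (s t))) \<in> borel_measurable lebesgue" proof -
  have "{t \<in> space lebesgue. norm (nrm (s t)) \<le> Ca} \<in> sets lebesgue"
   by (rule borel_measurable_le[OF borel_measurable_continuous_on[OF _ m, of norm] borel_measurable_const])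
     (intro continuous_intros)
  then show ?thesis unfolding cut_def by (intro measurable_If m) auto
 qed
 have meas: "(\<lambda>t. Aop (cut Ca (nrm (s t))) (f t)) \<in> borel_measurable lebesgue" if f: "f \<in> borel_measurable lebesgue" for f
  unfolding Aop_def
  by (intro borel_measurable_add borel_measurable_continuous_on[OF linear_continuous_on[OF bounded_linear_Lop] f]
   borel_measurable_continuous_Pair[OF m' f] bounded_bilinear.continuous_on[OF bounded_bilinear_Nop] continuous_intros)
 show ?thesis by (rule that[of c lam C], intro evolution.intro hilbert_pair.intro evolution_axioms.intro)
    (rule iota2 T Aop_linear C cb meas P2_Aop Aop_P2 G gard | assumption)+
qed

lemma sqint_rho: "F \<in> L2_Hminus1 \<Omega> T ==> sqint (\<lambda>t. indicator {0<..T} t *\<^sub>R rho (F t))"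
 by (rule L2_time_sqint[OF _ embeds_Hminus1])

lemma adjoint_iota2_grad: "v \<in> H10 \<Omega> ==> adjoint iota2 q \<bullet> (grad v, 0) = fst q \<bullet> cls \<Omega> v"
proof -
 assume v: "v \<in> H10 \<Omega>"
 have "adjoint iota2 q \<bullet> (grad v, 0) = grad v \<bullet> adjoint iota (fst q)"
  by (simp add: adjoint_iota2 inner_prod_def) (rule inner_commute)
 also have "\<dots> = iota (grad v) \<bullet> fst q" by (rule adjoint_inner[OF bounded_linear_iota, symmetric])
 also have "\<dots> = fst q \<bullet> cls \<Omega> v" unfolding iota_grad'[OF v] by (rule inner_commute)
 finally show ?thesis .
qed

lemma cls_rep_inner': "cls \<Omega> f = cls \<Omega> (rep_l2 y) ==> g \<in> L2 \<Omega> ==> cls \<Omega> f \<bullet> cls \<Omega> g = y \<bullet> cls \<Omega> g"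
 by (simp add: cls_rep_inner)

text \<open>The representative of \<open>F + U\<close>, cut off outside the time interval. The projection makes its values
 lie in \<open>V0\<close> also at the exceptional times where \<open>F t\<close> or \<open>U t\<close> is not in \<open>Hminus1\<close>.\<close>

definition forcing :: "real => (real => (real^2 => real^2) => real) => (real => (real^2 => real^2) => real) => real =>
  (real^2, real^2^2) l2 \<times> (real^2, real) l2" where
 "forcing T F U t = (PV (indicator {0<..T} t *\<^sub>R rho (F t) + indicator {0<..T} t *\<^sub>R rho (U t)), 0)"

lemma forcing:
 assumes F: "F \<in> L2_Hminus1 \<Omega> T" and U: "U \<in> L2_Hminus1 \<Omega> T"
 shows "sqint (forcing T F U)" "P2 (forcing T F U t) = forcing T F U t"
  "AE t in lebesgue. t \<in> {0<..T} \<longrightarrow> (\<forall>v\<in>H10 \<Omega>. fst (forcing T F U t) \<bullet> grad v = F t v + U t v)"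
proof -
 show "sqint (forcing T F U)" unfolding forcing_def[abs_def]
  by (intro sqint_Pair sqint_bounded_linear[OF PV(1)] sqint_add sqint_rho F U sqint_zero)
 show "P2 (forcing T F U t) = forcing T F U t" by (simp add: P2_def forcing_def PV(5))
 have FV: "AE t in lebesgue_on {0..T}. F t \<in> Hminus1 \<Omega>" and UV: "AE t in lebesgue_on {0..T}. U t \<in> Hminus1 \<Omega>"
  using F U by (auto simp: L2_time_def)
 show "AE t in lebesgue. t \<in> {0<..T} \<longrightarrow> (\<forall>v\<in>H10 \<Omega>. fst (forcing T F U t) \<bullet> grad v = F t v + U t v)"
  using FV UV unfolding AE_interval_iff by eventually_elim (simp add: forcing_def PV(2) PV_grad inner_add_left rho)
qed

text \<open>The abstract solution consists of classes; functions are chosen from them in such a way that the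
 velocity is an \<open>H10\<close> function whenever its class contains one, which happens at almost every time.\<close>

lemma linearized_existence:
 assumes T: "T > 0" and s: "s \<in> borel_measurable lebesgue"
  and b: "AE t in lebesgue. t \<in> {0<..T} \<longrightarrow> (\<lambda>x. norm (uh t x + w0 t x)) \<in> L2 \<Omega> \<and>
   cut Ca (nrm (s t)) = cls \<Omega> (\<lambda>x. norm (uh t x + w0 t x))"
  and data: "F \<in> L2_Hminus1 \<Omega> T" "U \<in> L2_Hminus1 \<Omega> T" "v0 \<in> L2 \<Omega>" "\<eta>0 \<in> L2 \<Omega>"
 shows "\<exists>w \<eta>. linearized_weak_solution \<Omega> T \<alpha> \<beta> h \<gamma> w0 uh F U v0 \<eta>0 w \<eta>"
proof -
 define A where "A t = Aop (cut Ca (nrm (s t)))" for t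
 obtain c lam C where ev: "evolution iota2 P2 T (\<lambda>t. Aop (cut Ca (nrm (s t)))) c lam C"
  by (rule evolution_tidal[OF T s, where Ca = Ca]) (rule that)
 interpret ev: evolution iota2 P2 T A c lam C unfolding A_def[abs_def] by (rule ev)
 define g where "g = forcing T F U"
 note g = forcing[OF data(1,2), folded g_def]
 have z0: "(cls \<Omega> v0, cls \<Omega> \<eta>0) \<in> closure (range iota2)" proof -
  have "range iota2 = range iota \<times> UNIV" by (auto simp: iota2_def image_iff)
  then show ?thesis using dense_iota[OF data(3)] by (simp add: closure_Times)
 qed
 obtain W z where W: "sqint W" "\<And>t. P2 (W t) = W t" and z: "continuous_on {0..T} z" "z 0 = (cls \<Omega> v0, cls \<Omega> \<eta>0)"
  and zW: "AE t in lebesgue. t \<in> {0<..T} \<longrightarrow> z t = iota2 (W t)"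
  and eq: "\<And>t. t \<in> {0..T} ==> adjoint iota2 (z t) = adjoint iota2 (cls \<Omega> v0, cls \<Omega> \<eta>0) + tint (\<lambda>r. g r - A r (W r)) 0 t"
  by (rule ev.evolution_exists[OF g(1) g(2) z0]) (rule that)
 define f where "f t = g t - A t (W t)" for t
 have f: "sqint f" unfolding f_def[abs_def] by (intro sqint_diff g(1) ev.sqint_A W(1))
 have Pf: "P2 (f t) = f t" for t by (simp add: f_def g(2) ev.PA linear_diff[OF bounded_linear.linear[OF iota2(2)]])
 have pv: "PV (fst p) = fst p" if "P2 p = p" for p using arg_cong[OF that, of fst] by (simp add: P2_def)
 (* Where no H10 function lies in the class, any representative serves continuity in L2. *)
 define w where "w t = (if \<exists>u\<in>H10 \<Omega>. cls \<Omega> u = fst (z t) then SOME u. u \<in> H10 \<Omega> \<and> cls \<Omega> u = fst (z t)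
  else rep_l2 (fst (z t)))" for t
 define \<eta> where "\<eta> t = rep_l2 (snd (z t))" for t
 define dw where "dw t v = fst (f t) \<bullet> grad v" for t v
 define d\<eta> where "d\<eta> t = rep_l2 (snd (f t))" for t
 have w_H10: "w t \<in> H10 \<Omega> \<and> cls \<Omega> (w t) = fst (z t)" if "u \<in> H10 \<Omega>" "cls \<Omega> u = fst (z t)" for t u proof -
  have ex: "\<exists>u. u \<in> H10 \<Omega> \<and> cls \<Omega> u = fst (z t)" using that by blast
  then have "w t = (SOME u. u \<in> H10 \<Omega> \<and> cls \<Omega> u = fst (z t))" unfolding w_def by auto
  then show ?thesis using someI_ex[OF ex] by simp
 qed
 have w: "w t \<in> L2 \<Omega>" "cls \<Omega> (w t) = cls \<Omega> (rep_l2 (fst (z t)))" for t proof -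
  have "w t \<in> L2 \<Omega> \<and> cls \<Omega> (w t) = cls \<Omega> (rep_l2 (fst (z t)))" proof (cases "\<exists>u\<in>H10 \<Omega>. cls \<Omega> u = fst (z t)")
   case True
   then obtain u where "u \<in> H10 \<Omega>" "cls \<Omega> u = fst (z t)" by blast
   from w_H10[OF this] have "w t \<in> L2 \<Omega>" "cls \<Omega> (w t) = fst (z t)" using H10_L2 by auto
   then show ?thesis using cls_rep_cls by metis
  next
   case False
   then show ?thesis by (simp add: w_def rep_L2)
  qed
  then show "w t \<in> L2 \<Omega>" "cls \<Omega> (w t) = cls \<Omega> (rep_l2 (fst (z t)))" by auto
 qed
 have \<eta>: "\<eta> t \<in> L2 \<Omega>" for t by (simp add: \<eta>_def rep_L2)
 have wW: "AE t in lebesgue. t \<in> {0<..T} \<longrightarrow> w t \<in> H10 \<Omega> \<and> grad (w t) = fst (W t) \<and> snd (z t) = snd (W t)" using zW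
 proof eventually_elim
  case (elim t)
  show ?case proof
   assume "t \<in> {0<..T}"
   with elim have e: "fst (z t) = iota (fst (W t))" "snd (z t) = snd (W t)" by (simp_all add: iota2_def)
   have wt: "w t \<in> H10 \<Omega>" "cls \<Omega> (w t) = iota (fst (W t))"
    using w_H10[OF lift(1), of "fst (W t)" t] by (simp_all add: e iota_def)
   have "iota (grad (w t) - fst (W t)) = 0"
    by (simp add: linear_diff[OF bounded_linear.linear[OF bounded_linear_iota]] iota_grad' wt)
   then have "PV (grad (w t) - fst (W t)) = 0" by (rule iota_inj)
   then have "grad (w t) = fst (W t)"
    by (simp add: linear_diff[OF bounded_linear.linear[OF PV(1)]] PV_grad wt pv[OF W(2)])
   then show "w t \<in> H10 \<Omega> \<and> grad (w t) = fst (W t) \<and> snd (z t) = snd (W t)" using wt e by simp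
  qed
 qed
 have cz: "continuous_on {0..T} (\<lambda>t. fst (z t))" "continuous_on {0..T} (\<lambda>t. snd (z t))"
  by (intro continuous_intros z(1))+
 have wt: "tint (\<lambda>t. deriv \<phi> t * (adjoint iota2 (z t) \<bullet> q)) 0 T = - tint (\<lambda>t. \<phi> t * (f t \<bullet> q)) 0 T"
  if \<phi>: "\<phi> \<in> test_functions {0<..<T}" for \<phi> q proof -
  have fq: "sqint (\<lambda>t. f t \<bullet> q)" by (rule sqint_bounded_linear[OF bounded_linear_inner_left f])
  have key: "adjoint iota2 (z t) \<bullet> q = adjoint iota2 (z 0) \<bullet> q + tint (\<lambda>r. f r \<bullet> q) 0 t" if "t \<in> {0..T}" for t
   unfolding eq[OF that] z(2) inner_add_left f_def[symmetric]
   by (simp add: tint_bounded_linear(1)[OF bounded_linear_inner_left sqint_tintegrable[OF f]])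
  have "tint (\<lambda>t. deriv \<phi> t * (adjoint iota2 (z t) \<bullet> q)) 0 T
    = tint (\<lambda>t. deriv \<phi> t * (adjoint iota2 (z 0) \<bullet> q + tint (\<lambda>r. f r \<bullet> q) 0 t)) 0 T"
  proof (rule tint_cong)
   fix t assume "t \<in> {0<..T}"
   then have "t \<in> {0..T}" by simp
   from key[OF this] show "deriv \<phi> t * (adjoint iota2 (z t) \<bullet> q)
    = deriv \<phi> t * (adjoint iota2 (z 0) \<bullet> q + tint (\<lambda>r. f r \<bullet> q) 0 t)" by (rule arg_cong)
  qed
  then show ?thesis using tint_weak_derivative[OF fq T \<phi>] by simp
 qed
 have sol: "solution_class \<Omega> T w \<eta> dw d\<eta>" unfolding solution_class_def proof (intro conjI IntI)
  show "w \<in> C_time T (L2 \<Omega>) (L2_norm \<Omega>)" unfolding C_time_iff w(2)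
   using w(1) by (auto intro!: continuous_on_compose2[OF linear_continuous_on[OF bounded_linear_cls_rep] cz(1)])
  show "\<eta> \<in> C_time T (L2 \<Omega>) (L2_norm \<Omega>)" unfolding C_time_iff \<eta>_def
   using rep_L2 by (auto intro!: continuous_on_compose2[OF linear_continuous_on[OF bounded_linear_cls_rep] cz(2)])
  show "w \<in> L2_time T (H10 \<Omega>) (H10_norm \<Omega>)"
  proof (rule H10_L2_time[OF sqint_bounded_linear[OF bounded_linear_fst W(1)]])
   show "AE t in lebesgue_on {0..T}. w t \<in> H10 \<Omega> \<and> grad (w t) = fst (W t)"
    unfolding AE_interval_iff using wW by eventually_elim auto
  qed
  show "dw \<in> L2_Hminus1 \<Omega> T" proof (rule Hminus1_L2_time[OF sqint_bounded_linear[OF bounded_linear_fst f]])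
   have "fst (f t) \<in> V0" for t using pv[OF Pf, of t] PV(3) by metis
   then show "AE t in lebesgue_on {0..T}. dw t \<in> Hminus1 \<Omega> \<and> rho (dw t) = fst (f t)"
    unfolding dw_def[abs_def] by (intro AE_I2 conjI inner_Hminus1 rho_inner)
  qed
  show "d\<eta> \<in> L2_time T (L2 \<Omega>) (L2_norm \<Omega>)"
   by (rule L2_L2_time[OF sqint_bounded_linear[OF bounded_linear_cls_rep sqint_bounded_linear[OF bounded_linear_snd f]]])
     (simp add: d\<eta>_def rep_L2)
  show "has_weak_time_deriv T (H10 \<Omega>) (\<lambda>t. L2_inner \<Omega> (w t)) dw"
   unfolding has_weak_time_deriv_def integral_interval_eq_tint proof (intro ballI)
   fix v and \<phi> :: "real => real" assume v: "v \<in> H10 \<Omega>" and \<phi>: "\<phi> \<in> test_functions {0<..<T}"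
   have "L2_inner \<Omega> (w t) v = adjoint iota2 (z t) \<bullet> (grad v, 0)" for t
    unfolding L2_inner_cls[OF w(1) H10_L2[OF v]] cls_rep_inner'[OF w(2) H10_L2[OF v]] adjoint_iota2_grad[OF v] ..
   then show "tint (\<lambda>t. deriv \<phi> t * L2_inner \<Omega> (w t) v) 0 T = - tint (\<lambda>t. \<phi> t * dw t v) 0 T"
    using wt[OF \<phi>, of "(grad v, 0)"] by (simp add: dw_def inner_prod_def)
  qed
  show "has_weak_time_deriv T (L2 \<Omega>) (\<lambda>t. L2_inner \<Omega> (\<eta> t)) (\<lambda>t. L2_inner \<Omega> (d\<eta> t))"
   unfolding has_weak_time_deriv_def integral_interval_eq_tint proof (intro ballI)
   fix \<zeta> :: "real^2 => real" and \<phi> :: "real => real" assume v: "\<zeta> \<in> L2 \<Omega>" and \<phi>: "\<phi> \<in> test_functions {0<..<T}"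
   have "L2_inner \<Omega> (\<eta> t) \<zeta> = adjoint iota2 (z t) \<bullet> (0, cls \<Omega> \<zeta>)" "L2_inner \<Omega> (d\<eta> t) \<zeta> = f t \<bullet> (0, cls \<Omega> \<zeta>)" for t
    unfolding \<eta>_def d\<eta>_def L2_inner_cls[OF rep_L2 v] cls_rep_inner[OF v]
    by (simp_all add: adjoint_iota2 inner_prod_def)
   then show "tint (\<lambda>t. deriv \<phi> t * L2_inner \<Omega> (\<eta> t) \<zeta>) 0 T = - tint (\<lambda>t. \<phi> t * L2_inner \<Omega> (d\<eta> t) \<zeta>) 0 T"
    using wt[OF \<phi>, of "(0, cls \<Omega> \<zeta>)"] by simp
  qed
 qed
 have e1: "AE t in lebesgue_on {0..T}. \<forall>v \<in> H10 \<Omega>. dw t v + A_op \<Omega> \<alpha> \<beta> (w t) v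
   + L2_inner \<Omega> (B'_op \<gamma> (w0 t) (uh t) (w t)) v + grad_op \<Omega> (\<eta> t) v = F t v + U t v"
  unfolding AE_interval_iff using wW b g(3) proof eventually_elim
  case (elim t)
  show ?case proof (intro impI ballI)
   fix v assume t: "t \<in> {0<..T}" and v: "v \<in> H10 \<Omega>"
   have 1: "w t \<in> H10 \<Omega>" "W t = (grad (w t), snd (z t))" using elim t by (auto simp: prod_eq_iff)
   have 2: "(\<lambda>x. norm (uh t x + w0 t x)) \<in> L2 \<Omega>" "cut Ca (nrm (s t)) = cls \<Omega> (\<lambda>x. norm (uh t x + w0 t x))"
    using elim t by auto
   have 3: "fst (A t (W t)) \<bullet> grad v = A_op \<Omega> \<alpha> \<beta> (w t) v
     + L2_inner \<Omega> (B'_op \<gamma> (w0 t) (uh t) (w t)) v + grad_op \<Omega> (\<eta> t) v"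
    unfolding A_def 1(2) 2(2) by (rule Aop_weak[OF 1(1) v \<eta> _ 2(1)]) (simp add: \<eta>_def)
   have "fst (g t) \<bullet> grad v = F t v + U t v" using elim t v by blast
   then show "dw t v + A_op \<Omega> \<alpha> \<beta> (w t) v + L2_inner \<Omega> (B'_op \<gamma> (w0 t) (uh t) (w t)) v + grad_op \<Omega> (\<eta> t) v
    = F t v + U t v" using 3 by (simp add: dw_def f_def inner_diff_left)
  qed
 qed
 have e2: "AE t in lebesgue_on {0..T}. \<forall>\<zeta> \<in> L2 \<Omega>.
   L2_inner \<Omega> (d\<eta> t) \<zeta> + L2_inner \<Omega> (weak_div \<Omega> (\<lambda>x. h x *\<^sub>R w t x)) \<zeta> = 0"
  unfolding AE_interval_iff using wW proof eventually_elim
  case (elim t)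
  show ?case proof (intro impI ballI)
   fix \<zeta> :: "real^2 => real" assume t: "t \<in> {0<..T}" and \<zeta>: "\<zeta> \<in> L2 \<Omega>"
   have 1: "w t \<in> H10 \<Omega>" "grad (w t) = fst (W t)" using elim t by auto
   have "snd (f t) = - divh (fst (W t))" by (simp add: f_def g_def forcing_def A_def Aop_def Lop_def Nop_def)
   then show "L2_inner \<Omega> (d\<eta> t) \<zeta> + L2_inner \<Omega> (weak_div \<Omega> (\<lambda>x. h x *\<^sub>R w t x)) \<zeta> = 0"
    by (simp add: d\<eta>_def L2_inner_cls rep_L2 \<zeta> cls_rep_inner divh_grad[OF 1(1)] 1(2))
  qed
 qed
 have i1: "AE x in lebesgue_on \<Omega>. w 0 x = v0 x"
  using w[of 0] unfolding z(2) fst_conv cls_rep_cls[OF data(3)] by (simp add: cls_eq_iff data)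
 have i2: "AE x in lebesgue_on \<Omega>. \<eta> 0 x = \<eta>0 x" proof -
  have "cls \<Omega> (\<eta> 0) = cls \<Omega> \<eta>0" by (simp add: \<eta>_def z(2) cls_rep_cls data)
  then show ?thesis by (simp add: cls_eq_iff data \<eta>)
 qed
 show ?thesis unfolding linearized_weak_solution_def using sol e1 e2 i1 i2 by blast
qed

end

section \<open>Uniqueness\<close>

context linearized_tidal begin

text \<open>Fields are separated by gradients and elevations by \<open>L2\<close> functions, provided that the first
 components lie in \<open>V0\<close> and the second ones vanish outside the domain.\<close>

lemma V0_L2_eqI:
 fixes p q :: "(real^2, real^2^2) l2 \<times> (real^2, real) l2"
 assumes "PV (fst p) = fst p" "PV (fst q) = fst q" "cls \<Omega> (rep_l2 (snd p)) = snd p" "cls \<Omega> (rep_l2 (snd q)) = snd q"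
  and g: "\<And>v. v \<in> H10 \<Omega> ==> fst p \<bullet> grad v = fst q \<bullet> grad v"
  and l: "\<And>\<zeta>. \<zeta> \<in> L2 \<Omega> ==> snd p \<bullet> cls \<Omega> \<zeta> = snd q \<bullet> cls \<Omega> \<zeta>"
 shows "p = q"
proof (rule prod_eqI)
 have "fst p \<in> V0" "fst q \<in> V0" using assms(1,2) PV(3) by metis+
 then show "fst p = fst q" using g by (rule V0_eqI)
 define y where "y = snd p - snd q"
 have "cls \<Omega> (rep_l2 y) = y"
  unfolding y_def linear_diff[OF bounded_linear.linear[OF bounded_linear_cls_rep]] assms(3,4) ..
 then have "y \<bullet> y = y \<bullet> cls \<Omega> (rep_l2 y)" by simp
 also have "\<dots> = 0" using l[OF rep_L2, of y] by (simp add: y_def inner_diff_left)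
 finally show "snd p = snd q" by (simp add: y_def)
qed

text \<open>The converse of the construction of a solution: a weak solution satisfies the integrated abstract
 equation. Each test pair gives a scalar function of time whose weak derivative is known; by du
 Bois-Reymond it is an integral, and test pairs separate the values.\<close>

lemma linearized_integrated:
 assumes T: "T > 0" and s: "s \<in> borel_measurable lebesgue"
  and b: "AE t in lebesgue. t \<in> {0<..T} \<longrightarrow> (\<lambda>x. norm (uh t x + w0 t x)) \<in> L2 \<Omega> \<and>
   cut Ca (nrm (s t)) = cls \<Omega> (\<lambda>x. norm (uh t x + w0 t x))"
  and data: "F \<in> L2_Hminus1 \<Omega> T" "U \<in> L2_Hminus1 \<Omega> T"
  and sol: "linearized_weak_solution \<Omega> T \<alpha> \<beta> h \<gamma> w0 uh F U v0 \<eta>0 w \<eta>"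
  and sA: "\<And>f. sqint f ==> sqint (\<lambda>t. Aop (cut Ca (nrm (s t))) (f t))"
 obtains W where "sqint W" "\<And>t. P2 (W t) = W t"
  "continuous_on {0..T} (\<lambda>t. (cls \<Omega> (w t), cls \<Omega> (\<eta> t)))"
  "AE t in lebesgue. t \<in> {0<..T} \<longrightarrow> (cls \<Omega> (w t), cls \<Omega> (\<eta> t)) = iota2 (W t)"
  "\<And>t. t \<in> {0..T} ==> adjoint iota2 (cls \<Omega> (w t), cls \<Omega> (\<eta> t)) = adjoint iota2 (cls \<Omega> (w 0), cls \<Omega> (\<eta> 0))
   + tint (\<lambda>r. forcing T F U r - Aop (cut Ca (nrm (s r))) (W r)) 0 t"
proof -
 define Z where "Z t = (cls \<Omega> (w t), cls \<Omega> (\<eta> t))" for t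
 define A where "A t = Aop (cut Ca (nrm (s t)))" for t
 define ind where "ind = (indicator {0<..T} :: real => real)"
 obtain dw d\<eta> where sc: "solution_class \<Omega> T w \<eta> dw d\<eta>"
  and e1: "AE t in lebesgue_on {0..T}. \<forall>v \<in> H10 \<Omega>. dw t v + A_op \<Omega> \<alpha> \<beta> (w t) v
   + L2_inner \<Omega> (B'_op \<gamma> (w0 t) (uh t) (w t)) v + grad_op \<Omega> (\<eta> t) v = F t v + U t v"
  and e2: "AE t in lebesgue_on {0..T}. \<forall>\<zeta> \<in> L2 \<Omega>.
   L2_inner \<Omega> (d\<eta> t) \<zeta> + L2_inner \<Omega> (weak_div \<Omega> (\<lambda>x. h x *\<^sub>R w t x)) \<zeta> = 0"
  using sol unfolding linearized_weak_solution_def by blast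
 note sc = sc[unfolded solution_class_def]
 have cw: "w \<in> C_time T (L2 \<Omega>) (L2_norm \<Omega>)" and lw: "w \<in> L2_time T (H10 \<Omega>) (H10_norm \<Omega>)"
  and c\<eta>: "\<eta> \<in> C_time T (L2 \<Omega>) (L2_norm \<Omega>)" and ldw: "dw \<in> L2_Hminus1 \<Omega> T"
  and ld\<eta>: "d\<eta> \<in> L2_time T (L2 \<Omega>) (L2_norm \<Omega>)"
  and dw: "has_weak_time_deriv T (H10 \<Omega>) (\<lambda>t. L2_inner \<Omega> (w t)) dw"
  and d\<eta>: "has_weak_time_deriv T (L2 \<Omega>) (\<lambda>t. L2_inner \<Omega> (\<eta> t)) (\<lambda>t. L2_inner \<Omega> (d\<eta> t))"
  using sc by auto
 have w2: "\<And>t. t \<in> {0..T} ==> w t \<in> L2 \<Omega>" and ccw: "continuous_on {0..T} (\<lambda>t. cls \<Omega> (w t))"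
  using cw unfolding C_time_iff by auto
 have \<eta>2: "\<And>t. t \<in> {0..T} ==> \<eta> t \<in> L2 \<Omega>" and cc\<eta>: "continuous_on {0..T} (\<lambda>t. cls \<Omega> (\<eta> t))"
  using c\<eta> unfolding C_time_iff by auto
 have wH: "AE t in lebesgue_on {0..T}. w t \<in> H10 \<Omega>" and dwH: "AE t in lebesgue_on {0..T}. dw t \<in> Hminus1 \<Omega>"
  and d\<eta>2: "AE t in lebesgue_on {0..T}. d\<eta> t \<in> L2 \<Omega>"
  using lw ldw ld\<eta> by (auto simp: L2_time_def)
 (* Projected and cut off in time, the representatives are square integrable on the line. *)
 define W where "W t = (PV (ind t *\<^sub>R grad (w t)), ind t *\<^sub>R cls \<Omega> (\<eta> t))" for t
 define D where "D t = (PV (ind t *\<^sub>R rho (dw t)), cls \<Omega> (rep_l2 (ind t *\<^sub>R cls \<Omega> (d\<eta> t))))" for t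
 have W: "sqint W" unfolding W_def[abs_def] ind_def
  by (intro sqint_Pair sqint_bounded_linear[OF PV(1)] L2_time_sqint[OF lw embeds_H10] sqint_continuous_interval cc\<eta>)
 have PW: "P2 (W t) = W t" for t by (simp add: P2_def W_def PV(5))
 have D: "sqint D" unfolding D_def[abs_def] ind_def
  by (intro sqint_Pair sqint_bounded_linear[OF PV(1)] sqint_bounded_linear[OF bounded_linear_cls_rep]
    L2_time_sqint[OF ldw embeds_Hminus1] L2_time_sqint[OF ld\<eta> embeds_L2])
 have WD: "AE t in lebesgue. t \<in> {0<..T} \<longrightarrow> w t \<in> H10 \<Omega> \<and> W t = (grad (w t), cls \<Omega> (\<eta> t)) \<and>
   dw t \<in> Hminus1 \<Omega> \<and> d\<eta> t \<in> L2 \<Omega> \<and> D t = (rho (dw t), cls \<Omega> (d\<eta> t))"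
  using wH dwH d\<eta>2 unfolding AE_interval_iff
  by eventually_elim (simp add: W_def D_def ind_def PV_grad PV(4)[OF rho_V0] cls_rep_cls)
 have ZW: "AE t in lebesgue. t \<in> {0<..T} \<longrightarrow> Z t = iota2 (W t)"
  using WD by eventually_elim (auto simp: Z_def iota2_def iota_grad')
 have cZ: "continuous_on {0..T} Z" unfolding Z_def[abs_def] by (intro continuous_on_Pair ccw cc\<eta>)
 have L: "adjoint iota2 (Z t) \<bullet> q = adjoint iota2 (Z 0) \<bullet> q + tint (\<lambda>r. D r \<bullet> q) 0 t"
  if t: "t \<in> {0..T}" and q: "(\<exists>v\<in>H10 \<Omega>. q = (grad v, 0)) \<or> (\<exists>\<zeta>\<in>L2 \<Omega>. q = (0, cls \<Omega> \<zeta>))" for t q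
 proof (rule du_bois_reymond[OF _ _ T _ t])
  show "continuous_on {0..T} (\<lambda>t. adjoint iota2 (Z t) \<bullet> q)" by (intro continuous_intros
    continuous_on_compose2[OF linear_continuous_on[OF bounded_linear_adjoint[OF iota2(1)]] cZ]) auto
  show Dq: "sqint (\<lambda>r. D r \<bullet> q)" by (rule sqint_bounded_linear[OF bounded_linear_inner_left D])
  fix \<phi> :: "real => real" assume \<phi>: "\<phi> \<in> test_functions {0<..<T}"
  have ti: "tintegrable (\<lambda>t. \<phi> t * (D t \<bullet> q)) 0 T" using tintegrable_inner[OF sqint_test[OF \<phi>] Dq, of 0 T] by simp
  from q show "tint (\<lambda>t. deriv \<phi> t * (adjoint iota2 (Z t) \<bullet> q)) 0 T = - tint (\<lambda>t. \<phi> t * (D t \<bullet> q)) 0 T" proof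
   assume "\<exists>v\<in>H10 \<Omega>. q = (grad v, 0)"
   then obtain v where v: "v \<in> H10 \<Omega>" "q = (grad v, 0)" by blast
   have "tint (\<lambda>t. deriv \<phi> t * (adjoint iota2 (Z t) \<bullet> q)) 0 T = tint (\<lambda>t. deriv \<phi> t * L2_inner \<Omega> (w t) v) 0 T"
    by (rule tint_cong) (simp add: v(2) adjoint_iota2_grad[OF v(1)] L2_inner_cls[OF w2 H10_L2[OF v(1)]] Z_def)
   also have "\<dots> = - tint (\<lambda>t. \<phi> t * dw t v) 0 T"
    using dw v(1) \<phi> unfolding has_weak_time_deriv_def integral_interval_eq_tint by blast
   also have "tint (\<lambda>t. \<phi> t * dw t v) 0 T = tint (\<lambda>t. \<phi> t * (D t \<bullet> q)) 0 T"
   proof (rule tint_AE_eq[OF ti, symmetric])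
    show "AE t in lebesgue. t \<in> {0<..T} \<longrightarrow> \<phi> t * (D t \<bullet> q) = \<phi> t * dw t v"
     using WD by eventually_elim (auto simp: v(2) rho[OF _ v(1)])
   qed
   finally show ?thesis .
  next
   assume "\<exists>\<zeta>\<in>L2 \<Omega>. q = (0, cls \<Omega> \<zeta>)"
   then obtain \<zeta> where \<zeta>: "\<zeta> \<in> L2 \<Omega>" "q = (0, cls \<Omega> \<zeta>)" by blast
   have "tint (\<lambda>t. deriv \<phi> t * (adjoint iota2 (Z t) \<bullet> q)) 0 T = tint (\<lambda>t. deriv \<phi> t * L2_inner \<Omega> (\<eta> t) \<zeta>) 0 T"
    by (rule tint_cong) (simp add: \<zeta>(2) adjoint_iota2 L2_inner_cls[OF \<eta>2 \<zeta>(1)] Z_def)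
   also have "\<dots> = - tint (\<lambda>t. \<phi> t * L2_inner \<Omega> (d\<eta> t) \<zeta>) 0 T"
    using d\<eta> \<zeta>(1) \<phi> unfolding has_weak_time_deriv_def integral_interval_eq_tint by blast
   also have "tint (\<lambda>t. \<phi> t * L2_inner \<Omega> (d\<eta> t) \<zeta>) 0 T = tint (\<lambda>t. \<phi> t * (D t \<bullet> q)) 0 T"
   proof (rule tint_AE_eq[OF ti, symmetric])
    show "AE t in lebesgue. t \<in> {0<..T} \<longrightarrow> \<phi> t * (D t \<bullet> q) = \<phi> t * L2_inner \<Omega> (d\<eta> t) \<zeta>"
     using WD by eventually_elim (auto simp: \<zeta>(2) L2_inner_cls[OF _ \<zeta>(1)])
   qed
   finally show ?thesis .
  qed
 qed
 have int: "adjoint iota2 (Z t) = adjoint iota2 (Z 0) + tint D 0 t" if t: "t \<in> {0..T}" for t proof -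
  let ?q = "adjoint iota2 (Z 0) + tint D 0 t"
  note Di = sqint_tintegrable[OF D, of 0 t]
  have inner: "adjoint iota2 (Z t) \<bullet> q = ?q \<bullet> q"
   if "(\<exists>v\<in>H10 \<Omega>. q = (grad v, 0)) \<or> (\<exists>\<zeta>\<in>L2 \<Omega>. q = (0, cls \<Omega> \<zeta>))" for q
   using L[OF t that] by (simp add: inner_add_left tint_bounded_linear(1)[OF bounded_linear_inner_left Di])
  have Pfix: "PV (fst (adjoint iota2 (Z t))) = fst (adjoint iota2 (Z t))" for t
   by (simp add: adjoint_iota2 PV_adjoint[OF bounded_linear_iota iota_PV])
  have Rfix: "cls \<Omega> (rep_l2 (snd (adjoint iota2 (Z t)))) = snd (adjoint iota2 (Z t))" if "t \<in> {0..T}" for t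
   by (simp add: adjoint_iota2 Z_def cls_rep_cls[OF \<eta>2[OF that]])
  have ft: "fst (tint D 0 t) = tint (\<lambda>r. fst (D r)) 0 t" "snd (tint D 0 t) = tint (\<lambda>r. snd (D r)) 0 t"
   using tint_bounded_linear(1)[OF bounded_linear_fst Di] tint_bounded_linear(1)[OF bounded_linear_snd Di] by auto
  have PD: "PV (fst (tint D 0 t)) = fst (tint D 0 t)"
   unfolding ft tint_bounded_linear(1)[OF PV(1) tint_bounded_linear(2)[OF bounded_linear_fst Di], symmetric]
   by (simp add: D_def PV(5))
  have RD: "cls \<Omega> (rep_l2 (snd (tint D 0 t))) = snd (tint D 0 t)"
   unfolding ft tint_bounded_linear(1)[OF bounded_linear_cls_rep tint_bounded_linear(2)[OF bounded_linear_snd Di], symmetric]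
   by (simp add: D_def cls_rep_cls rep_L2)
  show ?thesis proof (rule V0_L2_eqI)
   show "PV (fst ?q) = fst ?q" by (simp add: linear_add[OF bounded_linear.linear[OF PV(1)]] PD Pfix)
   show "cls \<Omega> (rep_l2 (snd ?q)) = snd ?q"
    using Rfix[of 0] T by (simp add: linear_add[OF bounded_linear.linear[OF bounded_linear_cls_rep]] RD)
   show "fst (adjoint iota2 (Z t)) \<bullet> grad v = fst ?q \<bullet> grad v" if "v \<in> H10 \<Omega>" for v
    using inner[of "(grad v, 0)"] that unfolding inner_prod_def by auto
   show "snd (adjoint iota2 (Z t)) \<bullet> cls \<Omega> \<zeta> = snd ?q \<bullet> cls \<Omega> \<zeta>" if "\<zeta> \<in> L2 \<Omega>" for \<zeta>
    using inner[of "(0, cls \<Omega> \<zeta>)"] that unfolding inner_prod_def by auto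
  qed (rule Pfix Rfix t)+
 qed
 have ode: "AE t in lebesgue. t \<in> {0<..T} \<longrightarrow> D t = forcing T F U t - A t (W t)"
  using WD b forcing(3)[OF data] e1[unfolded AE_interval_iff] e2[unfolded AE_interval_iff] proof eventually_elim
  case (elim t)
  show ?case proof
   assume t: "t \<in> {0<..T}"
   have tT: "t \<in> {0..T}" using t by simp
   have wt: "w t \<in> H10 \<Omega>" "W t = (grad (w t), cls \<Omega> (\<eta> t))"
    and Dt: "dw t \<in> Hminus1 \<Omega>" "d\<eta> t \<in> L2 \<Omega>" "D t = (rho (dw t), cls \<Omega> (d\<eta> t))" using elim t by auto
   have b: "(\<lambda>x. norm (uh t x + w0 t x)) \<in> L2 \<Omega>" "cut Ca (nrm (s t)) = cls \<Omega> (\<lambda>x. norm (uh t x + w0 t x))"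
    using elim t by auto
   have PfA: "P2 (forcing T F U t - A t (W t)) = forcing T F U t - A t (W t)"
    by (simp add: A_def P2_Aop forcing(2)[OF data] linear_diff[OF bounded_linear.linear[OF iota2(2)]])
   have sn: "snd (forcing T F U t - A t (W t)) = - cls \<Omega> (weak_div \<Omega> (\<lambda>x. h x *\<^sub>R w t x))"
    by (simp add: forcing_def A_def Aop_def Lop_def Nop_def wt(2) divh_grad(2)[OF wt(1)])
   show "D t = forcing T F U t - A t (W t)" proof (rule V0_L2_eqI)
    show "PV (fst (D t)) = fst (D t)" by (simp add: D_def PV(5))
    show "PV (fst (forcing T F U t - A t (W t))) = fst (forcing T F U t - A t (W t))"
     using arg_cong[OF PfA, of fst] by (simp add: P2_def)
    show "cls \<Omega> (rep_l2 (snd (D t))) = snd (D t)" by (simp add: Dt cls_rep_cls)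
    show "cls \<Omega> (rep_l2 (snd (forcing T F U t - A t (W t)))) = snd (forcing T F U t - A t (W t))"
     unfolding sn linear_neg[OF bounded_linear.linear[OF bounded_linear_cls_rep]]
     by (simp add: cls_rep_cls divh_grad(1)[OF wt(1)])
    show "fst (D t) \<bullet> grad v = fst (forcing T F U t - A t (W t)) \<bullet> grad v" if v: "v \<in> H10 \<Omega>" for v proof -
     have 1: "fst (A t (W t)) \<bullet> grad v = A_op \<Omega> \<alpha> \<beta> (w t) v
       + L2_inner \<Omega> (B'_op \<gamma> (w0 t) (uh t) (w t)) v + grad_op \<Omega> (\<eta> t) v"
      unfolding A_def wt(2) b(2) by (rule Aop_weak[OF wt(1) v \<eta>2[OF tT] cls_rep_cls[OF \<eta>2[OF tT]] b(1)])
     have 2: "fst (forcing T F U t) \<bullet> grad v = F t v + U t v" using elim t v by blast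
     have 3: "dw t v + A_op \<Omega> \<alpha> \<beta> (w t) v
      + L2_inner \<Omega> (B'_op \<gamma> (w0 t) (uh t) (w t)) v + grad_op \<Omega> (\<eta> t) v = F t v + U t v" using elim t v by blast
     show ?thesis using 1 2 3 by (simp add: Dt inner_diff_left rho[OF Dt(1) v, symmetric])
    qed
    show "snd (D t) \<bullet> cls \<Omega> \<zeta> = snd (forcing T F U t - A t (W t)) \<bullet> cls \<Omega> \<zeta>" if \<zeta>: "\<zeta> \<in> L2 \<Omega>" for \<zeta> proof -
     have "L2_inner \<Omega> (d\<eta> t) \<zeta> + L2_inner \<Omega> (weak_div \<Omega> (\<lambda>x. h x *\<^sub>R w t x)) \<zeta> = 0" using elim t \<zeta> by blast
     then show ?thesis unfolding sn by (simp add: Dt L2_inner_cls \<zeta> divh_grad(1)[OF wt(1)] inner_minus_left)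
    qed
   qed
  qed
 qed
 have fA: "sqint (\<lambda>t. forcing T F U t - A t (W t))" unfolding A_def by (intro sqint_diff forcing(1) data sA W)
 have "adjoint iota2 (Z t) = adjoint iota2 (Z 0) + tint (\<lambda>r. forcing T F U r - A r (W r)) 0 t"
  if t: "t \<in> {0..T}" for t proof -
  have "tint D 0 t = tint (\<lambda>r. forcing T F U r - A r (W r)) 0 t"
   by (rule tint_cong_AE[OF _ sqint_tintegrable[OF D] sqint_tintegrable[OF fA]])
     (use ode t in \<open>eventually_elim, auto\<close>)
  then show ?thesis using int[OF t] by simp
 qed
 with W PW cZ ZW show ?thesis unfolding Z_def A_def by (rule that)
qed

lemma linearized_uniqueness:
 assumes T: "T > 0" and s: "s \<in> borel_measurable lebesgue"
  and b: "AE t in lebesgue. t \<in> {0<..T} \<longrightarrow> (\<lambda>x. norm (uh t x + w0 t x)) \<in> L2 \<Omega> \<and>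
   cut Ca (nrm (s t)) = cls \<Omega> (\<lambda>x. norm (uh t x + w0 t x))"
  and data: "F \<in> L2_Hminus1 \<Omega> T" "U \<in> L2_Hminus1 \<Omega> T" "v0 \<in> L2 \<Omega>" "\<eta>0 \<in> L2 \<Omega>"
  and sol: "linearized_weak_solution \<Omega> T \<alpha> \<beta> h \<gamma> w0 uh F U v0 \<eta>0 w \<eta>"
  and sol': "linearized_weak_solution \<Omega> T \<alpha> \<beta> h \<gamma> w0 uh F U v0 \<eta>0 w' \<eta>'"
  and t: "t \<in> {0..T}"
 shows "AE x in lebesgue_on \<Omega>. w' t x = w t x" "AE x in lebesgue_on \<Omega>. \<eta>' t x = \<eta> t x"
proof -
 define A where "A t = Aop (cut Ca (nrm (s t)))" for t
 obtain c lam C where ev: "evolution iota2 P2 T (\<lambda>t. Aop (cut Ca (nrm (s t)))) c lam C"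
  by (rule evolution_tidal[OF T s, where Ca = Ca]) (rule that)
 interpret ev: evolution iota2 P2 T A c lam C unfolding A_def[abs_def] by (rule ev)
 note sA = ev.sqint_A[unfolded A_def]
 obtain W where W: "sqint W" "\<And>t. P2 (W t) = W t"
  "continuous_on {0..T} (\<lambda>t. (cls \<Omega> (w t), cls \<Omega> (\<eta> t)))"
  "AE t in lebesgue. t \<in> {0<..T} \<longrightarrow> (cls \<Omega> (w t), cls \<Omega> (\<eta> t)) = iota2 (W t)"
  "\<And>t. t \<in> {0..T} ==> adjoint iota2 (cls \<Omega> (w t), cls \<Omega> (\<eta> t)) = adjoint iota2 (cls \<Omega> (w 0), cls \<Omega> (\<eta> 0))
   + tint (\<lambda>r. forcing T F U r - Aop (cut Ca (nrm (s r))) (W r)) 0 t"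
  by (rule linearized_integrated[OF T s b data(1,2) sol sA]) (assumption, rule that)
 obtain W' where W': "sqint W'" "\<And>t. P2 (W' t) = W' t"
  "continuous_on {0..T} (\<lambda>t. (cls \<Omega> (w' t), cls \<Omega> (\<eta>' t)))"
  "AE t in lebesgue. t \<in> {0<..T} \<longrightarrow> (cls \<Omega> (w' t), cls \<Omega> (\<eta>' t)) = iota2 (W' t)"
  "\<And>t. t \<in> {0..T} ==> adjoint iota2 (cls \<Omega> (w' t), cls \<Omega> (\<eta>' t)) = adjoint iota2 (cls \<Omega> (w' 0), cls \<Omega> (\<eta>' 0))
   + tint (\<lambda>r. forcing T F U r - Aop (cut Ca (nrm (s r))) (W' r)) 0 t"
  by (rule linearized_integrated[OF T s b data(1,2) sol' sA]) (assumption, rule that)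
 define z where "z t = (cls \<Omega> (w' t), cls \<Omega> (\<eta>' t)) - (cls \<Omega> (w t), cls \<Omega> (\<eta> t))" for t
 have inL: "w t \<in> L2 \<Omega>" "\<eta> t \<in> L2 \<Omega>" "w' t \<in> L2 \<Omega>" "\<eta>' t \<in> L2 \<Omega>" if "t \<in> {0..T}" for t proof -
  have "w \<in> C_time T (L2 \<Omega>) (L2_norm \<Omega>)" "\<eta> \<in> C_time T (L2 \<Omega>) (L2_norm \<Omega>)"
   "w' \<in> C_time T (L2 \<Omega>) (L2_norm \<Omega>)" "\<eta>' \<in> C_time T (L2 \<Omega>) (L2_norm \<Omega>)"
   using sol sol' unfolding linearized_weak_solution_def solution_class_def by blast+
  then show "w t \<in> L2 \<Omega>" "\<eta> t \<in> L2 \<Omega>" "w' t \<in> L2 \<Omega>" "\<eta>' t \<in> L2 \<Omega>" using that unfolding C_time_iff by blast+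
 qed
 have T0: "0 \<in> {0..T}" using T by simp
 have init: "cls \<Omega> (w 0) = cls \<Omega> v0" "cls \<Omega> (\<eta> 0) = cls \<Omega> \<eta>0" "cls \<Omega> (w' 0) = cls \<Omega> v0" "cls \<Omega> (\<eta>' 0) = cls \<Omega> \<eta>0"
  using sol sol' unfolding linearized_weak_solution_def by (simp_all add: cls_eq_iff data inL[OF T0])
 have "z t = 0" proof (rule ev.evolution_unique[where w = "\<lambda>t. W' t - W t" and z = z])
  show "sqint (\<lambda>t. W' t - W t)" by (intro sqint_diff W W')
  show "P2 (W' t - W t) = W' t - W t" for t by (simp add: ev.P.diff W W')
  show "continuous_on {0..T} z" unfolding z_def[abs_def] by (intro continuous_on_diff W W')
  show "AE t in lebesgue. t \<in> {0<..T} \<longrightarrow> z t = iota2 (W' t - W t)"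
   using W(4) W'(4) by eventually_elim (auto simp only: z_def ev.\<iota>.diff)
  fix t assume t: "t \<in> {0..T}"
  have i1: "tintegrable (\<lambda>r. forcing T F U r - A r (W r)) 0 t" "tintegrable (\<lambda>r. forcing T F U r - A r (W' r)) 0 t"
   by (intro sqint_tintegrable sqint_diff forcing(1) data ev.sqint_A W W')+
  have "adjoint iota2 (z t) = tint (\<lambda>r. forcing T F U r - A r (W' r)) 0 t - tint (\<lambda>r. forcing T F U r - A r (W r)) 0 t"
   unfolding z_def ev.\<iota>a.diff W(5)[OF t] W'(5)[OF t] init A_def by (simp only: add_diff_cancel_left)
  also have "\<dots> = tint (\<lambda>r. (forcing T F U r - A r (W' r)) - (forcing T F U r - A r (W r))) 0 t"
   by (rule tint_diff[OF i1(2,1), symmetric])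
  also have "\<dots> = tint (\<lambda>r. - A r (W' r - W r)) 0 t" by (simp add: linear_diff[OF ev.A_lin])
  finally show "adjoint iota2 (z t) = tint (\<lambda>r. - A r (W' r - W r)) 0 t" .
 qed (rule t)
 then have "cls \<Omega> (w' t) = cls \<Omega> (w t)" "cls \<Omega> (\<eta>' t) = cls \<Omega> (\<eta> t)" by (simp_all add: z_def zero_prod_def)
 then show "AE x in lebesgue_on \<Omega>. w' t x = w t x" "AE x in lebesgue_on \<Omega>. \<eta>' t x = \<eta> t x"
  by (simp_all add: cls_eq_iff inL[OF t])
qed

end

section \<open>Well-posedness of the linearized system\<close>

theorem theorem2p7:
  fixes \<Omega> :: "(real^2) set"
    and T \<alpha> \<beta> r lam mu M :: real
    and h \<gamma> :: "real^2 \<Rightarrow> real"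
    and dh :: "real^2 \<Rightarrow> real^2"
    and w0 :: "real \<Rightarrow> real^2 \<Rightarrow> real^2"
    and gt gh U :: "real \<Rightarrow> (real^2 \<Rightarrow> real^2) \<Rightarrow> real"
    and uh0 v0 :: "real^2 \<Rightarrow> real^2"
    and \<xi>h0 \<eta>0 :: "real^2 \<Rightarrow> real"
    and uh :: "real \<Rightarrow> real^2 \<Rightarrow> real^2"
    and \<xi>h :: "real \<Rightarrow> real^2 \<Rightarrow> real"
  assumes domain: "smooth_bounded_domain \<Omega>"
    and constants: "T > 0" "\<alpha> > 0" "\<beta> > 0" "r > 0" "M \<ge> 0"
    and h_C1: "continuous_on (closure \<Omega>) h" "continuous_on (closure \<Omega>) dh"
      "\<And>x. x \<in> \<Omega> \<Longrightarrow> GDERIV h x :> dh x"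
    and h_bounds: "lam = (INF x\<in>closure \<Omega>. h x)" "0 < lam" "mu = (SUP x\<in>closure \<Omega>. h x)"
      "\<And>x. x \<in> closure \<Omega> \<Longrightarrow> norm (dh x) \<le> M"
    and gamma: "\<And>x. x \<in> closure \<Omega> \<Longrightarrow> \<gamma> x = r / h x"
      "\<And>x. x \<in> closure \<Omega> \<Longrightarrow> \<gamma> x > 0" "smooth_on \<Omega> \<gamma>"
    and w0: "smooth_ext_on (\<Omega> \<times> {0..T}) (\<lambda>(x, t). w0 t x)"
      "w0 \<in> Linf_time T (L2 \<Omega>) (L2_norm \<Omega>) \<inter> L2_time T (H1 \<Omega>) (H1_norm \<Omega>)"
      "\<exists>dw0 \<in> L2_Hminus1 \<Omega> T. has_weak_time_deriv T (H10 \<Omega>) (\<lambda>t. L2_inner \<Omega> (w0 t)) dw0"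
    and base_data: "gt \<in> L2_Hminus1 \<Omega> T" "uh0 \<in> L2 \<Omega>" "\<xi>h0 \<in> L2 \<Omega>"
    and base_solution:
      "tidal_weak_solution \<Omega> T \<alpha> \<beta> h \<gamma> w0 gt (\<lambda>_ _. 0) uh0 \<xi>h0 uh \<xi>h"
    and data: "v0 \<in> L2 \<Omega>" "\<eta>0 \<in> L2 \<Omega>" "gh \<in> L2_Hminus1 \<Omega> T" "U \<in> L2_Hminus1 \<Omega> T"
  shows "\<exists>w \<eta>. linearized_weak_solution \<Omega> T \<alpha> \<beta> h \<gamma> w0 uh gh U v0 \<eta>0 w \<eta> \<and>
    (\<forall>w' \<eta>'. linearized_weak_solution \<Omega> T \<alpha> \<beta> h \<gamma> w0 uh gh U v0 \<eta>0 w' \<eta>' \<longrightarrow>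
       (\<forall>t\<in>{0..T}. (AE x in lebesgue_on \<Omega>. w' t x = w t x) \<and>
                   (AE x in lebesgue_on \<Omega>. \<eta>' t x = \<eta> t x)))"
proof -
 interpret bo: bounded_open \<Omega> using domain by unfold_locales (auto simp: smooth_bounded_domain_def)
 have cl: "x \<in> closure \<Omega>" if "x \<in> \<Omega>" for x using that by (rule subsetD[OF closure_subset])
 have comp: "compact (closure \<Omega>)" using bo.bd by (simp add: compact_closure)
 have bh: "bounded (h ` closure \<Omega>)" by (rule compact_imp_bounded[OF compact_continuous_image[OF h_C1(1) comp]])
 then obtain Bh where Bh: "\<And>x. x \<in> closure \<Omega> ==> norm (h x) \<le> Bh" unfolding bounded_iff by blast
 have lam: "lam \<le> h x" if "x \<in> closure \<Omega>" for x
  unfolding h_bounds(1) by (rule cINF_lower[OF bounded_imp_bdd_below[OF bh] that])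
 interpret lt: linearized_tidal \<Omega> \<alpha> \<beta> h \<gamma> dh Bh M "r / lam" proof
  show "(h has_derivative (\<lambda>w. dh x \<bullet> w)) (at x)" if "x \<in> \<Omega>" for x
   using h_C1(3)[OF that] by (simp add: gderiv_def inner_commute)
  show "continuous_on \<Omega> dh" by (rule continuous_on_subset[OF h_C1(2) closure_subset])
  show "continuous_on \<Omega> \<gamma>" using gamma(3) unfolding smooth_on_def by (metis Ck_on.simps(1))
  fix x assume x: "x \<in> \<Omega>"
  show "norm (\<gamma> x) \<le> r / lam" using lam[OF cl[OF x]] gamma(1)[OF cl[OF x]] constants(4) h_bounds(2)
   by (simp add: frac_le)
  show "norm (h x) \<le> Bh" "norm (dh x) \<le> M" "0 \<le> \<gamma> x" using Bh h_bounds(4) gamma(2)[OF cl[OF x]] cl[OF x] by auto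
 qed (rule constants)
 have "uh \<in> C_time T (L2 \<Omega>) (L2_norm \<Omega>)"
  using base_solution unfolding tidal_weak_solution_def solution_class_def by blast
 then have uh: "\<And>t. t \<in> {0..T} ==> uh t \<in> L2 \<Omega>" and cuh: "continuous_on {0..T} (\<lambda>t. cls \<Omega> (uh t))"
  unfolding bo.C_time_iff by auto
 obtain C1 where C1: "\<And>t. t \<in> {0..T} ==> norm (cls \<Omega> (uh t)) \<le> C1" proof -
  have "bounded ((\<lambda>t. cls \<Omega> (uh t)) ` {0..T})" by (intro compact_imp_bounded compact_continuous_image cuh) simp
  then obtain C1 where "\<forall>z\<in>(\<lambda>t. cls \<Omega> (uh t)) ` {0..T}. norm z \<le> C1" unfolding bounded_iff by blast
  then show ?thesis by (intro that[of C1]) blast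
 qed
 have w0V: "AE t in lebesgue_on {0..T}. w0 t \<in> L2 \<Omega>" and sm: "strongly_measurable T (L2 \<Omega>) (L2_norm \<Omega>) w0"
  using w0(2) by (auto simp: Linf_time_def)
 obtain C2 where C2: "AE t in lebesgue_on {0..T}. L2_norm \<Omega> (w0 t) \<le> C2" using w0(2) by (auto simp: Linf_time_def)
 (* The class of u + w0, whose pointwise norm is the friction coefficient. *)
 define s where "s t = indicator {0<..T} t *\<^sub>R cls \<Omega> (uh t) + indicator {0<..T} t *\<^sub>R cls \<Omega> (w0 t)" for t
 have s: "s \<in> borel_measurable lebesgue" unfolding s_def[abs_def] proof (rule borel_measurable_add)
  show "(\<lambda>t. indicator {0<..T} t *\<^sub>R cls \<Omega> (uh t)) \<in> borel_measurable lebesgue"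
   by (rule sqintD[OF sqint_continuous_interval[OF cuh]])
  show "(\<lambda>t. indicator {0<..T} t *\<^sub>R cls \<Omega> (w0 t)) \<in> borel_measurable lebesgue"
   by (rule strongly_measurable_imp_measurable[OF sm w0V]) (use bo.embeds_L2 in \<open>auto simp: embeds_def\<close>)
 qed
 have b: "AE t in lebesgue. t \<in> {0<..T} \<longrightarrow> (\<lambda>x. norm (uh t x + w0 t x)) \<in> L2 \<Omega> \<and>
   lt.cut (C1 + C2) (bo.nrm (s t)) = cls \<Omega> (\<lambda>x. norm (uh t x + w0 t x))"
  using w0V C2 unfolding AE_interval_iff proof eventually_elim
  case (elim t)
  show ?case proof
   assume t: "t \<in> {0<..T}"
   then have u: "uh t \<in> L2 \<Omega>" "norm (cls \<Omega> (uh t)) \<le> C1" using uh C1 by auto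
   have w: "w0 t \<in> L2 \<Omega>" "norm (cls \<Omega> (w0 t)) \<le> C2" using elim t by (auto simp: bo.L2_norm_cls)
   note uw = bo.L2_add[OF u(1) w(1)]
   have st: "s t = cls \<Omega> (\<lambda>x. uh t x + w0 t x)" using t by (simp add: s_def bo.cls_add u w)
   have "norm (s t) \<le> C1 + C2" using norm_triangle_mono[OF u(2) w(2)] t by (simp add: s_def)
   then have "lt.cut (C1 + C2) (bo.nrm (s t)) = bo.nrm (s t)"
    using bo.norm_nrm_le[of "s t"] by (simp add: lt.cut_def)
   moreover have "sqint (\<lambda>x. norm (indicator \<Omega> x *\<^sub>R (uh t x + w0 t x)))" by (rule sqint_norm[OF bo.L2_sqint[OF uw]])
   ultimately show "(\<lambda>x. norm (uh t x + w0 t x)) \<in> L2 \<Omega> \<and>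
     lt.cut (C1 + C2) (bo.nrm (s t)) = cls \<Omega> (\<lambda>x. norm (uh t x + w0 t x))"
    by (simp add: st bo.nrm_cls[OF uw] bo.L2_iff)
  qed
 qed
 obtain w \<eta> where sol: "linearized_weak_solution \<Omega> T \<alpha> \<beta> h \<gamma> w0 uh gh U v0 \<eta>0 w \<eta>"
  using lt.linearized_existence[OF constants(1) s b data(3,4,1,2)] by blast
 show ?thesis using sol lt.linearized_uniqueness[OF constants(1) s b data(3,4,1,2) sol] by blast
qed

end
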